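(* Let $n\ge1$. For all $k\in\mathbb N=\{0,1,2,\dots\}$, all $f\in\mathcal H^k(\mathbb R^n,\gamma_n)$ with $\|f\|_{L^\infty}\le1$, and all $1\le q\le p\le 2$ with $q<2$, $$\frac{\big\||\nabla^kf|\big\|_{L^p}^{p}}{\Big[1+\frac{q}{2k(2-q)}\ln^{+}\Big(\big\||\nabla^kf|\big\|_{L^p}^{p}/\big\||\nabla^kf|\big\|_{L^q}^{2}\Big)\Big]^{kp/2}}\ \ge\ C(p,q)^k\,W^{\ge k}(f),$$ and further $$\sum_{\kappa\in\mathbb N^n:|\kappa|=k}\frac{\|D^\kappa f\|_{L^p}^{p}}{\Big[1+\frac{q}{2k(2-q)}\ln^{+}\big(\|D^\kappa f\|_{L^p}^{p}/\|D^\kappa f\|_{L^q}^{2}\big)\Big]^{kp/2}}\ \ge\ C(p,q)^k\,W^{\ge k}(f),$$ where $$C(p,q)=\Big(M(p)^{-\frac2p}+\frac{pq}{4e(2-q)}\Big)^{-\frac p2},\qquad M(p):=p\,2^{-\frac p2}\max_{x\ge0}\frac{1-e^{-x}}{x^{p/2}}.$$ Moreover there is an absolute constant $c>0$ with $C(p,q)\ge c\,(2-q)$ for all such $p,q$.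
   Context: $\gamma_n$ is the standard Gaussian measure on $\mathbb R^n$, with density $\varphi_n(x)=(2\pi)^{-n/2}e^{-|x|^2/2}$; all norms and inner products are with respect to $\gamma_n$. For $\kappa\in\mathbb N^n$, $|\kappa|=\sum_i\kappa_i$ and $D^\kappa:=\prod_{i=1}^n\frac{1}{\sqrt{\kappa_i!}}\partial_i^{\kappa_i}$ is the normalized weak partial derivative ($D^{0}$ is the identity). $\mathcal H^k(\mathbb R^n,\gamma_n):=\{f\in L^2(\gamma_n): D^\kappa f\in L^2(\gamma_n)\text{ for all }|\kappa|\le k\}$. $\nabla^kf:=(D^\kappa f)_{|\kappa|=k}$ and $|\nabla^kf|^2:=\sum_{|\kappa|=k}|D^\kappa f|^2$ (pointwise). For $f\in L^2(\gamma_n)$, $f^{\ge k}$ is the component of $f$ orthogonal in $L^2(\gamma_n)$ to the null space of $\nabla^k$ (polynomials of degree less than $k$), and $W^{\ge k}(f):=\|f^{\ge k}\|_{L^2}^2$; equivalently $W^{\ge k}(f)=\sum_{|\alpha|\ge k}\widehat f(\alpha)^2$, $\widehat f(\alpha)=\langle f,h_\alpha\rangle_{L^2}$, with $h_\alpha=(-1)^{|\alpha|}\varphi_n^{-1}D^\alpha\varphi_n$ the normalized Hermite polynomials. $\ln^+(x)=\max\{\ln x,0\}$. In $M(p)$ the value at $x=0$ is taken as the limit $x\to0^+$. Conventions: the left-hand side of the first inequality is $0$ if $\nabla^kf=0$, and summands with $D^\kappa f=0$ are $0$; for $k=0$ a bracket raised to the power $0$ equals $1$. *)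

theory Defs
  imports "HOL-Analysis.Analysis" "HOL-Probability.Essential_Supremum"
begin

section \<open>Gaussian measure and norms\<close>

definition gauss_density :: "real ^ 'n::finite \<Rightarrow> real" where
  "gauss_density x = (2 * pi) powr (- real CARD('n) / 2) * exp (- (norm x)\<^sup>2 / 2)"

definition gauss :: "(real ^ 'n::finite) measure" where
  "gauss = density lborel (\<lambda>x. ennreal (gauss_density x))"

definition L2_gauss :: "(real ^ 'n::finite \<Rightarrow> real) set" where
  "L2_gauss = {f \<in> borel_measurable gauss. integrable gauss (\<lambda>x. (f x)\<^sup>2)}"

definition inner_gauss :: "(real ^ 'n::finite \<Rightarrow> real) \<Rightarrow> (real ^ 'n \<Rightarrow> real) \<Rightarrow> real" where
  "inner_gauss f g = (LINT x|gauss. f x * g x)"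

text \<open>The Bochner integral is \<open>0\<close> on non-integrable functions, so this is the
  \<open>L\<^sup>p\<close> norm only for functions in \<open>L\<^sup>p\<close>. Below it is applied to functions in
  \<open>L\<^sup>2\<close> with \<open>1 \<le> p \<le> 2\<close>, and the measure is finite.\<close>

definition Lp_gauss :: "real \<Rightarrow> (real ^ 'n::finite \<Rightarrow> real) \<Rightarrow> real" where
  "Lp_gauss p f = (LINT x|gauss. \<bar>f x\<bar> powr p) powr (1 / p)"

definition Linf_gauss :: "(real ^ 'n::finite \<Rightarrow> real) \<Rightarrow> ereal" where
  "Linf_gauss f = esssup gauss (\<lambda>x. ereal \<bar>f x\<bar>)"


section \<open>Weak partial derivatives\<close>

definition mi_size :: "('n::finite \<Rightarrow> nat) \<Rightarrow> nat" where
  "mi_size \<kappa> = (\<Sum>i\<in>UNIV. \<kappa> i)"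

lemma finite_mi_size: "finite {\<kappa> :: 'n::finite \<Rightarrow> nat. mi_size \<kappa> = k}"
proof (rule finite_subset)
  show "{\<kappa> :: 'n \<Rightarrow> nat. mi_size \<kappa> = k} \<subseteq> PiE UNIV (\<lambda>_. {..k})"
    unfolding mi_size_def by (auto intro: member_le_sum)
qed (simp add: finite_PiE)

definition partial_deriv :: "'n::finite \<Rightarrow> (real ^ 'n \<Rightarrow> real) \<Rightarrow> real ^ 'n \<Rightarrow> real" where
  "partial_deriv i \<phi> x = deriv (\<lambda>t. \<phi> (x + t *\<^sub>R axis i 1)) 0"

text \<open>\<open>C\<^sub>c\<^sup>\<infinity>\<close>: every iterated partial derivative exists and is (Frechet) differentiable,
  hence continuous.\<close>

definition test_function :: "(real ^ 'n::finite \<Rightarrow> real) \<Rightarrow> bool" where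
  "test_function \<phi> \<longleftrightarrow>
     (\<forall>is. foldr partial_deriv is \<phi> differentiable_on UNIV) \<and>
     compact (closure {x. \<phi> x \<noteq> 0})"

text \<open>The index type carries no order, so an enumeration of the coordinates is chosen; partial
  derivatives of smooth functions commute, so the choice is immaterial.\<close>

definition coords :: "'n::finite list" where
  "coords = (SOME is. distinct is \<and> set is = UNIV)"

definition mi_deriv :: "('n::finite \<Rightarrow> nat) \<Rightarrow> (real ^ 'n \<Rightarrow> real) \<Rightarrow> real ^ 'n \<Rightarrow> real" where
  "mi_deriv \<kappa> \<phi> = foldr (\<lambda>i. partial_deriv i ^^ \<kappa> i) coords \<phi>"

definition locally_integrable :: "(real ^ 'n::finite \<Rightarrow> real) \<Rightarrow> bool" where
  "locally_integrable f \<longleftrightarrow> (\<forall>K. compact K \<longrightarrow> set_integrable lborel K f)"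

definition has_weak_deriv ::
    "(real ^ 'n::finite \<Rightarrow> real) \<Rightarrow> ('n \<Rightarrow> nat) \<Rightarrow> (real ^ 'n \<Rightarrow> real) \<Rightarrow> bool" where
  "has_weak_deriv f \<kappa> g \<longleftrightarrow>
     locally_integrable f \<and> locally_integrable g \<and>
     (\<forall>\<phi>. test_function \<phi> \<longrightarrow>
        (LINT x|lborel. f x * mi_deriv \<kappa> \<phi> x) = (- 1) ^ mi_size \<kappa> * (LINT x|lborel. g x * \<phi> x))"

text \<open>Weak derivatives are determined up to null sets, so the representative chosen here does not
  matter below. In particular \<open>D\<close> at the zero multi-index is the identity almost everywhere.\<close>

definition D :: "('n::finite \<Rightarrow> nat) \<Rightarrow> (real ^ 'n \<Rightarrow> real) \<Rightarrow> real ^ 'n \<Rightarrow> real" where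
  "D \<kappa> f x = (\<Prod>i\<in>UNIV. 1 / sqrt (fact (\<kappa> i))) * (SOME g. has_weak_deriv f \<kappa> g) x"

definition Hk_gauss :: "nat \<Rightarrow> (real ^ 'n::finite \<Rightarrow> real) set" where
  "Hk_gauss k = {f \<in> L2_gauss. \<forall>\<kappa>. mi_size \<kappa> \<le> k \<longrightarrow>
                    (\<exists>g. has_weak_deriv f \<kappa> g) \<and> D \<kappa> f \<in> L2_gauss}"

definition nabla_norm :: "nat \<Rightarrow> (real ^ 'n::finite \<Rightarrow> real) \<Rightarrow> real ^ 'n \<Rightarrow> real" where
  "nabla_norm k f x = L2_set (\<lambda>\<kappa>. D \<kappa> f x) {\<kappa>. mi_size \<kappa> = k}"


section \<open>The weight at degrees at least \<open>k\<close>\<close>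

definition nabla_null_space :: "nat \<Rightarrow> (real ^ 'n::finite \<Rightarrow> real) set" where
  "nabla_null_space k =
     {h \<in> Hk_gauss k. \<forall>\<kappa>. mi_size \<kappa> = k \<longrightarrow> (AE x in gauss. D \<kappa> h x = 0)}"

text \<open>The null space of the \<open>k\<close>-th gradient consists of the polynomials of degree less than \<open>k\<close> (up to
  null sets); it is finite-dimensional, so for \<open>f\<close> in \<open>L\<^sup>2\<close> the orthogonal component
  exists and is unique almost everywhere.\<close>

definition ge_part :: "nat \<Rightarrow> (real ^ 'n::finite \<Rightarrow> real) \<Rightarrow> real ^ 'n \<Rightarrow> real" where
  "ge_part k f = (SOME g. g \<in> L2_gauss \<and> (\<lambda>x. f x - g x) \<in> nabla_null_space k \<and>
                    (\<forall>h\<in>nabla_null_space k. inner_gauss g h = 0))"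

definition W_ge :: "nat \<Rightarrow> (real ^ 'n::finite \<Rightarrow> real) \<Rightarrow> real" where
  "W_ge k f = (Lp_gauss 2 (ge_part k f))\<^sup>2"


section \<open>Constants\<close>

definition ln_plus :: "real \<Rightarrow> real" where
  "ln_plus x = max (ln x) 0"

definition M_quot :: "real \<Rightarrow> real \<Rightarrow> real" where
  "M_quot p x = (1 - exp (- x)) / x powr (p / 2)"

text \<open>The supremum is attained for \<open>1 \<le> p \<le> 2\<close> (at \<open>x = 0\<close> when \<open>p = 2\<close>).\<close>

definition M_const :: "real \<Rightarrow> real" where
  "M_const p = p * 2 powr (- p / 2) *
     (SUP x\<in>{0..}. if x = 0 then Lim (at_right 0) (M_quot p) else M_quot p x)"

definition C_const :: "real \<Rightarrow> real \<Rightarrow> real" where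
  "C_const p q =
     (M_const p powr (- 2 / p) + p * q / (4 * exp 1 * (2 - q))) powr (- p / 2)"

text \<open>Since \<open>a / 0 = 0\<close> and \<open>ln 0 = 0\<close>, the quotient is \<open>0\<close> for
  \<open>g = 0\<close>, and for \<open>k = 0\<close> the bracket is \<open>1\<close> with exponent \<open>0\<close>, so the denominator is \<open>1\<close>.\<close>

definition talagrand_quot ::
    "nat \<Rightarrow> real \<Rightarrow> real \<Rightarrow> (real ^ 'n::finite \<Rightarrow> real) \<Rightarrow> real" where
  "talagrand_quot k p q g =
     Lp_gauss p g powr p /
       (1 + q / (2 * real k * (2 - q)) * ln_plus (Lp_gauss p g powr p / (Lp_gauss q g)\<^sup>2))
         powr (real k * p / 2)"

end

theory Submission
  imports Defs "HOL-Probability.Probability"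
begin

text \<open>Let \<open>g\<close> be the vector of the derivatives of \<open>f\<close> of order \<open>k\<close>, let \<open>OU s\<close> be the Ornstein-Uhlenbeck
  operator with correlation \<open>s\<close>, and consider \<open>G(s) = \<Sum>\<^sub>\<kappa> \<langle>g\<^sub>\<kappa>, OU s g\<^sub>\<kappa>\<rangle>\<close>.  The Hermite expansion
  (\<open>OU_form_sums\<close>, \<open>parseval\<close>) makes \<open>G\<close> a power series \<open>\<Sum>\<^sub>m a\<^sub>m s\<^sup>m\<close> with nonnegative coefficients, and
  \<open>hcoef_D\<close> with Vandermonde's identity expresses the weight of \<open>f\<close> at degrees at least \<open>k\<close> as
  \<open>\<Sum>\<^sub>m a\<^sub>m / binomial(m + k, k)\<close>.  The reciprocal binomial coefficients are Beta integrals, so the weight is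
  the integral of \<open>k (1 - s)\<^sup>k\<^sup>-\<^sup>1 G(s)\<close> over the unit interval, and everything depends on the growth of \<open>G\<close>.

  Two estimates control \<open>G\<close>.  Write \<open>A\<close> for the \<open>p\<close>-th moment of \<open>\<bar>g\<bar>\<close> and \<open>B\<close> for its squared \<open>L\<^sup>q\<close> norm.
  First, because \<open>\<bar>f\<bar> \<le> 1\<close>, moving the derivatives to the Gaussian kernel and applying Bessel's inequality
  bounds \<open>\<bar>OU s g\<bar>\<^sup>2\<close> by \<open>(1 - s\<^sup>2)\<^sup>-\<^sup>k\<close> at every point (\<open>OU_D_square_sum_le\<close>), whence
  \<open>G(s) \<le> A (1 - s\<^sup>2)\<^bsup>-k(1 - p/2)\<^esup>\<close> (\<open>correlation_le_moment\<close>).  Secondly, hypercontractivity and interpolation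
  between \<open>L\<^sup>q\<close> and \<open>L\<^sup>2\<close> give \<open>G(s u) \<le> G(u)\<^bsup>1-\<theta>\<^esup> B\<^sup>\<theta>\<close> with
  \<open>\<theta> = q (1 - s) / ((2 - q) (1 + s))\<close>, as long as \<open>\<theta> \<le> 1\<close> (\<open>correlation_contraction\<close>).

  The \<open>k\<close>-th root \<open>\<phi> = (G / A)\<^bsup>1/k\<^esup>\<close> obeys the same two estimates with \<open>k = 1\<close>, and by
  \<open>integral_power_le_power_integral\<close> the weight is at most \<open>A\<close> times the \<open>k\<close>-th power of the integral of \<open>\<phi>\<close>.
  What remains is a problem about one increasing function on the unit interval; it is solved in
  \<open>contractive_profile_bound\<close>, where the constants \<open>M_const\<close> and \<open>C_const\<close> arise.  The
  argument works for any family of derivatives of order \<open>k\<close>: all of them together give the first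
  inequality, and each \<open>D \<kappa> f\<close> on its own gives a summand of the second.

  Three ingredients are developed from the Gaussian integral.  Hypercontractivity is proved by
  interpolation along the heat flow, in steps of length \<open>1 / N\<close>.  Completeness of the Hermite
  polynomials is read off from the Mehler kernel, whose Hilbert-Schmidt norm equals the sum of the
  squared eigenvalues.  Weak derivatives are unique by testing with smooth approximations of boxes, and
  admit integration by parts against Gaussian kernels after cutting these off.\<close>

section \<open>The Gaussian measure as a product and its rotation invariance\<close>

lemma Basis_cart: "(Basis :: (real ^ 'n::finite) set) = (\<lambda>i. axis i 1) ` UNIV"
  unfolding Basis_vec_def by auto

lemma inj_axis1: "inj (\<lambda>i::'n::finite. axis i (1::real))"
  by (auto simp: inj_def axis_eq_axis)

lemma prod_Basis_cart: "(\<Prod>b\<in>(Basis :: (real ^ 'n::finite) set). g b) = (\<Prod>i\<in>UNIV. g (axis i 1))"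
  unfolding Basis_cart by (subst prod.reindex[OF inj_axis1]) simp

text \<open>Lebesgue measure is defined as the image of a product over the basis vectors; products over the
  index type are transported along \<open>i \<mapsto> axis i 1\<close>.\<close>

lemma lborel_integral_prod:
  fixes g :: "'n::finite \<Rightarrow> real \<Rightarrow> real"
  assumes g: "\<And>i. integrable lborel (g i)"
  shows "integrable lborel (\<lambda>x :: real ^ 'n. \<Prod>i\<in>UNIV. g i (x $ i))"
    and "(LINT x|lborel. (\<Prod>i\<in>UNIV. g i ((x :: real ^ 'n) $ i))) = (\<Prod>i\<in>UNIV. LINT t|lborel. g i t)"
proof -
  define ix where "ix b = (THE i. b = axis i (1::real))" for b :: "real ^ 'n"
  have ix: "ix (axis i 1) = i" for i unfolding ix_def by (auto simp: axis_eq_axis)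
  interpret product_sigma_finite "\<lambda>_ :: real ^ 'n. lborel :: real measure"
    by standard
  let ?T = "\<lambda>f :: real ^ 'n \<Rightarrow> real. \<Sum>b\<in>Basis. f b *\<^sub>R b"
  have T: "?T \<in> borel_measurable (\<Pi>\<^sub>M b\<in>Basis. lborel)" by measurable
  have comp: "?T f $ i = f (axis i 1)" for f and i :: 'n
  proof -
    have "?T f $ i = ?T f \<bullet> axis i 1" by (simp add: inner_axis)
    also have "\<dots> = f (axis i 1)" by (subst inner_sum_left_Basis) (auto simp: axis_in_Basis_iff)
    finally show ?thesis .
  qed
  have gm[measurable]: "g i \<in> borel_measurable borel" for i using borel_measurable_integrable[OF g[of i]] by simp
  have m: "(\<lambda>x :: real ^ 'n. \<Prod>i\<in>UNIV. g i (x $ i)) \<in> borel_measurable borel" by measurable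
  have eq: "(\<Prod>i\<in>UNIV. g i (?T f $ i)) = (\<Prod>b\<in>Basis. g (ix b) (f b))" for f
    unfolding prod_Basis_cart comp ix ..
  have "integrable (\<Pi>\<^sub>M b\<in>(Basis :: (real ^ 'n) set). lborel) (\<lambda>f. \<Prod>b\<in>Basis. g (ix b) (f b))"
    by (rule product_integrable_prod) (auto intro: g)
  then show "integrable lborel (\<lambda>x :: real ^ 'n. \<Prod>i\<in>UNIV. g i (x $ i))"
    by (subst lborel_eq, subst integrable_distr_eq[OF T m]) (simp only: eq)
  have "(LINT x|lborel. (\<Prod>i\<in>UNIV. g i ((x :: real ^ 'n) $ i)))
      = (LINT f|(\<Pi>\<^sub>M b\<in>(Basis :: (real ^ 'n) set). lborel). (\<Prod>b\<in>Basis. g (ix b) (f b)))"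
    by (subst lborel_eq, subst integral_distr[OF T m]) (simp only: eq)
  also have "\<dots> = (\<Prod>b\<in>(Basis :: (real ^ 'n) set). LINT t|lborel. g (ix b) t)"
    by (rule product_integral_prod) (auto intro: g)
  also have "\<dots> = (\<Prod>i\<in>UNIV. LINT t|lborel. g i t)" unfolding prod_Basis_cart ix ..
  finally show "(LINT x|lborel. (\<Prod>i\<in>UNIV. g i ((x :: real ^ 'n) $ i))) = (\<Prod>i\<in>UNIV. LINT t|lborel. g i t)" .
qed

lemma gauss_density_pos: "0 < gauss_density x"
  unfolding gauss_density_def by simp

lemma gauss_density_nonneg [simp]: "0 \<le> gauss_density x"
  using gauss_density_pos[of x] by simp

lemma gauss_density_measurable [measurable]: "gauss_density \<in> borel_measurable borel"
  unfolding gauss_density_def[abs_def] by measurable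

lemma gauss_density_prod: "gauss_density (x :: real ^ 'n::finite) = (\<Prod>i\<in>UNIV. std_normal_density (x $ i))"
proof -
  have "(\<Prod>i\<in>(UNIV :: 'n set). std_normal_density (x $ i))
      = (1 / sqrt (2 * pi)) ^ CARD('n) * exp (- (\<Sum>i\<in>UNIV. (x $ i)\<^sup>2) / 2)"
    unfolding std_normal_density_def prod.distrib prod_constant
    by (simp add: exp_sum[symmetric] sum_negf sum_divide_distrib)
  moreover have "(\<Sum>i\<in>UNIV. (x $ i)\<^sup>2) = (norm x)\<^sup>2"
    unfolding norm_vec_def L2_set_def by (simp add: sum_nonneg)
  moreover have "(1 / sqrt (2 * pi)) ^ CARD('n) = (2 * pi) powr (- real CARD('n) / 2)"
  proof -
    have "1 / sqrt (2 * pi) = (2 * pi) powr (- 1 / 2)"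
      by (simp add: powr_half_sqrt[symmetric] powr_minus_divide)
    then show ?thesis by (simp add: powr_realpow[symmetric] powr_powr)
  qed
  ultimately show ?thesis unfolding gauss_density_def by simp
qed

lemma sets_gauss [simp, measurable_cong]: "sets gauss = sets borel"
  and space_gauss [simp]: "space gauss = UNIV"
  unfolding gauss_def by simp_all

lemma nn_integral_gauss:
  "f \<in> borel_measurable borel \<Longrightarrow> (\<integral>\<^sup>+x. f x \<partial>gauss) = (\<integral>\<^sup>+x. ennreal (gauss_density x) * f x \<partial>lborel)"
  unfolding gauss_def by (subst nn_integral_density) auto

lemma integral_gauss:
  fixes f :: "real ^ 'n::finite \<Rightarrow> real"
  shows "f \<in> borel_measurable borel \<Longrightarrow> (LINT x|gauss. f x) = (LINT x|lborel. gauss_density x * f x)"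
  unfolding gauss_def by (subst integral_density) auto

lemma integrable_gauss:
  fixes f :: "real ^ 'n::finite \<Rightarrow> real"
  shows "f \<in> borel_measurable borel \<Longrightarrow> integrable gauss f \<longleftrightarrow> integrable lborel (\<lambda>x. gauss_density x * f x)"
  unfolding gauss_def by (subst integrable_density) auto

lemma AE_gauss_iff: "(AE x in gauss. P x) \<longleftrightarrow> (AE x in lborel. P x)"
  unfolding gauss_def by (subst AE_density) (auto simp: gauss_density_pos)

lemma gauss_integral_prod:
  fixes f :: "'n::finite \<Rightarrow> real \<Rightarrow> real"
  assumes f: "\<And>i. integrable lborel (\<lambda>t. std_normal_density t * f i t)" and [measurable]: "\<And>i. f i \<in> borel_measurable borel"
  shows "integrable gauss (\<lambda>x :: real ^ 'n. \<Prod>i\<in>UNIV. f i (x $ i))"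
    and "(LINT x|gauss. (\<Prod>i\<in>UNIV. f i ((x :: real ^ 'n) $ i))) = (\<Prod>i\<in>UNIV. LINT t|lborel. std_normal_density t * f i t)"
proof -
  have m: "(\<lambda>x :: real ^ 'n. \<Prod>i\<in>UNIV. f i (x $ i)) \<in> borel_measurable borel" by measurable
  show "integrable gauss (\<lambda>x :: real ^ 'n. \<Prod>i\<in>UNIV. f i (x $ i))"
    using lborel_integral_prod(1)[OF f] unfolding integrable_gauss[OF m] gauss_density_prod
    by (simp add: prod.distrib)
  show "(LINT x|gauss. (\<Prod>i\<in>UNIV. f i ((x :: real ^ 'n) $ i))) = (\<Prod>i\<in>UNIV. LINT t|lborel. std_normal_density t * f i t)"
    using lborel_integral_prod(2)[OF f] unfolding integral_gauss[OF m] gauss_density_prod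
    by (simp add: prod.distrib)
qed

interpretation gauss: prob_space "gauss :: (real ^ 'n::finite) measure"
proof
  have std: "integrable lborel std_normal_density" "(LINT t|lborel. std_normal_density t) = 1"
    using integrable_std_normal_moment[of 0] integral_std_normal_moment_even[of 0] by simp_all
  have i: "integrable lborel (gauss_density :: real ^ 'n \<Rightarrow> real)" and "(LINT x|lborel. gauss_density (x :: real ^ 'n)) = 1"
    unfolding gauss_density_prod[abs_def] using lborel_integral_prod[of "\<lambda>_::'n. std_normal_density"] std by simp_all
  then have "(\<integral>\<^sup>+x. ennreal (gauss_density (x :: real ^ 'n)) \<partial>lborel) = 1"
    by (subst nn_integral_eq_integral) auto
  then have "(\<integral>\<^sup>+x. 1 \<partial>(gauss :: (real ^ 'n) measure)) = 1"
    by (subst nn_integral_gauss) auto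
  then show "emeasure (gauss :: (real ^ 'n) measure) (space gauss) = 1" by simp
qed

interpretation gauss2: pair_prob_space "gauss :: (real ^ 'n::finite) measure" "gauss :: (real ^ 'm::finite) measure"
  by standard

lemma nn_integral_lborel_affine:
  fixes f :: "'a::euclidean_space \<Rightarrow> ennreal"
  assumes [measurable]: "f \<in> borel_measurable borel" and c: "c \<noteq> 0"
  shows "(\<integral>\<^sup>+x. f x \<partial>lborel) = ennreal (\<bar>c\<bar> ^ DIM('a)) * (\<integral>\<^sup>+x. f (t + c *\<^sub>R x) \<partial>lborel)"
proof -
  have "(\<integral>\<^sup>+x. f x \<partial>lborel) = (\<integral>\<^sup>+x. f x \<partial>density (distr lborel borel (\<lambda>x. t + c *\<^sub>R x)) (\<lambda>_. \<bar>c\<bar>^DIM('a)))"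
    by (subst lborel_affine[OF c, of t]) simp
  also have "\<dots> = (\<integral>\<^sup>+x. ennreal (\<bar>c\<bar> ^ DIM('a)) * f (t + c *\<^sub>R x) \<partial>lborel)"
    by (subst nn_integral_density) (auto simp: nn_integral_distr)
  also have "\<dots> = ennreal (\<bar>c\<bar> ^ DIM('a)) * (\<integral>\<^sup>+x. f (t + c *\<^sub>R x) \<partial>lborel)"
    by (rule nn_integral_cmult) simp
  finally show ?thesis .
qed

text \<open>Substitute first in the second variable and then, after Tonelli, in the first one; the two
  Jacobians cancel and the product density depends only on the rotation-invariant
  \<open>\<bar>x\<bar>\<^sup>2 + \<bar>z\<bar>\<^sup>2\<close>.\<close>

lemma nn_integral_gauss_rotate:
  fixes F :: "(real ^ 'n::finite) \<times> (real ^ 'n) \<Rightarrow> ennreal"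
  assumes [measurable]: "F \<in> borel_measurable (borel \<Otimes>\<^sub>M borel)" and cd: "c\<^sup>2 + d\<^sup>2 = 1" "d \<noteq> 0"
  shows "(\<integral>\<^sup>+x. \<integral>\<^sup>+z. F (c *\<^sub>R x + d *\<^sub>R z, d *\<^sub>R x - c *\<^sub>R z) \<partial>gauss \<partial>gauss) = (\<integral>\<^sup>+x. \<integral>\<^sup>+z. F (x, z) \<partial>gauss \<partial>gauss)"
proof -
  define \<phi> where "\<phi> x = ennreal (gauss_density x)" for x :: "real ^ 'n"
  have [measurable]: "\<phi> \<in> borel_measurable borel" unfolding \<phi>_def by measurable
  have rot: "\<phi> (c *\<^sub>R w + d *\<^sub>R y) * \<phi> (d *\<^sub>R w - c *\<^sub>R y) = \<phi> w * \<phi> y" for w y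
  proof -
    have "(norm (c *\<^sub>R w + d *\<^sub>R y))\<^sup>2 + (norm (d *\<^sub>R w - c *\<^sub>R y))\<^sup>2 = (c\<^sup>2 + d\<^sup>2) * ((norm w)\<^sup>2 + (norm y)\<^sup>2)"
      unfolding power2_norm_eq_inner by (simp add: inner_add_left inner_add_right inner_diff_left inner_diff_right inner_commute algebra_simps power2_eq_square)
    then have n: "(norm (c *\<^sub>R w + d *\<^sub>R y))\<^sup>2 + (norm (d *\<^sub>R w - c *\<^sub>R y))\<^sup>2 = (norm w)\<^sup>2 + (norm y)\<^sup>2" using cd by simp
    have "gauss_density (c *\<^sub>R w + d *\<^sub>R y) * gauss_density (d *\<^sub>R w - c *\<^sub>R y) = gauss_density w * gauss_density y"
    proof -
      have e: "exp (- a / 2) * exp (- b / 2) = exp (- (a + b) / 2)" for a b :: real by (simp add: exp_add[symmetric] add_divide_distrib)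
      have "gauss_density u * gauss_density v = (2 * pi) powr (- real CARD('n) / 2) * (2 * pi) powr (- real CARD('n) / 2) * exp (- ((norm u)\<^sup>2 + (norm v)\<^sup>2) / 2)"
        for u v :: "real ^ 'n"
        unfolding gauss_density_def e[symmetric] by simp
      then show ?thesis using n by simp
    qed
    then show ?thesis unfolding \<phi>_def by (simp add: ennreal_mult[symmetric])
  qed
  have "(\<integral>\<^sup>+x. \<integral>\<^sup>+z. F (c *\<^sub>R x + d *\<^sub>R z, d *\<^sub>R x - c *\<^sub>R z) \<partial>gauss \<partial>gauss)
      = (\<integral>\<^sup>+x. \<integral>\<^sup>+z. \<phi> x * \<phi> z * F (c *\<^sub>R x + d *\<^sub>R z, d *\<^sub>R x - c *\<^sub>R z) \<partial>lborel \<partial>lborel)"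
    by (subst nn_integral_gauss, measurable, subst nn_integral_gauss, measurable,
        simp add: \<phi>_def nn_integral_cmult[symmetric] mult.assoc)
  also have "\<dots> = (\<integral>\<^sup>+x. ennreal (\<bar>1 / d\<bar> ^ CARD('n)) * (\<integral>\<^sup>+w. \<phi> x * \<phi> ((1 / d) *\<^sub>R (w - c *\<^sub>R x)) * F (w, (1 / d) *\<^sub>R (x - c *\<^sub>R w)) \<partial>lborel) \<partial>lborel)"
  proof (rule nn_integral_cong)
    fix x :: "real ^ 'n"
    have s: "- (c / d) *\<^sub>R x + (1 / d) *\<^sub>R w = (1 / d) *\<^sub>R (w - c *\<^sub>R x)" for w
      by (simp add: scaleR_diff_right)
    have t1: "c *\<^sub>R x + d *\<^sub>R ((1 / d) *\<^sub>R (w - c *\<^sub>R x)) = w" for w using cd by (simp add: algebra_simps)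
    have t2: "d *\<^sub>R x - c *\<^sub>R ((1 / d) *\<^sub>R (w - c *\<^sub>R x)) = (1 / d) *\<^sub>R (x - c *\<^sub>R w)" for w
    proof -
      have "d = (1 - c\<^sup>2) / d" using cd by (simp add: field_simps power2_eq_square)
      then have "d *\<^sub>R x = (1 / d) *\<^sub>R x - (c\<^sup>2 / d) *\<^sub>R x"
        by (metis diff_divide_distrib scaleR_left_diff_distrib)
      then show ?thesis by (simp add: algebra_simps power2_eq_square)
    qed
    show "(\<integral>\<^sup>+z. \<phi> x * \<phi> z * F (c *\<^sub>R x + d *\<^sub>R z, d *\<^sub>R x - c *\<^sub>R z) \<partial>lborel) =
       ennreal (\<bar>1 / d\<bar> ^ CARD('n)) * (\<integral>\<^sup>+w. \<phi> x * \<phi> ((1 / d) *\<^sub>R (w - c *\<^sub>R x)) * F (w, (1 / d) *\<^sub>R (x - c *\<^sub>R w)) \<partial>lborel)"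
      using nn_integral_lborel_affine[of "\<lambda>z. \<phi> x * \<phi> z * F (c *\<^sub>R x + d *\<^sub>R z, d *\<^sub>R x - c *\<^sub>R z)" "1 / d" "- (c / d) *\<^sub>R x"] cd
      unfolding s t1 t2 by simp
  qed
  also have "\<dots> = ennreal (\<bar>1 / d\<bar> ^ CARD('n)) * (\<integral>\<^sup>+x. \<integral>\<^sup>+w. \<phi> x * \<phi> ((1 / d) *\<^sub>R (w - c *\<^sub>R x)) * F (w, (1 / d) *\<^sub>R (x - c *\<^sub>R w)) \<partial>lborel \<partial>lborel)"
    by (rule nn_integral_cmult) measurable
  also have "(\<integral>\<^sup>+x. \<integral>\<^sup>+w. \<phi> x * \<phi> ((1 / d) *\<^sub>R (w - c *\<^sub>R x)) * F (w, (1 / d) *\<^sub>R (x - c *\<^sub>R w)) \<partial>lborel \<partial>lborel)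
      = (\<integral>\<^sup>+w. \<integral>\<^sup>+x. \<phi> x * \<phi> ((1 / d) *\<^sub>R (w - c *\<^sub>R x)) * F (w, (1 / d) *\<^sub>R (x - c *\<^sub>R w)) \<partial>lborel \<partial>lborel)"
    by (rule lborel_pair.Fubini') measurable
  also have "\<dots> = (\<integral>\<^sup>+w. ennreal (\<bar>d\<bar> ^ CARD('n)) * (\<integral>\<^sup>+y. \<phi> w * \<phi> y * F (w, y) \<partial>lborel) \<partial>lborel)"
  proof (rule nn_integral_cong)
    fix w :: "real ^ 'n"
    have t1: "(1 / d) *\<^sub>R (w - c *\<^sub>R (c *\<^sub>R w + d *\<^sub>R y)) = d *\<^sub>R w - c *\<^sub>R y" for y
    proof -
      have "d = (1 - c\<^sup>2) / d" using cd by (simp add: field_simps power2_eq_square)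
      then have "d *\<^sub>R w = (1 / d) *\<^sub>R w - (c\<^sup>2 / d) *\<^sub>R w"
        by (metis diff_divide_distrib scaleR_left_diff_distrib)
      then show ?thesis using cd by (simp add: algebra_simps power2_eq_square)
    qed
    have t2: "(1 / d) *\<^sub>R (c *\<^sub>R w + d *\<^sub>R y - c *\<^sub>R w) = y" for y using cd by simp
    show "(\<integral>\<^sup>+x. \<phi> x * \<phi> ((1 / d) *\<^sub>R (w - c *\<^sub>R x)) * F (w, (1 / d) *\<^sub>R (x - c *\<^sub>R w)) \<partial>lborel) =
         ennreal (\<bar>d\<bar> ^ CARD('n)) * (\<integral>\<^sup>+y. \<phi> w * \<phi> y * F (w, y) \<partial>lborel)"
      using nn_integral_lborel_affine[of "\<lambda>x. \<phi> x * \<phi> ((1 / d) *\<^sub>R (w - c *\<^sub>R x)) * F (w, (1 / d) *\<^sub>R (x - c *\<^sub>R w))" d "c *\<^sub>R w"] cd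
      unfolding t1 t2 rot by simp
  qed
  also have "\<dots> = ennreal (\<bar>d\<bar> ^ CARD('n)) * (\<integral>\<^sup>+w. \<integral>\<^sup>+y. \<phi> w * \<phi> y * F (w, y) \<partial>lborel \<partial>lborel)"
    by (rule nn_integral_cmult) measurable
  also have "ennreal (\<bar>1 / d\<bar> ^ CARD('n)) * (ennreal (\<bar>d\<bar> ^ CARD('n)) * (\<integral>\<^sup>+w. \<integral>\<^sup>+y. \<phi> w * \<phi> y * F (w, y) \<partial>lborel \<partial>lborel))
      = (\<integral>\<^sup>+w. \<integral>\<^sup>+y. \<phi> w * \<phi> y * F (w, y) \<partial>lborel \<partial>lborel)"
  proof -
    have "ennreal (\<bar>1 / d\<bar> ^ CARD('n)) * ennreal (\<bar>d\<bar> ^ CARD('n)) = 1"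
      using cd by (simp add: ennreal_mult[symmetric] power_mult_distrib[symmetric])
    then show ?thesis by (simp add: mult.assoc[symmetric])
  qed
  also have "\<dots> = (\<integral>\<^sup>+x. \<integral>\<^sup>+z. F (x, z) \<partial>gauss \<partial>gauss)"
    by (subst nn_integral_gauss, measurable, subst nn_integral_gauss, measurable,
        simp add: \<phi>_def nn_integral_cmult[symmetric] mult.assoc)
  finally show ?thesis .
qed

abbreviation gauss_pair :: "((real ^ 'n::finite) \<times> (real ^ 'n)) measure" where
  "gauss_pair \<equiv> gauss \<Otimes>\<^sub>M gauss"

lemma borel_measurable_gauss_pair: "borel_measurable gauss_pair = borel_measurable (borel \<Otimes>\<^sub>M borel)"
  by (intro measurable_cong_sets sets_pair_measure_cong) simp_all

text \<open>\<open>(x, z) \<mapsto> (c x + d z, d x - c z)\<close> is an orthogonal involution, which is why it preserves the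
  standard Gaussian measure on the product space.\<close>

lemma distr_gauss_rotate:
  assumes cd: "c\<^sup>2 + d\<^sup>2 = 1" "d \<noteq> 0"
  shows "distr gauss_pair (gauss_pair :: ((real ^ 'n::finite) \<times> (real ^ 'n)) measure)
      (\<lambda>(x, z). (c *\<^sub>R x + d *\<^sub>R z, d *\<^sub>R x - c *\<^sub>R z)) = gauss_pair" (is "distr _ _ ?R = _")
proof (rule measure_eqI)
  have R[measurable]: "?R \<in> measurable gauss_pair (gauss_pair :: ((real ^ 'n) \<times> (real ^ 'n)) measure)" by measurable
  fix A assume "A \<in> sets (distr gauss_pair (gauss_pair :: ((real ^ 'n) \<times> (real ^ 'n)) measure) ?R)"
  then have A[measurable]: "A \<in> sets (gauss_pair :: ((real ^ 'n) \<times> (real ^ 'n)) measure)" by simp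
  have A'[simp]: "A \<in> sets (borel \<Otimes>\<^sub>M borel)"
    using A sets_pair_measure_cong[OF sets_gauss sets_gauss] by metis
  have ind: "(indicator A :: _ \<Rightarrow> ennreal) \<in> borel_measurable (borel \<Otimes>\<^sub>M borel)"
    using A by (simp add: borel_measurable_gauss_pair[symmetric])
  have "emeasure (distr gauss_pair gauss_pair ?R) A = (\<integral>\<^sup>+z. indicator A (?R z) \<partial>gauss_pair)"
    by (subst nn_integral_distr[OF R, symmetric]) (auto intro!: nn_integral_indicator[symmetric])
  also have "\<dots> = (\<integral>\<^sup>+x. \<integral>\<^sup>+z. indicator A (?R (x, z)) \<partial>gauss \<partial>gauss)"
    by (subst gauss.nn_integral_fst[symmetric]) auto
  also have "\<dots> = (\<integral>\<^sup>+x. \<integral>\<^sup>+z. indicator A (x, z) \<partial>gauss \<partial>gauss)"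
    using nn_integral_gauss_rotate[OF ind cd] by simp
  also have "\<dots> = emeasure gauss_pair A"
    by (subst gauss.nn_integral_fst) (auto intro!: nn_integral_indicator)
  finally show "emeasure (distr gauss_pair gauss_pair ?R) A = emeasure gauss_pair A" .
qed simp

section \<open>Correlated Gaussian pairs and the Ornstein-Uhlenbeck operator\<close>

text \<open>The joint law of two standard Gaussian vectors whose corresponding coordinates have
  correlation \<open>s\<close>.\<close>

definition corr :: "real \<Rightarrow> ((real ^ 'n::finite) \<times> (real ^ 'n)) measure" where
  "corr s = distr gauss_pair gauss_pair (\<lambda>(x, z). (x, s *\<^sub>R x + sqrt (1 - s\<^sup>2) *\<^sub>R z))"

definition OU :: "real \<Rightarrow> (real ^ 'n::finite \<Rightarrow> real) \<Rightarrow> real ^ 'n \<Rightarrow> real" where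
  "OU s u x = (LINT z|gauss. u (s *\<^sub>R x + sqrt (1 - s\<^sup>2) *\<^sub>R z))"

lemma sets_corr [simp, measurable_cong]: "sets (corr s) = sets gauss_pair"
  and space_corr [simp]: "space (corr s) = UNIV"
  unfolding corr_def by (simp_all add: space_pair_measure)

lemma prob_space_corr: "prob_space (corr s)"
  unfolding corr_def by (intro gauss2.prob_space_distr) measurable

lemma distr_gauss_pair_fst: "distr gauss_pair gauss fst = (gauss :: (real ^ 'n::finite) measure)"
  by (rule gauss.distr_pair_fst)

lemma distr_gauss_linear:
  assumes "c\<^sup>2 + d\<^sup>2 = 1" "d \<noteq> 0"
  shows "distr gauss_pair gauss (\<lambda>(x, z). c *\<^sub>R x + d *\<^sub>R z) = (gauss :: (real ^ 'n::finite) measure)"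
proof -
  let ?P = "gauss_pair :: ((real ^ 'n) \<times> (real ^ 'n)) measure"
  define R where "R = (\<lambda>(x :: real ^ 'n, z). (c *\<^sub>R x + d *\<^sub>R z, d *\<^sub>R x - c *\<^sub>R z))"
  have [measurable]: "R \<in> measurable ?P ?P"
    unfolding R_def by measurable
  have rot: "distr ?P ?P R = ?P" unfolding R_def by (rule distr_gauss_rotate[OF assms])
  have "(\<lambda>(x, z). c *\<^sub>R x + d *\<^sub>R z) = fst \<circ> R" unfolding R_def by auto
  then have "distr ?P gauss (\<lambda>(x, z). c *\<^sub>R x + d *\<^sub>R z) = distr (distr ?P ?P R) gauss fst"
    by (simp add: distr_distr)
  then show ?thesis unfolding rot by (simp add: distr_gauss_pair_fst)
qed

context
  fixes s :: real
  assumes s: "0 \<le> s" "s < 1"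
begin

lemma corr_coeffs: "s\<^sup>2 + (sqrt (1 - s\<^sup>2))\<^sup>2 = 1" "sqrt (1 - s\<^sup>2) \<noteq> 0"
proof -
  have "s\<^sup>2 < 1" using s by (simp add: abs_square_less_1)
  then show "s\<^sup>2 + (sqrt (1 - s\<^sup>2))\<^sup>2 = 1" "sqrt (1 - s\<^sup>2) \<noteq> 0" by auto
qed

lemma corr_fst: "distr (corr s) gauss fst = (gauss :: (real ^ 'n::finite) measure)"
proof -
  have "distr (corr s) gauss fst = distr gauss_pair (gauss :: (real ^ 'n) measure) fst"
    unfolding corr_def by (subst distr_distr) (auto simp: comp_def case_prod_beta intro!: arg_cong[where f = "distr _ _"])
  then show ?thesis by (simp add: distr_gauss_pair_fst)
qed

lemma corr_snd: "distr (corr s) gauss snd = (gauss :: (real ^ 'n::finite) measure)"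
proof -
  have "distr (corr s) gauss snd = distr gauss_pair (gauss :: (real ^ 'n) measure) (\<lambda>(x, z). s *\<^sub>R x + sqrt (1 - s\<^sup>2) *\<^sub>R z)"
    unfolding corr_def by (subst distr_distr) (auto simp: comp_def case_prod_beta intro!: arg_cong[where f = "distr _ _"])
  then show ?thesis using distr_gauss_linear[OF corr_coeffs] by metis
qed

lemma swap_measurable: "prod.swap \<in> measurable gauss_pair (gauss_pair :: ((real ^ 'n::finite) \<times> (real ^ 'n)) measure)"
  unfolding prod.swap_def by measurable

text \<open>The pair is exchangeable: the orthogonal involution with cosine \<open>s\<close> exchanges its two
  components.  Self-adjointness of the Ornstein-Uhlenbeck operator is a restatement of this.\<close>

lemma corr_swap: "distr (corr s) gauss_pair prod.swap = (corr s :: ((real ^ 'n::finite) \<times> (real ^ 'n)) measure)"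
proof -
  let ?d = "sqrt (1 - s\<^sup>2)"
  let ?P = "gauss_pair :: ((real ^ 'n) \<times> (real ^ 'n)) measure"
  define R where "R = (\<lambda>(x :: real ^ 'n, z). (s *\<^sub>R x + ?d *\<^sub>R z, ?d *\<^sub>R x - s *\<^sub>R z))"
  define g where "g = (\<lambda>(x :: real ^ 'n, z). (x, s *\<^sub>R x + ?d *\<^sub>R z))"
  have [measurable]: "R \<in> measurable ?P ?P" "g \<in> measurable ?P ?P"
    unfolding R_def g_def by measurable
  have rot: "distr ?P ?P R = ?P" unfolding R_def by (rule distr_gauss_rotate[OF corr_coeffs])
  have gR: "g \<circ> R = prod.swap \<circ> g"
  proof (rule ext, clarify)
    fix x z :: "real ^ 'n"
    have "s *\<^sub>R (s *\<^sub>R x + ?d *\<^sub>R z) + ?d *\<^sub>R (?d *\<^sub>R x - s *\<^sub>R z) = (s\<^sup>2 + ?d\<^sup>2) *\<^sub>R x"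
      by (simp add: algebra_simps power2_eq_square)
    then show "(g \<circ> R) (x, z) = (prod.swap \<circ> g) (x, z)"
      unfolding g_def R_def corr_coeffs(1) by simp
  qed
  have "corr s = distr (distr ?P ?P R) ?P g" unfolding rot corr_def g_def ..
  also have "\<dots> = distr (distr ?P ?P g) ?P prod.swap"
  proof -
    have "distr (distr ?P ?P R) ?P g = distr ?P ?P (g \<circ> R)" by (rule distr_distr) measurable
    also have "\<dots> = distr (distr ?P ?P g) ?P prod.swap" unfolding gR
      by (rule distr_distr[symmetric, OF swap_measurable]) measurable
    finally show ?thesis .
  qed
  finally show ?thesis unfolding corr_def g_def by simp
qed

lemma integrable_corr_fst: "integrable gauss (f :: real ^ 'n::finite \<Rightarrow> real) \<Longrightarrow> integrable (corr s) (\<lambda>xy. f (fst xy))"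
  by (rule integrable_distr[of fst "corr s" gauss]) (auto simp: corr_fst)

lemma integrable_corr_snd: "integrable gauss (f :: real ^ 'n::finite \<Rightarrow> real) \<Longrightarrow> integrable (corr s) (\<lambda>xy. f (snd xy))"
  by (rule integrable_distr[of snd "corr s" gauss]) (auto simp: corr_snd)

lemma integral_corr_fst:
  assumes [measurable]: "(f :: real ^ 'n::finite \<Rightarrow> real) \<in> borel_measurable borel"
  shows "(LINT xy|corr s. f (fst xy)) = (LINT x|gauss. f x)"
  using integral_distr[of fst "corr s" gauss f] by (simp add: corr_fst)

lemma integral_corr_snd:
  assumes [measurable]: "(f :: real ^ 'n::finite \<Rightarrow> real) \<in> borel_measurable borel"
  shows "(LINT xy|corr s. f (snd xy)) = (LINT x|gauss. f x)"
  using integral_distr[of snd "corr s" gauss f] by (simp add: corr_snd)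

lemma AE_corr_fst: "AE x in (gauss :: (real ^ 'n::finite) measure). P x \<Longrightarrow> AE xy in corr s. P (fst xy)"
proof (rule AE_distrD[of fst "corr s" "gauss :: (real ^ 'n) measure"])
  assume "AE x in (gauss :: (real ^ 'n) measure). P x"
  then show "AE x in distr (corr s) (gauss :: (real ^ 'n) measure) fst. P x" unfolding corr_fst .
qed simp

lemma AE_corr_snd: "AE x in (gauss :: (real ^ 'n::finite) measure). P x \<Longrightarrow> AE xy in corr s. P (snd xy)"
proof (rule AE_distrD[of snd "corr s" "gauss :: (real ^ 'n) measure"])
  assume "AE x in (gauss :: (real ^ 'n) measure). P x"
  then show "AE x in distr (corr s) (gauss :: (real ^ 'n) measure) snd. P x" unfolding corr_snd .
qed simp

lemma integrable_corr_iff: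
  assumes "(F :: (real ^ 'n::finite) \<times> (real ^ 'n) \<Rightarrow> real) \<in> borel_measurable gauss_pair"
  shows "integrable (corr s) F \<longleftrightarrow> integrable gauss_pair (\<lambda>(x, z). F (x, s *\<^sub>R x + sqrt (1 - s\<^sup>2) *\<^sub>R z))"
  unfolding corr_def by (subst integrable_distr_eq) (auto simp: assms split_beta')

lemma integral_corr_eq_pair:
  assumes "(F :: (real ^ 'n::finite) \<times> (real ^ 'n) \<Rightarrow> real) \<in> borel_measurable gauss_pair"
  shows "(LINT xy|corr s. F xy) = (LINT (x, z)|gauss_pair. F (x, s *\<^sub>R x + sqrt (1 - s\<^sup>2) *\<^sub>R z))"
  unfolding corr_def by (subst integral_distr) (auto simp: assms split_beta')

lemma integral_corr:
  assumes F: "integrable (corr s) (F :: (real ^ 'n::finite) \<times> (real ^ 'n) \<Rightarrow> real)"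
  shows "(LINT xy|corr s. F xy) = (LINT x|gauss. LINT z|gauss. F (x, s *\<^sub>R x + sqrt (1 - s\<^sup>2) *\<^sub>R z))"
    and "AE x in gauss. integrable gauss (\<lambda>z. F (x, s *\<^sub>R x + sqrt (1 - s\<^sup>2) *\<^sub>R z))"
    and "integrable gauss (\<lambda>x. LINT z|gauss. F (x, s *\<^sub>R x + sqrt (1 - s\<^sup>2) *\<^sub>R z))"
proof -
  have Fm: "F \<in> borel_measurable gauss_pair"
    using borel_measurable_integrable[OF F] by (simp add: measurable_cong_sets[OF sets_corr refl])
  have I: "integrable gauss_pair (\<lambda>(x, z). F (x, s *\<^sub>R x + sqrt (1 - s\<^sup>2) *\<^sub>R z))"
    using F integrable_corr_iff[OF Fm] by simp
  show "(LINT xy|corr s. F xy) = (LINT x|gauss. LINT z|gauss. F (x, s *\<^sub>R x + sqrt (1 - s\<^sup>2) *\<^sub>R z))"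
    unfolding integral_corr_eq_pair[OF Fm] using gauss2.integral_fst'[OF I] by simp
  show "AE x in gauss. integrable gauss (\<lambda>z. F (x, s *\<^sub>R x + sqrt (1 - s\<^sup>2) *\<^sub>R z))"
    using gauss2.AE_integrable_fst'[OF I] by simp
  show "integrable gauss (\<lambda>x. LINT z|gauss. F (x, s *\<^sub>R x + sqrt (1 - s\<^sup>2) *\<^sub>R z))"
    using gauss2.integrable_fst'[OF I] by simp
qed

end

lemma L2_gaussD [dest]:
  assumes "u \<in> L2_gauss"
  shows "u \<in> borel_measurable borel" "integrable gauss (\<lambda>x. (u x)\<^sup>2)"
  using assms unfolding L2_gauss_def by auto

lemma L2_gaussI: "u \<in> borel_measurable borel \<Longrightarrow> integrable gauss (\<lambda>x. (u x)\<^sup>2) \<Longrightarrow> u \<in> L2_gauss"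
  unfolding L2_gauss_def by auto

lemma abs_mult_le_squares: "\<bar>a * b\<bar> \<le> a\<^sup>2 + (b :: real)\<^sup>2"
proof -
  have "2 * (\<bar>a\<bar> * \<bar>b\<bar>) \<le> \<bar>a\<bar>\<^sup>2 + \<bar>b\<bar>\<^sup>2" using sum_squares_bound[of "\<bar>a\<bar>" "\<bar>b\<bar>"] by simp
  then have "2 * (\<bar>a\<bar> * \<bar>b\<bar>) \<le> a\<^sup>2 + b\<^sup>2" by (simp add: mult.assoc)
  moreover have "0 \<le> \<bar>a\<bar> * \<bar>b\<bar>" by simp
  ultimately show ?thesis unfolding abs_mult by linarith
qed

lemma L2_gauss_mult: "u \<in> L2_gauss \<Longrightarrow> v \<in> L2_gauss \<Longrightarrow> integrable gauss (\<lambda>x. u x * v x)"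
proof (rule Bochner_Integration.integrable_bound[of gauss "\<lambda>x. (u x)\<^sup>2 + (v x)\<^sup>2"])
  assume uv: "u \<in> L2_gauss" "v \<in> L2_gauss"
  then have [measurable]: "u \<in> borel_measurable borel" "v \<in> borel_measurable borel" by auto
  show "integrable gauss (\<lambda>x. (u x)\<^sup>2 + (v x)\<^sup>2)" using uv by (intro Bochner_Integration.integrable_add L2_gaussD)
  show "(\<lambda>x. u x * v x) \<in> borel_measurable gauss" by measurable
  show "AE x in gauss. norm (u x * v x) \<le> norm ((u x)\<^sup>2 + (v x)\<^sup>2)"
    by (intro AE_I2) (auto intro!: order_trans[OF abs_mult_le_squares])
qed

lemma L2_gauss_const [simp]: "(\<lambda>x. c) \<in> L2_gauss"
  by (rule L2_gaussI) auto

lemma L2_gauss_integrable: "u \<in> L2_gauss \<Longrightarrow> integrable gauss u"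
  using L2_gauss_mult[of u "\<lambda>_. 1"] by simp

lemma L2_gauss_add:
  assumes "u \<in> L2_gauss" "v \<in> L2_gauss" shows "(\<lambda>x. u x + v x) \<in> L2_gauss"
proof (rule L2_gaussI)
  have [measurable]: "u \<in> borel_measurable borel" "v \<in> borel_measurable borel" using assms by auto
  show "(\<lambda>x. u x + v x) \<in> borel_measurable borel" by measurable
  have "integrable gauss (\<lambda>x. (u x)\<^sup>2 + 2 * (u x * v x) + (v x)\<^sup>2)"
    using assms by (intro Bochner_Integration.integrable_add integrable_mult_right L2_gauss_mult L2_gaussD)
  then show "integrable gauss (\<lambda>x. (u x + v x)\<^sup>2)" by (simp add: power2_sum algebra_simps)
qed

lemma L2_gauss_cmult: "u \<in> L2_gauss \<Longrightarrow> (\<lambda>x. c * u x) \<in> L2_gauss"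
  by (rule L2_gaussI) (auto simp: power_mult_distrib)

lemma L2_gauss_diff: "u \<in> L2_gauss \<Longrightarrow> v \<in> L2_gauss \<Longrightarrow> (\<lambda>x. u x - v x) \<in> L2_gauss"
  using L2_gauss_add[of u "\<lambda>x. - 1 * v x"] L2_gauss_cmult[of v "-1"] by simp

lemma L2_gauss_abs: "u \<in> L2_gauss \<Longrightarrow> (\<lambda>x. \<bar>u x\<bar>) \<in> L2_gauss"
  by (rule L2_gaussI) (auto)

lemma L2_gauss_sum: "finite A \<Longrightarrow> (\<And>i. i \<in> A \<Longrightarrow> u i \<in> L2_gauss) \<Longrightarrow> (\<lambda>x. \<Sum>i\<in>A. u i x) \<in> L2_gauss"
  by (induction A rule: finite_induct) (auto intro: L2_gauss_add)

lemma L2_gauss_bounded: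
  assumes "u \<in> borel_measurable borel" "AE x in gauss. \<bar>u x\<bar> \<le> C" shows "u \<in> L2_gauss"
proof (rule L2_gaussI)
  show "integrable gauss (\<lambda>x. (u x)\<^sup>2)"
  proof (rule gauss.integrable_const_bound[of _ "C\<^sup>2"])
    show "AE x in gauss. norm ((u x)\<^sup>2) \<le> C\<^sup>2"
      using assms(2) by eventually_elim (simp add: abs_le_square_iff[symmetric])
  qed (use assms in simp)
qed (use assms in simp)

lemma L2_gauss_AE_cong:
  assumes "u \<in> L2_gauss" "v \<in> borel_measurable borel" "AE x in gauss. u x = v x" shows "v \<in> L2_gauss"
proof (rule L2_gaussI)
  show "integrable gauss (\<lambda>x. (v x)\<^sup>2)"
    by (rule integrable_cong_AE_imp[of _ "\<lambda>x. (u x)\<^sup>2"]) (use assms in \<open>auto\<close>)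
qed fact

lemma inner_gauss_commute: "inner_gauss u v = inner_gauss v u"
  unfolding inner_gauss_def by (simp add: mult.commute)

lemma inner_gauss_self_nonneg: "0 \<le> inner_gauss u u"
  unfolding inner_gauss_def by (intro integral_nonneg_AE) auto

lemma inner_gauss_diff_left: "u \<in> L2_gauss \<Longrightarrow> v \<in> L2_gauss \<Longrightarrow> w \<in> L2_gauss \<Longrightarrow>
   inner_gauss (\<lambda>x. u x - v x) w = inner_gauss u w - inner_gauss v w"
  unfolding inner_gauss_def left_diff_distrib by (intro Bochner_Integration.integral_diff L2_gauss_mult)

lemma inner_gauss_sum_left: "finite A \<Longrightarrow> (\<And>i. i \<in> A \<Longrightarrow> u i \<in> L2_gauss) \<Longrightarrow> w \<in> L2_gauss \<Longrightarrow>
   inner_gauss (\<lambda>x. \<Sum>i\<in>A. u i x) w = (\<Sum>i\<in>A. inner_gauss (u i) w)"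
  unfolding inner_gauss_def sum_distrib_right by (intro Bochner_Integration.integral_sum L2_gauss_mult)

lemma inner_gauss_cmult_left: "inner_gauss (\<lambda>x. c * u x) w = c * inner_gauss u w"
  unfolding inner_gauss_def by (simp add: mult.assoc)

lemma inner_gauss_AE_cong:
  assumes "AE x in gauss. u x = u' x" "u \<in> borel_measurable borel" "u' \<in> borel_measurable borel" "v \<in> borel_measurable borel"
  shows "inner_gauss u v = inner_gauss u' v"
  unfolding inner_gauss_def using assms by (intro integral_cong_AE) auto

lemma corr_integrable_mult:
  assumes s: "0 \<le> s" "s < 1" and uv: "u \<in> L2_gauss" "v \<in> L2_gauss"
  shows "integrable (corr s) (\<lambda>xy. u (fst xy) * v (snd xy))"
proof (rule Bochner_Integration.integrable_bound[of _ "\<lambda>xy. (u (fst xy))\<^sup>2 + (v (snd xy))\<^sup>2"])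
  show "integrable (corr s) (\<lambda>xy. (u (fst xy))\<^sup>2 + (v (snd xy))\<^sup>2)"
    using integrable_corr_fst[OF s L2_gaussD(2)[OF uv(1)]] integrable_corr_snd[OF s L2_gaussD(2)[OF uv(2)]] by simp
  have [measurable]: "u \<in> borel_measurable borel" "v \<in> borel_measurable borel" using uv by auto
  show "(\<lambda>xy. u (fst xy) * v (snd xy)) \<in> borel_measurable (corr s)" by measurable
  show "AE xy in corr s. norm (u (fst xy) * v (snd xy)) \<le> norm ((u (fst xy))\<^sup>2 + (v (snd xy))\<^sup>2)"
    by (intro AE_I2) (auto intro!: order_trans[OF abs_mult_le_squares])
qed

lemma OU_measurable [measurable]:
  assumes [measurable]: "u \<in> borel_measurable borel" shows "OU s u \<in> borel_measurable borel"
proof -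
  have "(\<lambda>x. LINT z|gauss. u (s *\<^sub>R x + sqrt (1 - s\<^sup>2) *\<^sub>R z)) \<in> borel_measurable borel"
    by (intro gauss.borel_measurable_lebesgue_integral) measurable
  then show ?thesis by (simp add: OU_def[abs_def])
qed

lemma OU_AE_integrable:
  assumes s: "0 \<le> s" "s < 1" and u: "integrable gauss (u :: real ^ 'n::finite \<Rightarrow> real)"
  shows "AE x in gauss. integrable gauss (\<lambda>z. u (s *\<^sub>R x + sqrt (1 - s\<^sup>2) *\<^sub>R z))"
  using integral_corr(2)[OF s integrable_corr_snd[OF s u]] by simp

lemma OU_integral:
  assumes s: "0 \<le> s" "s < 1" and u: "integrable gauss (u :: real ^ 'n::finite \<Rightarrow> real)"
  shows "integrable gauss (OU s u)" "(LINT x|gauss. OU s u x) = (LINT x|gauss. u x)"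
  using integral_corr(1,3)[OF s integrable_corr_snd[OF s u]] integral_corr_snd[OF s, of u] borel_measurable_integrable[OF u]
  by (simp_all add: OU_def[abs_def])

lemma inner_OU:
  assumes s: "0 \<le> s" "s < 1" and uv: "u \<in> L2_gauss" "v \<in> L2_gauss"
  shows "inner_gauss u (OU s v) = (LINT xy|corr s. u (fst xy) * v (snd xy))"
  using integral_corr(1)[OF s corr_integrable_mult[OF s uv]] unfolding inner_gauss_def OU_def by simp

lemma inner_OU_commute:
  assumes s: "0 \<le> s" "s < 1" and uv: "u \<in> L2_gauss" "v \<in> L2_gauss"
  shows "inner_gauss u (OU s v) = inner_gauss v (OU s u)"
proof -
  have [measurable]: "u \<in> borel_measurable borel" "v \<in> borel_measurable borel" using uv by auto
  have "(LINT xy|corr s. u (fst xy) * v (snd xy)) = (LINT xy|distr (corr s) gauss_pair prod.swap. u (fst xy) * v (snd xy))"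
    unfolding corr_swap[OF s] ..
  also have "\<dots> = (LINT xy|corr s. v (fst xy) * u (snd xy))"
    by (subst integral_distr) (auto simp: mult.commute measurable_cong_sets[OF sets_corr refl] intro: swap_measurable)
  finally show ?thesis unfolding inner_OU[OF s uv] inner_OU[OF s uv(2,1)] .
qed

lemma square_gauss_integral_le:
  assumes "u \<in> borel_measurable borel" "integrable gauss u" "integrable gauss (\<lambda>x. (u x)\<^sup>2)"
  shows "(LINT x|gauss. u x)\<^sup>2 \<le> (LINT x|gauss. (u x)\<^sup>2 :: real)"
proof -
  have "0 \<le> gauss.variance u" by (intro integral_nonneg_AE) auto
  then show ?thesis using gauss.variance_eq[OF assms(2,3)] by simp
qed

lemma OU_square_le:
  assumes s: "0 \<le> s" "s < 1" and u: "u \<in> L2_gauss"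
  shows "AE x in gauss. (OU s u x)\<^sup>2 \<le> OU s (\<lambda>x. (u x)\<^sup>2) x"
  using OU_AE_integrable[OF s L2_gauss_integrable[OF u]] OU_AE_integrable[OF s L2_gaussD(2)[OF u]]
proof eventually_elim
  case (elim x)
  have [measurable]: "u \<in> borel_measurable borel" using u by auto
  show ?case unfolding OU_def by (rule square_gauss_integral_le) (use elim in auto)
qed

lemma OU_L2:
  assumes s: "0 \<le> s" "s < 1" and u: "u \<in> L2_gauss" shows "OU s u \<in> L2_gauss"
proof (rule L2_gaussI)
  have [measurable]: "u \<in> borel_measurable borel" using u by auto
  show "OU s u \<in> borel_measurable borel" by measurable
  show "integrable gauss (\<lambda>x. (OU s u x)\<^sup>2)"
  proof (rule Bochner_Integration.integrable_bound[OF OU_integral(1)[OF s L2_gaussD(2)[OF u]]])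
    show "AE x in gauss. norm ((OU s u x)\<^sup>2) \<le> norm (OU s (\<lambda>x. (u x)\<^sup>2) x)"
      using OU_square_le[OF s u] by eventually_elim auto
  qed simp
qed

lemma young_powr:
  assumes "0 \<le> a" "0 \<le> b" "1 \<le> (p::real)"
  shows "a * b powr (p - 1) \<le> a powr p / p + (p - 1) / p * b powr p"
proof (cases "a = 0 \<or> b = 0")
  case True then show ?thesis using assms by (auto intro!: add_nonneg_nonneg)
next
  case False
  have "(a powr p) powr (1 / p) * (b powr p) powr ((p - 1) / p) \<le> 1 / p * a powr p + (p - 1) / p * b powr p"
    using assms False by (intro Youngs_inequality_0) (auto simp: field_simps)
  moreover have "(a powr p) powr (1 / p) = a" "(b powr p) powr ((p - 1) / p) = b powr (p - 1)"
    using False assms by (simp_all add: powr_powr)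
  ultimately show ?thesis by simp
qed

text \<open>The power function lies above its tangent at the mean.\<close>

lemma gauss_jensen_powr:
  fixes v :: "real ^ 'n::finite \<Rightarrow> real"
  assumes v: "integrable gauss v" "\<And>x. 0 \<le> v x" and q: "1 \<le> q" "integrable gauss (\<lambda>x. v x powr q)"
  shows "(LINT x|gauss. v x) powr q \<le> (LINT x|gauss. v x powr q)"
proof -
  let ?m = "LINT x|gauss. v x"
  have m0: "0 \<le> ?m" using v by (intro integral_nonneg_AE) auto
  have "(LINT x|gauss. v x * ?m powr (q - 1)) \<le> (LINT x|gauss. v x powr q / q + (q - 1) / q * ?m powr q)"
    using v q m0 by (intro integral_mono young_powr) auto
  also have "\<dots> = (LINT x|gauss. v x powr q) / q + (q - 1) / q * ?m powr q"
    using q by (simp add: gauss.prob_space[simplified])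
  also have "(LINT x|gauss. v x * ?m powr (q - 1)) = ?m powr q"
    using m0 q by (cases "?m = 0") (auto simp: powr_mult_base)
  finally have "?m powr q * q \<le> (LINT x|gauss. v x powr q) + (q - 1) * ?m powr q"
    using q by (simp add: field_simps)
  then show ?thesis by (simp add: algebra_simps)
qed

lemma gauss_bounded_integrable:
  "f \<in> borel_measurable borel \<Longrightarrow> (\<And>x. \<bar>f x\<bar> \<le> C) \<Longrightarrow> integrable gauss (f :: real ^ 'n::finite \<Rightarrow> real)"
  by (rule gauss.integrable_const_bound[of _ C]) auto

lemma L2_gauss_powr_integrable:
  assumes u: "u \<in> L2_gauss" "\<And>x. 0 \<le> u x" and r: "0 \<le> r" "r \<le> 2"
  shows "integrable gauss (\<lambda>x. u x powr r)"
proof (rule Bochner_Integration.integrable_bound)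
  have [measurable]: "u \<in> borel_measurable borel" using L2_gaussD[OF u(1)] by simp
  show "integrable gauss (\<lambda>x. 1 + (u x)\<^sup>2)" using L2_gaussD(2)[OF u(1)] by simp
  show "(\<lambda>x. u x powr r) \<in> borel_measurable gauss" by measurable
  show "AE x in gauss. norm (u x powr r) \<le> norm (1 + (u x)\<^sup>2)"
  proof (rule AE_I2)
    fix x
    have "u x powr r \<le> 1 + (u x)\<^sup>2"
    proof (cases "u x \<le> 1")
      case True
      then have "u x powr r \<le> 1" using u(2) r by (intro powr_le1) auto
      then show ?thesis by (simp add: add_increasing2)
    next
      case False
      then have "u x powr r \<le> u x powr 2" using r by (intro powr_mono) auto
      then show ?thesis using u(2)[of x] by (simp add: powr_numeral)
    qed
    then show "norm (u x powr r) \<le> norm (1 + (u x)\<^sup>2)" by simp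
  qed
qed

section \<open>Gaussian moments and translations\<close>

lemma gauss_exp_quadratic:
  assumes \<eta>: "2 * \<eta> < 1"
  shows "integrable gauss (\<lambda>z :: real ^ 'n::finite. exp (\<eta> * (norm z)\<^sup>2))"
    and "(LINT z|gauss. exp (\<eta> * (norm (z :: real ^ 'n))\<^sup>2)) = (1 / sqrt (1 - 2 * \<eta>)) ^ CARD('n)"
proof -
  define c where "c = 1 / sqrt (1 - 2 * \<eta>)"
  have c0: "0 < c" unfolding c_def using \<eta> by simp
  have c2: "c\<^sup>2 * (1 - 2 * \<eta>) = 1" unfolding c_def using \<eta> by (simp add: power_divide)
  have dens: "gauss_density (c *\<^sub>R z) * exp (\<eta> * (norm (c *\<^sub>R z))\<^sup>2) = gauss_density z" for z :: "real ^ 'n"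
  proof -
    have "- (c * norm z)\<^sup>2 / 2 + \<eta> * (c * norm z)\<^sup>2 = - (c\<^sup>2 * (1 - 2 * \<eta>)) * (norm z)\<^sup>2 / 2"
      by (simp add: power_mult_distrib algebra_simps add_divide_distrib)
    also have "\<dots> = - (norm z)\<^sup>2 / 2" unfolding c2 by simp
    finally have "exp (- (c * norm z)\<^sup>2 / 2) * exp (\<eta> * (c * norm z)\<^sup>2) = exp (- (norm z)\<^sup>2 / 2)"
      by (simp only: exp_add[symmetric])
    then show ?thesis unfolding gauss_density_def using c0 by simp
  qed
  have "(\<integral>\<^sup>+z. ennreal (exp (\<eta> * (norm (z :: real ^ 'n))\<^sup>2)) \<partial>gauss)
      = (\<integral>\<^sup>+z. ennreal (gauss_density z * exp (\<eta> * (norm (z :: real ^ 'n))\<^sup>2)) \<partial>lborel)"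
    by (subst nn_integral_gauss) (auto simp: ennreal_mult)
  also have "\<dots> = ennreal (c ^ CARD('n)) * (\<integral>\<^sup>+z. ennreal (gauss_density (z :: real ^ 'n)) \<partial>lborel)"
    using nn_integral_lborel_affine[of "\<lambda>z. ennreal (gauss_density z * exp (\<eta> * (norm (z :: real ^ 'n))\<^sup>2))" c 0] c0
    by (simp add: dens del: norm_scaleR)
  also have "(\<integral>\<^sup>+z. ennreal (gauss_density (z :: real ^ 'n)) \<partial>lborel) = 1"
    using nn_integral_gauss[of "\<lambda>_ :: real ^ 'n. 1"] by (simp add: gauss.emeasure_space_1[simplified])
  finally have nn: "(\<integral>\<^sup>+z. ennreal (exp (\<eta> * (norm (z :: real ^ 'n))\<^sup>2)) \<partial>gauss) = ennreal (c ^ CARD('n))" by simp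
  show I: "integrable gauss (\<lambda>z :: real ^ 'n. exp (\<eta> * (norm z)\<^sup>2))"
    by (rule integrableI_bounded) (auto simp: nn)
  show "(LINT z|gauss. exp (\<eta> * (norm (z :: real ^ 'n))\<^sup>2)) = (1 / sqrt (1 - 2 * \<eta>)) ^ CARD('n)"
    by (subst integral_eq_nn_integral) (use c0 in \<open>auto simp: nn c_def[symmetric]\<close>)
qed

lemma power_le_fact_exp: "0 \<le> (t::real) \<Longrightarrow> t ^ j \<le> fact j * exp t"
proof -
  assume t: "0 \<le> t"
  have "(\<Sum>n\<in>{j}. t ^ n /\<^sub>R fact n) \<le> (\<Sum>n. t ^ n /\<^sub>R fact n)"
    using t by (intro sum_le_suminf summable_exp_generic) auto
  then have "inverse (fact j) * t ^ j \<le> exp t" unfolding exp_def by simp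
  then show ?thesis by (simp add: field_simps)
qed

lemma norm_power_gauss_integrable [simp]: "integrable gauss (\<lambda>z :: real ^ 'n::finite. norm z ^ j)"
proof (rule Bochner_Integration.integrable_bound)
  show "integrable gauss (\<lambda>z :: real ^ 'n. fact j * exp 1 * exp ((1/4) * (norm z)\<^sup>2))"
    using gauss_exp_quadratic(1)[of "1/4", where 'n = 'n] by simp
  show "AE z in gauss. norm (norm z ^ j) \<le> norm (fact j * exp 1 * exp ((1/4) * (norm (z :: real ^ 'n))\<^sup>2))"
  proof (rule AE_I2)
    fix z :: "real ^ 'n"
    have "0 \<le> (norm z / 2 - 1)\<^sup>2" by simp
    then have "norm z \<le> 1 + (1/4) * (norm z)\<^sup>2" by (simp add: power2_diff power_divide)
    then have "exp (norm z) \<le> exp 1 * exp ((1/4) * (norm z)\<^sup>2)" by (simp add: exp_add[symmetric])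
    then have "fact j * exp (norm z) \<le> fact j * (exp 1 * exp ((1/4) * (norm z)\<^sup>2))" by (intro mult_left_mono) auto
    then have "norm z ^ j \<le> fact j * exp 1 * exp ((1/4) * (norm z)\<^sup>2)"
      using power_le_fact_exp[of "norm z" j] unfolding mult.assoc by (rule order_trans[rotated]) simp
    then show "norm (norm z ^ j) \<le> norm (fact j * exp 1 * exp ((1/4) * (norm z)\<^sup>2))" by simp
  qed
qed simp

lemma gauss_growth_integrable:
  assumes "f \<in> borel_measurable borel" "\<And>z. \<bar>f z\<bar> \<le> C * (1 + norm z) ^ j"
  shows "integrable gauss (f :: real ^ 'n::finite \<Rightarrow> real)"
proof (rule Bochner_Integration.integrable_bound)
  show "integrable gauss (\<lambda>z :: real ^ 'n. C * (\<Sum>k\<le>j. of_nat (j choose k) * norm z ^ k))" by simp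
  show "AE z in gauss. norm (f z) \<le> norm (C * (\<Sum>k\<le>j. of_nat (j choose k) * norm z ^ k))"
  proof (rule AE_I2)
    fix z :: "real ^ 'n"
    have "(1 + norm z) ^ j = (\<Sum>k\<le>j. of_nat (j choose k) * norm z ^ k)"
      using binomial_ring[of "norm z" 1 j] by (simp add: add.commute)
    then show "norm (f z) \<le> norm (C * (\<Sum>k\<le>j. of_nat (j choose k) * norm z ^ k))"
      using assms(2)[of z] by (simp add: abs_le_iff order_trans)
  qed
qed (use assms in simp)

lemma inner_gauss_integrable [simp]: "integrable gauss (\<lambda>z :: real ^ 'n::finite. l \<bullet> z)"
  by (rule gauss_growth_integrable[of _ "norm l" 1])
    (auto intro!: order_trans[OF Cauchy_Schwarz_ineq2] mult_left_mono)

lemma inner2_gauss_integrable [simp]: "integrable gauss (\<lambda>z :: real ^ 'n::finite. (l \<bullet> z) * (m \<bullet> z))"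
proof (rule gauss_growth_integrable[of _ "norm l * norm m" 2])
  fix z :: "real ^ 'n"
  have "\<bar>(l \<bullet> z) * (m \<bullet> z)\<bar> \<le> (norm l * (1 + norm z)) * (norm m * (1 + norm z))"
    unfolding abs_mult
    by (intro mult_mono order_trans[OF Cauchy_Schwarz_ineq2]) (auto intro!: mult_left_mono)
  then show "\<bar>(l \<bullet> z) * (m \<bullet> z)\<bar> \<le> norm l * norm m * (1 + norm z)\<^sup>2" by (simp add: power2_eq_square mult_ac)
qed simp

lemma std_normal_moments:
  "integrable lborel (\<lambda>t. std_normal_density t * t ^ k)"
  "(LINT t|lborel. std_normal_density t) = 1"
  "(LINT t|lborel. std_normal_density t * t) = 0"
  "(LINT t|lborel. std_normal_density t * t\<^sup>2) = 1"
  using integral_std_normal_moment_even[of 0] integral_std_normal_moment_odd[of 0] integral_std_normal_moment_even[of 1]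
    integrable_std_normal_moment[of k] by simp_all

lemma gauss_coord_integral: "(LINT z|gauss. (z :: real ^ 'n::finite) $ i) = 0"
proof -
  let ?f = "\<lambda>k (t::real). if k = i then t else 1"
  have "(LINT z|gauss. (\<Prod>k\<in>UNIV. ?f k ((z :: real ^ 'n) $ k))) = (\<Prod>k\<in>UNIV. LINT t|lborel. std_normal_density t * ?f k t)"
  proof (rule gauss_integral_prod)
    show "integrable lborel (\<lambda>t. std_normal_density t * ?f k t)" for k
      using std_normal_moments(1)[of 1] std_normal_moments(1)[of 0] by (cases "k = i") simp_all
  qed auto
  also have "\<dots> = 0"
  proof (rule prod_zero)
    show "\<exists>k\<in>UNIV. (LINT t|lborel. std_normal_density t * ?f k t) = 0"
      by (rule bexI[of _ i]) (simp_all add: std_normal_moments)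
  qed simp
  also have "(\<lambda>z. \<Prod>k\<in>UNIV. ?f k ((z :: real ^ 'n) $ k)) = (\<lambda>z. z $ i)" by (simp add: prod.delta)
  finally show ?thesis .
qed

lemma gauss_coord2_integral: "(LINT z|gauss. (z :: real ^ 'n::finite) $ i * z $ j) = (if i = j then 1 else 0)"
proof -
  let ?f = "\<lambda>k (t::real). (if k = i then t else 1) * (if k = j then t else 1)"
  have sq: "integrable lborel (\<lambda>t. std_normal_density t * (t * t))" "(LINT t|lborel. std_normal_density t * (t * t)) = 1"
    using std_normal_moments(1)[of 2] std_normal_moments(4) by (simp_all add: power2_eq_square)
  have "(LINT z|gauss. (\<Prod>k\<in>UNIV. ?f k ((z :: real ^ 'n) $ k))) = (\<Prod>k\<in>UNIV. LINT t|lborel. std_normal_density t * ?f k t)"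
  proof (rule gauss_integral_prod)
    show "integrable lborel (\<lambda>t. std_normal_density t * ?f k t)" for k
      using std_normal_moments(1)[of 1] std_normal_moments(1)[of 0] sq(1) by (cases "k = i"; cases "k = j") simp_all
  qed auto
  also have "\<dots> = (if i = j then 1 else 0)"
  proof (cases "i = j")
    case True
    have "(LINT t|lborel. std_normal_density t * ?f k t) = 1" for k
      using True sq(2) by (cases "k = i") (simp_all add: std_normal_moments)
    then show ?thesis using True by simp
  next
    case False
    have "\<exists>k\<in>UNIV. (LINT t|lborel. std_normal_density t * ?f k t) = 0"
      by (rule bexI[of _ i]) (use False in \<open>simp_all add: std_normal_moments\<close>)
    then show ?thesis using False prod_zero[of UNIV] by auto
  qed
  also have "(\<lambda>z. \<Prod>k\<in>UNIV. ?f k ((z :: real ^ 'n) $ k)) = (\<lambda>z. z $ i * z $ j)" by (simp add: prod.distrib prod.delta)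
  finally show ?thesis .
qed

lemma inner_gauss_integral [simp]: "(LINT z|gauss. l \<bullet> (z :: real ^ 'n::finite)) = 0"
proof -
  have "integrable gauss (\<lambda>z :: real ^ 'n. z $ i)" for i
    using inner_gauss_integrable[of "axis i 1"] by (simp add: inner_axis')
  then show ?thesis unfolding inner_vec_def by (simp add: gauss_coord_integral)
qed

lemma inner2_gauss_integral: "(LINT z|gauss. (l \<bullet> z) * (m \<bullet> (z :: real ^ 'n::finite))) = l \<bullet> m"
proof -
  have "integrable gauss (\<lambda>z :: real ^ 'n. z $ i * z $ j)" for i j
    using inner2_gauss_integrable[of "axis i 1" "axis j 1"] by (simp add: inner_axis')
  then have I: "integrable gauss (\<lambda>z :: real ^ 'n. l $ i * z $ i * (m $ j * z $ j))" for i j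
    using integrable_mult_right[of "l $ i * m $ j" gauss "\<lambda>z. z $ i * z $ j"] by (simp add: mult_ac)
  have "(LINT z|gauss. (l \<bullet> z) * (m \<bullet> (z :: real ^ 'n))) = (\<Sum>i\<in>UNIV. \<Sum>j\<in>UNIV. LINT z|gauss. l $ i * z $ i * (m $ j * (z :: real ^ 'n) $ j))"
    unfolding inner_vec_def inner_real_def sum_product using I by simp
  also have "\<dots> = (\<Sum>i\<in>UNIV. \<Sum>j\<in>UNIV. l $ i * m $ j * (if i = j then 1 else 0))"
    by (intro sum.cong refl, subst gauss_coord2_integral[symmetric], subst integral_mult_right_zero[symmetric]) (simp add: mult_ac)
  also have "\<dots> = l \<bullet> m" unfolding inner_vec_def inner_real_def by (simp add: if_distrib cong: if_cong)
  finally show ?thesis .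
qed

lemma lborel_translate:
  fixes F :: "'a::euclidean_space \<Rightarrow> real"
  assumes [measurable]: "F \<in> borel_measurable borel"
  shows "integrable lborel (\<lambda>z. F (c + z)) \<longleftrightarrow> integrable lborel F" "(LINT z|lborel. F (c + z)) = (LINT z|lborel. F z)"
proof -
  have "integrable (distr lborel borel ((+) c)) F \<longleftrightarrow> integrable lborel (\<lambda>z. F (c + z))"
    by (intro integrable_distr_eq) auto
  then show "integrable lborel (\<lambda>z. F (c + z)) \<longleftrightarrow> integrable lborel F" by (simp add: lborel_distr_plus)
  have "(LINT z|distr lborel borel ((+) c). F z) = (LINT z|lborel. F (c + z))"
    by (intro integral_distr) auto
  then show "(LINT z|lborel. F (c + z)) = (LINT z|lborel. F z)" by (simp add: lborel_distr_plus)
qed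

text \<open>The Cameron-Martin formula: the density of a shifted Gaussian is the exponential of a linear
  function.\<close>

lemma gauss_shift:
  fixes F :: "real ^ 'n::finite \<Rightarrow> real"
  assumes [measurable]: "F \<in> borel_measurable borel"
  shows "integrable gauss (\<lambda>z. F (z + w)) \<longleftrightarrow> integrable gauss (\<lambda>z. F z * exp (w \<bullet> z - (norm w)\<^sup>2 / 2))"
    and "(LINT z|gauss. F (z + w)) = (LINT z|gauss. F z * exp (w \<bullet> z - (norm w)\<^sup>2 / 2))"
proof -
  define G where "G z = gauss_density z * (F z * exp (w \<bullet> z - (norm w)\<^sup>2 / 2))" for z
  have [measurable]: "G \<in> borel_measurable borel" unfolding G_def by measurable
  have "gauss_density z * F (z + w) = G (w + z)" for z
  proof -
    have "- (norm (w + z))\<^sup>2 / 2 + (w \<bullet> (w + z) - (norm w)\<^sup>2 / 2) = - (norm z)\<^sup>2 / 2"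
      unfolding power2_norm_eq_inner by (simp add: inner_add_left inner_add_right inner_commute field_simps)
    then have "exp (- (norm (w + z))\<^sup>2 / 2) * exp (w \<bullet> (w + z) - (norm w)\<^sup>2 / 2) = exp (- (norm z)\<^sup>2 / 2)"
      by (simp only: exp_add[symmetric])
    then show ?thesis unfolding G_def gauss_density_def by (simp add: add.commute)
  qed
  note eq = this
  have m: "(\<lambda>z. F (z + w)) \<in> borel_measurable borel" "(\<lambda>z. F z * exp (w \<bullet> z - (norm w)\<^sup>2 / 2)) \<in> borel_measurable borel" by measurable
  show "integrable gauss (\<lambda>z. F (z + w)) \<longleftrightarrow> integrable gauss (\<lambda>z. F z * exp (w \<bullet> z - (norm w)\<^sup>2 / 2))"
    unfolding integrable_gauss[OF m(1)] integrable_gauss[OF m(2)] eq lborel_translate(1)[of G w, simplified] by (simp add: G_def[abs_def])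
  show "(LINT z|gauss. F (z + w)) = (LINT z|gauss. F z * exp (w \<bullet> z - (norm w)\<^sup>2 / 2))"
    unfolding integral_gauss[OF m(1)] integral_gauss[OF m(2)] eq lborel_translate(2)[of G w, simplified] by (simp add: G_def[abs_def])
qed

text \<open>The density of a translate, minus its linearisation, has second moment \<open>exp \<bar>w\<bar>\<^sup>2 - 1 - \<bar>w\<bar>\<^sup>2\<close>,
  which is of order \<open>\<bar>w\<bar>\<^sup>4\<close> for small \<open>w\<close>; large \<open>w\<close> are handled by the triangle inequality.\<close>

lemma gauss_shift_error:
  fixes w :: "real ^ 'n::finite"
  defines "e \<equiv> \<lambda>z. exp (w \<bullet> z - (norm w)\<^sup>2 / 2) - 1 - w \<bullet> z"
  shows "integrable gauss e" and "(LINT z|gauss. \<bar>e z\<bar>) \<le> (2 + (LINT z|gauss. norm (z :: real ^ 'n))) * (norm w)\<^sup>2"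
proof -
  define m where "m = (LINT z|gauss. norm (z :: real ^ 'n))"
  have m0: "0 \<le> m" unfolding m_def by (intro integral_nonneg_AE) auto
  define E where "E z = exp (w \<bullet> z - (norm w)\<^sup>2 / 2)" for z
  have [measurable]: "E \<in> borel_measurable borel" unfolding E_def by measurable
  have E1: "integrable gauss E" "(LINT z|gauss. E z) = 1"
    using gauss_shift[of "\<lambda>_. 1" w] by (simp_all add: E_def[abs_def] gauss.prob_space[simplified])
  have E2: "integrable gauss (\<lambda>z. (E z)\<^sup>2)" "(LINT z|gauss. (E z)\<^sup>2) = exp ((norm w)\<^sup>2)"
  proof -
    have "exp ((2 *\<^sub>R w) \<bullet> z - (norm (2 *\<^sub>R w))\<^sup>2 / 2) * exp ((norm w)\<^sup>2) = (E z)\<^sup>2" for z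
      unfolding E_def by (simp add: exp_add[symmetric] power2_eq_square field_simps)
    moreover have "integrable gauss (\<lambda>z. exp ((2 *\<^sub>R w) \<bullet> z - (norm (2 *\<^sub>R w))\<^sup>2 / 2) * exp ((norm w)\<^sup>2))"
       "(LINT z|gauss. exp ((2 *\<^sub>R w) \<bullet> z - (norm (2 *\<^sub>R w))\<^sup>2 / 2) * exp ((norm w)\<^sup>2)) = exp ((norm w)\<^sup>2)"
      using gauss_shift[of "\<lambda>_. 1" "2 *\<^sub>R w"] by (simp_all add: gauss.prob_space[simplified])
    ultimately show "integrable gauss (\<lambda>z. (E z)\<^sup>2)" "(LINT z|gauss. (E z)\<^sup>2) = exp ((norm w)\<^sup>2)" by simp_all
  qed
  have E3: "integrable gauss (\<lambda>z. (w \<bullet> z) * E z)" "(LINT z|gauss. (w \<bullet> z) * E z) = (norm w)\<^sup>2"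
  proof -
    have "integrable gauss (\<lambda>z. w \<bullet> (z + w))" "(LINT z|gauss. w \<bullet> (z + w)) = (norm w)\<^sup>2"
      by (simp_all add: inner_add_right gauss.prob_space[simplified] power2_norm_eq_inner)
    then show "integrable gauss (\<lambda>z. (w \<bullet> z) * E z)" "(LINT z|gauss. (w \<bullet> z) * E z) = (norm w)\<^sup>2"
      using gauss_shift[of "\<lambda>z. w \<bullet> z" w] by (simp_all add: E_def[abs_def])
  qed
  have eE: "e z = E z - 1 - w \<bullet> z" for z unfolding e_def E_def ..
  show Ie: "integrable gauss e" unfolding e_def using E1 unfolding E_def by simp
  have sq: "(e z)\<^sup>2 = (E z)\<^sup>2 + 1 + (w \<bullet> z) * (w \<bullet> z) - 2 * E z - 2 * ((w \<bullet> z) * E z) + 2 * (w \<bullet> z)" for z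
    unfolding eE by (simp add: power2_eq_square algebra_simps)
  have Isq: "integrable gauss (\<lambda>z. (e z)\<^sup>2)" unfolding sq using E1 E2 E3 by simp
  have esq: "(LINT z|gauss. (e z)\<^sup>2) = exp ((norm w)\<^sup>2) - 1 - (norm w)\<^sup>2"
    unfolding sq using E1 E2 E3 inner2_gauss_integral[of w w] by (simp add: gauss.prob_space[simplified] power2_norm_eq_inner)
  show "(LINT z|gauss. \<bar>e z\<bar>) \<le> (2 + (LINT z|gauss. norm (z :: real ^ 'n))) * (norm w)\<^sup>2"
  proof (cases "norm w \<le> 1")
    case True
    then have w1: "(norm w)\<^sup>2 \<le> 1" by (simp add: power_le_one)
    have [measurable]: "e \<in> borel_measurable borel" unfolding e_def by measurable
    have "(LINT z|gauss. \<bar>e z\<bar>)\<^sup>2 \<le> (LINT z|gauss. (e z)\<^sup>2)"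
      using square_gauss_integral_le[of "\<lambda>z. \<bar>e z\<bar>"] Ie Isq by simp
    also have "\<dots> \<le> ((norm w)\<^sup>2)\<^sup>2" using exp_bound[of "(norm w)\<^sup>2"] w1 unfolding esq by simp
    finally have "(LINT z|gauss. \<bar>e z\<bar>) \<le> (norm w)\<^sup>2" by (rule power2_le_imp_le) simp
    also have "\<dots> \<le> (2 + m) * (norm w)\<^sup>2" using m0 by (simp add: mult_le_cancel_right1)
    finally show ?thesis unfolding m_def .
  next
    case False
    have "(LINT z|gauss. \<bar>e z\<bar>) \<le> (LINT z|gauss. E z + 1 + norm w * norm z)"
    proof (rule integral_mono)
      show "integrable gauss (\<lambda>z :: real ^ 'n. E z + 1 + norm w * norm z)" using E1 norm_power_gauss_integrable[of 1, where 'n='n] by simp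
      fix z :: "real ^ 'n"
      have "0 \<le> E z" unfolding E_def by simp
      then show "\<bar>e z\<bar> \<le> E z + 1 + norm w * norm z" unfolding eE using Cauchy_Schwarz_ineq2[of w z] by linarith
    qed (use Ie in simp)
    also have "\<dots> = 2 + norm w * m"
      using E1 norm_power_gauss_integrable[of 1, where 'n='n] by (simp add: gauss.prob_space[simplified] m_def)
    also have "\<dots> \<le> 2 * (norm w)\<^sup>2 + (norm w)\<^sup>2 * m"
    proof (intro add_mono mult_right_mono m0)
      have n1: "1 \<le> norm w" using False by simp
      then have "1 * norm w \<le> norm w * norm w" by (intro mult_right_mono) auto
      then show "norm w \<le> (norm w)\<^sup>2" by (simp add: power2_eq_square)
      then show "2 \<le> 2 * (norm w)\<^sup>2" using n1 by simp
    qed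
    finally show ?thesis unfolding m_def by (simp add: algebra_simps)
  qed
qed

section \<open>Heat flow\<close>

definition heat :: "real \<Rightarrow> (real ^ 'n::finite \<Rightarrow> real) \<Rightarrow> real ^ 'n \<Rightarrow> real" where
  "heat v u x = (LINT z|gauss. u (x + sqrt v *\<^sub>R z))"

lemma heat_measurable [measurable]:
  assumes [measurable]: "u \<in> borel_measurable borel" shows "heat v u \<in> borel_measurable borel"
proof -
  have "(\<lambda>x. LINT z|gauss. u (x + sqrt v *\<^sub>R z)) \<in> borel_measurable borel"
    by (intro gauss.borel_measurable_lebesgue_integral) measurable
  then show ?thesis by (simp add: heat_def[abs_def])
qed

lemma gauss_integral_bounds:
  fixes u :: "real ^ 'n::finite \<Rightarrow> real"
  assumes [measurable]: "u \<in> borel_measurable borel" and "\<And>x. \<delta> \<le> u x" "\<And>x. u x \<le> M"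
  shows "\<delta> \<le> (LINT z|gauss. u (z :: real ^ 'n::finite))" "(LINT z|gauss. u (z :: real ^ 'n)) \<le> M"
proof -
  have I: "integrable gauss u"
    by (rule gauss_bounded_integrable[of _ "\<bar>\<delta>\<bar> + \<bar>M\<bar>"]) (simp, smt (verit) assms(2,3))
  have "(LINT z|(gauss :: (real ^ 'n) measure). \<delta>) \<le> (LINT z|gauss. u z)" using assms I by (intro integral_mono) auto
  then show "\<delta> \<le> (LINT z|gauss. u z)" by (simp add: gauss.prob_space[simplified])
  have "(LINT z|gauss. u z) \<le> (LINT z|(gauss :: (real ^ 'n) measure). M)" using assms I by (intro integral_mono) auto
  then show "(LINT z|gauss. u z) \<le> M" by (simp add: gauss.prob_space[simplified])
qed

lemma heat_bounds:
  fixes u :: "real ^ 'n::finite \<Rightarrow> real"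
  assumes [measurable]: "u \<in> borel_measurable borel" and "\<And>x. \<delta> \<le> u x" "\<And>x. u x \<le> M"
  shows "\<delta> \<le> heat v u x" "heat v u x \<le> M"
  unfolding heat_def using assms by (auto intro!: gauss_integral_bounds)

text \<open>The sum of independent centred Gaussians is Gaussian and the variances add.\<close>

lemma gauss_convolution:
  fixes F :: "real ^ 'n::finite \<Rightarrow> real"
  assumes [measurable]: "F \<in> borel_measurable borel" and bd: "\<And>x. \<bar>F x\<bar> \<le> M" and ab: "0 \<le> a" "0 < b"
  shows "(LINT z|gauss. LINT z'|gauss. F (sqrt a *\<^sub>R z + sqrt b *\<^sub>R z')) = (LINT z|gauss. F (sqrt (a + b) *\<^sub>R z))"
proof -
  define c d where "c = sqrt (a / (a + b))" and "d = sqrt (b / (a + b))"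
  have cd: "c\<^sup>2 + d\<^sup>2 = 1" "d \<noteq> 0"
    unfolding c_def d_def using ab by (auto simp: add_divide_distrib[symmetric])
  have ca: "sqrt (a + b) * c = sqrt a" "sqrt (a + b) * d = sqrt b"
    unfolding c_def d_def real_sqrt_mult[symmetric] using ab by auto
  have mm: "(\<lambda>(x, z). c *\<^sub>R x + d *\<^sub>R z) \<in> measurable gauss_pair (gauss :: (real ^ 'n) measure)" by measurable
  have "(LINT z|gauss. F (sqrt (a + b) *\<^sub>R z)) = (LINT z|distr gauss_pair gauss (\<lambda>(x, z). c *\<^sub>R x + d *\<^sub>R z). F (sqrt (a + b) *\<^sub>R z))"
    unfolding distr_gauss_linear[OF cd] ..
  also have "\<dots> = (LINT xz|gauss_pair. F (sqrt a *\<^sub>R fst xz + sqrt b *\<^sub>R snd xz))"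
    by (subst integral_distr[OF mm]) (auto simp: split_beta' scaleR_add_right ca)
  also have "\<dots> = (LINT z|gauss. LINT z'|gauss. F (sqrt a *\<^sub>R z + sqrt b *\<^sub>R z'))"
  proof -
    have "integrable gauss_pair (\<lambda>xz. F (sqrt a *\<^sub>R fst xz + sqrt b *\<^sub>R snd xz))"
      by (rule gauss2.integrable_const_bound[of _ M]) (auto simp: bd)
    from gauss2.integral_fst'[OF this] show ?thesis by simp
  qed
  finally show ?thesis by simp
qed

lemma heat_heat:
  assumes [measurable]: "u \<in> borel_measurable borel" and bd: "\<And>x. \<bar>u x\<bar> \<le> M" and ab: "0 \<le> a" "0 < b"
  shows "heat a (heat b u) x = heat (a + b) u x"
  unfolding heat_def using gauss_convolution[of "\<lambda>y. u (x + y)" M a b] assms by (simp add: add.assoc)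

lemma gauss_swap:
  fixes F :: "real ^ 'n::finite \<Rightarrow> real ^ 'n \<Rightarrow> real"
  assumes [measurable]: "(\<lambda>(x, y). F x y) \<in> borel_measurable gauss_pair" and bd: "\<And>x y. \<bar>F x y\<bar> \<le> M"
  shows "(LINT x|gauss. LINT y|gauss. F x y) = (LINT y|gauss. LINT x|gauss. F x y)"
proof (rule gauss2.Fubini_integral[symmetric])
  show "integrable gauss_pair (case_prod F)"
    by (rule gauss2.integrable_const_bound[of _ M]) (use assms in auto)
qed

text \<open>A correlated pair of variance \<open>a + b\<close> is the sum of independent correlated pairs of variances \<open>a\<close>
  and \<open>b\<close>.  This lets the heat flow be followed in small steps.\<close>

lemma corr_split:
  fixes F :: "(real ^ 'n::finite) \<times> (real ^ 'n) \<Rightarrow> real"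
  assumes F[measurable]: "F \<in> borel_measurable (borel \<Otimes>\<^sub>M borel)" and bd: "\<And>x. \<bar>F x\<bar> \<le> M" and ab: "0 \<le> a" "0 < b"
    and s: "0 \<le> s" "s < 1"
  shows "(LINT xy|corr s. F (sqrt (a + b) *\<^sub>R fst xy, sqrt (a + b) *\<^sub>R snd xy))
     = (LINT xy|corr s. LINT xy'|corr s. F (sqrt a *\<^sub>R fst xy + sqrt b *\<^sub>R fst xy', sqrt a *\<^sub>R snd xy + sqrt b *\<^sub>R snd xy'))"
proof -
  interpret c: prob_space "corr s :: ((real ^ 'n) \<times> (real ^ 'n)) measure" by (rule prob_space_corr)
  let ?d = "sqrt (1 - s\<^sup>2)"
  define H where "H x z = F (x, s *\<^sub>R x + ?d *\<^sub>R z)" for x z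
  have [measurable]: "(\<lambda>(x, z). H x z) \<in> borel_measurable (borel \<Otimes>\<^sub>M borel)" unfolding H_def by measurable
  have Hb: "\<bar>H x z\<bar> \<le> M" for x z unfolding H_def by (rule bd)
  have Hx[measurable]: "H x \<in> borel_measurable borel" for x unfolding H_def by measurable
  define \<Phi> where "\<Phi> x = (LINT z|gauss. LINT z'|gauss. H x (sqrt a *\<^sub>R z + sqrt b *\<^sub>R z'))" for x
  have intI: "\<bar>LINT z|gauss. g z\<bar> \<le> M" if "g \<in> borel_measurable borel" "\<And>z :: real ^ 'n. \<bar>g z\<bar> \<le> M" for g
    using gauss_integral_bounds[of g "- M" M] that by (auto simp: abs_le_iff minus_le_iff)
  have [measurable]: "\<Phi> \<in> borel_measurable borel"
    unfolding \<Phi>_def by measurable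
  have \<Phi>b: "\<bar>\<Phi> x\<bar> \<le> M" for x
    unfolding \<Phi>_def by (intro intI) (measurable, auto intro!: Hb)
  have ccb: "integrable (corr s) G" if "G \<in> borel_measurable (borel \<Otimes>\<^sub>M borel)" "\<And>x. \<bar>G x\<bar> \<le> M" for G :: "(real ^ 'n) \<times> (real ^ 'n) \<Rightarrow> real"
    using that by (intro c.integrable_const_bound[of _ M]) (auto simp: measurable_cong_sets[OF sets_corr refl] borel_measurable_gauss_pair)
  have "(LINT xy|corr s. F (sqrt (a + b) *\<^sub>R fst xy, sqrt (a + b) *\<^sub>R snd xy))
      = (LINT x|gauss. LINT z|gauss. H (sqrt (a + b) *\<^sub>R x) (sqrt (a + b) *\<^sub>R z))"
    by (subst integral_corr(1)[OF s], rule ccb) (auto simp: bd H_def algebra_simps)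
  also have "\<dots> = (LINT x|gauss. \<Phi> (sqrt (a + b) *\<^sub>R x))"
    unfolding \<Phi>_def by (subst gauss_convolution[OF Hx Hb ab]) simp
  also have "\<dots> = (LINT x|gauss. LINT x'|gauss. \<Phi> (sqrt a *\<^sub>R x + sqrt b *\<^sub>R x'))"
    by (rule gauss_convolution[symmetric, OF _ \<Phi>b ab]) measurable
  also have "\<dots> = (LINT x|gauss. LINT z|gauss. LINT x'|gauss. LINT z'|gauss. H (sqrt a *\<^sub>R x + sqrt b *\<^sub>R x') (sqrt a *\<^sub>R z + sqrt b *\<^sub>R z'))"
    unfolding \<Phi>_def
    by (intro Bochner_Integration.integral_cong refl gauss_swap[where M = M] intI) (measurable, auto intro!: Hb)
  also have "\<dots> = (LINT x|gauss. LINT z|gauss. LINT xy'|corr s. F (sqrt a *\<^sub>R x + sqrt b *\<^sub>R fst xy', sqrt a *\<^sub>R (s *\<^sub>R x + ?d *\<^sub>R z) + sqrt b *\<^sub>R snd xy'))"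
    by (subst integral_corr(1)[OF s], rule ccb) (auto simp: bd H_def algebra_simps)
  also have "\<dots> = (LINT xy|corr s. LINT xy'|corr s. F (sqrt a *\<^sub>R fst xy + sqrt b *\<^sub>R fst xy', sqrt a *\<^sub>R snd xy + sqrt b *\<^sub>R snd xy'))"
  proof -
    let ?L = "\<lambda>xy :: (real ^ 'n) \<times> (real ^ 'n). LINT xy'|corr s. F (sqrt a *\<^sub>R fst xy + sqrt b *\<^sub>R fst xy', sqrt a *\<^sub>R snd xy + sqrt b *\<^sub>R snd xy')"
    have "integrable (corr s) ?L"
    proof (rule ccb)
      show "?L \<in> borel_measurable (borel \<Otimes>\<^sub>M borel)"
        by measurable
      fix xy :: "(real ^ 'n) \<times> (real ^ 'n)"
      have I: "integrable (corr s) (\<lambda>xy'. F (sqrt a *\<^sub>R fst xy + sqrt b *\<^sub>R fst xy', sqrt a *\<^sub>R snd xy + sqrt b *\<^sub>R snd xy'))"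
        by (rule ccb) (auto simp: bd)
      have "?L xy \<le> M"
        by (rule c.integral_le_const[OF I]) (use bd in \<open>auto simp: abs_le_iff\<close>)
      moreover have "- M \<le> ?L xy"
        by (rule c.integral_ge_const[OF I]) (use bd in \<open>auto simp: abs_le_iff minus_le_iff\<close>)
      ultimately show "\<bar>?L xy\<bar> \<le> M"
        by simp
    qed
    from integral_corr(1)[OF s this] show ?thesis by simp
  qed
  finally show ?thesis .
qed

text \<open>After a translation of the Gaussian, the increments of \<open>heat v u\<close> are increments of the density and
  no longer of \<open>u\<close>; hence the heat flow is differentiable with a Lipschitz gradient, uniformly for
  \<open>v\<close> bounded away from \<open>0\<close>.\<close>

lemma heat_C11:
  fixes u :: "real ^ 'n::finite \<Rightarrow> real"
  assumes [measurable]: "u \<in> borel_measurable borel" and u: "\<And>x. 0 \<le> u x" "\<And>x. u x \<le> 1" and v: "0 < \<epsilon>" "\<epsilon> \<le> v"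
  defines "m \<equiv> LINT z|gauss. norm (z :: real ^ 'n)"
  shows "\<exists>l. norm l \<le> m / sqrt \<epsilon> \<and> (\<forall>w. \<bar>heat v u (x + w) - heat v u x - l \<bullet> w\<bar> \<le> (2 + m) / \<epsilon> * (norm w)\<^sup>2)"
proof -
  have v0: "0 < v" using v by simp
  have m0: "0 \<le> m" unfolding m_def by (intro integral_nonneg_AE) auto
  define k where "k z = u (x + sqrt v *\<^sub>R z)" for z
  have [measurable]: "k \<in> borel_measurable borel" unfolding k_def by measurable
  have k: "0 \<le> k z" "k z \<le> 1" for z unfolding k_def using u by auto
  have kI: "integrable gauss (\<lambda>z. k z * g z)" if "integrable gauss g" for g :: "real ^ 'n \<Rightarrow> real"
  proof (rule Bochner_Integration.integrable_bound[OF that])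
    show "(\<lambda>z. k z * g z) \<in> borel_measurable gauss" using borel_measurable_integrable[OF that] by simp
    show "AE z in gauss. norm (k z * g z) \<le> norm (g z)"
      using k by (intro AE_I2) (simp add: abs_mult mult_left_le_one_le)
  qed
  have ci: "integrable gauss (\<lambda>z :: real ^ 'n. z $ i)" for i
    using inner_gauss_integrable[of "axis i 1"] by (simp add: inner_axis')
  define l where "l = (\<chi> i. (LINT z|gauss. k z * z $ i) / sqrt v)"
  have lw: "l \<bullet> w = (LINT z|gauss. k z * (w \<bullet> z)) / sqrt v" for w
  proof -
    have "(LINT z|gauss. k z * (w \<bullet> z)) = (LINT z|gauss. (\<Sum>i\<in>UNIV. w $ i * (k z * z $ i)))"
      by (simp add: inner_vec_def sum_distrib_left mult_ac)
    also have "\<dots> = (\<Sum>i\<in>UNIV. w $ i * (LINT z|gauss. k z * z $ i))" using kI[OF ci] by simp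
    finally show ?thesis unfolding l_def by (simp add: inner_vec_def sum_divide_distrib mult_ac)
  qed
  have nI: "integrable gauss (\<lambda>z :: real ^ 'n. norm z)" using norm_power_gauss_integrable[of 1, where 'n = 'n] by simp
  have "norm l * norm l = l \<bullet> l" by (simp add: power2_norm_eq_inner[symmetric] power2_eq_square)
  also have "\<dots> = (LINT z|gauss. k z * (l \<bullet> z)) / sqrt v" by (rule lw)
  also have "\<dots> \<le> (LINT z|gauss. norm l * norm (z :: real ^ 'n)) / sqrt v"
  proof (intro divide_right_mono integral_mono kI inner_gauss_integrable)
    fix z :: "real ^ 'n"
    have "k z * (l \<bullet> z) \<le> \<bar>k z\<bar> * \<bar>l \<bullet> z\<bar>" by (simp add: abs_mult[symmetric])
    also have "\<dots> \<le> 1 * (norm l * norm z)" using k Cauchy_Schwarz_ineq2[of l z] by (intro mult_mono) auto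
    finally show "k z * (l \<bullet> z) \<le> norm l * norm z" by simp
  qed (use v0 nI in auto)
  also have "\<dots> = norm l * (m / sqrt v)" unfolding m_def by simp
  finally have "norm l \<le> m / sqrt v"
    using m0 v0 mult_le_cancel_left_pos[of "norm l" "norm l" "m / sqrt v"] by (cases "norm l = 0") auto
  also have "\<dots> \<le> m / sqrt \<epsilon>" using m0 v by (intro divide_left_mono) auto
  finally have ln: "norm l \<le> m / sqrt \<epsilon>" .
  have "\<bar>heat v u (x + w) - heat v u x - l \<bullet> w\<bar> \<le> (2 + m) / \<epsilon> * (norm w)\<^sup>2" for w
  proof -
    define W where "W = (1 / sqrt v) *\<^sub>R w"
    define e where "e z = exp (W \<bullet> z - (norm W)\<^sup>2 / 2) - 1 - W \<bullet> z" for z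
    have eI: "integrable gauss e" unfolding e_def by (rule gauss_shift_error)
    have "heat v u (x + w) = (LINT z|gauss. k (z + W))"
      unfolding heat_def k_def W_def using v0 by (simp add: algebra_simps)
    also have "\<dots> = (LINT z|gauss. k z * exp (W \<bullet> z - (norm W)\<^sup>2 / 2))" by (rule gauss_shift) measurable
    also have "\<dots> = (LINT z|gauss. k z * e z + k z * 1 + k z * (W \<bullet> z))"
      unfolding e_def by (simp add: algebra_simps)
    also have "\<dots> = (LINT z|gauss. k z * e z) + (LINT z|gauss. k z) + (LINT z|gauss. k z * (W \<bullet> z))"
      using kI[OF eI] kI[OF inner_gauss_integrable[of W]] kI[of "\<lambda>_. 1"] by simp
    also have "(LINT z|gauss. k z) = heat v u x" unfolding heat_def k_def ..
    also have "(LINT z|gauss. k z * (W \<bullet> z)) = l \<bullet> w" unfolding lw W_def by simp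
    finally have "\<bar>heat v u (x + w) - heat v u x - l \<bullet> w\<bar> = \<bar>LINT z|gauss. k z * e z\<bar>" by simp
    also have "\<dots> \<le> (LINT z|gauss. \<bar>k z * e z\<bar>)" by (rule integral_abs_bound)
    also have "\<dots> \<le> (LINT z|gauss. \<bar>e z\<bar>)"
    proof (rule integral_mono)
      show "integrable gauss (\<lambda>z. \<bar>k z * e z\<bar>)" "integrable gauss (\<lambda>z. \<bar>e z\<bar>)" using kI[OF eI] eI by simp_all
      show "\<bar>k z * e z\<bar> \<le> \<bar>e z\<bar>" for z using k[of z] by (simp add: abs_mult mult_left_le_one_le)
    qed
    also have "\<dots> \<le> (2 + m) * (norm W)\<^sup>2" unfolding e_def m_def by (rule gauss_shift_error)
    also have "\<dots> = (2 + m) / v * (norm w)\<^sup>2" unfolding W_def using v0 by (simp add: power_mult_distrib power_divide)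
    also have "\<dots> \<le> (2 + m) / \<epsilon> * (norm w)\<^sup>2" using m0 v by (intro mult_right_mono divide_left_mono) auto
    finally show ?thesis .
  qed
  then show ?thesis using ln by blast
qed

section \<open>Hypercontractivity\<close>

lemma powr_taylor_bounds:
  assumes E: "1 \<le> (E::real)" and a: "0 \<le> a" "a \<le> 1" and t: "1 / E \<le> 1 + t" "1 + t \<le> E"
  shows "\<bar>(1 + t) powr a - 1\<bar> \<le> 2 * E ^ 3 * \<bar>t\<bar>"
    and "\<bar>(1 + t) powr a - 1 - a * t\<bar> \<le> 2 * E ^ 3 * t\<^sup>2"
    and "\<bar>(1 + t) powr a - 1 - a * t + a * (1 - a) / 2 * t\<^sup>2\<bar> \<le> 2 * E ^ 3 * \<bar>t\<bar> ^ 3"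
proof -
  define d where "d = (\<lambda>(j::nat) u :: real. (\<Prod>i<j. a - real i) * u powr (a - real j))"
  have dd: "(d j has_real_derivative d (Suc j) u) (at u)" if "0 < u" for j u
  proof -
    have "((\<lambda>u. (\<Prod>i<j. a - real i) * u powr (a - real j)) has_real_derivative
        (\<Prod>i<j. a - real i) * ((a - real j) * u powr (a - real j - 1))) (at u)"
      by (intro DERIV_cmult has_real_derivative_powr that)
    moreover have "a - real j - 1 = a - real (Suc j)" by simp
    ultimately show ?thesis unfolding d_def by (simp add: mult_ac)
  qed
  have E0: "0 < 1 / E" using E by simp
  have E1: "1 / E \<le> 1" using E by simp
  have db: "\<bar>d j u\<bar> \<le> 2 * E ^ 3" if u: "1 / E \<le> u" "u \<le> E" and j: "j \<in> {1,2,3}" for j u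
  proof -
    have "u powr (a - real j) \<le> (1 / E) powr (a - real j)" using u j a E0 by (intro powr_mono2') auto
    also have "\<dots> = E powr (real j - a)" using E by (simp add: powr_divide powr_minus_divide[symmetric])
    also have "\<dots> \<le> E powr real 3" using E j a by (intro powr_mono) auto
    also have "\<dots> = E ^ 3" using E by (simp add: powr_numeral)
    finally have p: "u powr (a - real j) \<le> E ^ 3" .
    have pr: "\<bar>\<Prod>i<j. a - real i\<bar> \<le> 2"
    proof -
      have 1: "\<bar>a * (a - 1)\<bar> \<le> 1 * 1" unfolding abs_mult using a by (intro mult_mono) auto
      have 2: "\<bar>a * (a - 1) * (a - 2)\<bar> \<le> 1 * 2" unfolding abs_mult[of "a * (a - 1)"] using 1 a by (intro mult_mono) auto
      show ?thesis using j a 1 2 by (auto simp: numeral_2_eq_2 numeral_3_eq_3 lessThan_Suc mult_ac)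
    qed
    show ?thesis unfolding d_def abs_mult using p pr by (intro mult_mono) auto
  qed
  have taylor: "\<bar>(1 + t) powr a - (\<Sum>m<n. d m 1 / fact m * t ^ m)\<bar> \<le> 2 * E ^ 3 * \<bar>t\<bar> ^ n" if n: "n \<in> {1,2,3}" for n
  proof (cases "t = 0")
    case True then show ?thesis using n by (auto simp: d_def numeral_2_eq_2 numeral_3_eq_3)
  next
    case False
    have "\<exists>u. (if 1 + t < 1 then 1 + t < u \<and> u < 1 else 1 < u \<and> u < 1 + t) \<and>
        d 0 (1 + t) = (\<Sum>m<n. d m 1 / fact m * ((1 + t) - 1) ^ m) + d n u / fact n * ((1 + t) - 1) ^ n"
    proof (rule Taylor[of n d "d 0" "1 / E" E 1 "1 + t"])
      show "\<forall>m t. m < n \<and> 1 / E \<le> t \<and> t \<le> E \<longrightarrow> DERIV (d m) t :> d (Suc m) t"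
        by (intro allI impI dd) (use E0 in linarith)
    qed (use n E t False E1 in auto)
    then obtain u where u: "if 1 + t < 1 then 1 + t < u \<and> u < 1 else 1 < u \<and> u < 1 + t"
      and eq: "d 0 (1 + t) = (\<Sum>m<n. d m 1 / fact m * t ^ m) + d n u / fact n * t ^ n" by auto
    have "1 / E \<le> u \<and> u \<le> E"
    proof (cases "1 + t < 1")
      case True
      then show ?thesis using u t E by simp
    next
      case False
      then have "1 < u" "u < 1 + t" using u by auto
      then show ?thesis using t E1 by linarith
    qed
    then have b: "\<bar>d n u\<bar> \<le> 2 * E ^ 3" using db n by auto
    have "\<bar>(1 + t) powr a - (\<Sum>m<n. d m 1 / fact m * t ^ m)\<bar> = \<bar>d n u\<bar> / fact n * \<bar>t\<bar> ^ n"
      using eq by (simp add: d_def abs_mult power_abs)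
    also have "\<dots> \<le> \<bar>d n u\<bar> * \<bar>t\<bar> ^ n"
    proof (rule mult_right_mono)
      have "(1::real) \<le> fact n" by simp
      then show "\<bar>d n u\<bar> / fact n \<le> \<bar>d n u\<bar>" by (simp add: divide_le_eq mult_le_cancel_left1)
    qed simp
    also have "\<dots> \<le> 2 * E ^ 3 * \<bar>t\<bar> ^ n" using b by (intro mult_right_mono) auto
    finally show ?thesis .
  qed
  show "\<bar>(1 + t) powr a - 1\<bar> \<le> 2 * E ^ 3 * \<bar>t\<bar>" using taylor[of 1] by (simp add: d_def)
  show "\<bar>(1 + t) powr a - 1 - a * t\<bar> \<le> 2 * E ^ 3 * t\<^sup>2"
    using taylor[of 2] by (simp add: d_def numeral_2_eq_2)
  show "\<bar>(1 + t) powr a - 1 - a * t + a * (1 - a) / 2 * t\<^sup>2\<bar> \<le> 2 * E ^ 3 * \<bar>t\<bar> ^ 3"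
  proof -
    have "(\<Sum>m<3. d m 1 / fact m * t ^ m) = 1 + a * t - a * (1 - a) / 2 * t\<^sup>2"
      by (simp add: d_def numeral_2_eq_2 numeral_3_eq_3 field_simps)
    then show ?thesis using taylor[of 3] by (simp add: algebra_simps)
  qed
qed

lemma square_mult_le_cubes:
  assumes "0 \<le> (x::real)" "0 \<le> y" shows "x\<^sup>2 * y + x * y\<^sup>2 \<le> x ^ 3 + y ^ 3"
proof -
  have "0 \<le> (x - y)\<^sup>2 * (x + y)" using assms by simp
  also have "\<dots> = x ^ 3 + y ^ 3 - (x\<^sup>2 * y + x * y\<^sup>2)" by (simp add: power2_eq_square power3_eq_cube algebra_simps)
  finally show ?thesis by simp
qed

lemma powr_product_bounds:
  assumes E: "1 \<le> (E::real)" and a: "0 \<le> a" "a \<le> 1"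
    and t: "1 / E \<le> 1 + t" "1 + t \<le> E" and t': "1 / E \<le> 1 + t'" "1 + t' \<le> E"
  defines "F \<equiv> 2 * E ^ 3"
  shows "(1 + t) powr a * (1 + t') powr a \<le> 1 + a * t + a * t' - a * (1 - a) / 2 * (t\<^sup>2 + t'\<^sup>2) + a\<^sup>2 * (t * t')
            + (2 * F + F\<^sup>2) * (\<bar>t\<bar> ^ 3 + \<bar>t'\<bar> ^ 3)" (is ?upper)
    and "1 + a * t + a * t' - (F + F\<^sup>2) * (t\<^sup>2 + t'\<^sup>2) \<le> (1 + t) powr a * (1 + t') powr a" (is ?lower)
proof -
  define g g' where "g = (1 + t) powr a - 1" and "g' = (1 + t') powr a - 1"
  have prod: "(1 + t) powr a * (1 + t') powr a = 1 + g + g' + g * g'" unfolding g_def g'_def by (simp add: algebra_simps)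
  have F0: "0 \<le> F" unfolding F_def using E by simp
  note b = powr_taylor_bounds[OF E a t, folded g_def F_def] powr_taylor_bounds[OF E a t', folded g'_def F_def]
  have gg: "\<bar>g * g' - a\<^sup>2 * (t * t')\<bar> \<le> (F\<^sup>2 + F) * (\<bar>t\<bar> ^ 3 + \<bar>t'\<bar> ^ 3)"
  proof -
    have e: "g * g' - a\<^sup>2 * (t * t') = (g - a * t) * g' + a * t * (g' - a * t')" by (simp add: algebra_simps power2_eq_square)
    have "\<bar>g * g' - a\<^sup>2 * (t * t')\<bar> \<le> \<bar>(g - a * t) * g'\<bar> + \<bar>a * t * (g' - a * t')\<bar>"
      unfolding e by (rule abs_triangle_ineq)
    also have "\<dots> = \<bar>g - a * t\<bar> * \<bar>g'\<bar> + a * \<bar>t\<bar> * \<bar>g' - a * t'\<bar>"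
      using a by (simp add: abs_mult)
    also have "\<dots> \<le> (F * t\<^sup>2) * (F * \<bar>t'\<bar>) + 1 * \<bar>t\<bar> * (F * t'\<^sup>2)"
    proof (rule add_mono)
      show "\<bar>g - a * t\<bar> * \<bar>g'\<bar> \<le> (F * t\<^sup>2) * (F * \<bar>t'\<bar>)" by (rule mult_mono[OF b(2) b(4)]) (use F0 in auto)
      show "a * \<bar>t\<bar> * \<bar>g' - a * t'\<bar> \<le> 1 * \<bar>t\<bar> * (F * t'\<^sup>2)"
        by (rule mult_mono[OF mult_right_mono[OF a(2)] b(5)]) auto
    qed
    also have "\<dots> \<le> F\<^sup>2 * (\<bar>t\<bar>\<^sup>2 * \<bar>t'\<bar>) + F * (\<bar>t\<bar> * \<bar>t'\<bar>\<^sup>2)" by (simp add: power2_eq_square mult_ac)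
    also have "\<dots> \<le> F\<^sup>2 * (\<bar>t\<bar>\<^sup>2 * \<bar>t'\<bar> + \<bar>t\<bar> * \<bar>t'\<bar>\<^sup>2) + F * (\<bar>t\<bar>\<^sup>2 * \<bar>t'\<bar> + \<bar>t\<bar> * \<bar>t'\<bar>\<^sup>2)"
      using F0 by (intro add_mono mult_left_mono) auto
    also have "\<dots> = (F\<^sup>2 + F) * (\<bar>t\<bar>\<^sup>2 * \<bar>t'\<bar> + \<bar>t\<bar> * \<bar>t'\<bar>\<^sup>2)" by (simp add: algebra_simps)
    also have "\<dots> \<le> (F\<^sup>2 + F) * (\<bar>t\<bar> ^ 3 + \<bar>t'\<bar> ^ 3)" using F0 square_mult_le_cubes[of "\<bar>t\<bar>" "\<bar>t'\<bar>"] by (intro mult_left_mono) auto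
    finally show ?thesis .
  qed
  have "g \<le> a * t - a * (1 - a) / 2 * t\<^sup>2 + F * \<bar>t\<bar> ^ 3" "g' \<le> a * t' - a * (1 - a) / 2 * t'\<^sup>2 + F * \<bar>t'\<bar> ^ 3"
    using b(3) b(6) by linarith+
  moreover have "g * g' \<le> a\<^sup>2 * (t * t') + (F\<^sup>2 + F) * (\<bar>t\<bar> ^ 3 + \<bar>t'\<bar> ^ 3)" using gg by linarith
  ultimately have "1 + g + g' + g * g' \<le> 1 + (a * t - a * (1 - a) / 2 * t\<^sup>2 + F * \<bar>t\<bar> ^ 3) + (a * t' - a * (1 - a) / 2 * t'\<^sup>2 + F * \<bar>t'\<bar> ^ 3)
       + (a\<^sup>2 * (t * t') + (F\<^sup>2 + F) * (\<bar>t\<bar> ^ 3 + \<bar>t'\<bar> ^ 3))" by linarith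
  also have "\<dots> = 1 + a * t + a * t' - a * (1 - a) / 2 * (t\<^sup>2 + t'\<^sup>2) + a\<^sup>2 * (t * t')
            + (2 * F + F\<^sup>2) * (\<bar>t\<bar> ^ 3 + \<bar>t'\<bar> ^ 3)" by (simp only: distrib_left distrib_right mult_2)
  finally show ?upper unfolding prod .
  have "a * t - F * t\<^sup>2 \<le> g" "a * t' - F * t'\<^sup>2 \<le> g'" using b(2) b(5) by linarith+
  moreover have "- (F\<^sup>2 * (t\<^sup>2 + t'\<^sup>2)) \<le> g * g'"
  proof -
    have "\<bar>g * g'\<bar> \<le> (F * \<bar>t\<bar>) * (F * \<bar>t'\<bar>)" unfolding abs_mult by (rule mult_mono[OF b(1) b(4)]) (use F0 in auto)
    also have "\<dots> = F\<^sup>2 * \<bar>t * t'\<bar>" by (simp add: power2_eq_square abs_mult)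
    also have "\<dots> \<le> F\<^sup>2 * (t\<^sup>2 + t'\<^sup>2)" by (intro mult_left_mono abs_mult_le_squares) simp
    finally show ?thesis by linarith
  qed
  ultimately show ?lower unfolding prod by (simp add: algebra_simps)
qed

text \<open>Bookkeeping for one step of length \<open>h\<close>: an increment \<open>\<tau> + r\<close> has a linear part \<open>\<tau>\<close> of order
  \<open>sqrt h\<close> and a remainder \<open>r\<close> of order \<open>h\<close>.  Replacing the increment by \<open>\<tau>\<close> in quadratic terms, or
  dropping cubic terms, costs \<open>h sqrt h\<close> times a power of the Gaussian variables; all powers that
  occur are absorbed by the sixth.\<close>

lemma quadratic_remainders:
  fixes N N' h B \<tau> \<tau>' r r' :: real
  assumes h: "0 < h" "h \<le> 1" and N: "0 \<le> N" "0 \<le> N'" and B: "1 \<le> B"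
    and \<tau>: "\<bar>\<tau>\<bar> \<le> sqrt h * B * N" "\<bar>\<tau>'\<bar> \<le> sqrt h * B * N'"
    and r: "\<bar>r\<bar> \<le> B * h * N\<^sup>2" "\<bar>r'\<bar> \<le> B * h * N'\<^sup>2"
  defines "M \<equiv> (1 + N) ^ 6 + (1 + N') ^ 6"
  shows "(\<tau> + r) * (\<tau>' + r') \<le> \<tau> * \<tau>' + 3 * B\<^sup>2 * (h * sqrt h) * M"
    and "\<tau>\<^sup>2 - 2 * B\<^sup>2 * (h * sqrt h) * (1 + N) ^ 6 \<le> (\<tau> + r)\<^sup>2"
    and "\<bar>\<tau> + r\<bar> ^ 3 \<le> B ^ 3 * (h * sqrt h) * (1 + N) ^ 6"
proof -
  define k where "k = sqrt h"
  have k: "0 < k" "k \<le> 1" "k * k = h" unfolding k_def using h by auto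
  have kh: "h * h \<le> h * k" using k h by (metis mult.commute mult_left_le mult_left_mono order_less_imp_le)
  have hk0: "0 \<le> h * k" using k h by simp
  have p1: "1 \<le> (1 + N)" "1 \<le> 1 + N'" using N by auto
  have pw: "x ^ i * y ^ j \<le> M" if "i + j \<le> 6" "x \<in> {1 + N, 1 + N'}" "y \<in> {1 + N, 1 + N'}" for x y i j
  proof -
    define z where "z = max (1 + N) (1 + N')"
    have z: "1 \<le> z" "x \<le> z" "y \<le> z" "0 \<le> x" "0 \<le> y" using that p1 unfolding z_def by auto
    have "x ^ i * y ^ j \<le> z ^ i * z ^ j" using z by (intro mult_mono power_mono) auto
    also have "\<dots> = z ^ (i + j)" by (simp add: power_add)
    also have "\<dots> \<le> z ^ 6" using that z by (intro power_increasing) auto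
    also have "\<dots> \<le> M" unfolding M_def z_def max_def using p1 by simp
    finally show ?thesis .
  qed
  have t1: "\<bar>\<tau>\<bar> \<le> k * B * (1 + N)"
    by (rule order_trans[OF \<tau>(1)[folded k_def]]) (use k B N in \<open>auto intro!: mult_left_mono\<close>)
  have t2: "\<bar>\<tau>'\<bar> \<le> k * B * (1 + N')"
    by (rule order_trans[OF \<tau>(2)[folded k_def]]) (use k B N in \<open>auto intro!: mult_left_mono\<close>)
  have r1: "\<bar>r\<bar> \<le> B * h * (1 + N)\<^sup>2"
    by (rule order_trans[OF r(1)]) (use h B N in \<open>auto intro!: mult_left_mono power_mono\<close>)
  have r2: "\<bar>r'\<bar> \<le> B * h * (1 + N')\<^sup>2"
    by (rule order_trans[OF r(2)]) (use h B N in \<open>auto intro!: mult_left_mono power_mono\<close>)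
  have b1: "\<bar>\<tau>\<bar> * \<bar>r'\<bar> \<le> B\<^sup>2 * (h * k) * M"
  proof -
    have "\<bar>\<tau>\<bar> * \<bar>r'\<bar> \<le> (k * B * (1 + N)) * (B * h * (1 + N')\<^sup>2)"
      by (rule mult_mono[OF t1 r2]) (use k B N in auto)
    also have "\<dots> = B\<^sup>2 * (h * k) * ((1 + N) ^ 1 * (1 + N') ^ 2)" by (simp add: power2_eq_square mult_ac)
    also have "\<dots> \<le> B\<^sup>2 * (h * k) * M" using hk0 by (intro mult_left_mono pw) auto
    finally show ?thesis .
  qed
  have b2: "\<bar>r\<bar> * \<bar>\<tau>'\<bar> \<le> B\<^sup>2 * (h * k) * M"
  proof -
    have "\<bar>r\<bar> * \<bar>\<tau>'\<bar> \<le> (B * h * (1 + N)\<^sup>2) * (k * B * (1 + N'))"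
      by (rule order_trans[OF mult_mono[OF r1 t2]]) (use h B N in auto)
    also have "\<dots> = B\<^sup>2 * (h * k) * ((1 + N) ^ 2 * (1 + N') ^ 1)" by (simp add: power2_eq_square mult_ac)
    also have "\<dots> \<le> B\<^sup>2 * (h * k) * M" using hk0 by (intro mult_left_mono pw) auto
    finally show ?thesis .
  qed
  have b3: "\<bar>r\<bar> * \<bar>r'\<bar> \<le> B\<^sup>2 * (h * k) * M"
  proof -
    have "\<bar>r\<bar> * \<bar>r'\<bar> \<le> (B * h * (1 + N)\<^sup>2) * (B * h * (1 + N')\<^sup>2)"
      by (rule mult_mono[OF r1 r2]) (use h B N in auto)
    also have "\<dots> = B\<^sup>2 * (h * h) * ((1 + N) ^ 2 * (1 + N') ^ 2)" by (simp add: power2_eq_square mult_ac)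
    also have "\<dots> \<le> B\<^sup>2 * (h * k) * M" using kh p1 h k by (intro mult_mono mult_left_mono pw) auto
    finally show ?thesis .
  qed
  have "(\<tau> + r) * (\<tau>' + r') = \<tau> * \<tau>' + \<tau> * r' + r * \<tau>' + r * r'" by (simp add: algebra_simps)
  also have "\<dots> \<le> \<tau> * \<tau>' + \<bar>\<tau>\<bar> * \<bar>r'\<bar> + \<bar>r\<bar> * \<bar>\<tau>'\<bar> + \<bar>r\<bar> * \<bar>r'\<bar>"
    by (intro add_mono order_refl) (simp_all add: abs_mult[symmetric])
  also have "\<dots> \<le> \<tau> * \<tau>' + 3 * B\<^sup>2 * (h * k) * M" using b1 b2 b3 by linarith
  finally show "(\<tau> + r) * (\<tau>' + r') \<le> \<tau> * \<tau>' + 3 * B\<^sup>2 * (h * sqrt h) * M" unfolding k_def .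
  have b4: "\<bar>\<tau>\<bar> * \<bar>r\<bar> \<le> B\<^sup>2 * (h * k) * (1 + N) ^ 6"
  proof -
    have "\<bar>\<tau>\<bar> * \<bar>r\<bar> \<le> (k * B * (1 + N)) * (B * h * (1 + N)\<^sup>2)"
      by (rule mult_mono[OF t1 r1]) (use k B N in auto)
    also have "\<dots> = B\<^sup>2 * (h * k) * (1 + N) ^ 3" by (simp add: power2_eq_square power3_eq_cube mult_ac)
    also have "\<dots> \<le> B\<^sup>2 * (h * k) * (1 + N) ^ 6" using hk0 p1 by (intro mult_left_mono power_increasing) auto
    finally show ?thesis .
  qed
  have "\<tau>\<^sup>2 - 2 * (\<bar>\<tau>\<bar> * \<bar>r\<bar>) \<le> (\<tau> + r)\<^sup>2"
  proof -
    have "- (\<bar>\<tau>\<bar> * \<bar>r\<bar>) \<le> \<tau> * r" unfolding abs_mult[symmetric] by simp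
    moreover have "0 \<le> r\<^sup>2" by simp
    ultimately show ?thesis unfolding power2_sum by linarith
  qed
  then show "\<tau>\<^sup>2 - 2 * B\<^sup>2 * (h * sqrt h) * (1 + N) ^ 6 \<le> (\<tau> + r)\<^sup>2" using b4 unfolding k_def by linarith
  have "\<bar>\<tau> + r\<bar> \<le> k * B * N + B * h * N\<^sup>2" using \<tau>(1) r(1) unfolding k_def by linarith
  also have "\<dots> \<le> k * B * (N + N\<^sup>2)"
  proof -
    have "h \<le> k" using k by (metis mult_left_le mult.commute order_less_imp_le)
    then have "B * h * N\<^sup>2 \<le> B * k * N\<^sup>2" using B by (intro mult_right_mono mult_left_mono) auto
    then show ?thesis by (simp add: algebra_simps)
  qed
  also have "\<dots> \<le> k * B * (1 + N)\<^sup>2"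
  proof (rule mult_left_mono)
    show "N + N\<^sup>2 \<le> (1 + N)\<^sup>2" using N by (simp add: power2_eq_square algebra_simps)
  qed (use k B in auto)
  finally have "\<bar>\<tau> + r\<bar> ^ 3 \<le> (k * B * (1 + N)\<^sup>2) ^ 3" by (intro power_mono) auto
  also have "\<dots> = (k ^ 3) * B ^ 3 * ((1 + N)\<^sup>2) ^ 3" by (simp only: power_mult_distrib)
  also have "((1 + N)\<^sup>2) ^ 3 = (1 + N) ^ 6" by (simp add: power_mult[symmetric])
  also have "k ^ 3 = h * k" using k(3) by (simp add: power3_eq_cube)
  finally show "\<bar>\<tau> + r\<bar> ^ 3 \<le> B ^ 3 * (h * sqrt h) * (1 + N) ^ 6" unfolding k_def by (simp add: mult_ac)
qed

text \<open>The increment of \<open>V\<close> relative to its value at \<open>x\<close>, along a Gaussian step of variance \<open>h\<close>, split into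
  a linear part and a remainder in the form that the preceding estimates require.\<close>

lemma relative_increment:
  fixes V :: "real ^ 'n::finite \<Rightarrow> real"
  assumes A: "1 \<le> A" and V: "\<forall>x. 1 / A \<le> V x \<and> V x \<le> 1"
    and C11: "\<forall>x. \<exists>l. norm l \<le> A \<and> (\<forall>w. \<bar>V (x + w) - V x - l \<bullet> w\<bar> \<le> A * (norm w)\<^sup>2)" and h: "0 < h"
  obtains v where "\<And>z. \<bar>v \<bullet> z\<bar> \<le> sqrt h * A\<^sup>2 * norm z"
    and "\<And>z. \<bar>V (x + sqrt h *\<^sub>R z) / V x - 1 - v \<bullet> z\<bar> \<le> A\<^sup>2 * h * (norm z)\<^sup>2"
    and "\<And>z. 1 / A\<^sup>2 \<le> V (x + sqrt h *\<^sub>R z) / V x" "\<And>z. V (x + sqrt h *\<^sub>R z) / V x \<le> A\<^sup>2"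
proof -
  define p where "p = V x"
  have A0: "0 < 1 / A" using A by simp
  have p: "1 / A \<le> p" "p \<le> 1" unfolding p_def using V by auto
  then have p0: "0 < p" using A0 by linarith
  have ip: "1 / p \<le> A" using p p0 A by (simp add: field_simps)
  obtain l where l: "norm l \<le> A" "\<And>w. \<bar>V (x + w) - p - l \<bullet> w\<bar> \<le> A * (norm w)\<^sup>2" using C11 p_def by metis
  show thesis
  proof (rule that[of "sqrt h *\<^sub>R (1 / p) *\<^sub>R l"])
    fix z
    have "\<bar>((1 / p) *\<^sub>R l) \<bullet> z\<bar> \<le> (1 / p) * norm l * norm z" using Cauchy_Schwarz_ineq2[of "(1 / p) *\<^sub>R l" z] p0 by simp
    also have "\<dots> \<le> A * A * norm z" using ip l A p0 by (intro mult_right_mono mult_mono) auto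
    finally have "sqrt h * \<bar>((1 / p) *\<^sub>R l) \<bullet> z\<bar> \<le> sqrt h * (A * A * norm z)" using h by (intro mult_left_mono) auto
    then show "\<bar>(sqrt h *\<^sub>R (1 / p) *\<^sub>R l) \<bullet> z\<bar> \<le> sqrt h * A\<^sup>2 * norm z"
      using h by (simp add: abs_mult power2_eq_square mult.assoc)
    have "V (x + sqrt h *\<^sub>R z) / p - 1 - (sqrt h *\<^sub>R (1 / p) *\<^sub>R l) \<bullet> z = (1 / p) * (V (x + sqrt h *\<^sub>R z) - p - l \<bullet> (sqrt h *\<^sub>R z))"
      using p0 by (simp add: field_simps)
    then have "\<bar>V (x + sqrt h *\<^sub>R z) / p - 1 - (sqrt h *\<^sub>R (1 / p) *\<^sub>R l) \<bullet> z\<bar> = (1 / p) * \<bar>V (x + sqrt h *\<^sub>R z) - p - l \<bullet> (sqrt h *\<^sub>R z)\<bar>"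
      using p0 by (simp add: abs_mult)
    also have "\<dots> \<le> A * (A * (norm (sqrt h *\<^sub>R z))\<^sup>2)" by (rule mult_mono[OF ip l(2)]) (use A in auto)
    finally show "\<bar>V (x + sqrt h *\<^sub>R z) / V x - 1 - (sqrt h *\<^sub>R (1 / p) *\<^sub>R l) \<bullet> z\<bar> \<le> A\<^sup>2 * h * (norm z)\<^sup>2"
      unfolding p_def[symmetric] using h by (simp add: power_mult_distrib power2_eq_square[of A] mult.assoc)
    let ?u = "x + sqrt h *\<^sub>R z"
    have "1 / A\<^sup>2 \<le> 1 / A" using A by (simp add: field_simps power2_eq_square)
    also have "\<dots> \<le> V ?u" using V by simp
    also have "\<dots> \<le> V ?u / p" using p p0 V A0 by (smt (verit) le_divide_eq_1_pos mult_left_le pos_le_divide_eq)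
    finally show "1 / A\<^sup>2 \<le> V ?u / V x" unfolding p_def .
    have "V ?u / p \<le> 1 / p" using V p0 by (simp add: divide_right_mono)
    also have "\<dots> \<le> A" by (rule ip)
    also have "\<dots> \<le> A\<^sup>2" using A by (simp add: power2_eq_square)
    finally show "V ?u / V x \<le> A\<^sup>2" unfolding p_def .
  qed
qed

text \<open>One infinitesimal step of the heat flow.  Since \<open>a (1 - a) = s a\<^sup>2\<close> for \<open>a = 1 / (1 + s)\<close>, the
  quadratic terms in the expansion of \<open>V(X)\<^sup>a V(Y)\<^sup>a\<close> have mean equal to a negative multiple of
  \<open>\<bar>v - v'\<bar>\<^sup>2\<close>, where \<open>v\<close> and \<open>v'\<close> are \<open>sqrt h\<close> times the logarithmic gradients of \<open>V\<close> at \<open>x\<close> and \<open>y\<close>; this is where the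
  exponent \<open>1 + s\<close> comes from.  Over \<open>1 / h\<close> steps the errors add up to the order \<open>sqrt h\<close>.\<close>

lemma hypercontractive_step:
  assumes s: "0 \<le> s" "s < 1" and a: "a = 1 / (1 + s)" and A0: "1 \<le> A0"
  shows "\<exists>C\<ge>0. \<forall>(V :: real ^ 'n::finite \<Rightarrow> real) h x y. V \<in> borel_measurable borel \<longrightarrow> (\<forall>x. 1 / A0 \<le> V x \<and> V x \<le> 1) \<longrightarrow>
      (\<forall>x. \<exists>l. norm l \<le> A0 \<and> (\<forall>w. \<bar>V (x + w) - V x - l \<bullet> w\<bar> \<le> A0 * (norm w)\<^sup>2)) \<longrightarrow> 0 < h \<longrightarrow> h \<le> 1 \<longrightarrow>
      (LINT xy|corr s. V (x + sqrt h *\<^sub>R fst xy) powr a * V (y + sqrt h *\<^sub>R snd xy) powr a)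
        \<le> heat h V x powr a * heat h V y powr a + C * (h * sqrt h)"
proof -
  define B where "B = A0\<^sup>2"
  define F where "F = 2 * B ^ 3"
  define m2 where "m2 = (LINT z|gauss. (norm (z :: real ^ 'n))\<^sup>2)"
  define m6 where "m6 = 2 * (LINT z|gauss. (1 + norm (z :: real ^ 'n)) ^ 6)"
  \<comment> \<open>\<open>C1\<close> bounds the error in expanding the integrand, the second summand of \<open>C\<close> that in expanding the claimed bound\<close>
  define C1 where "C1 = 5 * B\<^sup>2 + (2 * F + F\<^sup>2) * B ^ 3"
  define C where "C = C1 * m6 + (F + F\<^sup>2) * (2 * (B * m2)\<^sup>2)"
  have B: "1 \<le> B" unfolding B_def using A0 by simp
  have F0: "0 \<le> F" unfolding F_def using B by simp
  have m2: "0 \<le> m2" and m6: "0 \<le> m6" unfolding m2_def m6_def by (auto intro!: integral_nonneg_AE)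
  have C1: "0 \<le> C1" unfolding C1_def using B F0 by simp
  have C0: "0 \<le> C" unfolding C_def using C1 F0 m6 by simp
  have a01: "0 \<le> a" "a \<le> 1" and aa: "a * (1 - a) = s * a\<^sup>2" unfolding a using s by (auto simp: field_simps power2_eq_square)
  interpret c: prob_space "corr s :: ((real ^ 'n) \<times> (real ^ 'n)) measure" by (rule prob_space_corr)
  have I6: "integrable gauss (\<lambda>z :: real ^ 'n. (1 + norm z) ^ 6)"
    by (rule gauss_growth_integrable[of _ 1 6]) auto
  show ?thesis
  proof (intro exI[of _ C] conjI C0 allI impI)
    fix V :: "real ^ 'n \<Rightarrow> real" and h :: real and x y :: "real ^ 'n"
    assume [measurable]: "V \<in> borel_measurable borel" and V: "\<forall>x. 1 / A0 \<le> V x \<and> V x \<le> 1"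
      and C11: "\<forall>x. \<exists>l. norm l \<le> A0 \<and> (\<forall>w. \<bar>V (x + w) - V x - l \<bullet> w\<bar> \<le> A0 * (norm w)\<^sup>2)" and h: "0 < h" "h \<le> 1"
    define p q where "p = V x" and "q = V y"
    have D0: "0 < 1 / A0" using A0 by simp
    have pq: "1 / A0 \<le> p" "p \<le> 1" "1 / A0 \<le> q" "q \<le> 1" unfolding p_def q_def using V by auto
    then have pq0: "0 < p" "0 < q" using D0 by linarith+
    obtain v where v: "\<And>z. \<bar>v \<bullet> z\<bar> \<le> sqrt h * B * norm z" "\<And>z. \<bar>V (x + sqrt h *\<^sub>R z) / p - 1 - v \<bullet> z\<bar> \<le> B * h * (norm z)\<^sup>2"
        "\<And>z. 1 / B \<le> V (x + sqrt h *\<^sub>R z) / p" "\<And>z. V (x + sqrt h *\<^sub>R z) / p \<le> B"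
      using relative_increment[OF A0 V C11 h(1), of x] unfolding B_def p_def by blast
    obtain v' where v': "\<And>z. \<bar>v' \<bullet> z\<bar> \<le> sqrt h * B * norm z" "\<And>z. \<bar>V (y + sqrt h *\<^sub>R z) / q - 1 - v' \<bullet> z\<bar> \<le> B * h * (norm z)\<^sup>2"
        "\<And>z. 1 / B \<le> V (y + sqrt h *\<^sub>R z) / q" "\<And>z. V (y + sqrt h *\<^sub>R z) / q \<le> B"
      using relative_increment[OF A0 V C11 h(1), of y] unfolding B_def q_def by blast
    define t t' where "t z = V (x + sqrt h *\<^sub>R z) / p - 1" and "t' z = V (y + sqrt h *\<^sub>R z) / q - 1" for z
    define \<tau> \<tau>' where "\<tau> z = v \<bullet> z" and "\<tau>' z = v' \<bullet> z" for z
    define r r' where "r z = t z - \<tau> z" and "r' z = t' z - \<tau>' z" for z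
    have [measurable]: "t \<in> borel_measurable borel" "t' \<in> borel_measurable borel" "\<tau> \<in> borel_measurable borel" "\<tau>' \<in> borel_measurable borel"
      unfolding t_def t'_def \<tau>_def \<tau>'_def by measurable
    have \<tau>b: "\<bar>\<tau> z\<bar> \<le> sqrt h * B * norm z" "\<bar>\<tau>' z\<bar> \<le> sqrt h * B * norm z"
      and rb: "\<bar>r z\<bar> \<le> B * h * (norm z)\<^sup>2" "\<bar>r' z\<bar> \<le> B * h * (norm z)\<^sup>2"
      and tb: "1 / B \<le> 1 + t z" "1 + t z \<le> B" "1 / B \<le> 1 + t' z" "1 + t' z \<le> B" for z
      unfolding r_def r'_def t_def t'_def \<tau>_def \<tau>'_def using v[of z] v'[of z] by simp_all
    have tI: "integrable gauss t" "integrable gauss t'"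
      using tb B by (auto intro!: gauss_bounded_integrable[of _ "B + 1"] simp: abs_le_iff; smt (verit) divide_nonneg_nonneg tb)+
    define G where "G xy = 1 + a * t (fst xy) + a * t' (snd xy) - a * (1 - a) / 2 * ((\<tau> (fst xy))\<^sup>2 + (\<tau>' (snd xy))\<^sup>2)
        + a\<^sup>2 * (\<tau> (fst xy) * \<tau>' (snd xy)) + C1 * (h * sqrt h) * ((1 + norm (fst xy)) ^ 6 + (1 + norm (snd xy)) ^ 6)" for xy
    have pw: "(1 + t (fst xy)) powr a * (1 + t' (snd xy)) powr a \<le> G xy" for xy
    proof -
      define N N' where "N = norm (fst xy)" and "N' = norm (snd xy)"
      define H where "H = h * sqrt h"
      have H0: "0 \<le> H" unfolding H_def using h by simp
      note R1 = quadratic_remainders[OF h _ _ B \<tau>b(1)[of "fst xy", folded N_def] \<tau>b(2)[of "snd xy", folded N'_def] rb(1)[of "fst xy", folded N_def] rb(2)[of "snd xy", folded N'_def], folded H_def]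
      note R2 = quadratic_remainders[OF h _ _ B \<tau>b(2)[of "snd xy", folded N'_def] \<tau>b(1)[of "fst xy", folded N_def] rb(2)[of "snd xy", folded N'_def] rb(1)[of "fst xy", folded N_def], folded H_def]
      have N0: "0 \<le> N" "0 \<le> N'" unfolding N_def N'_def by auto
      have tr: "\<tau> (fst xy) + r (fst xy) = t (fst xy)" "\<tau>' (snd xy) + r' (snd xy) = t' (snd xy)" unfolding r_def r'_def by auto
      note R = R1(1,2,3)[OF N0, unfolded tr] R2(2,3)[OF N0(2,1), unfolded tr]
      define M where "M = (1 + N) ^ 6 + (1 + N') ^ 6"
      have M0: "0 \<le> M" unfolding M_def by simp
      have "(1 + t (fst xy)) powr a * (1 + t' (snd xy)) powr a \<le> 1 + a * t (fst xy) + a * t' (snd xy) - a * (1 - a) / 2 * ((t (fst xy))\<^sup>2 + (t' (snd xy))\<^sup>2)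
          + a\<^sup>2 * (t (fst xy) * t' (snd xy)) + (2 * F + F\<^sup>2) * (\<bar>t (fst xy)\<bar> ^ 3 + \<bar>t' (snd xy)\<bar> ^ 3)"
        unfolding F_def by (intro powr_product_bounds B a01 tb)
      also have "\<dots> \<le> 1 + a * t (fst xy) + a * t' (snd xy) - a * (1 - a) / 2 * (((\<tau> (fst xy))\<^sup>2 + (\<tau>' (snd xy))\<^sup>2) - 2 * B\<^sup>2 * H * M)
          + a\<^sup>2 * (\<tau> (fst xy) * \<tau>' (snd xy) + 3 * B\<^sup>2 * H * M) + (2 * F + F\<^sup>2) * (B ^ 3 * H * M)"
      proof -
        have 1: "(\<tau> (fst xy))\<^sup>2 + (\<tau>' (snd xy))\<^sup>2 - 2 * B\<^sup>2 * H * M \<le> (t (fst xy))\<^sup>2 + (t' (snd xy))\<^sup>2"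
          using R(2) R(4) unfolding M_def distrib_left by linarith
        have 2: "a * (1 - a) / 2 * ((\<tau> (fst xy))\<^sup>2 + (\<tau>' (snd xy))\<^sup>2 - 2 * B\<^sup>2 * H * M) \<le> a * (1 - a) / 2 * ((t (fst xy))\<^sup>2 + (t' (snd xy))\<^sup>2)"
          using 1 a01 by (intro mult_left_mono) auto
        have 3: "a\<^sup>2 * (t (fst xy) * t' (snd xy)) \<le> a\<^sup>2 * (\<tau> (fst xy) * \<tau>' (snd xy) + 3 * B\<^sup>2 * H * M)"
          using R(1) unfolding M_def by (intro mult_left_mono) auto
        have 4: "(2 * F + F\<^sup>2) * (\<bar>t (fst xy)\<bar> ^ 3 + \<bar>t' (snd xy)\<bar> ^ 3) \<le> (2 * F + F\<^sup>2) * (B ^ 3 * H * M)"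
          using R(3) R(5) F0 unfolding M_def by (intro mult_left_mono) (auto simp: distrib_left)
        show ?thesis using 2 3 4 by linarith
      qed
      also have "\<dots> \<le> G xy"
      proof -
        have H: "0 \<le> B\<^sup>2 * H * M" using H0 M0 by simp
        have aq: "a * (1 - a) \<le> 1 * 1" using a01 by (intro mult_mono) auto
        have 1: "a * (1 - a) / 2 * (2 * B\<^sup>2 * H * M) \<le> 2 * (B\<^sup>2 * H * M)"
        proof -
          have "a * (1 - a) * (B\<^sup>2 * H * M) \<le> 2 * (B\<^sup>2 * H * M)" using aq H by (intro mult_right_mono) auto
          then show ?thesis by (simp add: mult_ac)
        qed
        have 2: "a\<^sup>2 * (3 * B\<^sup>2 * H * M) \<le> 3 * (B\<^sup>2 * H * M)"
        proof -
          have "a\<^sup>2 * (B\<^sup>2 * H * M) \<le> 1 * (B\<^sup>2 * H * M)" using a01 H by (intro mult_right_mono) (auto simp: power_le_one)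
          then show ?thesis by (simp add: mult_ac)
        qed
        have 3: "C1 * H * M = 5 * (B\<^sup>2 * H * M) + (2 * F + F\<^sup>2) * (B ^ 3 * H * M)" unfolding C1_def by (simp add: algebra_simps)
        have 4: "G xy = 1 + a * t (fst xy) + a * t' (snd xy) - a * (1 - a) / 2 * ((\<tau> (fst xy))\<^sup>2 + (\<tau>' (snd xy))\<^sup>2)
           + a\<^sup>2 * (\<tau> (fst xy) * \<tau>' (snd xy)) + C1 * H * M" unfolding G_def H_def M_def N_def N'_def by simp
        have 5: "a * (1 - a) / 2 * (x - y) = a * (1 - a) / 2 * x - a * (1 - a) / 2 * y" for x y :: real
          by (rule right_diff_distrib)
        show ?thesis unfolding 4 3 5 distrib_left[of "a\<^sup>2"] using 1 2 by linarith
      qed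
      finally show ?thesis .
    qed
    have GI: "integrable (corr s) G" and Gint: "(LINT xy|corr s. G xy) \<le> 1 + a * (LINT z|gauss. t z) + a * (LINT z|gauss. t' z) + C1 * (h * sqrt h) * m6"
    proof -
      have I2: "integrable gauss (\<lambda>z. (w \<bullet> z)\<^sup>2)" "(LINT z|gauss. (w \<bullet> z)\<^sup>2) = (norm w)\<^sup>2" for w :: "real ^ 'n"
        unfolding power2_eq_square[of "w \<bullet> _"] by (simp_all add: inner2_gauss_integral power2_norm_eq_inner)
      have Iq: "integrable (corr s) (\<lambda>xy. (\<tau> (fst xy))\<^sup>2)" "(LINT xy|corr s. (\<tau> (fst xy))\<^sup>2) = (norm v)\<^sup>2"
        "integrable (corr s) (\<lambda>xy. (\<tau>' (snd xy))\<^sup>2)" "(LINT xy|corr s. (\<tau>' (snd xy))\<^sup>2) = (norm v')\<^sup>2"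
        unfolding \<tau>_def \<tau>'_def using integrable_corr_fst[OF s I2(1)] integral_corr_fst[OF s, of "\<lambda>z. (v \<bullet> z)\<^sup>2"]
          integrable_corr_snd[OF s I2(1)] integral_corr_snd[OF s, of "\<lambda>z. (v' \<bullet> z)\<^sup>2"] by (simp_all add: I2)
      have L2: "\<tau> \<in> L2_gauss" "\<tau>' \<in> L2_gauss"
        unfolding \<tau>_def[abs_def] \<tau>'_def[abs_def] by (auto intro!: L2_gaussI I2)
      have Ix: "integrable (corr s) (\<lambda>xy. \<tau> (fst xy) * \<tau>' (snd xy))" by (rule corr_integrable_mult[OF s L2])
      have Ixv: "(LINT xy|corr s. \<tau> (fst xy) * \<tau>' (snd xy)) = s * (v \<bullet> v')"
      proof -
        have i2: "(LINT z|gauss. \<tau>' (s *\<^sub>R x + sqrt (1 - s\<^sup>2) *\<^sub>R z)) = s * \<tau>' x" for x :: "real ^ 'n"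
          unfolding \<tau>'_def inner_add_right using inner_gauss_integrable by (simp add: gauss.prob_space[simplified])
        have "(LINT xy|corr s. \<tau> (fst xy) * \<tau>' (snd xy)) = (LINT x|gauss. s * (\<tau> x * \<tau>' x))"
          unfolding integral_corr(1)[OF s Ix] by (simp add: i2 mult_ac)
        also have "\<dots> = s * (v \<bullet> v')" unfolding \<tau>_def \<tau>'_def by (simp only: integral_mult_right_zero inner2_gauss_integral)
        finally show ?thesis .
      qed
      have It: "integrable (corr s) (\<lambda>xy. t (fst xy))" "(LINT xy|corr s. t (fst xy)) = (LINT z|gauss. t z)"
        "integrable (corr s) (\<lambda>xy. t' (snd xy))" "(LINT xy|corr s. t' (snd xy)) = (LINT z|gauss. t' z)"
        using integrable_corr_fst[OF s tI(1)] integrable_corr_snd[OF s tI(2)] integral_corr_fst[OF s, of t] integral_corr_snd[OF s, of t'] by simp_all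
      have I6': "integrable (corr s) (\<lambda>xy :: (real ^ 'n) \<times> (real ^ 'n). (1 + norm (fst xy)) ^ 6)" "integrable (corr s) (\<lambda>xy :: (real ^ 'n) \<times> (real ^ 'n). (1 + norm (snd xy)) ^ 6)"
        "(LINT xy|corr s. (1 + norm (fst xy :: real ^ 'n)) ^ 6) = m6 / 2" "(LINT xy|corr s. (1 + norm (snd xy :: real ^ 'n)) ^ 6) = m6 / 2"
        using integrable_corr_fst[OF s I6] integrable_corr_snd[OF s I6] integral_corr_fst[OF s, of "\<lambda>z. (1 + norm z) ^ 6"]
          integral_corr_snd[OF s, of "\<lambda>z. (1 + norm z) ^ 6"] unfolding m6_def by simp_all
      show "integrable (corr s) G" unfolding G_def[abs_def]
        by (intro Bochner_Integration.integrable_add Bochner_Integration.integrable_diff integrable_mult_right It I6' Iq Ix c.integrable_const)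
      have "(LINT xy|corr s. G xy) = 1 + a * (LINT z|gauss. t z) + a * (LINT z|gauss. t' z)
         - a * (1 - a) / 2 * ((norm v)\<^sup>2 + (norm v')\<^sup>2) + a\<^sup>2 * (s * (v \<bullet> v')) + C1 * (h * sqrt h) * m6"
        unfolding G_def[abs_def] using It I6' Iq Ix Ixv by (simp add: c.prob_space[simplified])
      also have "\<dots> = 1 + a * (LINT z|gauss. t z) + a * (LINT z|gauss. t' z) + C1 * (h * sqrt h) * m6
          - a * (1 - a) / 2 * (norm (v - v'))\<^sup>2"
        unfolding power2_norm_eq_inner inner_diff_left inner_diff_right inner_commute[of v' v] aa by (simp add: field_simps)
      also have "\<dots> \<le> 1 + a * (LINT z|gauss. t z) + a * (LINT z|gauss. t' z) + C1 * (h * sqrt h) * m6"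
        using a01 h by simp
      finally show "(LINT xy|corr s. G xy) \<le> 1 + a * (LINT z|gauss. t z) + a * (LINT z|gauss. t' z) + C1 * (h * sqrt h) * m6" .
    qed
    define T T' where "T = (LINT z|gauss. t z)" and "T' = (LINT z|gauss. t' z)"
    have VI: "integrable gauss (\<lambda>z. V (u + sqrt h *\<^sub>R z))" for u
    proof (rule gauss_bounded_integrable[of _ 1])
      fix z
      have "0 < V (u + sqrt h *\<^sub>R z)" "V (u + sqrt h *\<^sub>R z) \<le> 1" using V less_le_trans[OF D0] by blast+
      then show "\<bar>V (u + sqrt h *\<^sub>R z)\<bar> \<le> 1" by simp
    qed measurable
    have heatT: "heat h V x = p * (1 + T)" "heat h V y = q * (1 + T')"
      unfolding T_def T'_def t_def t'_def heat_def using VI pq0 by (simp_all add: gauss.prob_space[simplified])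
    have TB: "1 / B \<le> 1 + T" "1 + T \<le> B" "1 / B \<le> 1 + T'" "1 + T' \<le> B"
      using gauss_integral_bounds[of t "1 / B - 1" "B - 1"] gauss_integral_bounds[of t' "1 / B - 1" "B - 1"] tb
      unfolding T_def T'_def by (auto simp: algebra_simps)
    have rI: "\<bar>LINT z|gauss. u z\<bar> \<le> B * h * m2"
      if u: "integrable gauss u" "\<And>z. \<bar>u z - v \<bullet> z\<bar> \<le> B * h * (norm z)\<^sup>2" for u :: "real ^ 'n \<Rightarrow> real" and v
    proof -
      have "(LINT z|gauss. u z) = (LINT z|gauss. u z - v \<bullet> z)" using u(1) by simp
      also have "\<bar>\<dots>\<bar> \<le> (LINT z|gauss. \<bar>u z - v \<bullet> z\<bar>)" by (rule integral_abs_bound)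
      also have "\<dots> \<le> (LINT z|gauss. B * h * (norm (z :: real ^ 'n))\<^sup>2)" using u by (intro integral_mono) auto
      finally show ?thesis unfolding m2_def by simp
    qed
    have Tb: "\<bar>T\<bar> \<le> B * h * m2" "\<bar>T'\<bar> \<le> B * h * m2"
      unfolding T_def T'_def
      by (rule rI[of _ v, OF tI(1)], use rb(1) in \<open>simp add: r_def \<tau>_def\<close>,
          rule rI[of _ v', OF tI(2)], use rb(2) in \<open>simp add: r'_def \<tau>'_def\<close>)
    have TT: "T\<^sup>2 + T'\<^sup>2 \<le> 2 * (B * m2)\<^sup>2 * (h * sqrt h)"
    proof -
      have "T\<^sup>2 \<le> (B * h * m2)\<^sup>2" "T'\<^sup>2 \<le> (B * h * m2)\<^sup>2"
        using Tb by (simp_all add: abs_le_square_iff[symmetric] abs_of_nonneg B h m2 order_trans[OF Tb(1)] order_trans[OF Tb(2)])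
      then have "T\<^sup>2 + T'\<^sup>2 \<le> 2 * (B * m2)\<^sup>2 * (h * h)" by (simp add: power2_eq_square mult_ac)
      also have "\<dots> \<le> 2 * (B * m2)\<^sup>2 * (h * sqrt h)"
      proof -
        have "h * h \<le> h * sqrt h" using h by (intro mult_left_mono) (auto simp: real_le_rsqrt power2_eq_square mult_le_one mult_left_le)
        then show ?thesis by (rule mult_left_mono) simp
      qed
      finally show ?thesis .
    qed
    have low: "1 + a * T + a * T' - (F + F\<^sup>2) * (T\<^sup>2 + T'\<^sup>2) \<le> (1 + T) powr a * (1 + T') powr a"
      unfolding F_def by (intro powr_product_bounds B a01 TB)
    have PI: "integrable (corr s) (\<lambda>xy. (1 + t (fst xy)) powr a * (1 + t' (snd xy)) powr a)"
    proof (rule Bochner_Integration.integrable_bound[OF GI])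
      show "(\<lambda>xy. (1 + t (fst xy)) powr a * (1 + t' (snd xy)) powr a) \<in> borel_measurable (corr s)" by measurable
      show "AE xy in corr s. norm ((1 + t (fst xy)) powr a * (1 + t' (snd xy)) powr a) \<le> norm (G xy)"
      proof (rule AE_I2)
        fix xy :: "(real ^ 'n) \<times> (real ^ 'n)"
        have "0 \<le> (1 + t (fst xy)) powr a * (1 + t' (snd xy)) powr a" by simp
        then show "norm ((1 + t (fst xy)) powr a * (1 + t' (snd xy)) powr a) \<le> norm (G xy)" using pw[of xy] by simp
      qed
    qed
    have main: "(LINT xy|corr s. (1 + t (fst xy)) powr a * (1 + t' (snd xy)) powr a) \<le> (1 + T) powr a * (1 + T') powr a + C * (h * sqrt h)"
    proof -
      have "(LINT xy|corr s. (1 + t (fst xy)) powr a * (1 + t' (snd xy)) powr a) \<le> (LINT xy|corr s. G xy)"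
        by (rule integral_mono[OF PI GI pw])
      also have "\<dots> \<le> 1 + a * T + a * T' + C1 * (h * sqrt h) * m6" using Gint unfolding T_def T'_def .
      also have "\<dots> \<le> (1 + T) powr a * (1 + T') powr a + (F + F\<^sup>2) * (T\<^sup>2 + T'\<^sup>2) + C1 * (h * sqrt h) * m6" using low by linarith
      also have "(F + F\<^sup>2) * (T\<^sup>2 + T'\<^sup>2) \<le> (F + F\<^sup>2) * (2 * (B * m2)\<^sup>2 * (h * sqrt h))" using TT F0 by (intro mult_left_mono) auto
      finally show ?thesis unfolding C_def by (simp add: algebra_simps)
    qed
    have "V (x + sqrt h *\<^sub>R u) powr a * V (y + sqrt h *\<^sub>R w) powr a = p powr a * q powr a * ((1 + t u) powr a * (1 + t' w) powr a)" for u w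
    proof -
      have "0 \<le> 1 + t u" "0 \<le> 1 + t' w" using tb[of u] tb[of w] B by (smt (verit) divide_nonneg_nonneg)+
      moreover have "V (x + sqrt h *\<^sub>R u) = p * (1 + t u)" "V (y + sqrt h *\<^sub>R w) = q * (1 + t' w)"
        unfolding t_def t'_def using pq0 by simp_all
      ultimately show ?thesis using pq0 by (simp only: powr_mult less_imp_le) (simp add: mult_ac)
    qed
    then have "(LINT xy|corr s. V (x + sqrt h *\<^sub>R fst xy) powr a * V (y + sqrt h *\<^sub>R snd xy) powr a)
        = p powr a * q powr a * (LINT xy|corr s. (1 + t (fst xy)) powr a * (1 + t' (snd xy)) powr a)" by simp
    also have "\<dots> \<le> p powr a * q powr a * ((1 + T) powr a * (1 + T') powr a + C * (h * sqrt h))"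
      using main by (intro mult_left_mono) auto
    also have "\<dots> = heat h V x powr a * heat h V y powr a + p powr a * q powr a * (C * (h * sqrt h))"
    proof -
      have "0 \<le> 1 + T" "0 \<le> 1 + T'" using TB B by (smt (verit) divide_nonneg_nonneg)+
      then show ?thesis using pq0 by (simp only: heatT powr_mult less_imp_le) (simp add: algebra_simps)
    qed
    also have "p powr a * q powr a * (C * (h * sqrt h)) \<le> 1 * (C * (h * sqrt h))"
    proof (rule mult_right_mono)
      have "p powr a \<le> 1" "q powr a \<le> 1" using pq pq0 a01 by (auto intro: powr_le1)
      then show "p powr a * q powr a \<le> 1" by (intro mult_le_one) auto
    qed (use C0 h in auto)
    finally show "(LINT xy|corr s. V (x + sqrt h *\<^sub>R fst xy) powr a * V (y + sqrt h *\<^sub>R snd xy) powr a)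
        \<le> heat h V x powr a * heat h V y powr a + C * (h * sqrt h)" by simp
  qed
qed

lemma corr_bounded_integrable:
  fixes G :: "(real ^ 'n::finite) \<times> (real ^ 'n) \<Rightarrow> real"
  assumes "G \<in> borel_measurable (borel \<Otimes>\<^sub>M borel)" "\<And>x. \<bar>G x\<bar> \<le> M"
  shows "integrable (corr s) G"
proof -
  interpret c: prob_space "corr s :: ((real ^ 'n) \<times> (real ^ 'n)) measure" by (rule prob_space_corr)
  show ?thesis
    using assms by (intro c.integrable_const_bound[of _ M]) (auto simp: measurable_cong_sets[OF sets_corr refl] borel_measurable_gauss_pair)
qed

text \<open>Interpolation along the heat flow: \<open>\<Psi> i\<close> releases a fraction of the variance in the correlated pair
  and keeps the rest in the heat flow.  It starts at the right-hand side, ends at the left-hand side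
  and grows by at most \<open>C h sqrt h\<close> in each of \<open>N = 1 / h\<close> steps; then \<open>N\<close> tends to infinity.\<close>

lemma hypercontractive_smooth:
  fixes U :: "real ^ 'n::finite \<Rightarrow> real"
  assumes s: "0 \<le> s" "s < 1" and a: "a = 1 / (1 + s)" and U[measurable]: "U \<in> borel_measurable borel"
    and \<delta>: "0 < \<delta>" "\<And>x. \<delta> \<le> U x" "\<And>x. U x \<le> 1" and \<epsilon>: "0 < \<epsilon>"
  shows "(LINT xy|corr s. heat \<epsilon> U (fst xy) powr a * heat \<epsilon> U (snd xy) powr a) \<le> heat (1 + \<epsilon>) U 0 powr (2 * a)"
proof -
  interpret c: prob_space "corr s :: ((real ^ 'n) \<times> (real ^ 'n)) measure" by (rule prob_space_corr)
  define m where "m = (LINT z|gauss. norm (z :: real ^ 'n))"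
  \<comment> \<open>one constant for all bounds on the functions \<open>heat v U\<close> with \<open>v \<ge> \<epsilon>\<close>\<close>
  define A0 where "A0 = Max {1, 1 / \<delta>, m / sqrt \<epsilon>, (2 + m) / \<epsilon>}"
  have A0: "1 \<le> A0" "1 / \<delta> \<le> A0" "m / sqrt \<epsilon> \<le> A0" "(2 + m) / \<epsilon> \<le> A0" unfolding A0_def by auto
  have a0: "0 < a" "a \<le> 1" unfolding a using s by (auto simp: field_simps)
  obtain C where C0: "0 \<le> C" and C: "\<And>(V :: real ^ 'n \<Rightarrow> real) h x y. V \<in> borel_measurable borel \<Longrightarrow> (\<forall>x. 1 / A0 \<le> V x \<and> V x \<le> 1) \<Longrightarrow>
      (\<forall>x. \<exists>l. norm l \<le> A0 \<and> (\<forall>w. \<bar>V (x + w) - V x - l \<bullet> w\<bar> \<le> A0 * (norm w)\<^sup>2)) \<Longrightarrow> 0 < h \<Longrightarrow> h \<le> 1 \<Longrightarrow>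
      (LINT xy|corr s. V (x + sqrt h *\<^sub>R fst xy) powr a * V (y + sqrt h *\<^sub>R snd xy) powr a)
        \<le> heat h V x powr a * heat h V y powr a + C * (h * sqrt h)"
    using hypercontractive_step[OF s a A0(1)] by blast
  have U0: "0 \<le> U x" "\<bar>U x\<bar> \<le> 1" for x using \<delta>(1) \<delta>(2)[of x] \<delta>(3)[of x] by auto
  have hb: "\<delta> \<le> heat v U x" "heat v U x \<le> 1" "0 \<le> heat v U x" for v x
    using heat_bounds[OF U \<delta>(2,3)] \<delta>(1) by (auto intro: order_trans[OF less_imp_le])
  have pb: "\<bar>heat v U x powr a * heat v U y powr a\<bar> \<le> 1" for v x y
  proof -
    have "heat v U x powr a \<le> 1" "heat v U y powr a \<le> 1" using hb a0 by (auto intro!: powr_le1)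
    then show ?thesis by (simp add: abs_mult mult_le_one)
  qed
  have main: "(LINT xy|corr s. heat \<epsilon> U (fst xy) powr a * heat \<epsilon> U (snd xy) powr a) \<le> heat (1 + \<epsilon>) U 0 powr (2 * a) + C / sqrt (real N)"
    if N: "0 < N" for N :: nat
  proof -
    define h where "h = 1 / real N"
    have h: "0 < h" "h \<le> 1" "real N * h = 1" unfolding h_def using N by auto
    define Ui where "Ui i = heat (\<epsilon> + 1 - real i * h) U" for i
    define \<Psi> where "\<Psi> i = (LINT xy|corr s. Ui i (sqrt (real i * h) *\<^sub>R fst xy) powr a * Ui i (sqrt (real i * h) *\<^sub>R snd xy) powr a)" for i
    have Um[measurable]: "Ui i \<in> borel_measurable borel" for i unfolding Ui_def by measurable
    have step: "\<Psi> (Suc i) \<le> \<Psi> i + C * (h * sqrt h)" if i: "i < N" for i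
    proof -
      have ih: "real (Suc i) * h \<le> 1"
      proof -
        have "real (Suc i) * h \<le> real N * h" using i h by (intro mult_right_mono) auto
        then show ?thesis using h by simp
      qed
      define v where "v = \<epsilon> + 1 - real (Suc i) * h"
      have v: "\<epsilon> \<le> v" unfolding v_def using ih by simp
      have hV: "heat h (Ui (Suc i)) x = Ui i x" for x
      proof -
        have "heat h (heat v U) x = heat (h + v) U x" using h \<epsilon> v by (intro heat_heat[OF U U0(2)]) auto
        moreover have "h + v = \<epsilon> + 1 - real i * h" unfolding v_def by (simp add: algebra_simps)
        ultimately show ?thesis by (simp only: Ui_def v_def[symmetric])
      qed
      let ?V = "Ui (Suc i)"
      have V1: "\<forall>x. 1 / A0 \<le> ?V x \<and> ?V x \<le> 1"
      proof
        fix x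
        have "1 / A0 \<le> \<delta>" using A0 \<delta>(1) by (simp add: field_simps)
        then show "1 / A0 \<le> ?V x \<and> ?V x \<le> 1" unfolding Ui_def using hb(1,2) order_trans by blast
      qed
      have V2: "\<forall>x. \<exists>l. norm l \<le> A0 \<and> (\<forall>w. \<bar>?V (x + w) - ?V x - l \<bullet> w\<bar> \<le> A0 * (norm w)\<^sup>2)"
      proof
        fix x
        obtain l where l: "norm l \<le> m / sqrt \<epsilon>" "\<And>w. \<bar>heat v U (x + w) - heat v U x - l \<bullet> w\<bar> \<le> (2 + m) / \<epsilon> * (norm w)\<^sup>2"
          using heat_C11[OF U U0(1) \<delta>(3) \<epsilon> v, of x] unfolding m_def by blast
        have "\<bar>?V (x + w) - ?V x - l \<bullet> w\<bar> \<le> A0 * (norm w)\<^sup>2" for w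
        proof -
          have "(2 + m) / \<epsilon> * (norm w)\<^sup>2 \<le> A0 * (norm w)\<^sup>2" using A0(4) by (intro mult_right_mono) auto
          then show ?thesis using l(2)[of w] unfolding Ui_def v_def by simp
        qed
        then show "\<exists>l. norm l \<le> A0 \<and> (\<forall>w. \<bar>?V (x + w) - ?V x - l \<bullet> w\<bar> \<le> A0 * (norm w)\<^sup>2)"
          using l(1) A0(3) order_trans by blast
      qed
      define F where "F xy = ?V (fst xy) powr a * ?V (snd xy) powr a" for xy :: "(real ^ 'n) \<times> (real ^ 'n)"
      have [measurable]: "F \<in> borel_measurable (borel \<Otimes>\<^sub>M borel)" unfolding F_def by measurable
      have Fb: "\<bar>F xy\<bar> \<le> 1" for xy unfolding F_def Ui_def by (rule pb)
      have e: "real i * h + h = real (Suc i) * h" by (simp add: algebra_simps)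
      have i0: "0 \<le> real i * h" using h by simp
      let ?L = "\<lambda>xy. LINT xy'|corr s. F (sqrt (real i * h) *\<^sub>R fst xy + sqrt h *\<^sub>R fst xy', sqrt (real i * h) *\<^sub>R snd xy + sqrt h *\<^sub>R snd xy')"
      let ?P = "\<lambda>xy. Ui i (sqrt (real i * h) *\<^sub>R fst xy) powr a * Ui i (sqrt (real i * h) *\<^sub>R snd xy) powr a"
      have PI: "integrable (corr s) ?P"
      proof (rule corr_bounded_integrable[of _ 1])
        show "\<bar>?P xy\<bar> \<le> 1" for xy
          unfolding Ui_def by (rule pb)
      qed measurable
      have "\<Psi> (Suc i) = (LINT xy|corr s. F (sqrt (real i * h + h) *\<^sub>R fst xy, sqrt (real i * h + h) *\<^sub>R snd xy))"
        unfolding \<Psi>_def F_def e by simp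
      also have "\<dots> = (LINT xy|corr s. ?L xy)"
        by (rule corr_split[OF _ Fb i0 h(1) s]) measurable
      also have "\<dots> \<le> (LINT xy|corr s. ?P xy + C * (h * sqrt h))"
      proof (rule integral_mono)
        show "integrable (corr s) ?L"
        proof (rule corr_bounded_integrable[of _ 1])
          show "?L \<in> borel_measurable (borel \<Otimes>\<^sub>M borel)"
            by measurable
          fix xy :: "(real ^ 'n) \<times> (real ^ 'n)"
          have I: "integrable (corr s) (\<lambda>xy'. F (sqrt (real i * h) *\<^sub>R fst xy + sqrt h *\<^sub>R fst xy', sqrt (real i * h) *\<^sub>R snd xy + sqrt h *\<^sub>R snd xy'))"
            by (rule corr_bounded_integrable[of _ 1]) (auto simp: Fb)
          have "?L xy \<le> 1"
            by (rule c.integral_le_const[OF I]) (use Fb in \<open>auto simp: abs_le_iff\<close>)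
          moreover have "- 1 \<le> ?L xy"
            by (rule c.integral_ge_const[OF I]) (use Fb in \<open>auto simp: abs_le_iff minus_le_iff\<close>)
          ultimately show "\<bar>?L xy\<bar> \<le> 1" by simp
        qed
        show "integrable (corr s) (\<lambda>xy. ?P xy + C * (h * sqrt h))"
          by (intro Bochner_Integration.integrable_add PI c.integrable_const)
        fix xy :: "(real ^ 'n) \<times> (real ^ 'n)"
        show "?L xy
          \<le> ?P xy + C * (h * sqrt h)"
          using C[OF Um V1 V2 h(1,2), of "sqrt (real i * h) *\<^sub>R fst xy" "sqrt (real i * h) *\<^sub>R snd xy"] unfolding F_def hV by simp
      qed
      also have "\<dots> = \<Psi> i + C * (h * sqrt h)"
        using PI unfolding \<Psi>_def by (simp add: c.prob_space[simplified])
      finally show ?thesis .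
    qed
    have "\<Psi> i \<le> \<Psi> 0 + real i * (C * (h * sqrt h))" if "i \<le> N" for i
      using that
    proof (induction i)
      case (Suc i)
      then show ?case using step[of i] by (simp add: algebra_simps)
    qed simp
    from this[of N] have "\<Psi> N \<le> \<Psi> 0 + real N * h * (C * sqrt h)" by (simp add: mult_ac)
    then have "\<Psi> N \<le> \<Psi> 0 + C * sqrt h" using h by simp
    moreover have "\<Psi> N = (LINT xy|corr s. heat \<epsilon> U (fst xy) powr a * heat \<epsilon> U (snd xy) powr a)"
      unfolding \<Psi>_def Ui_def h(3) by simp
    moreover have "\<Psi> 0 = heat (1 + \<epsilon>) U 0 powr (2 * a)"
    proof -
      have "\<Psi> 0 = heat (1 + \<epsilon>) U 0 powr a * heat (1 + \<epsilon>) U 0 powr a"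
        unfolding \<Psi>_def Ui_def by (simp add: c.prob_space[simplified] add.commute)
      then show ?thesis by (simp add: powr_add[symmetric])
    qed
    moreover have "C * sqrt h = C / sqrt (real N)" unfolding h_def by (simp add: real_sqrt_divide)
    ultimately show ?thesis by simp
  qed
  have "(\<lambda>N. heat (1 + \<epsilon>) U 0 powr (2 * a) + C * (1 / sqrt (real (Suc N)))) \<longlonglongrightarrow> heat (1 + \<epsilon>) U 0 powr (2 * a) + C * 0"
    by (intro tendsto_intros LIMSEQ_Suc tendsto_divide_0[OF tendsto_const] filterlim_at_top_imp_at_infinity
        filterlim_compose[OF sqrt_at_top] filterlim_real_sequentially)
  moreover have "(LINT xy|corr s. heat \<epsilon> U (fst xy) powr a * heat \<epsilon> U (snd xy) powr a)
      \<le> heat (1 + \<epsilon>) U 0 powr (2 * a) + C * (1 / sqrt (real (Suc N)))" for N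
    using main[of "Suc N"] by simp
  ultimately show ?thesis using LIMSEQ_le_const[of _ "heat (1 + \<epsilon>) U 0 powr (2 * a) + C * 0"] by auto
qed

lemma hypercontractive_continuous:
  fixes U :: "real ^ 'n::finite \<Rightarrow> real"
  assumes s: "0 \<le> s" "s < 1" and a: "a = 1 / (1 + s)" and U: "continuous_on UNIV U"
    and \<delta>: "0 < \<delta>" "\<And>x. \<delta> \<le> U x" "\<And>x. U x \<le> 1"
  shows "(LINT xy|corr s. U (fst xy) powr a * U (snd xy) powr a) \<le> (LINT z|gauss. U z) powr (2 * a)"
proof -
  interpret c: prob_space "corr s :: ((real ^ 'n) \<times> (real ^ 'n)) measure" by (rule prob_space_corr)
  have Um[measurable]: "U \<in> borel_measurable borel" using U by (rule borel_measurable_continuous_onI)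
  have a0: "0 < a" unfolding a using s by simp
  define e where "e j = 1 / real (Suc j)" for j
  have e: "0 < e j" for j unfolding e_def by simp
  have elim: "e \<longlonglongrightarrow> 0" unfolding e_def by (rule LIMSEQ_Suc[OF lim_1_over_n])
  have U0: "0 < U x" "\<bar>U x\<bar> \<le> 1" for x using \<delta>(1) \<delta>(2)[of x] \<delta>(3)[of x] by auto
  have hb: "\<delta> \<le> heat v U x" "heat v U x \<le> 1" "0 < heat v U x" for v x
    using heat_bounds[OF Um \<delta>(2,3)] \<delta>(1) by (auto intro: less_le_trans)
  have Uc: "isCont U x" for x using U by (simp add: continuous_on_eq_continuous_at)
  have lim: "(\<lambda>j. heat (e j) U x) \<longlonglongrightarrow> U x" for x
  proof -
    have "(\<lambda>j. LINT z|gauss. U (x + sqrt (e j) *\<^sub>R z)) \<longlonglongrightarrow> (LINT z|(gauss :: (real ^ 'n) measure). U x)"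
    proof (rule integral_dominated_convergence[where w = "\<lambda>_. 1"])
      show "AE z in (gauss :: (real ^ 'n) measure). (\<lambda>j. U (x + sqrt (e j) *\<^sub>R z)) \<longlonglongrightarrow> U x"
      proof (rule AE_I2)
        fix z :: "real ^ 'n"
        have "(\<lambda>j. x + sqrt (e j) *\<^sub>R z) \<longlonglongrightarrow> x + sqrt 0 *\<^sub>R z" by (intro tendsto_intros elim)
        then show "(\<lambda>j. U (x + sqrt (e j) *\<^sub>R z)) \<longlonglongrightarrow> U x" using isCont_tendsto_compose[OF Uc] by simp
      qed
    qed (auto simp: U0)
    then show ?thesis unfolding heat_def by (simp add: gauss.prob_space[simplified])
  qed
  have L1: "(\<lambda>j. LINT xy|corr s. heat (e j) U (fst xy) powr a * heat (e j) U (snd xy) powr a) \<longlonglongrightarrow> (LINT xy|corr s. U (fst xy) powr a * U (snd xy) powr a)"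
  proof (rule integral_dominated_convergence[where w = "\<lambda>_. 1"])
    show "AE xy in corr s. (\<lambda>j. heat (e j) U (fst xy) powr a * heat (e j) U (snd xy) powr a) \<longlonglongrightarrow> U (fst xy) powr a * U (snd xy) powr a"
      by (intro AE_I2 tendsto_intros lim) (use U0 in \<open>auto simp: less_imp_neq[symmetric]\<close>)
    show "AE xy in corr s. norm (heat (e j) U (fst xy) powr a * heat (e j) U (snd xy) powr a) \<le> 1" for j
    proof (rule AE_I2)
      fix xy :: "(real ^ 'n) \<times> (real ^ 'n)"
      have "heat (e j) U (fst xy) powr a \<le> 1" "heat (e j) U (snd xy) powr a \<le> 1" using hb a0 by (intro powr_le1; simp add: less_imp_le)+
      then show "norm (heat (e j) U (fst xy) powr a * heat (e j) U (snd xy) powr a) \<le> 1" by (simp add: abs_mult mult_le_one)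
    qed
  qed (auto simp: c.integrable_const)
  have L2: "(\<lambda>j. heat (1 + e j) U 0 powr (2 * a)) \<longlonglongrightarrow> (LINT z|gauss. U z) powr (2 * a)"
  proof (intro tendsto_powr tendsto_const)
    have "(\<lambda>j. LINT z|gauss. U (0 + sqrt (1 + e j) *\<^sub>R z)) \<longlonglongrightarrow> (LINT z|(gauss :: (real ^ 'n) measure). U z)"
    proof (rule integral_dominated_convergence[where w = "\<lambda>_. 1"])
      show "AE z in (gauss :: (real ^ 'n) measure). (\<lambda>j. U (0 + sqrt (1 + e j) *\<^sub>R z)) \<longlonglongrightarrow> U z"
      proof (rule AE_I2)
        fix z :: "real ^ 'n"
        have "(\<lambda>j. 0 + sqrt (1 + e j) *\<^sub>R z) \<longlonglongrightarrow> 0 + sqrt (1 + 0) *\<^sub>R z" by (intro tendsto_intros elim)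
        then show "(\<lambda>j. U (0 + sqrt (1 + e j) *\<^sub>R z)) \<longlonglongrightarrow> U z" using isCont_tendsto_compose[OF Uc] by simp
      qed
    qed (auto simp: U0)
    then show "(\<lambda>j. heat (1 + e j) U 0) \<longlonglongrightarrow> (LINT z|gauss. U z)" unfolding heat_def .
    show "(LINT z|gauss. U z) \<noteq> 0" using gauss_integral_bounds(1)[OF Um \<delta>(2,3)] \<delta>(1) by simp
  qed
  show ?thesis
    by (rule LIMSEQ_le[OF L1 L2]) (use hypercontractive_smooth[OF s a Um \<delta> e] in auto)
qed

lemma hypercontractive_bounded:
  fixes U :: "real ^ 'n::finite \<Rightarrow> real"
  assumes s: "0 \<le> s" "s < 1" and a: "a = 1 / (1 + s)" and Um[measurable]: "U \<in> borel_measurable borel"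
    and U: "\<And>x. 0 \<le> U x" "\<And>x. U x \<le> 1"
  shows "(LINT xy|corr s. U (fst xy) powr a * U (snd xy) powr a) \<le> (LINT z|gauss. U z) powr (2 * a)"
proof -
  interpret c: prob_space "corr s :: ((real ^ 'n) \<times> (real ^ 'n)) measure" by (rule prob_space_corr)
  have a0: "0 < a" unfolding a using s by simp
  have "U measurable_on UNIV" by (rule lebesgue_measurable_imp_measurable_on) (auto intro: measurable_completion)
  then obtain N g where N: "negligible N" and g: "\<And>n. continuous_on UNIV (g n)" "\<And>x. x \<notin> N \<Longrightarrow> (\<lambda>n. g n x) \<longlonglongrightarrow> U x"
    unfolding measurable_on_def by auto
  define G where "G n x = max (1 / real (Suc n)) (min 1 (g n x))" for n x
  have Gc: "continuous_on UNIV (G n)" for n unfolding G_def by (intro continuous_intros g)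
  have Gm[measurable]: "G n \<in> borel_measurable borel" for n using Gc by (rule borel_measurable_continuous_onI)
  have Gb: "1 / real (Suc n) \<le> G n x" "G n x \<le> 1" "0 < G n x" for n x
    unfolding G_def by (auto simp: less_max_iff_disj)
  have Glim: "(\<lambda>n. G n x) \<longlonglongrightarrow> U x" if "x \<notin> N" for x
  proof -
    have "(\<lambda>n. G n x) \<longlonglongrightarrow> max 0 (min 1 (U x))"
      unfolding G_def by (intro tendsto_max tendsto_min tendsto_const g(2)[OF that] LIMSEQ_Suc[OF lim_1_over_n])
    then show ?thesis using U[of x] by (simp add: min_absorb2 max_absorb2)
  qed
  have AEN: "AE x in (gauss :: (real ^ 'n) measure). x \<notin> N"
    using N unfolding AE_gauss_iff negligible_iff_null_sets by (metis AE_completion_iff AE_not_in)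
  have L1: "(\<lambda>j. LINT xy|corr s. G j (fst xy) powr a * G j (snd xy) powr a) \<longlonglongrightarrow> (LINT xy|corr s. U (fst xy) powr a * U (snd xy) powr a)"
  proof (rule integral_dominated_convergence[where w = "\<lambda>_. 1"])
    show "AE xy in corr s. (\<lambda>j. G j (fst xy) powr a * G j (snd xy) powr a) \<longlonglongrightarrow> U (fst xy) powr a * U (snd xy) powr a"
      using AE_corr_fst[OF s AEN] AE_corr_snd[OF s AEN]
    proof eventually_elim
      case (elim xy)
      show ?case using a0 U Gb(3)
        by (intro tendsto_mult tendsto_powr' Glim elim tendsto_const) (auto simp: less_imp_le intro!: always_eventually)
    qed
    show "AE xy in corr s. norm (G j (fst xy) powr a * G j (snd xy) powr a) \<le> 1" for j
    proof (rule AE_I2)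
      fix xy :: "(real ^ 'n) \<times> (real ^ 'n)"
      have "G j (fst xy) powr a \<le> 1" "G j (snd xy) powr a \<le> 1" using Gb(2,3) a0 by (intro powr_le1; simp add: less_imp_le)+
      then show "norm (G j (fst xy) powr a * G j (snd xy) powr a) \<le> 1" by (simp add: abs_mult mult_le_one)
    qed
  qed (auto simp: c.integrable_const)
  have L2: "(\<lambda>j. (LINT z|gauss. G j z) powr (2 * a)) \<longlonglongrightarrow> (LINT z|gauss. U z) powr (2 * a)"
  proof (rule tendsto_powr')
    show "(\<lambda>j. LINT z|gauss. G j z) \<longlonglongrightarrow> (LINT z|gauss. U z)"
    proof (rule integral_dominated_convergence[where w = "\<lambda>_. 1"])
      show "AE z in gauss. (\<lambda>j. G j z) \<longlonglongrightarrow> U z" using AEN by eventually_elim (rule Glim)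
      show "AE z in gauss. norm (G j z) \<le> 1" for j using Gb(2,3) by (intro AE_I2) (simp add: less_imp_le)
    qed auto
    have "0 \<le> (LINT z|gauss. G j z)" for j using Gb(3) by (intro integral_nonneg_AE AE_I2 less_imp_le)
    moreover have "0 \<le> (LINT z|gauss. U z)" using U by (intro integral_nonneg_AE AE_I2)
    ultimately show "(LINT z|gauss. U z) \<noteq> 0 \<or> 0 < 2 * a \<and> (\<forall>\<^sub>F j in sequentially. 0 \<le> (LINT z|gauss. G j z))"
      using a0 by simp
  qed simp
  show ?thesis
  proof (rule LIMSEQ_le[OF L1 L2], intro exI[of _ 0] allI impI)
    fix n :: nat
    show "(LINT xy|corr s. G n (fst xy) powr a * G n (snd xy) powr a) \<le> (LINT z|gauss. G n z) powr (2 * a)"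
      by (rule hypercontractive_continuous[OF s a Gc _ Gb(1,2)]) simp
  qed
qed

text \<open>Nelson's inequality in its symmetric bilinear form, obtained by inserting \<open>U = u\<^sup>1\<^sup>+\<^sup>s\<close> for
  truncations of \<open>u\<close> rescaled to the unit interval.\<close>

theorem hypercontractive:
  fixes u :: "real ^ 'n::finite \<Rightarrow> real"
  assumes s: "0 \<le> s" "s < 1" and u: "u \<in> L2_gauss" "\<And>x. 0 \<le> u x"
  shows "(LINT xy|corr s. u (fst xy) * u (snd xy)) \<le> (LINT z|gauss. u z powr (1 + s)) powr (2 / (1 + s))"
proof -
  interpret c: prob_space "corr s :: ((real ^ 'n) \<times> (real ^ 'n)) measure" by (rule prob_space_corr)
  define a where "a = 1 / (1 + s)"
  have a0: "0 < a" and as: "(1 + s) * a = 1" unfolding a_def using s by auto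
  have [measurable]: "u \<in> borel_measurable borel" using u by auto
  have uI: "integrable gauss (\<lambda>z. u z powr (1 + s))" by (rule L2_gauss_powr_integrable[OF u]) (use s in auto)
  define R where "R = (LINT z|gauss. u z powr (1 + s)) powr (2 * a)"
  define un where "un m z = min (u z) (real (Suc m))" for m z
  have [measurable]: "un m \<in> borel_measurable borel" for m unfolding un_def by measurable
  have un: "0 \<le> un m z" "un m z \<le> u z" "un m z \<le> real (Suc m)" for m z unfolding un_def using u by auto
  have bd: "(LINT xy|corr s. un m (fst xy) * un m (snd xy)) \<le> R" for m
  proof -
    define M where "M = real (Suc m)"
    have M: "0 < M" unfolding M_def by simp
    define U where "U z = (un m z / M) powr (1 + s)" for z
    have [measurable]: "U \<in> borel_measurable borel" unfolding U_def by measurable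
    have Ub: "0 \<le> U z" "U z \<le> 1" for z
    proof -
      have "un m z / M \<le> 1" using un(3)[of m z] M unfolding M_def by simp
      then show "0 \<le> U z" "U z \<le> 1" unfolding U_def using un(1) M s by (auto intro!: powr_le1)
    qed
    have Ua: "U z powr a = un m z / M" for z unfolding U_def powr_powr as using un(1) M by simp
    have UM: "U z = un m z powr (1 + s) / M powr (1 + s)" for z unfolding U_def using un(1) M by (simp add: powr_divide)
    have unI: "integrable gauss (\<lambda>z. un m z powr (1 + s))"
      using un s by (intro Bochner_Integration.integrable_bound[OF uI]) (auto intro!: powr_mono2)
    have "(LINT xy|corr s. un m (fst xy) * un m (snd xy)) = M\<^sup>2 * (LINT xy|corr s. U (fst xy) powr a * U (snd xy) powr a)"
      unfolding Ua using M by (simp add: power2_eq_square)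
    also have "\<dots> \<le> M\<^sup>2 * (LINT z|gauss. U z) powr (2 * a)"
      by (intro mult_left_mono hypercontractive_bounded[OF s a_def] Ub) auto
    also have "(LINT z|gauss. U z) = (LINT z|gauss. un m z powr (1 + s)) / M powr (1 + s)" unfolding UM by simp
    also have "M\<^sup>2 * (\<dots>) powr (2 * a) = (LINT z|gauss. un m z powr (1 + s)) powr (2 * a)"
    proof -
      have "(1 + s) * (2 * a) = 2" using as by simp
      then have "(M powr (1 + s)) powr (2 * a) = M\<^sup>2" using M by (simp only: powr_powr powr_numeral)
      moreover have "0 \<le> (LINT z|gauss. un m z powr (1 + s))" by (intro integral_nonneg_AE) auto
      ultimately show ?thesis using M by (simp add: powr_divide)
    qed
    also have "\<dots> \<le> R" unfolding R_def
      using a0 un s unI uI by (intro powr_mono2 integral_mono integral_nonneg_AE) (auto intro!: powr_mono2)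
    finally show ?thesis .
  qed
  have "(\<lambda>m. LINT xy|corr s. un m (fst xy) * un m (snd xy)) \<longlonglongrightarrow> (LINT xy|corr s. u (fst xy) * u (snd xy))"
  proof (rule integral_dominated_convergence[where w = "\<lambda>xy. u (fst xy) * u (snd xy)"])
    show "integrable (corr s) (\<lambda>xy. u (fst xy) * u (snd xy))" by (rule corr_integrable_mult[OF s u(1) u(1)])
    have lim: "(\<lambda>m. un m z) \<longlonglongrightarrow> u z" for z
    proof (rule tendsto_eventually)
      obtain k where "u z \<le> real k" using real_arch_simple by blast
      then show "\<forall>\<^sub>F m in sequentially. un m z = u z"
        unfolding un_def eventually_sequentially by (intro exI[of _ k]) auto
    qed
    show "AE xy in corr s. (\<lambda>m. un m (fst xy) * un m (snd xy)) \<longlonglongrightarrow> u (fst xy) * u (snd xy)"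
      by (intro AE_I2 tendsto_mult lim)
    show "AE xy in corr s. norm (un m (fst xy) * un m (snd xy)) \<le> u (fst xy) * u (snd xy)" for m
      using un u by (intro AE_I2) (auto simp: abs_mult intro!: mult_mono)
  qed measurable
  then have "(LINT xy|corr s. u (fst xy) * u (snd xy)) \<le> R" by (rule LIMSEQ_le_const2) (use bd in auto)
  then show ?thesis unfolding R_def a_def by simp
qed

section \<open>Hermite polynomials\<close>

fun He :: "nat \<Rightarrow> real poly" where
  "He 0 = 1"
| "He (Suc m) = pCons 0 (He m) - pderiv (He m)"

lemma pderiv_pCons_0: "pderiv (pCons 0 p) = p + pCons 0 (pderiv (p :: real poly))"
  by (simp add: pderiv_pCons)

lemma pderiv_He: "pderiv (He (Suc m)) = smult (real (Suc m)) (He m)"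
proof (induction m)
  case 0
  show ?case by (simp add: pderiv_pCons pderiv_1)
next
  case (Suc m)
  have "pderiv (He (Suc (Suc m))) = He (Suc m) + pCons 0 (pderiv (He (Suc m))) - pderiv (pderiv (He (Suc m)))"
    by (subst He.simps(2)) (simp only: pderiv_diff pderiv_pCons_0)
  also have "\<dots> = He (Suc m) + smult (real (Suc m)) (pCons 0 (He m) - pderiv (He m))"
    unfolding Suc.IH by (simp only: pderiv_smult smult_diff_right smult_pCons mult_zero_right)
  also have "\<dots> = He (Suc m) + smult (real (Suc m)) (He (Suc m))" by simp
  also have "\<dots> = smult (real (Suc (Suc m))) (He (Suc m))" by (simp only: of_nat_Suc[of "Suc m"] smult_add_left smult_1_left)
  finally show ?case .
qed

definition gauss1 :: "real poly \<Rightarrow> real" where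
  "gauss1 p = (LINT t|lborel. std_normal_density t * poly p t)"

lemma std_normal_poly_integrable [simp]: "integrable lborel (\<lambda>t. std_normal_density t * poly p t)"
proof -
  have "integrable lborel (\<lambda>t. \<Sum>i\<le>degree p. coeff p i * (std_normal_density t * t ^ i))"
    using integrable_std_normal_moment by (intro Bochner_Integration.integrable_sum integrable_mult_right)
  then show ?thesis by (simp add: poly_altdef sum_distrib_left mult_ac)
qed

lemma gauss1_linear:
  "gauss1 (p + q) = gauss1 p + gauss1 q" "gauss1 (p - q) = gauss1 p - gauss1 q" "gauss1 (smult c p) = c * gauss1 p"
  "gauss1 0 = 0"
proof -
  have "std_normal_density t * poly (p + q) t = std_normal_density t * poly p t + std_normal_density t * poly q t"
    "std_normal_density t * poly (p - q) t = std_normal_density t * poly p t - std_normal_density t * poly q t"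
    for t by (simp_all add: algebra_simps)
  then show "gauss1 (p + q) = gauss1 p + gauss1 q" "gauss1 (p - q) = gauss1 p - gauss1 q" "gauss1 0 = 0"
    unfolding gauss1_def by simp_all
  show "gauss1 (smult c p) = c * gauss1 p"
    unfolding gauss1_def by (subst integral_mult_right_zero[symmetric]) (simp add: mult_ac)
qed

lemma gauss1_sum: "finite A \<Longrightarrow> gauss1 (\<Sum>i\<in>A. p i) = (\<Sum>i\<in>A. gauss1 (p i))"
  by (induction A rule: finite_induct) (auto simp: gauss1_linear)

lemma gauss1_1 [simp]: "gauss1 1 = 1"
  unfolding gauss1_def using integral_std_normal_moment_even[of 0] by simp

lemma gauss1_const [simp]: "gauss1 [:c:] = c"
  using gauss1_linear(3)[of c 1] by simp

lemma std_moment_step: "(LINT t|lborel. std_normal_density t * t ^ Suc k) = real k * (LINT t|lborel. std_normal_density t * t ^ (k - 1))"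
proof (cases "even k")
  case True
  then obtain j where "k = 2 * j" by (auto elim: evenE)
  moreover have "(LINT t|lborel. std_normal_density t * t ^ (2 * j - 1)) = 0" if "j > 0"
    using integral_std_normal_moment_odd[of "j - 1"] that by (cases j) auto
  ultimately show ?thesis using integral_std_normal_moment_odd[of j] by (cases "j = 0") auto
next
  case False
  then obtain j where k: "k = 2 * j + 1" by (auto elim: oddE)
  have "(LINT t|lborel. std_normal_density t * t ^ (2 * Suc j)) = fact (2 * Suc j) / (2 ^ Suc j * fact (Suc j))"
    by (rule integral_std_normal_moment_even)
  also have "\<dots> = real k * (fact (2 * j) / (2 ^ j * fact j))"
  proof -
    have "fact (2 * Suc j) = (2 * (real j + 1)) * (2 * real j + 1) * fact (2 * j)" "fact (Suc j) = (real j + 1) * (fact j :: real)"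
      by (simp_all add: algebra_simps)
    moreover have "real j + 1 \<noteq> 0" by simp
    ultimately show ?thesis unfolding k by (simp only: power_Suc) (simp add: divide_simps)
  qed
  also have "fact (2 * j) / (2 ^ j * fact j) = (LINT t|lborel. std_normal_density t * t ^ (2 * j))"
    by (rule integral_std_normal_moment_even[symmetric])
  finally show ?thesis unfolding k by simp
qed

lemma gauss1_stein_monom: "gauss1 (pCons 0 (monom a i)) = gauss1 (pderiv (monom a i))"
proof -
  have g: "gauss1 (monom b j) = b * (LINT t|lborel. std_normal_density t * t ^ j)" for b j
    unfolding gauss1_def poly_monom by (subst integral_mult_right_zero[symmetric]) (simp add: mult_ac)
  have "pCons 0 (monom a i) = monom a (Suc i)" by (simp add: monom_Suc)
  moreover have "pderiv (monom a i) = monom (of_nat i * a) (i - 1)" by (rule pderiv_monom)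
  ultimately show ?thesis unfolding g by (simp only: std_moment_step g) (simp add: mult_ac)
qed

lemma pderiv_sum_poly: "finite A \<Longrightarrow> pderiv (\<Sum>i\<in>A. p i :: real poly) = (\<Sum>i\<in>A. pderiv (p i))"
  by (induction A rule: finite_induct) (simp_all add: pderiv_add)

text \<open>Stein's identity for polynomials: multiplication by the variable is adjoint to differentiation.
  It makes multiplication by \<open>He m\<close> adjoint to the \<open>m\<close>-th derivative, whence the orthogonality of the
  Hermite polynomials.\<close>

lemma gauss1_stein: "gauss1 (pCons 0 p) = gauss1 (pderiv p)"
proof -
  define c d where "c = coeff p" and "d = degree p"
  have p: "p = (\<Sum>i\<le>d. monom (c i) i)" unfolding c_def d_def by (rule poly_as_sum_of_monoms[symmetric])
  define Xp where "Xp = [:0, 1::real:]"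
  have X: "pCons 0 q = Xp * q" for q unfolding Xp_def by simp
  have "Xp * p = (\<Sum>i\<le>d. Xp * monom (c i) i)"
    using arg_cong[OF p, of "\<lambda>q. Xp * q"] by (simp only: sum_distrib_left)
  then have "gauss1 (pCons 0 p) = (\<Sum>i\<le>d. gauss1 (pCons 0 (monom (c i) i)))"
    unfolding X by (simp only: gauss1_sum finite_atMost)
  also have "\<dots> = (\<Sum>i\<le>d. gauss1 (pderiv (monom (c i) i)))" unfolding gauss1_stein_monom ..
  also have "\<dots> = gauss1 (\<Sum>i\<le>d. pderiv (monom (c i) i))" by (simp only: gauss1_sum finite_atMost)
  also have "(\<Sum>i\<le>d. pderiv (monom (c i) i)) = pderiv p"
    using arg_cong[OF p, of pderiv] by (simp only: pderiv_sum_poly finite_atMost)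
  finally show ?thesis .
qed

lemma gauss1_He_mult: "gauss1 (He m * p) = gauss1 ((pderiv ^^ m) p)"
proof (induction m arbitrary: p)
  case (Suc m)
  have "gauss1 (He (Suc m) * p) = gauss1 (pCons 0 (He m * p)) - gauss1 (pderiv (He m) * p)"
    by (simp add: left_diff_distrib gauss1_linear)
  also have "\<dots> = gauss1 (He m * pderiv p)"
    unfolding gauss1_stein pderiv_mult by (simp add: gauss1_linear mult.commute)
  finally show ?case by (simp add: Suc.IH funpow_swap1)
qed simp

lemma pderiv_funpow_smult: "(pderiv ^^ m) (smult c p) = smult c ((pderiv ^^ m) (p :: real poly))"
  by (induction m) (simp_all add: pderiv_smult)

lemma pderiv_funpow_0: "(pderiv ^^ m) (0 :: real poly) = 0"
  by (induction m) simp_all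

lemma pderiv_funpow_He: "(pderiv ^^ m) (He j) = (if j < m then 0 else smult (fact j / fact (j - m)) (He (j - m)))"
proof (induction m arbitrary: j)
  case (Suc m)
  show ?case
  proof (cases j)
    case 0
    have "(pderiv ^^ Suc m) (He 0) = (pderiv ^^ m) (pderiv 1)" by (simp add: funpow_swap1)
    then show ?thesis unfolding 0 by (simp only: pderiv_1 pderiv_funpow_0) simp
  next
    case (Suc i)
    have "(pderiv ^^ Suc m) (He (Suc i)) = (pderiv ^^ m) (pderiv (He (Suc i)))" by (simp add: funpow_swap1)
    also have "\<dots> = smult (real (Suc i)) ((pderiv ^^ m) (He i))" by (simp only: pderiv_He pderiv_funpow_smult)
    finally show ?thesis unfolding Suc Suc.IH by (auto simp: fact_Suc)
  qed
qed simp

lemma gauss1_He_orthogonal: "gauss1 (He m * He j) = (if m = j then fact m else 0)"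
proof -
  have "gauss1 (He m * He j) = (if m = j then fact m else 0)" if "j \<le> m" for m j
    using that by (auto simp: gauss1_He_mult pderiv_funpow_He gauss1_linear)
  from this[of j m] this[of m j] show ?thesis by (cases "j \<le> m") (auto simp: mult.commute)
qed

text \<open>The Hermite polynomials are eigenfunctions of the Ornstein-Uhlenbeck operator: the recursion of
  \<open>He\<close> and Stein's identity reproduce the recursion, with one factor \<open>c\<close> more in each step because
  \<open>1 - d\<^sup>2 = c\<^sup>2\<close>.\<close>

lemma gauss1_He_OU:
  assumes cd: "c\<^sup>2 + d\<^sup>2 = (1::real)"
  shows "gauss1 (pcompose (He m) [:c * x, d:]) = c ^ m * poly (He m) x"
proof (induction m rule: less_induct)
  case (less m)
  show ?case
  proof (cases m)
    case 0
    show ?thesis unfolding 0 He.simps pcompose_1 by simp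
  next
    case (Suc i)
    define L where "L = [:c * x, d:]"
    have IH: "gauss1 (pcompose (He i) L) = c ^ i * poly (He i) x" unfolding L_def by (rule less) (simp add: Suc)
    have IH': "c * gauss1 (pcompose (pderiv (He i)) L) = c ^ i * poly (pderiv (He i)) x"
    proof (cases i)
      case 0
      show ?thesis unfolding 0 He.simps pderiv_1 pcompose_0 gauss1_linear by simp
    next
      case (Suc j)
      have "gauss1 (pcompose (He j) L) = c ^ j * poly (He j) x" unfolding L_def by (rule less) (simp add: \<open>m = Suc i\<close> Suc)
      then show ?thesis unfolding Suc pderiv_He pcompose_smult gauss1_linear by simp
    qed
    have "pcompose (He (Suc i)) L = L * pcompose (He i) L - pcompose (pderiv (He i)) L"
      by (simp add: pcompose_diff pcompose_pCons)
    moreover have "L * pcompose (He i) L = smult (c * x) (pcompose (He i) L) + smult d (pCons 0 (pcompose (He i) L))"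
      unfolding L_def by (simp add: mult_pCons_left)
    ultimately have "gauss1 (pcompose (He (Suc i)) L)
        = c * x * gauss1 (pcompose (He i) L) + d * gauss1 (pderiv (pcompose (He i) L)) - gauss1 (pcompose (pderiv (He i)) L)"
      by (simp only: gauss1_linear gauss1_stein)
    also have "pderiv (pcompose (He i) L) = smult d (pcompose (pderiv (He i)) L)"
      unfolding pderiv_pcompose L_def by (simp add: pderiv_pCons)
    also have "c * x * gauss1 (pcompose (He i) L) + d * gauss1 (smult d (pcompose (pderiv (He i)) L)) - gauss1 (pcompose (pderiv (He i)) L)
        = c * x * gauss1 (pcompose (He i) L) - (1 - d\<^sup>2) * gauss1 (pcompose (pderiv (He i)) L)"
      by (simp add: gauss1_linear power2_eq_square algebra_simps)
    also have "1 - d\<^sup>2 = c * c" using cd by (simp add: power2_eq_square)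
    also have "c * x * gauss1 (pcompose (He i) L) - c * c * gauss1 (pcompose (pderiv (He i)) L)
       = c ^ Suc i * (x * poly (He i) x - poly (pderiv (He i)) x)"
      unfolding IH using IH' by (simp add: algebra_simps)
    finally show ?thesis unfolding Suc L_def by simp
  qed
qed

definition herm :: "('n::finite \<Rightarrow> nat) \<Rightarrow> real ^ 'n \<Rightarrow> real" where
  "herm \<alpha> x = (\<Prod>i\<in>UNIV. poly (He (\<alpha> i)) (x $ i) / sqrt (fact (\<alpha> i)))"

definition hcoef :: "('n::finite \<Rightarrow> nat) \<Rightarrow> (real ^ 'n \<Rightarrow> real) \<Rightarrow> real" where
  "hcoef \<alpha> u = inner_gauss u (herm \<alpha>)"

lemma poly_borel_measurable [measurable]: "(\<lambda>t::real. poly p t) \<in> borel_measurable borel"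
  by (intro borel_measurable_continuous_onI continuous_intros)

lemma herm_measurable [measurable]: "herm \<alpha> \<in> borel_measurable borel"
proof -
  have "continuous_on UNIV (herm \<alpha>)"
    unfolding herm_def by (intro continuous_intros) auto
  then show ?thesis by (rule borel_measurable_continuous_onI)
qed

lemma herm_mult_integral:
  "integrable gauss (\<lambda>x. herm \<alpha> x * herm \<beta> x)" "(LINT x|gauss. herm \<alpha> x * herm \<beta> x) = (if \<alpha> = \<beta> then 1 else 0)"
proof -
  let ?f = "\<lambda>i t. poly (He (\<alpha> i)) t / sqrt (fact (\<alpha> i)) * (poly (He (\<beta> i)) t / sqrt (fact (\<beta> i)))"
  have e: "std_normal_density t * ?f i t = 1 / (sqrt (fact (\<alpha> i)) * sqrt (fact (\<beta> i))) * (std_normal_density t * poly (He (\<alpha> i) * He (\<beta> i)) t)" for i t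
    by simp
  have I: "integrable lborel (\<lambda>t. std_normal_density t * ?f i t)" for i
    unfolding e by (intro integrable_mult_right std_normal_poly_integrable)
  have v: "(LINT t|lborel. std_normal_density t * ?f i t) = (if \<alpha> i = \<beta> i then 1 else 0)" for i
    unfolding e integral_mult_right_zero gauss1_def[symmetric] gauss1_He_orthogonal by simp
  have p: "herm \<alpha> x * herm \<beta> x = (\<Prod>i\<in>UNIV. ?f i (x $ i))" for x unfolding herm_def prod.distrib[symmetric] ..
  show "integrable gauss (\<lambda>x. herm \<alpha> x * herm \<beta> x)" unfolding p by (rule gauss_integral_prod(1)[OF I]) measurable
  have "(LINT x|gauss. herm \<alpha> x * herm \<beta> x) = (\<Prod>i\<in>UNIV. if \<alpha> i = \<beta> i then 1 else 0)"
    unfolding p by (subst gauss_integral_prod(2)[OF I]) (measurable, simp only: v)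
  also have "\<dots> = (if \<alpha> = \<beta> then 1 else 0)"
  proof (cases "\<alpha> = \<beta>")
    case False
    then obtain i where "\<alpha> i \<noteq> \<beta> i" by auto
    then show ?thesis using False by (auto intro!: prod_zero bexI[of _ i])
  qed simp
  finally show "(LINT x|gauss. herm \<alpha> x * herm \<beta> x) = (if \<alpha> = \<beta> then 1 else 0)" .
qed

lemma herm_L2 [simp]: "herm \<alpha> \<in> L2_gauss"
  by (rule L2_gaussI) (use herm_mult_integral(1)[of \<alpha> \<alpha>] in \<open>auto simp: power2_eq_square\<close>)

lemma herm_orthonormal: "inner_gauss (herm \<alpha>) (herm \<beta>) = (if \<alpha> = \<beta> then 1 else 0)"
  unfolding inner_gauss_def by (rule herm_mult_integral)

lemma OU_herm:
  assumes s: "0 \<le> s" "s < 1" shows "OU s (herm \<alpha>) x = s ^ mi_size \<alpha> * herm \<alpha> x"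
proof -
  let ?d = "sqrt (1 - s\<^sup>2)"
  define P where "P i = pcompose (He (\<alpha> i)) [:s * x $ i, ?d:]" for i
  have e: "std_normal_density t * (poly (P i) t / sqrt (fact (\<alpha> i))) = 1 / sqrt (fact (\<alpha> i)) * (std_normal_density t * poly (P i) t)" for i t
    by simp
  have I: "integrable lborel (\<lambda>t. std_normal_density t * (poly (P i) t / sqrt (fact (\<alpha> i))))" for i
    unfolding e by (intro integrable_mult_right std_normal_poly_integrable)
  have "OU s (herm \<alpha>) x = (LINT z|gauss. (\<Prod>i\<in>UNIV. poly (P i) (z $ i) / sqrt (fact (\<alpha> i))))"
    unfolding OU_def herm_def P_def by (simp add: poly_pcompose mult.commute)
  also have "\<dots> = (\<Prod>i\<in>UNIV. LINT t|lborel. std_normal_density t * (poly (P i) t / sqrt (fact (\<alpha> i))))"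
    by (rule gauss_integral_prod(2)[OF I]) measurable
  also have "\<dots> = (\<Prod>i\<in>UNIV. s ^ \<alpha> i * (poly (He (\<alpha> i)) (x $ i) / sqrt (fact (\<alpha> i))))"
  proof (rule prod.cong[OF refl])
    fix i
    have "gauss1 (P i) = s ^ \<alpha> i * poly (He (\<alpha> i)) (x $ i)"
      unfolding P_def by (rule gauss1_He_OU) (rule corr_coeffs(1)[OF s])
    then show "(LINT t|lborel. std_normal_density t * (poly (P i) t / sqrt (fact (\<alpha> i)))) = s ^ \<alpha> i * (poly (He (\<alpha> i)) (x $ i) / sqrt (fact (\<alpha> i)))"
      unfolding e integral_mult_right_zero gauss1_def[symmetric] by simp
  qed
  also have "\<dots> = s ^ mi_size \<alpha> * herm \<alpha> x" unfolding prod.distrib herm_def mi_size_def by (simp add: power_sum)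
  finally show ?thesis .
qed

lemma hcoef_OU:
  assumes s: "0 \<le> s" "s < 1" and u: "u \<in> L2_gauss"
  shows "hcoef \<alpha> (OU s u) = s ^ mi_size \<alpha> * hcoef \<alpha> u"
proof -
  have "hcoef \<alpha> (OU s u) = inner_gauss u (OU s (herm \<alpha>))"
    unfolding hcoef_def by (subst inner_gauss_commute, rule inner_OU_commute[OF s _ u]) simp
  also have "\<dots> = s ^ mi_size \<alpha> * hcoef \<alpha> u"
    unfolding hcoef_def inner_gauss_def OU_herm[OF s] by (subst integral_mult_right_zero[symmetric]) (simp add: mult_ac)
  finally show ?thesis .
qed

section \<open>The Mehler kernel and Parseval's identity\<close>

text \<open>The density, relative to the Gaussian measure, of the variable \<open>s x + sqrt (1 - s\<^sup>2) Z\<close> whose law is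
  averaged by the Ornstein-Uhlenbeck operator.\<close>

definition mehler :: "real \<Rightarrow> real ^ 'n::finite \<Rightarrow> real ^ 'n \<Rightarrow> real" where
  "mehler s x y = (1 / sqrt (1 - s\<^sup>2)) ^ CARD('n) * exp ((norm y)\<^sup>2 / 2 - (norm (y - s *\<^sub>R x))\<^sup>2 / (2 * (1 - s\<^sup>2)))"

lemma mehler_pos: "0 \<le> s \<Longrightarrow> s < 1 \<Longrightarrow> 0 < mehler s x y"
  unfolding mehler_def by (simp add: abs_square_less_1)

lemma mehler_measurable [measurable]: "(\<lambda>(x, y). mehler s x y) \<in> borel_measurable (borel \<Otimes>\<^sub>M borel)"
  unfolding mehler_def by measurable

context
  fixes s :: real
  assumes s: "0 \<le> s" "s < 1"
begin

lemma mehler_nn_integral: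
  fixes F :: "real ^ 'n::finite \<Rightarrow> ennreal"
  assumes [measurable]: "F \<in> borel_measurable borel"
  shows "(\<integral>\<^sup>+z. F (s *\<^sub>R x + sqrt (1 - s\<^sup>2) *\<^sub>R z) \<partial>gauss) = (\<integral>\<^sup>+y. ennreal (mehler s x y) * F y \<partial>gauss)"
proof -
  let ?d = "sqrt (1 - s\<^sup>2)"
  have "s\<^sup>2 < 1" using s by (simp add: abs_square_less_1)
  then have d: "0 < ?d" "?d\<^sup>2 = 1 - s\<^sup>2" by simp_all
  have e: "gauss_density ((1 / ?d) *\<^sub>R (y - s *\<^sub>R x)) * (1 / ?d) ^ CARD('n) = gauss_density y * mehler s x y" for y :: "real ^ 'n"
  proof -
    have "(norm ((1 / ?d) *\<^sub>R (y - s *\<^sub>R x)))\<^sup>2 = (norm (y - s *\<^sub>R x))\<^sup>2 / (1 - s\<^sup>2)"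
      using d by (simp add: power_divide)
    then have "exp (- (norm ((1 / ?d) *\<^sub>R (y - s *\<^sub>R x)))\<^sup>2 / 2) = exp (- (norm y)\<^sup>2 / 2) * exp ((norm y)\<^sup>2 / 2 - (norm (y - s *\<^sub>R x))\<^sup>2 / (2 * (1 - s\<^sup>2)))"
      by (simp add: exp_add[symmetric])
    then show ?thesis unfolding gauss_density_def mehler_def by simp
  qed
  have "(\<integral>\<^sup>+z. F (s *\<^sub>R x + ?d *\<^sub>R z) \<partial>gauss) = (\<integral>\<^sup>+z. ennreal (gauss_density z) * F (s *\<^sub>R x + ?d *\<^sub>R z) \<partial>lborel)"
    by (subst nn_integral_gauss) auto
  also have "\<dots> = ennreal ((1 / ?d) ^ CARD('n)) * (\<integral>\<^sup>+y. ennreal (gauss_density ((1 / ?d) *\<^sub>R (y - s *\<^sub>R x))) * F y \<partial>lborel)"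
  proof -
    have t: "- (s / ?d) *\<^sub>R x + (1 / ?d) *\<^sub>R y = (1 / ?d) *\<^sub>R (y - s *\<^sub>R x)" "s *\<^sub>R x + ?d *\<^sub>R ((1 / ?d) *\<^sub>R (y - s *\<^sub>R x)) = y" for y :: "real ^ 'n"
      using d by (simp_all add: scaleR_diff_right)
    show ?thesis
      using nn_integral_lborel_affine[of "\<lambda>z. ennreal (gauss_density z) * F (s *\<^sub>R x + ?d *\<^sub>R z)" "1 / ?d" "- (s / ?d) *\<^sub>R x"] d
      unfolding t by simp
  qed
  also have "\<dots> = (\<integral>\<^sup>+y. ennreal (gauss_density ((1 / ?d) *\<^sub>R (y - s *\<^sub>R x)) * (1 / ?d) ^ CARD('n)) * F y \<partial>lborel)"
    using d by (subst nn_integral_cmult[symmetric]) (auto simp: ennreal_mult mult_ac)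
  also have "\<dots> = (\<integral>\<^sup>+y. ennreal (gauss_density y) * (ennreal (mehler s x y) * F y) \<partial>lborel)"
    unfolding e by (simp add: ennreal_mult[OF gauss_density_nonneg less_imp_le[OF mehler_pos[OF s]]] mult.assoc)
  also have "\<dots> = (\<integral>\<^sup>+y. ennreal (mehler s x y) * F y \<partial>gauss)" by (subst nn_integral_gauss) auto
  finally show ?thesis .
qed

lemma distr_mehler:
  "distr gauss gauss (\<lambda>z. s *\<^sub>R x + sqrt (1 - s\<^sup>2) *\<^sub>R z) = density (gauss :: (real ^ 'n::finite) measure) (\<lambda>y. ennreal (mehler s x y))"
proof (rule measure_eqI)
  fix A assume "A \<in> sets (distr gauss gauss (\<lambda>z. s *\<^sub>R x + sqrt (1 - s\<^sup>2) *\<^sub>R (z :: real ^ 'n)))"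
  then have [measurable]: "A \<in> sets (borel :: (real ^ 'n) measure)" by simp
  have "emeasure (distr gauss gauss (\<lambda>z. s *\<^sub>R x + sqrt (1 - s\<^sup>2) *\<^sub>R z)) A = (\<integral>\<^sup>+z. indicator A (s *\<^sub>R x + sqrt (1 - s\<^sup>2) *\<^sub>R z) \<partial>gauss)"
    by (subst nn_integral_distr[of _ gauss gauss, symmetric]) auto
  also have "\<dots> = (\<integral>\<^sup>+y. ennreal (mehler s x y) * indicator A y \<partial>gauss)" by (rule mehler_nn_integral) simp
  also have "\<dots> = emeasure (density gauss (\<lambda>y. ennreal (mehler s x y))) A"
    by (subst emeasure_density) auto
  finally show "emeasure (distr gauss gauss (\<lambda>z. s *\<^sub>R x + sqrt (1 - s\<^sup>2) *\<^sub>R z)) A = emeasure (density gauss (\<lambda>y. ennreal (mehler s x y))) A" .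
qed simp

lemma OU_mehler:
  fixes u :: "real ^ 'n::finite \<Rightarrow> real"
  assumes [measurable]: "u \<in> borel_measurable borel"
  shows "OU s u x = (LINT y|gauss. mehler s x y * u y)"
    and "integrable gauss (\<lambda>z. u (s *\<^sub>R x + sqrt (1 - s\<^sup>2) *\<^sub>R z)) \<longleftrightarrow> integrable gauss (\<lambda>y. mehler s x y * u y)"
proof -
  have nn: "AE y in gauss. 0 \<le> mehler s x (y :: real ^ 'n)" using mehler_pos[OF s] by (intro AE_I2 less_imp_le)
  have "OU s u x = (LINT y|distr gauss gauss (\<lambda>z. s *\<^sub>R x + sqrt (1 - s\<^sup>2) *\<^sub>R z). u y)"
    unfolding OU_def by (subst integral_distr) auto
  also have "\<dots> = (LINT y|gauss. mehler s x y * u y)"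
    unfolding distr_mehler by (subst integral_density) (use nn in auto)
  finally show "OU s u x = (LINT y|gauss. mehler s x y * u y)" .
  have "integrable gauss (\<lambda>z. u (s *\<^sub>R x + sqrt (1 - s\<^sup>2) *\<^sub>R z)) \<longleftrightarrow> integrable (distr gauss gauss (\<lambda>z. s *\<^sub>R x + sqrt (1 - s\<^sup>2) *\<^sub>R z)) u"
    by (subst integrable_distr_eq) auto
  also have "\<dots> \<longleftrightarrow> integrable gauss (\<lambda>y. mehler s x y * u y)"
    unfolding distr_mehler by (subst integrable_density) (use nn in auto)
  finally show "integrable gauss (\<lambda>z. u (s *\<^sub>R x + sqrt (1 - s\<^sup>2) *\<^sub>R z)) \<longleftrightarrow> integrable gauss (\<lambda>y. mehler s x y * u y)" .
qed

text \<open>The Hilbert-Schmidt norm of the Ornstein-Uhlenbeck operator.  The rotation by 45 degrees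
  diagonalizes the quadratic form in the exponent.\<close>

lemma mehler_square_integral:
  "(\<integral>\<^sup>+x. \<integral>\<^sup>+y. ennreal ((mehler s x y)\<^sup>2) \<partial>gauss \<partial>(gauss :: (real ^ 'n::finite) measure)) = ennreal ((1 / (1 - s\<^sup>2)) ^ CARD('n))"
proof -
  have s2: "s\<^sup>2 < 1" using s by (simp add: abs_square_less_1)
  define c :: real where "c = sqrt (1 / 2)"
  have c: "c * c = 1 / 2" "0 < c" unfolding c_def by (simp_all add: real_sqrt_mult_self)
  have cc: "c * (c * y) = y / 2" for y using c(1) by (simp add: mult.assoc[symmetric])
  \<comment> \<open>the eigenvalues of the quadratic form in the exponent\<close>
  define \<eta> \<eta>' where "\<eta> = s / (1 + s)" and "\<eta>' = - (s / (1 - s))"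
  define A where "A = (1 / (1 - s\<^sup>2)) ^ CARD('n)"
  have A0: "0 \<le> A" unfolding A_def using s2 by simp
  define F where "F = (\<lambda>(x :: real ^ 'n, y). ennreal ((mehler s x y)\<^sup>2))"
  have [measurable]: "F \<in> borel_measurable (borel \<Otimes>\<^sub>M borel)" unfolding F_def by measurable
  have FR: "F (c *\<^sub>R x + c *\<^sub>R z, c *\<^sub>R x - c *\<^sub>R z) = ennreal (A * (exp (\<eta> * (norm x)\<^sup>2) * exp (\<eta>' * (norm z)\<^sup>2)))" for x z
  proof -
    define p q where "p = c *\<^sub>R x + c *\<^sub>R z" and "q = c *\<^sub>R x - c *\<^sub>R z"
    have pp: "p \<bullet> p = (x \<bullet> x + z \<bullet> z) / 2 + x \<bullet> z" "q \<bullet> q = (x \<bullet> x + z \<bullet> z) / 2 - x \<bullet> z" "p \<bullet> q = (x \<bullet> x - z \<bullet> z) / 2"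
      unfolding p_def q_def
      by (simp_all add: inner_add_left inner_add_right inner_diff_left inner_diff_right inner_commute[of z x] cc field_simps)
    have n1: "1 - s \<noteq> 0" "1 + s \<noteq> 0" "1 - s\<^sup>2 = (1 - s) * (1 + s)" using s by (auto simp: power2_eq_square algebra_simps)
    have "2 * ((norm q)\<^sup>2 / 2 - (norm (q - s *\<^sub>R p))\<^sup>2 / (2 * (1 - s\<^sup>2)))
       = (q \<bullet> q) - (q \<bullet> q - 2 * s * (p \<bullet> q) + s\<^sup>2 * (p \<bullet> p)) / (1 - s\<^sup>2)"
      unfolding power2_norm_eq_inner using s2
      by (simp add: inner_diff_left inner_diff_right inner_commute[of q p] field_simps power2_eq_square)
    also have "\<dots> = \<eta> * (x \<bullet> x) + \<eta>' * (z \<bullet> z)"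
      unfolding pp \<eta>_def \<eta>'_def n1(3) using n1(1,2) by (simp add: divide_simps power2_eq_square) (simp add: algebra_simps)
    finally have ex: "2 * ((norm q)\<^sup>2 / 2 - (norm (q - s *\<^sub>R p))\<^sup>2 / (2 * (1 - s\<^sup>2))) = \<eta> * (norm x)\<^sup>2 + \<eta>' * (norm z)\<^sup>2"
      by (simp add: power2_norm_eq_inner)
    have "(mehler s p q)\<^sup>2 = A * exp (2 * ((norm q)\<^sup>2 / 2 - (norm (q - s *\<^sub>R p))\<^sup>2 / (2 * (1 - s\<^sup>2))))"
      unfolding mehler_def A_def power_mult_distrib exp_double[symmetric] using s2
      by (simp add: power_mult[symmetric] mult.commute[of _ 2]) (simp add: power_mult power_divide)
    then show ?thesis unfolding F_def p_def[symmetric] q_def[symmetric] ex by (simp add: exp_add)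
  qed
  have 1: "2 * \<eta> < 1" "2 * \<eta>' < 1" unfolding \<eta>_def \<eta>'_def using s by (auto simp: field_simps)
  have "(\<integral>\<^sup>+x. \<integral>\<^sup>+y. ennreal ((mehler s x y)\<^sup>2) \<partial>gauss \<partial>(gauss :: (real ^ 'n) measure)) = (\<integral>\<^sup>+x. \<integral>\<^sup>+y. F (x, y) \<partial>gauss \<partial>gauss)"
    unfolding F_def by simp
  also have "\<dots> = (\<integral>\<^sup>+x. \<integral>\<^sup>+z. F (c *\<^sub>R x + c *\<^sub>R z, c *\<^sub>R x - c *\<^sub>R z) \<partial>gauss \<partial>gauss)"
    by (rule nn_integral_gauss_rotate[symmetric]) (use c in \<open>auto simp: power2_eq_square\<close>)
  also have "\<dots> = (\<integral>\<^sup>+x. \<integral>\<^sup>+z. ennreal (A * exp (\<eta> * (norm x)\<^sup>2)) * ennreal (exp (\<eta>' * (norm (z :: real ^ 'n))\<^sup>2)) \<partial>gauss \<partial>(gauss :: (real ^ 'n) measure))"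
    unfolding FR using A0 by (simp add: ennreal_mult mult.assoc)
  also have "\<dots> = (\<integral>\<^sup>+x. ennreal (A * exp (\<eta> * (norm (x :: real ^ 'n))\<^sup>2)) * ennreal ((1 / sqrt (1 - 2 * \<eta>')) ^ CARD('n)) \<partial>gauss)"
    using gauss_exp_quadratic[OF 1(2), where 'n = 'n] by (subst nn_integral_cmult) (auto simp: nn_integral_eq_integral)
  also have "\<dots> = ennreal (A * (1 / sqrt (1 - 2 * \<eta>)) ^ CARD('n)) * ennreal ((1 / sqrt (1 - 2 * \<eta>')) ^ CARD('n))"
    using gauss_exp_quadratic[OF 1(1), where 'n = 'n] A0 by (subst nn_integral_multc) (auto simp: nn_integral_eq_integral)
  also have "\<dots> = ennreal (A * ((1 / sqrt (1 - 2 * \<eta>)) * (1 / sqrt (1 - 2 * \<eta>'))) ^ CARD('n))"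
    using A0 1 by (subst ennreal_mult[symmetric]) (auto simp: power_mult_distrib power_divide)
  also have "(1 / sqrt (1 - 2 * \<eta>)) * (1 / sqrt (1 - 2 * \<eta>')) = 1"
  proof -
    have "1 - 2 * \<eta> = (1 - s) / (1 + s)" "1 - 2 * \<eta>' = (1 + s) / (1 - s)"
      unfolding \<eta>_def \<eta>'_def using s by (simp_all add: field_simps)
    then have "(1 - 2 * \<eta>) * (1 - 2 * \<eta>') = 1" using s by simp
    then have "sqrt (1 - 2 * \<eta>) * sqrt (1 - 2 * \<eta>') = 1" by (simp add: real_sqrt_mult[symmetric])
    then show ?thesis by simp
  qed
  finally show ?thesis unfolding A_def by simp
qed

end

lemma Cauchy_Schwarz_integral:
  fixes f g :: "'a \<Rightarrow> real"
  assumes [measurable]: "f \<in> borel_measurable M" "g \<in> borel_measurable M"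
    and f: "integrable M (\<lambda>x. (f x)\<^sup>2)" and g: "integrable M (\<lambda>x. (g x)\<^sup>2)"
  shows "integrable M (\<lambda>x. f x * g x)" "(LINT x|M. f x * g x)\<^sup>2 \<le> (LINT x|M. (f x)\<^sup>2) * (LINT x|M. (g x)\<^sup>2)"
proof -
  show fg: "integrable M (\<lambda>x. f x * g x)"
    by (rule Bochner_Integration.integrable_bound[of M "\<lambda>x. (f x)\<^sup>2 + (g x)\<^sup>2"])
      (use f g in \<open>auto intro!: order_trans[OF abs_mult_le_squares]\<close>)
  define A B C where "A = (LINT x|M. (g x)\<^sup>2)" and "B = (LINT x|M. f x * g x)" and "C = (LINT x|M. (f x)\<^sup>2)"
  have A0: "0 \<le> A" unfolding A_def by (intro integral_nonneg_AE) auto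
  show "(LINT x|M. f x * g x)\<^sup>2 \<le> (LINT x|M. (f x)\<^sup>2) * (LINT x|M. (g x)\<^sup>2)"
  proof (cases "A = 0")
    case True
    then have "AE x in M. (g x)\<^sup>2 = 0" unfolding A_def by (subst (asm) integral_nonneg_eq_0_iff_AE) (use g in auto)
    then have "AE x in M. f x * g x = 0" by eventually_elim simp
    then have "(LINT x|M. f x * g x) = (LINT x|M. 0)" by (intro integral_cong_AE) auto
    then show ?thesis using True unfolding A_def by simp
  next
    case False
    have "0 \<le> (LINT x|M. (f x - (B / A) * g x)\<^sup>2)" by (intro integral_nonneg_AE) auto
    also have "(\<lambda>x. (f x - (B / A) * g x)\<^sup>2) = (\<lambda>x. (f x)\<^sup>2 - 2 * (B / A) * (f x * g x) + (B / A)\<^sup>2 * (g x)\<^sup>2)"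
      by (intro ext) (simp only: power2_diff power_mult_distrib, simp add: mult_ac)
    also have "(LINT x|M. (f x)\<^sup>2 - 2 * (B / A) * (f x * g x) + (B / A)\<^sup>2 * (g x)\<^sup>2) = C - 2 * (B / A) * B + (B / A)\<^sup>2 * A"
      unfolding A_def B_def C_def using f g fg by simp
    also have "\<dots> = C - B\<^sup>2 / A" using False by (simp add: power2_eq_square)
    finally have "B\<^sup>2 \<le> C * A" using False A0 by (simp add: field_simps)
    then show ?thesis unfolding A_def B_def C_def .
  qed
qed

lemma gauss_pair_product:
  fixes f g :: "real ^ 'n::finite \<Rightarrow> real"
  assumes f: "integrable gauss f" and g: "integrable gauss g"
  shows "integrable gauss_pair (\<lambda>xy. f (fst xy) * g (snd xy))"
    "(LINT xy|gauss_pair. f (fst xy) * g (snd xy)) = (LINT x|gauss. f x) * (LINT x|gauss. g x)"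
proof -
  have [measurable]: "f \<in> borel_measurable borel" "g \<in> borel_measurable borel" using borel_measurable_integrable[OF f] borel_measurable_integrable[OF g] by simp_all
  show I: "integrable gauss_pair (\<lambda>xy. f (fst xy) * g (snd xy))"
  proof (rule gauss2.Fubini_integrable)
    show "integrable gauss (\<lambda>x. LINT y|gauss. norm (f (fst (x, y)) * g (snd (x, y))))"
      using f by (simp add: abs_mult)
    show "AE x in gauss. integrable gauss (\<lambda>y. f (fst (x, y)) * g (snd (x, y)))" using g by simp
  qed measurable
  show "(LINT xy|gauss_pair. f (fst xy) * g (snd xy)) = (LINT x|gauss. f x) * (LINT x|gauss. g x)"
    using gauss2.integral_fst'[OF I] by simp
qed

text \<open>The left-hand side is the pairing of \<open>u \<otimes> u\<close> with the Mehler kernel minus a partial sum of its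
  Hermite expansion.  By Cauchy-Schwarz it suffices to know the norm of that difference, which the
  Hilbert-Schmidt norm of the kernel and the eigenvalues give exactly.  The completeness
  of the Hermite polynomials is contained in this computation.\<close>

lemma mehler_expansion_error:
  fixes u :: "real ^ 'n::finite \<Rightarrow> real"
  assumes s: "0 \<le> s" "s < 1" and u: "u \<in> L2_gauss" and S: "finite S"
  shows "(inner_gauss u (OU s u) - (\<Sum>\<alpha>\<in>S. s ^ mi_size \<alpha> * (hcoef \<alpha> u)\<^sup>2))\<^sup>2
     \<le> ((1 / (1 - s\<^sup>2)) ^ CARD('n) - (\<Sum>\<alpha>\<in>S. (s\<^sup>2) ^ mi_size \<alpha>)) * (inner_gauss u u)\<^sup>2"
proof -
  define K where "K xy = mehler s (fst xy) (snd xy)" for xy :: "(real ^ 'n) \<times> (real ^ 'n)"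
  define A where "A = (1 / (1 - s\<^sup>2)) ^ CARD('n)"
  have s2: "s\<^sup>2 < 1" using s by (simp add: abs_square_less_1)
  have A0: "0 \<le> A" unfolding A_def using s2 by simp
  have Km[measurable]: "K \<in> borel_measurable (gauss_pair :: ((real ^ 'n) \<times> (real ^ 'n)) measure)"
    unfolding K_def mehler_def by measurable
  have nnK: "(\<integral>\<^sup>+xy. ennreal ((K xy)\<^sup>2) \<partial>gauss_pair) = ennreal A"
    using gauss.nn_integral_fst[of "\<lambda>xy. ennreal ((K xy)\<^sup>2)", symmetric] mehler_square_integral[OF s, where 'n = 'n]
    unfolding A_def K_def by simp
  have KI: "integrable gauss_pair (\<lambda>xy. (K xy)\<^sup>2)" by (rule integrableI_bounded) (auto simp: nnK)
  have KA: "(LINT xy|gauss_pair. (K xy)\<^sup>2) = A" by (subst integral_eq_nn_integral) (use A0 in \<open>auto simp: nnK\<close>)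
  have prod: "integrable gauss_pair (\<lambda>xy. (v (fst xy) * w (snd xy)) * (v' (fst xy) * w' (snd xy)))"
     "(LINT xy|gauss_pair. (v (fst xy) * w (snd xy)) * (v' (fst xy) * w' (snd xy))) = inner_gauss v v' * inner_gauss w w'"
    if "v \<in> L2_gauss" "w \<in> L2_gauss" "v' \<in> L2_gauss" "w' \<in> L2_gauss" for v w v' w' :: "real ^ 'n \<Rightarrow> real"
    using gauss_pair_product[OF L2_gauss_mult[OF that(1,3)] L2_gauss_mult[OF that(2,4)]]
    unfolding inner_gauss_def by (simp_all add: mult_ac)
  have Kvw: "integrable gauss_pair (\<lambda>xy. K xy * (v (fst xy) * w (snd xy)))"
     "(LINT xy|gauss_pair. K xy * (v (fst xy) * w (snd xy))) = inner_gauss v (OU s w)"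
    if vw: "v \<in> L2_gauss" "w \<in> L2_gauss" for v w :: "real ^ 'n \<Rightarrow> real"
  proof -
    have [measurable]: "v \<in> borel_measurable borel" "w \<in> borel_measurable borel" using vw by auto
    show I: "integrable gauss_pair (\<lambda>xy. K xy * (v (fst xy) * w (snd xy)))"
      using prod(1)[OF vw vw] by (intro Cauchy_Schwarz_integral KI) (auto simp: power2_eq_square)
    have "(LINT xy|gauss_pair. K xy * (v (fst xy) * w (snd xy))) = (LINT x|gauss. LINT y|gauss. v x * (mehler s x y * w y))"
      using gauss2.integral_fst'[OF I, symmetric] by (simp add: K_def mult_ac)
    also have "\<dots> = inner_gauss v (OU s w)"
      unfolding inner_gauss_def by (simp add: OU_mehler(1)[OF s])
    finally show "(LINT xy|gauss_pair. K xy * (v (fst xy) * w (snd xy))) = inner_gauss v (OU s w)" .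
  qed
  define T where "T xy = (\<Sum>\<alpha>\<in>S. s ^ mi_size \<alpha> * (herm \<alpha> (fst xy) * herm \<alpha> (snd xy)))" for xy :: "(real ^ 'n) \<times> (real ^ 'n)"
  have [measurable]: "T \<in> borel_measurable (gauss_pair :: ((real ^ 'n) \<times> (real ^ 'n)) measure)" unfolding T_def by measurable
  have OUh: "inner_gauss (herm \<alpha>) (OU s (herm \<alpha>)) = s ^ mi_size \<alpha>" for \<alpha> :: "'n \<Rightarrow> nat"
    unfolding OU_herm[OF s, abs_def] inner_gauss_commute[of "herm \<alpha>"] inner_gauss_cmult_left herm_orthonormal by simp
  have KT: "integrable gauss_pair (\<lambda>xy. K xy * T xy)" "(LINT xy|gauss_pair. K xy * T xy) = (\<Sum>\<alpha>\<in>S. (s\<^sup>2) ^ mi_size \<alpha>)"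
  proof -
    have e: "K xy * T xy = (\<Sum>\<alpha>\<in>S. s ^ mi_size \<alpha> * (K xy * (herm \<alpha> (fst xy) * herm \<alpha> (snd xy))))" for xy
      unfolding T_def sum_distrib_left by (simp add: mult_ac)
    show "integrable gauss_pair (\<lambda>xy. K xy * T xy)" unfolding e using Kvw by (intro Bochner_Integration.integrable_sum integrable_mult_right) simp
    have "(LINT xy|gauss_pair. K xy * T xy) = (\<Sum>\<alpha>\<in>S. s ^ mi_size \<alpha> * s ^ mi_size \<alpha>)"
      unfolding e using Kvw OUh by (subst Bochner_Integration.integral_sum) (auto simp del: integral_mult_right_zero simp: integral_mult_right_zero)
    also have "\<dots> = (\<Sum>\<alpha>\<in>S. (s\<^sup>2) ^ mi_size \<alpha>)" by (simp add: power2_eq_square power_mult_distrib)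
    finally show "(LINT xy|gauss_pair. K xy * T xy) = (\<Sum>\<alpha>\<in>S. (s\<^sup>2) ^ mi_size \<alpha>)" .
  qed
  have TT: "integrable gauss_pair (\<lambda>xy. (T xy)\<^sup>2)" "(LINT xy|gauss_pair. (T xy)\<^sup>2) = (\<Sum>\<alpha>\<in>S. (s\<^sup>2) ^ mi_size \<alpha>)"
  proof -
    have e: "(T xy)\<^sup>2 = (\<Sum>\<alpha>\<in>S. \<Sum>\<beta>\<in>S. s ^ mi_size \<alpha> * s ^ mi_size \<beta> * ((herm \<alpha> (fst xy) * herm \<alpha> (snd xy)) * (herm \<beta> (fst xy) * herm \<beta> (snd xy))))" for xy
      unfolding T_def power2_eq_square sum_product by (simp add: mult_ac)
    have I: "integrable gauss_pair (\<lambda>xy. s ^ mi_size \<alpha> * s ^ mi_size \<beta> * ((herm \<alpha> (fst xy) * herm \<alpha> (snd xy)) * (herm \<beta> (fst xy) * herm \<beta> (snd xy))))" for \<alpha> \<beta> :: "'n \<Rightarrow> nat"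
      using prod by (intro integrable_mult_right) simp
    show "integrable gauss_pair (\<lambda>xy. (T xy)\<^sup>2)" unfolding e by (intro Bochner_Integration.integrable_sum I)
    have "(LINT xy|gauss_pair. (T xy)\<^sup>2) = (\<Sum>\<alpha>\<in>S. \<Sum>\<beta>\<in>S. s ^ mi_size \<alpha> * s ^ mi_size \<beta> * (inner_gauss (herm \<alpha>) (herm \<beta>) * inner_gauss (herm \<alpha>) (herm \<beta>)))"
      unfolding e by (subst Bochner_Integration.integral_sum, intro Bochner_Integration.integrable_sum I, intro sum.cong refl,
          subst Bochner_Integration.integral_sum, rule I, intro sum.cong refl, subst integral_mult_right_zero, subst prod(2)) simp_all
    also have "\<dots> = (\<Sum>\<alpha>\<in>S. (s\<^sup>2) ^ mi_size \<alpha>)"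
      unfolding herm_orthonormal using S by (simp add: if_distrib sum.delta power2_eq_square power_mult_distrib cong: if_cong)
    finally show "(LINT xy|gauss_pair. (T xy)\<^sup>2) = (\<Sum>\<alpha>\<in>S. (s\<^sup>2) ^ mi_size \<alpha>)" .
  qed
  define R where "R xy = K xy - T xy" for xy
  have Req: "(R xy)\<^sup>2 = (K xy)\<^sup>2 - 2 * (K xy * T xy) + (T xy)\<^sup>2" for xy unfolding R_def by (simp add: power2_diff)
  have [measurable]: "R \<in> borel_measurable gauss_pair" unfolding R_def by measurable
  have RI: "integrable gauss_pair (\<lambda>xy. (R xy)\<^sup>2)" unfolding Req using KI KT TT by simp
  have RA: "(LINT xy|gauss_pair. (R xy)\<^sup>2) = A - (\<Sum>\<alpha>\<in>S. (s\<^sup>2) ^ mi_size \<alpha>)" unfolding Req using KI KT TT KA by simp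
  have [measurable]: "u \<in> borel_measurable borel" using u by auto
  have uuI: "integrable gauss_pair (\<lambda>xy. (u (fst xy) * u (snd xy))\<^sup>2)" "(LINT xy|gauss_pair. (u (fst xy) * u (snd xy))\<^sup>2) = (inner_gauss u u)\<^sup>2"
    using prod[OF u u u u] by (simp_all add: power2_eq_square)
  have Ru: "(LINT xy|gauss_pair. R xy * (u (fst xy) * u (snd xy))) = inner_gauss u (OU s u) - (\<Sum>\<alpha>\<in>S. s ^ mi_size \<alpha> * (hcoef \<alpha> u)\<^sup>2)"
  proof -
    have e: "R xy * (u (fst xy) * u (snd xy)) = K xy * (u (fst xy) * u (snd xy)) - (\<Sum>\<alpha>\<in>S. s ^ mi_size \<alpha> * ((u (fst xy) * u (snd xy)) * (herm \<alpha> (fst xy) * herm \<alpha> (snd xy))))" for xy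
      unfolding R_def T_def left_diff_distrib sum_distrib_right by (simp add: mult_ac)
    have I: "integrable gauss_pair (\<lambda>xy. s ^ mi_size \<alpha> * ((u (fst xy) * u (snd xy)) * (herm \<alpha> (fst xy) * herm \<alpha> (snd xy))))" for \<alpha> :: "'n \<Rightarrow> nat"
      using prod(1)[OF u u] by (intro integrable_mult_right) simp
    have "(LINT xy|gauss_pair. R xy * (u (fst xy) * u (snd xy)))
        = (LINT xy|gauss_pair. K xy * (u (fst xy) * u (snd xy))) - (\<Sum>\<alpha>\<in>S. LINT xy|gauss_pair. s ^ mi_size \<alpha> * ((u (fst xy) * u (snd xy)) * (herm \<alpha> (fst xy) * herm \<alpha> (snd xy))))"
      unfolding e using Kvw(1)[OF u u] I by (subst Bochner_Integration.integral_diff) (auto intro!: Bochner_Integration.integrable_sum Bochner_Integration.integral_sum)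
    then show ?thesis
      unfolding Kvw(2)[OF u u] integral_mult_right_zero prod(2)[OF u u herm_L2 herm_L2] hcoef_def by (simp add: power2_eq_square)
  qed
  have "(LINT xy|gauss_pair. R xy * (u (fst xy) * u (snd xy)))\<^sup>2 \<le> (LINT xy|gauss_pair. (R xy)\<^sup>2) * (LINT xy|gauss_pair. (u (fst xy) * u (snd xy))\<^sup>2)"
    by (rule Cauchy_Schwarz_integral(2)[OF _ _ RI uuI(1)]) measurable
  then show ?thesis unfolding Ru RA uuI(2) A_def .
qed

definition hweight :: "nat \<Rightarrow> (real ^ 'n::finite \<Rightarrow> real) \<Rightarrow> real" where
  "hweight m u = (\<Sum>\<alpha> | mi_size \<alpha> = m. (hcoef \<alpha> u)\<^sup>2)"

lemma hweight_nonneg: "0 \<le> hweight m u"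
  unfolding hweight_def by (intro sum_nonneg) simp

lemma finite_mi_size_less: "finite {\<alpha> :: 'n::finite \<Rightarrow> nat. mi_size \<alpha> < N}"
proof -
  have "{\<alpha> :: 'n \<Rightarrow> nat. mi_size \<alpha> < N} = (\<Union>m\<in>{..<N}. {\<alpha>. mi_size \<alpha> = m})" by auto
  then show ?thesis by (simp add: finite_mi_size)
qed

lemma sum_mi_size_less:
  fixes f :: "('n::finite \<Rightarrow> nat) \<Rightarrow> real"
  shows "(\<Sum>\<alpha> | mi_size \<alpha> < N. f \<alpha>) = (\<Sum>m<N. \<Sum>\<alpha> | mi_size \<alpha> = m. f \<alpha>)"
proof -
  have "{\<alpha> :: 'n \<Rightarrow> nat. mi_size \<alpha> < N} = (\<Union>m\<in>{..<N}. {\<alpha>. mi_size \<alpha> = m})" by auto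
  then show ?thesis by (simp add: sum.UNION_disjoint finite_mi_size disjoint_iff)
qed

text \<open>The trace of the squared operator equals its Hilbert-Schmidt norm: the sum is squeezed between
  powers of partial geometric sums and the given bound.\<close>

lemma multi_geometric_limit:
  assumes r: "0 \<le> r" "r < (1::real)"
    and le: "\<And>N. (\<Sum>\<alpha> | mi_size (\<alpha> :: 'n::finite \<Rightarrow> nat) < N. r ^ mi_size \<alpha>) \<le> (1 / (1 - r)) ^ CARD('n)"
  shows "(\<lambda>N. \<Sum>\<alpha> | mi_size (\<alpha> :: 'n \<Rightarrow> nat) < N. r ^ mi_size \<alpha>) \<longlonglongrightarrow> (1 / (1 - r)) ^ CARD('n)"
proof -
  define A where "A = (1 / (1 - r)) ^ CARD('n)"
  define a where "a N = (\<Sum>\<alpha> | mi_size (\<alpha> :: 'n \<Rightarrow> nat) < N. r ^ mi_size \<alpha>)" for N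
  have box: "(\<Sum>j<M. r ^ j) ^ CARD('n) \<le> a N" if N: "CARD('n) * M < N" for M N
  proof -
    have "(\<Sum>j<M. r ^ j) ^ CARD('n) = (\<Prod>i\<in>(UNIV :: 'n set). \<Sum>j<M. r ^ j)" by simp
    also have "\<dots> = (\<Sum>\<alpha>\<in>PiE (UNIV :: 'n set) (\<lambda>_. {..<M}). \<Prod>i\<in>UNIV. r ^ \<alpha> i)"
      using prod_sum_PiE[of "UNIV :: 'n set" "\<lambda>_. {..<M}" "\<lambda>_ j. r ^ j"] by simp
    also have "\<dots> = (\<Sum>\<alpha>\<in>PiE (UNIV :: 'n set) (\<lambda>_. {..<M}). r ^ mi_size \<alpha>)" unfolding mi_size_def by (simp add: power_sum)
    also have "\<dots> \<le> a N" unfolding a_def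
    proof (rule sum_mono2[OF finite_mi_size_less])
      show "PiE UNIV (\<lambda>_. {..<M}) \<subseteq> {\<alpha> :: 'n \<Rightarrow> nat. mi_size \<alpha> < N}"
      proof
        fix \<alpha> :: "'n \<Rightarrow> nat" assume "\<alpha> \<in> PiE UNIV (\<lambda>_. {..<M})"
        then have "\<alpha> i \<le> M" for i by (auto simp: PiE_def Pi_def less_imp_le)
        then have "mi_size \<alpha> \<le> (\<Sum>i\<in>(UNIV :: 'n set). M)" unfolding mi_size_def by (intro sum_mono)
        then show "\<alpha> \<in> {\<alpha>. mi_size \<alpha> < N}" using N by simp
      qed
    qed (use r in simp)
    finally show ?thesis .
  qed
  have L: "(\<lambda>M. (\<Sum>j<M. r ^ j) ^ CARD('n)) \<longlonglongrightarrow> A"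
    unfolding A_def using geometric_sums[of r] r by (intro tendsto_power) (simp add: sums_def)
  show ?thesis unfolding a_def[symmetric] A_def[symmetric]
  proof (rule LIMSEQ_I)
    fix e :: real assume e: "0 < e"
    obtain M where M: "A - e < (\<Sum>j<M. r ^ j) ^ CARD('n)"
      using order_tendstoD(1)[OF L, of "A - e"] e by (auto simp: eventually_sequentially)
    show "\<exists>N0. \<forall>N\<ge>N0. norm (a N - A) < e"
    proof (intro exI[of _ "Suc (CARD('n) * M)"] allI impI)
      fix N assume "Suc (CARD('n) * M) \<le> N"
      then have "A - e < a N" using box[of M N] M by simp
      moreover have "a N \<le> A" using le unfolding a_def A_def .
      ultimately show "norm (a N - A) < e" by simp
    qed
  qed
qed

text \<open>The error bound of the partial expansions tends to zero because the squared eigenvalues exhaust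
  the Hilbert-Schmidt norm.  The case \<open>u = 1\<close> of the error bound shows that they do not exceed it.\<close>

theorem OU_form_sums:
  fixes u :: "real ^ 'n::finite \<Rightarrow> real"
  assumes s: "0 \<le> s" "s < 1" and u: "u \<in> L2_gauss"
  shows "(\<lambda>m. s ^ m * hweight m u) sums inner_gauss u (OU s u)"
proof -
  define S where "S N = {\<alpha> :: 'n \<Rightarrow> nat. mi_size \<alpha> < N}" for N
  define A where "A = (1 / (1 - s\<^sup>2)) ^ CARD('n)"
  have s2: "0 \<le> s\<^sup>2" "s\<^sup>2 < 1" using s by (simp_all add: abs_square_less_1)
  have fin: "finite (S N)" for N unfolding S_def by (rule finite_mi_size_less)
  have le: "(\<Sum>\<alpha>\<in>S N. (s\<^sup>2) ^ mi_size \<alpha>) \<le> A" for N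
  proof -
    have "inner_gauss (\<lambda>_ :: real ^ 'n. 1) (\<lambda>_. 1) = 1" unfolding inner_gauss_def by (simp add: gauss.prob_space[simplified])
    then have "0 \<le> A - (\<Sum>\<alpha>\<in>S N. (s\<^sup>2) ^ mi_size \<alpha>)"
      using order_trans[OF zero_le_power2 mehler_expansion_error[OF s L2_gauss_const[of 1] fin[of N]]] unfolding A_def by simp
    then show ?thesis by simp
  qed
  have lim: "(\<lambda>N. (A - (\<Sum>\<alpha>\<in>S N. (s\<^sup>2) ^ mi_size \<alpha>)) * (inner_gauss u u)\<^sup>2) \<longlonglongrightarrow> (A - A) * (inner_gauss u u)\<^sup>2"
    using multi_geometric_limit[OF s2] le unfolding S_def A_def by (intro tendsto_intros) auto
  have "(\<lambda>N. (inner_gauss u (OU s u) - (\<Sum>\<alpha>\<in>S N. s ^ mi_size \<alpha> * (hcoef \<alpha> u)\<^sup>2))\<^sup>2) \<longlonglongrightarrow> 0"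
    by (rule tendsto_sandwich[OF _ _ tendsto_const lim[simplified]])
      (use mehler_expansion_error[OF s u fin] in \<open>auto simp: A_def\<close>)
  then have "(\<lambda>N. inner_gauss u (OU s u) - (\<Sum>\<alpha>\<in>S N. s ^ mi_size \<alpha> * (hcoef \<alpha> u)\<^sup>2)) \<longlonglongrightarrow> 0"
    using tendsto_real_sqrt[of _ 0 sequentially] by (auto simp: tendsto_rabs_zero_iff)
  then have "(\<lambda>N. inner_gauss u (OU s u) - (inner_gauss u (OU s u) - (\<Sum>\<alpha>\<in>S N. s ^ mi_size \<alpha> * (hcoef \<alpha> u)\<^sup>2))) \<longlonglongrightarrow> inner_gauss u (OU s u) - 0"
    by (intro tendsto_intros)
  moreover have "(\<Sum>\<alpha>\<in>S N. s ^ mi_size \<alpha> * (hcoef \<alpha> u)\<^sup>2) = (\<Sum>m<N. s ^ m * hweight m u)" for N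
    unfolding S_def sum_mi_size_less hweight_def sum_distrib_left by (intro sum.cong refl) auto
  ultimately show ?thesis unfolding sums_def by simp
qed

lemma OU_form_le:
  assumes s: "0 \<le> s" "s < 1" and u: "u \<in> L2_gauss"
  shows "2 * (inner_gauss u u - inner_gauss u (OU s u)) = (LINT xy|corr s. (u (fst xy) - u (snd xy))\<^sup>2)"
    and "inner_gauss u (OU s u) \<le> inner_gauss u u"
proof -
  have I: "integrable (corr s) (\<lambda>xy. (u (fst xy))\<^sup>2)" "integrable (corr s) (\<lambda>xy. (u (snd xy))\<^sup>2)"
     "(LINT xy|corr s. (u (fst xy))\<^sup>2) = inner_gauss u u" "(LINT xy|corr s. (u (snd xy))\<^sup>2) = inner_gauss u u"
    using integrable_corr_fst[OF s L2_gaussD(2)[OF u]] integrable_corr_snd[OF s L2_gaussD(2)[OF u]] L2_gaussD(1)[OF u]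
      integral_corr_fst[OF s, of "\<lambda>x. (u x)\<^sup>2"] integral_corr_snd[OF s, of "\<lambda>x. (u x)\<^sup>2"]
    unfolding inner_gauss_def by (simp_all add: power2_eq_square)
  have "(LINT xy|corr s. (u (fst xy) - u (snd xy))\<^sup>2) = (LINT xy|corr s. (u (fst xy))\<^sup>2 + (u (snd xy))\<^sup>2 - 2 * (u (fst xy) * u (snd xy)))"
    by (simp add: power2_diff mult.assoc algebra_simps)
  also have "\<dots> = 2 * (inner_gauss u u - inner_gauss u (OU s u))"
    using I corr_integrable_mult[OF s u u] by (simp add: inner_OU[OF s u u])
  finally show e: "2 * (inner_gauss u u - inner_gauss u (OU s u)) = (LINT xy|corr s. (u (fst xy) - u (snd xy))\<^sup>2)" by simp
  have "0 \<le> (LINT xy|corr s. (u (fst xy) - u (snd xy))\<^sup>2)" by (intro integral_nonneg_AE) auto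
  then show "inner_gauss u (OU s u) \<le> inner_gauss u u" unfolding e[symmetric] by simp
qed

lemma L2_gauss_approx:
  fixes u :: "real ^ 'n::finite \<Rightarrow> real"
  assumes u: "u \<in> L2_gauss" and e: "0 < e"
  shows "\<exists>v M. continuous_on UNIV v \<and> (\<forall>x. \<bar>v x\<bar> \<le> M) \<and> (LINT x|gauss. (u x - v x)\<^sup>2) < e"
proof -
  have [measurable]: "u \<in> borel_measurable borel" using u by auto
  define clip where "clip m t = max (- real m) (min (real m) t)" for m t
  have clip: "\<bar>clip m t\<bar> \<le> real m" "\<bar>t - clip m t\<bar> \<le> \<bar>t\<bar>" for m t unfolding clip_def by auto
  have [measurable]: "(\<lambda>x. clip m (u x)) \<in> borel_measurable borel" for m unfolding clip_def by measurable
  have "(\<lambda>m. LINT x|gauss. (u x - clip m (u x))\<^sup>2) \<longlonglongrightarrow> (LINT x|(gauss :: (real ^ 'n) measure). 0)"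
  proof (rule integral_dominated_convergence[where w = "\<lambda>x. (u x)\<^sup>2"])
    show "AE x in gauss. (\<lambda>m. (u x - clip m (u x))\<^sup>2) \<longlonglongrightarrow> 0"
    proof (rule AE_I2, rule tendsto_eventually)
      fix x
      obtain k where "\<bar>u x\<bar> \<le> real k" using real_arch_simple by blast
      then show "\<forall>\<^sub>F m in sequentially. (u x - clip m (u x))\<^sup>2 = 0"
        unfolding clip_def eventually_sequentially by (intro exI[of _ k]) auto
    qed
    show "AE x in gauss. norm ((u x - clip m (u x))\<^sup>2) \<le> (u x)\<^sup>2" for m
      using clip(2) by (intro AE_I2) (simp add: abs_le_square_iff[symmetric])
  qed (use u in auto)
  then obtain m where m: "(LINT x|gauss. (u x - clip m (u x))\<^sup>2) < e / 4"
    using order_tendstoD(2)[of _ 0 sequentially "e / 4"] e by (auto simp: eventually_sequentially)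
  have "(\<lambda>x. clip m (u x)) measurable_on UNIV" by (rule lebesgue_measurable_imp_measurable_on) (auto intro: measurable_completion)
  then obtain N g where N: "negligible N" and g: "\<And>n. continuous_on UNIV (g n)" "\<And>x. x \<notin> N \<Longrightarrow> (\<lambda>n. g n x) \<longlonglongrightarrow> clip m (u x)"
    unfolding measurable_on_def by auto
  have AEN: "AE x in (gauss :: (real ^ 'n) measure). x \<notin> N"
    using N unfolding AE_gauss_iff negligible_iff_null_sets by (metis AE_completion_iff AE_not_in)
  have gc: "continuous_on UNIV (\<lambda>x. clip m (g n x))" for n unfolding clip_def by (intro continuous_intros g)
  have gm[measurable]: "(\<lambda>x. clip m (g n x)) \<in> borel_measurable borel" for n using gc by (rule borel_measurable_continuous_onI)
  have "(\<lambda>n. LINT x|gauss. (clip m (u x) - clip m (g n x))\<^sup>2) \<longlonglongrightarrow> (LINT x|(gauss :: (real ^ 'n) measure). 0)"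
  proof (rule integral_dominated_convergence[where w = "\<lambda>_. (2 * real m)\<^sup>2"])
    show "AE x in gauss. (\<lambda>n. (clip m (u x) - clip m (g n x))\<^sup>2) \<longlonglongrightarrow> 0"
      using AEN
    proof eventually_elim
      case (elim x)
      have "(\<lambda>n. clip m (g n x)) \<longlonglongrightarrow> clip m (clip m (u x))"
        unfolding clip_def[of m "clip m (u x)"] clip_def[of m "g _ x"] by (intro tendsto_max tendsto_min tendsto_const g(2)[OF elim])
      moreover have "clip m (clip m (u x)) = clip m (u x)" unfolding clip_def by auto
      ultimately have "(\<lambda>n. (clip m (u x) - clip m (g n x))\<^sup>2) \<longlonglongrightarrow> (clip m (u x) - clip m (u x))\<^sup>2" by (intro tendsto_intros) simp
      then show ?case by simp
    qed
    show "AE x in gauss. norm ((clip m (u x) - clip m (g n x))\<^sup>2) \<le> (2 * real m)\<^sup>2" for n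
    proof (rule AE_I2)
      fix x
      have "\<bar>clip m (u x) - clip m (g n x)\<bar> \<le> \<bar>2 * real m\<bar>" using clip(1)[of m "u x"] clip(1)[of m "g n x"] by simp
      then show "norm ((clip m (u x) - clip m (g n x))\<^sup>2) \<le> (2 * real m)\<^sup>2" by (simp only: abs_le_square_iff) simp
    qed
  qed auto
  then obtain n where n: "(LINT x|gauss. (clip m (u x) - clip m (g n x))\<^sup>2) < e / 4"
    using order_tendstoD(2)[of _ 0 sequentially "e / 4"] e by (auto simp: eventually_sequentially)
  define v where "v x = clip m (g n x)" for x
  have L2c: "(\<lambda>x. clip m (u x)) \<in> L2_gauss" "v \<in> L2_gauss"
    unfolding v_def using clip(1) by (auto intro!: L2_gauss_bounded[of _ "real m"])
  have "(LINT x|gauss. (u x - v x)\<^sup>2) \<le> (LINT x|gauss. 2 * (u x - clip m (u x))\<^sup>2 + 2 * (clip m (u x) - v x)\<^sup>2)"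
  proof (rule integral_mono)
    show "integrable gauss (\<lambda>x. (u x - v x)\<^sup>2)" using L2_gauss_diff[OF u L2c(2)] by auto
    show "integrable gauss (\<lambda>x. 2 * (u x - clip m (u x))\<^sup>2 + 2 * (clip m (u x) - v x)\<^sup>2)"
      using L2_gaussD(2)[OF L2_gauss_diff[OF u L2c(1)]] L2_gaussD(2)[OF L2_gauss_diff[OF L2c]] by simp
    fix x
    have "0 \<le> ((u x - clip m (u x)) - (clip m (u x) - v x))\<^sup>2" by simp
    then show "(u x - v x)\<^sup>2 \<le> 2 * (u x - clip m (u x))\<^sup>2 + 2 * (clip m (u x) - v x)\<^sup>2"
      by (simp add: power2_eq_square algebra_simps)
  qed
  also have "\<dots> = 2 * (LINT x|gauss. (u x - clip m (u x))\<^sup>2) + 2 * (LINT x|gauss. (clip m (u x) - v x)\<^sup>2)"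
    using L2_gaussD(2)[OF L2_gauss_diff[OF u L2c(1)]] L2_gaussD(2)[OF L2_gauss_diff[OF L2c]] by simp
  also have "\<dots> < e" using m n unfolding v_def by simp
  finally have "(LINT x|gauss. (u x - v x)\<^sup>2) < e" .
  then show ?thesis using gc clip(1) unfolding v_def by blast
qed

text \<open>The Dirichlet-type form \<open>E (u(X) - u(Y))\<^sup>2\<close> of the correlated pair vanishes as the correlation tends
  to one: for bounded continuous functions by dominated convergence, and in general by approximation,
  since both components of the pair are standard Gaussian whatever the correlation is.\<close>

lemma OU_form_tendsto:
  fixes u :: "real ^ 'n::finite \<Rightarrow> real"
  assumes u: "u \<in> L2_gauss" and s: "\<And>j. 0 \<le> s j" "\<And>j. s j < 1" "s \<longlonglongrightarrow> 1"
  shows "(\<lambda>j. inner_gauss u (OU (s j) u)) \<longlonglongrightarrow> inner_gauss u u"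
proof -
  have [measurable]: "u \<in> borel_measurable borel" using u by auto
  have "(\<lambda>j. LINT xy|corr (s j). (u (fst xy) - u (snd xy))\<^sup>2) \<longlonglongrightarrow> 0"
  proof (rule LIMSEQ_I)
    fix e :: real assume e: "0 < e"
    obtain v M where v: "continuous_on UNIV v" "\<And>x. \<bar>v x\<bar> \<le> M" "(LINT x|gauss. (u x - v x)\<^sup>2) < e / 12"
      using L2_gauss_approx[OF u, of "e / 12"] e by auto
    have vm[measurable]: "v \<in> borel_measurable borel" using v(1) by (rule borel_measurable_continuous_onI)
    have vL: "v \<in> L2_gauss" by (rule L2_gauss_bounded[of _ M]) (use v in auto)
    have dL: "(\<lambda>x. u x - v x) \<in> L2_gauss" by (rule L2_gauss_diff[OF u vL])
    have vc: "isCont v x" for x using v(1) by (simp add: continuous_on_eq_continuous_at)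
    have M0: "0 \<le> M" using v(2)[of 0] by linarith
    have vd: "\<bar>v x - v y\<bar> \<le> 2 * M" for x y using v(2)[of x] v(2)[of y] by linarith
    have vd2: "(v x - v y)\<^sup>2 \<le> (2 * M)\<^sup>2" for x y using vd[of x y] M0 by (metis abs_le_square_iff abs_of_nonneg mult_nonneg_nonneg zero_le_numeral)
    have "(\<lambda>j. LINT xz|gauss_pair. (v (fst xz) - v (s j *\<^sub>R fst xz + sqrt (1 - (s j)\<^sup>2) *\<^sub>R snd xz))\<^sup>2) \<longlonglongrightarrow> (LINT xz|(gauss_pair :: ((real ^ 'n) \<times> (real ^ 'n)) measure). 0)"
    proof (rule integral_dominated_convergence[where w = "\<lambda>_. (2 * M)\<^sup>2"])
      show "AE xz in (gauss_pair :: ((real ^ 'n) \<times> (real ^ 'n)) measure). (\<lambda>j. (v (fst xz) - v (s j *\<^sub>R fst xz + sqrt (1 - (s j)\<^sup>2) *\<^sub>R snd xz))\<^sup>2) \<longlonglongrightarrow> 0"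
      proof (rule AE_I2)
        fix xz :: "(real ^ 'n) \<times> (real ^ 'n)"
        have "(\<lambda>j. s j *\<^sub>R fst xz + sqrt (1 - (s j)\<^sup>2) *\<^sub>R snd xz) \<longlonglongrightarrow> 1 *\<^sub>R fst xz + sqrt (1 - 1\<^sup>2) *\<^sub>R snd xz"
          by (intro tendsto_intros s(3))
        then have "(\<lambda>j. v (s j *\<^sub>R fst xz + sqrt (1 - (s j)\<^sup>2) *\<^sub>R snd xz)) \<longlonglongrightarrow> v (fst xz)"
          using isCont_tendsto_compose[OF vc[of "fst xz"]] by simp
        then have "(\<lambda>j. (v (fst xz) - v (s j *\<^sub>R fst xz + sqrt (1 - (s j)\<^sup>2) *\<^sub>R snd xz))\<^sup>2) \<longlonglongrightarrow> (v (fst xz) - v (fst xz))\<^sup>2" by (intro tendsto_intros)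
        then show "(\<lambda>j. (v (fst xz) - v (s j *\<^sub>R fst xz + sqrt (1 - (s j)\<^sup>2) *\<^sub>R snd xz))\<^sup>2) \<longlonglongrightarrow> 0" by simp
      qed
      show "AE xz in (gauss_pair :: ((real ^ 'n) \<times> (real ^ 'n)) measure). norm ((v (fst xz) - v (s j *\<^sub>R fst xz + sqrt (1 - (s j)\<^sup>2) *\<^sub>R snd xz))\<^sup>2) \<le> (2 * M)\<^sup>2" for j
        by (intro AE_I2) (simp only: real_norm_def abs_power2 vd2)
    qed auto
    then obtain J where J: "\<And>j. J \<le> j \<Longrightarrow> (LINT xz|gauss_pair. (v (fst xz) - v (s j *\<^sub>R fst xz + sqrt (1 - (s j)\<^sup>2) *\<^sub>R snd xz))\<^sup>2) < e / 6"
      using order_tendstoD(2)[of _ 0 sequentially "e / 6"] e by (auto simp: eventually_sequentially)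
    show "\<exists>J. \<forall>j\<ge>J. norm ((LINT xy|corr (s j). (u (fst xy) - u (snd xy))\<^sup>2) - 0) < e"
    proof (intro exI[of _ J] allI impI)
      fix j assume j: "J \<le> j"
      interpret c: prob_space "corr (s j) :: ((real ^ 'n) \<times> (real ^ 'n)) measure" by (rule prob_space_corr)
      have vI: "integrable (corr (s j)) (\<lambda>xy. (v (fst xy) - v (snd xy))\<^sup>2)"
      proof (rule corr_bounded_integrable[of _ "(2 * M)\<^sup>2"])
        show "\<bar>(v (fst xy) - v (snd xy))\<^sup>2\<bar> \<le> (2 * M)\<^sup>2" for xy by (simp only: abs_power2 vd2)
      qed measurable
      have dI: "integrable (corr (s j)) (\<lambda>xy. (u (fst xy) - v (fst xy))\<^sup>2)" "integrable (corr (s j)) (\<lambda>xy. (u (snd xy) - v (snd xy))\<^sup>2)"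
        "(LINT xy|corr (s j). (u (fst xy) - v (fst xy))\<^sup>2) = (LINT x|gauss. (u x - v x)\<^sup>2)"
        "(LINT xy|corr (s j). (u (snd xy) - v (snd xy))\<^sup>2) = (LINT x|gauss. (u x - v x)\<^sup>2)"
        using integrable_corr_fst[OF s(1,2) L2_gaussD(2)[OF dL]] integrable_corr_snd[OF s(1,2) L2_gaussD(2)[OF dL]]
          integral_corr_fst[OF s(1,2), of "\<lambda>x. (u x - v x)\<^sup>2"] integral_corr_snd[OF s(1,2), of "\<lambda>x. (u x - v x)\<^sup>2"] by simp_all
      have vE: "(LINT xy|corr (s j). (v (fst xy) - v (snd xy))\<^sup>2) < e / 6"
        using J[OF j] by (subst integral_corr_eq_pair[OF s(1,2)]) (auto simp: split_beta')
      have "(LINT xy|corr (s j). (u (fst xy) - u (snd xy))\<^sup>2)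
          \<le> (LINT xy|corr (s j). 3 * (u (fst xy) - v (fst xy))\<^sup>2 + 3 * (v (fst xy) - v (snd xy))\<^sup>2 + 3 * (u (snd xy) - v (snd xy))\<^sup>2)"
      proof (rule integral_mono')
        show "integrable (corr (s j)) (\<lambda>xy. 3 * (u (fst xy) - v (fst xy))\<^sup>2 + 3 * (v (fst xy) - v (snd xy))\<^sup>2 + 3 * (u (snd xy) - v (snd xy))\<^sup>2)"
          using vI dI by simp
        fix xy :: "(real ^ 'n) \<times> (real ^ 'n)"
        have q: "(a + b - c)\<^sup>2 \<le> 3 * a\<^sup>2 + 3 * b\<^sup>2 + 3 * c\<^sup>2" for a b c :: real
        proof -
          have "0 \<le> (a - b)\<^sup>2 + (a + c)\<^sup>2 + (b + c)\<^sup>2" by simp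
          then show ?thesis by (simp add: power2_eq_square algebra_simps)
        qed
        show "(u (fst xy) - u (snd xy))\<^sup>2 \<le> 3 * (u (fst xy) - v (fst xy))\<^sup>2 + 3 * (v (fst xy) - v (snd xy))\<^sup>2 + 3 * (u (snd xy) - v (snd xy))\<^sup>2"
          using q[of "u (fst xy) - v (fst xy)" "v (fst xy) - v (snd xy)" "u (snd xy) - v (snd xy)"] by simp
      qed simp
      also have "\<dots> = 6 * (LINT x|gauss. (u x - v x)\<^sup>2) + 3 * (LINT xy|corr (s j). (v (fst xy) - v (snd xy))\<^sup>2)"
        using vI dI by simp
      also have "\<dots> < e" using v(3) vE by simp
      finally have "(LINT xy|corr (s j). (u (fst xy) - u (snd xy))\<^sup>2) < e" .
      moreover have "0 \<le> (LINT xy|corr (s j). (u (fst xy) - u (snd xy))\<^sup>2)" by (intro integral_nonneg_AE) auto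
      ultimately show "norm ((LINT xy|corr (s j). (u (fst xy) - u (snd xy))\<^sup>2) - 0) < e" by simp
    qed
  qed
  then have "(\<lambda>j. 2 * (inner_gauss u u - inner_gauss u (OU (s j) u))) \<longlonglongrightarrow> 0"
    unfolding OU_form_le(1)[OF s(1,2) u] .
  then have "(\<lambda>j. inner_gauss u u - (1 / 2) * (2 * (inner_gauss u u - inner_gauss u (OU (s j) u)))) \<longlonglongrightarrow> inner_gauss u u - (1 / 2) * 0"
    by (intro tendsto_intros)
  then show ?thesis by (simp add: diff_divide_distrib)
qed

text \<open>Let the correlation tend to \<open>1\<close> in the expansion of the Ornstein-Uhlenbeck form.\<close>

theorem parseval:
  fixes u :: "real ^ 'n::finite \<Rightarrow> real"
  assumes u: "u \<in> L2_gauss"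
  shows "(\<lambda>m. hweight m u) sums inner_gauss u u"
proof -
  \<comment> \<open>correlations increasing to \<open>1\<close>\<close>
  define s where "s j = 1 - 1 / real (Suc j)" for j
  have s: "0 \<le> s j" "s j < 1" for j unfolding s_def by auto
  have sl: "s \<longlonglongrightarrow> 1"
    unfolding s_def using tendsto_diff[OF tendsto_const LIMSEQ_Suc[OF lim_1_over_n], of 1] by simp
  have part: "(\<Sum>m<N. hweight m u) \<le> inner_gauss u u" for N
  proof (rule LIMSEQ_le_const2)
    have "(\<lambda>j. \<Sum>m<N. s j ^ m * hweight m u) \<longlonglongrightarrow> (\<Sum>m<N. 1 ^ m * hweight m u)" by (intro tendsto_intros sl)
    then show "(\<lambda>j. \<Sum>m<N. s j ^ m * hweight m u) \<longlonglongrightarrow> (\<Sum>m<N. hweight m u)" by simp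
    show "\<exists>J. \<forall>j\<ge>J. (\<Sum>m<N. s j ^ m * hweight m u) \<le> inner_gauss u u"
    proof (intro exI[of _ 0] allI impI)
      fix j
      have "(\<Sum>m<N. s j ^ m * hweight m u) \<le> (\<Sum>m. s j ^ m * hweight m u)"
        using OU_form_sums[OF s[of j] u] s hweight_nonneg by (intro sum_le_suminf) (auto simp: sums_iff intro!: mult_nonneg_nonneg zero_le_power)
      also have "\<dots> = inner_gauss u (OU (s j) u)" using OU_form_sums[OF s[of j] u] by (simp add: sums_iff)
      also have "\<dots> \<le> inner_gauss u u" by (rule OU_form_le(2)[OF s u])
      finally show "(\<Sum>m<N. s j ^ m * hweight m u) \<le> inner_gauss u u" .
    qed
  qed
  have summ: "summable (\<lambda>m. hweight m u)"
    by (rule summableI_nonneg_bounded[where x = "inner_gauss u u"]) (use part hweight_nonneg in auto)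
  have "(\<Sum>m. hweight m u) \<le> inner_gauss u u" by (rule suminf_le_const[OF summ part])
  moreover have "inner_gauss u u \<le> (\<Sum>m. hweight m u)"
  proof (rule LIMSEQ_le_const2[OF OU_form_tendsto[OF u s sl]], intro exI[of _ 0] allI impI)
    fix j
    have "(\<Sum>m. s j ^ m * hweight m u) \<le> (\<Sum>m. hweight m u)"
      using OU_form_sums[OF s[of j] u] s hweight_nonneg
      by (intro suminf_le summ mult_left_le_one_le power_le_one) (auto simp: sums_iff less_imp_le)
    then show "inner_gauss u (OU (s j) u) \<le> (\<Sum>m. hweight m u)" using OU_form_sums[OF s[of j] u] by (simp add: sums_iff)
  qed
  ultimately show ?thesis using summ by (simp add: sums_iff)
qed

lemma power_series_continuous_01:
  fixes a :: "nat \<Rightarrow> real"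
  assumes a: "\<And>m. 0 \<le> a m" "summable a"
  shows "continuous_on {0..1} (\<lambda>s. \<Sum>m. s ^ m * a m)"
proof -
  have "uniform_limit {0..1} (\<lambda>N s. \<Sum>m<N. s ^ m * a m) (\<lambda>s. \<Sum>m. s ^ m * a m) sequentially"
  proof (rule Weierstrass_m_test[OF _ a(2)])
    fix m and s :: real assume "s \<in> {0..1}"
    then show "norm (s ^ m * a m) \<le> a m" using a(1)[of m] by (simp add: abs_mult power_abs mult_left_le_one_le power_le_one)
  qed
  then show ?thesis by (rule uniform_limit_theorem[rotated]) (auto intro!: always_eventually continuous_intros)
qed

section \<open>Product test functions\<close>

text \<open>\<open>F m\<close> is the \<open>m\<close>-th derivative of the smooth function \<open>F 0\<close>.  Carrying all derivatives along avoids
  iterated derivative operators.\<close>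

definition deriv_seq :: "(nat \<Rightarrow> real \<Rightarrow> real) \<Rightarrow> bool" where
  "deriv_seq F \<longleftrightarrow> (\<forall>m x. (F m has_real_derivative F (Suc m) x) (at x))"

lemma deriv_seqD: "deriv_seq F \<Longrightarrow> (F m has_real_derivative F (Suc m) x) (at x)"
  unfolding deriv_seq_def by blast

lemma deriv_seq_continuous: "deriv_seq F \<Longrightarrow> continuous_on A (F m)"
  by (meson DERIV_continuous continuous_at_imp_continuous_on deriv_seqD)

lemma deriv_seq_measurable: "deriv_seq F \<Longrightarrow> F m \<in> borel_measurable borel"
  by (intro borel_measurable_continuous_onI deriv_seq_continuous)

lemma leibniz_sum:
  fixes a b :: "nat \<Rightarrow> real"
  shows "(\<Sum>j\<le>m. real (m choose j) * (a (Suc j) * b (m - j) + a j * b (Suc (m - j))))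
     = (\<Sum>j\<le>Suc m. real (Suc m choose j) * (a j * b (Suc m - j)))"
proof -
  have "(\<Sum>j\<le>Suc m. real (Suc m choose j) * (a j * b (Suc m - j)))
      = a 0 * b (Suc m) + (\<Sum>j\<le>m. real (Suc m choose Suc j) * (a (Suc j) * b (m - j)))"
    by (subst sum.atMost_Suc_shift) simp
  also have "\<dots> = (\<Sum>j\<le>m. real (m choose j) * (a (Suc j) * b (m - j)))
      + (a 0 * b (Suc m) + (\<Sum>j\<le>m. real (m choose Suc j) * (a (Suc j) * b (m - j))))"
    by (simp add: sum.distrib[symmetric] algebra_simps)
  also have "a 0 * b (Suc m) + (\<Sum>j\<le>m. real (m choose Suc j) * (a (Suc j) * b (m - j)))
      = (\<Sum>j\<le>Suc m. real (m choose j) * (a j * b (Suc m - j)))"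
    by (subst sum.atMost_Suc_shift) simp
  also have "\<dots> = (\<Sum>j\<le>m. real (m choose j) * (a j * b (Suc (m - j))))"
    by (simp add: Suc_diff_le)
  finally show ?thesis by (simp add: sum.distrib[symmetric] algebra_simps)
qed

lemma deriv_seq_mult:
  assumes F: "deriv_seq F" and G: "deriv_seq G"
  shows "deriv_seq (\<lambda>m x. \<Sum>j\<le>m. real (m choose j) * (F j x * G (m - j) x))"
  unfolding deriv_seq_def
proof (intro allI)
  fix m x
  have "((\<lambda>x. \<Sum>j\<le>m. real (m choose j) * (F j x * G (m - j) x)) has_real_derivative
      (\<Sum>j\<le>m. real (m choose j) * (F (Suc j) x * G (m - j) x + F j x * G (Suc (m - j)) x))) (at x)"
    by (intro DERIV_sum DERIV_cmult) (auto intro!: derivative_eq_intros deriv_seqD[OF F] deriv_seqD[OF G])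
  then show "((\<lambda>x. \<Sum>j\<le>m. real (m choose j) * (F j x * G (m - j) x)) has_real_derivative
      (\<Sum>j\<le>Suc m. real (Suc m choose j) * (F j x * G (Suc m - j) x))) (at x)"
    unfolding leibniz_sum[of m "\<lambda>j. F j x" "\<lambda>j. G j x"] .
qed

lemma deriv_seq_affine:
  assumes F: "deriv_seq F" shows "deriv_seq (\<lambda>m x. c ^ m * F m (c * x + b))"
  unfolding deriv_seq_def
proof (intro allI)
  fix m x
  have "((\<lambda>x. F m (c * x + b)) has_real_derivative F (Suc m) (c * x + b) * c) (at x)"
    by (rule DERIV_chain2[OF deriv_seqD[OF F]]) (auto intro!: derivative_eq_intros)
  then have "((\<lambda>x. c ^ m * F m (c * x + b)) has_real_derivative c ^ m * (F (Suc m) (c * x + b) * c)) (at x)"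
    by (rule DERIV_cmult)
  then show "((\<lambda>x. c ^ m * F m (c * x + b)) has_real_derivative c ^ Suc m * F (Suc m) (c * x + b)) (at x)"
    by (simp add: mult_ac)
qed

text \<open>These functions vanish on the negative half-line together with all derivatives, and their
  derivatives have the same form; \<open>P = 1\<close> is the usual \<open>exp (- 1 / x)\<close>.\<close>

definition flat :: "real poly \<Rightarrow> real \<Rightarrow> real" where
  "flat P x = (if x \<le> 0 then 0 else poly P (1 / x) * exp (- 1 / x))"

lemma poly_exp_tendsto_0: "((\<lambda>y::real. poly P y * exp (- y)) \<longlongrightarrow> 0) at_top"
proof -
  have "((\<lambda>y::real. \<Sum>i\<le>degree P. coeff P i * (y ^ i / exp y)) \<longlongrightarrow> (\<Sum>i\<le>degree P. coeff P i * 0)) at_top"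
    by (intro tendsto_sum tendsto_mult tendsto_const tendsto_power_div_exp_0)
  then show ?thesis by (simp add: poly_altdef sum_distrib_right exp_minus divide_inverse mult.assoc)
qed

lemma flat_has_derivative:
  "(flat P has_real_derivative flat (monom 1 2 * (P - pderiv P)) x) (at x)"
proof -
  consider "x < 0" | "x = 0" | "0 < x" by linarith
  then show ?thesis
  proof cases
    case 1
    have "((\<lambda>_. 0) has_real_derivative 0) (at x)" by simp
    moreover have "\<forall>\<^sub>F y in nhds x. flat P y = 0"
      using 1 by (auto simp: flat_def eventually_nhds intro!: exI[of _ "{..<0}"])
    ultimately have "(flat P has_real_derivative 0) (at x)" by (subst DERIV_cong_ev[OF refl _ refl]) auto
    then show ?thesis using 1 by (simp add: flat_def)
  next
    case 2
    have "((\<lambda>h. flat P h / h) \<longlongrightarrow> 0) (at 0)"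
    proof (rule filterlim_split_at)
      show "((\<lambda>h. flat P h / h) \<longlongrightarrow> 0) (at_left 0)"
        by (rule tendsto_eventually) (auto simp: flat_def eventually_at_left_field intro!: exI[of _ "-1"])
      have "((\<lambda>h::real. poly (pCons 0 P) (1 / h) * exp (- (1 / h))) \<longlongrightarrow> 0) (at_right 0)"
        by (rule filterlim_compose[OF poly_exp_tendsto_0]) (simp add: filterlim_inverse_at_top_right divide_inverse)
      moreover have "\<forall>\<^sub>F h in at_right 0. poly (pCons 0 P) (1 / h) * exp (- (1 / h)) = flat P h / h"
        by (auto simp: flat_def eventually_at_right_field intro!: exI[of _ 1])
      ultimately show "((\<lambda>h. flat P h / h) \<longlongrightarrow> 0) (at_right 0)" by (rule Lim_transform_eventually)
    qed
    then show ?thesis unfolding 2 by (simp add: DERIV_def flat_def)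
  next
    case 3
    have "((\<lambda>x. poly P (1 / x) * exp (- 1 / x)) has_real_derivative
        poly (pderiv P) (1 / x) * (- 1 / x\<^sup>2) * exp (- 1 / x) + poly P (1 / x) * (exp (- 1 / x) * (1 / x\<^sup>2))) (at x)"
      using 3 by (auto intro!: derivative_eq_intros DERIV_chain2[OF poly_DERIV] simp: power2_eq_square)
    moreover have "poly (pderiv P) (1 / x) * (- 1 / x\<^sup>2) * exp (- 1 / x) + poly P (1 / x) * (exp (- 1 / x) * (1 / x\<^sup>2))
        = flat (monom 1 2 * (P - pderiv P)) x"
      using 3 by (simp add: flat_def poly_monom field_simps power2_eq_square)
    moreover have "\<forall>\<^sub>F y in nhds x. poly P (1 / y) * exp (- 1 / y) = flat P y"
      using 3 by (auto simp: flat_def eventually_nhds intro!: exI[of _ "{0<..}"])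
    ultimately show ?thesis by (subst DERIV_cong_ev[OF refl _ refl, symmetric]) auto
  qed
qed

definition flat_seq :: "nat \<Rightarrow> real \<Rightarrow> real" where
  "flat_seq m = flat (((\<lambda>P. monom 1 2 * (P - pderiv P)) ^^ m) 1)"

lemma deriv_seq_flat: "deriv_seq flat_seq"
  unfolding deriv_seq_def flat_seq_def using flat_has_derivative by simp

lemma flat_seq_0: "flat_seq 0 x = (if x \<le> 0 then 0 else exp (- 1 / x))"
  by (simp add: flat_seq_def flat_def)

lemma flat_seq_neg: "x \<le> 0 \<Longrightarrow> flat_seq m x = 0"
  by (simp add: flat_seq_def flat_def)

text \<open>The \<open>m\<close>-th derivative of a smooth function that is supported on the interval from \<open>a\<close> to \<open>b\<close> and tends
  to its indicator as \<open>N\<close> grows; the formula is the Leibniz rule for the derivatives of a product of two flat functions.\<close>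

definition plateau :: "real \<Rightarrow> real \<Rightarrow> real \<Rightarrow> nat \<Rightarrow> real \<Rightarrow> real" where
  "plateau N a b m x = (\<Sum>j\<le>m. real (m choose j) * (N ^ j * flat_seq j (N * x + (- N * a)) * ((- N) ^ (m - j) * flat_seq (m - j) (- N * x + N * b))))"

lemma deriv_seq_plateau: "deriv_seq (plateau N a b)"
  unfolding plateau_def[abs_def] by (intro deriv_seq_mult deriv_seq_affine deriv_seq_flat)

lemma plateau_outside:
  assumes "0 < N" "x \<le> a \<or> b \<le> x" shows "plateau N a b m x = 0"
proof -
  have "flat_seq j (N * x + (- N * a)) = 0 \<or> flat_seq i (- N * x + N * b) = 0" for i j
    using assms(2)
  proof
    assume "x \<le> a"
    then have "N * x + (- N * a) \<le> 0" using assms(1) by simp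
    then show ?thesis by (simp only: flat_seq_neg) simp
  next
    assume "b \<le> x"
    then have "- N * x + N * b \<le> 0" using assms(1) by simp
    then show ?thesis by (simp only: flat_seq_neg) simp
  qed
  then show ?thesis unfolding plateau_def by (intro sum.neutral ballI) auto
qed

lemma plateau_0: "plateau N a b 0 x = flat_seq 0 (N * (x - a)) * flat_seq 0 (N * (b - x))"
  unfolding plateau_def by (simp add: algebra_simps)

lemma flat_seq_0_bounds: "0 \<le> flat_seq 0 x" "flat_seq 0 x \<le> 1"
  by (auto simp: flat_seq_0)

lemma plateau_tendsto:
  "(\<lambda>N. plateau (real (Suc N)) a b 0 x) \<longlonglongrightarrow> (if a < x \<and> x < b then 1 else 0)"
proof (cases "a < x \<and> x < b")
  case True
  have one: "(\<lambda>N. flat_seq 0 (real (Suc N) * t)) \<longlonglongrightarrow> 1" if "0 < t" for t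
  proof -
    have "(\<lambda>N. exp (- (1 / real (Suc N)) * (1 / t))) \<longlonglongrightarrow> exp (- 0 * (1 / t))"
      by (intro tendsto_intros LIMSEQ_Suc[OF lim_1_over_n])
    moreover have "flat_seq 0 (real (Suc N) * t) = exp (- (1 / real (Suc N)) * (1 / t))" for N
      using that by (simp add: flat_seq_0 mult_le_0_iff)
    ultimately show ?thesis by simp
  qed
  have "(\<lambda>N. flat_seq 0 (real (Suc N) * (x - a)) * flat_seq 0 (real (Suc N) * (b - x))) \<longlonglongrightarrow> 1 * 1"
    using True by (intro tendsto_mult one) auto
  then show ?thesis using True unfolding plateau_0 by simp
next
  case False
  then have "plateau (real (Suc N)) a b 0 x = 0" for N by (intro plateau_outside) auto
  then show ?thesis unfolding if_not_P[OF False] by (intro tendsto_eventually) simp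
qed

lemma plateau_0_bounds: "0 \<le> plateau N a b 0 x" "plateau N a b 0 x \<le> 1"
  unfolding plateau_0 using flat_seq_0_bounds by (auto intro!: mult_le_one)

definition prodf :: "('n::finite \<Rightarrow> real \<Rightarrow> real) \<Rightarrow> real ^ 'n \<Rightarrow> real" where
  "prodf g x = (\<Prod>i\<in>UNIV. g i (x $ i))"

lemma partial_deriv_prodf:
  assumes F: "\<And>i. deriv_seq (F i)"
  shows "partial_deriv j (prodf (\<lambda>i. F i (k i))) = prodf (\<lambda>i. F i ((k(j := Suc (k j))) i))"
proof
  fix x :: "real ^ 'a"
  have "prodf (\<lambda>i. F i (k i)) (x + t *\<^sub>R axis j 1) = F j (k j) (x $ j + t) * (\<Prod>i\<in>UNIV - {j}. F i (k i) (x $ i))" for t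
    unfolding prodf_def by (subst prod.remove[of _ j]) (auto simp: axis_def intro!: prod.cong)
  then have "partial_deriv j (prodf (\<lambda>i. F i (k i))) x = deriv (\<lambda>t. F j (k j) (x $ j + t) * (\<Prod>i\<in>UNIV - {j}. F i (k i) (x $ i))) 0"
    unfolding partial_deriv_def by simp
  also have "\<dots> = F j (Suc (k j)) (x $ j) * (\<Prod>i\<in>UNIV - {j}. F i (k i) (x $ i))"
  proof (rule DERIV_imp_deriv)
    have "((\<lambda>t. F j (k j) (x $ j + t)) has_real_derivative F j (Suc (k j)) (x $ j + 0) * 1) (at 0)"
      by (rule DERIV_chain2[OF deriv_seqD[OF F]]) (auto intro!: derivative_eq_intros)
    then show "((\<lambda>t. F j (k j) (x $ j + t) * (\<Prod>i\<in>UNIV - {j}. F i (k i) (x $ i))) has_real_derivative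
        F j (Suc (k j)) (x $ j) * (\<Prod>i\<in>UNIV - {j}. F i (k i) (x $ i))) (at 0)"
      by (intro DERIV_cmult_right) simp
  qed
  also have "\<dots> = prodf (\<lambda>i. F i ((k(j := Suc (k j))) i)) x"
    unfolding prodf_def by (subst (2) prod.remove[of _ j]) (auto intro!: prod.cong)
  finally show "partial_deriv j (prodf (\<lambda>i. F i (k i))) x = prodf (\<lambda>i. F i ((k(j := Suc (k j))) i)) x" .
qed

lemma foldr_partial_deriv_prodf:
  assumes F: "\<And>i. deriv_seq (F i)"
  shows "foldr partial_deriv is (prodf (\<lambda>i. F i 0)) = prodf (\<lambda>i. F i (count_list is i))"
proof (induction "is")
  case (Cons j js)
  have "foldr partial_deriv (j # js) (prodf (\<lambda>i. F i 0)) = partial_deriv j (prodf (\<lambda>i. F i (count_list js i)))"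
    by (simp add: Cons.IH)
  also have "\<dots> = prodf (\<lambda>i. F i (((count_list js)(j := Suc (count_list js j))) i))"
    by (rule partial_deriv_prodf[OF F])
  also have "(count_list js)(j := Suc (count_list js j)) = count_list (j # js)" by auto
  finally show ?case .
qed simp

text \<open>The order in which \<open>mi_deriv\<close> takes the single derivatives.\<close>

definition mi_list :: "('n::finite \<Rightarrow> nat) \<Rightarrow> 'n list" where
  "mi_list \<kappa> = concat (map (\<lambda>i. replicate (\<kappa> i) i) coords)"

lemma coords: "distinct (coords :: 'n::finite list)" "set (coords :: 'n list) = UNIV"
proof -
  have "\<exists>is :: 'n list. distinct is \<and> set is = UNIV" using finite_distinct_list[of "UNIV :: 'n set"] by auto
  from someI_ex[OF this] show "distinct (coords :: 'n list)" "set (coords :: 'n list) = UNIV" unfolding coords_def by auto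
qed

lemma mi_deriv_eq_foldr: "mi_deriv \<kappa> \<phi> = foldr partial_deriv (mi_list \<kappa>) \<phi>"
proof -
  have r: "foldr partial_deriv (replicate m i) \<psi> = (partial_deriv i ^^ m) \<psi>" for m i and \<psi> :: "real ^ 'a \<Rightarrow> real"
    by (induction m) auto
  have "foldr (\<lambda>i. partial_deriv i ^^ \<kappa> i) is \<phi> = foldr partial_deriv (concat (map (\<lambda>i. replicate (\<kappa> i) i) is)) \<phi>" for "is"
    by (induction "is") (auto simp: r)
  then show ?thesis unfolding mi_deriv_def mi_list_def .
qed

lemma count_mi_list: "count_list (mi_list \<kappa>) i = \<kappa> i"
proof -
  have r: "count_list (replicate m j) i = (if j = i then m else 0)" for m j by (induction m) auto
  have "count_list (concat (map (\<lambda>i. replicate (\<kappa> i) i) is)) i = (if i \<in> set is then \<kappa> i else 0)" if "distinct is" for "is"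
    using that by (induction "is") (auto simp: r)
  from this[OF coords(1)] show ?thesis by (simp add: mi_list_def coords(2))
qed

lemma length_mi_list: "length (mi_list \<kappa>) = mi_size \<kappa>"
proof -
  have "length (mi_list \<kappa>) = sum_list (map \<kappa> coords)" unfolding mi_list_def by (simp add: length_concat comp_def)
  also have "\<dots> = mi_size \<kappa>" unfolding mi_size_def by (simp add: sum_list_distinct_conv_sum_set coords)
  finally show ?thesis .
qed

lemma mi_deriv_prodf:
  assumes F: "\<And>i. deriv_seq (F i)"
  shows "mi_deriv \<kappa> (prodf (\<lambda>i. F i 0)) = prodf (\<lambda>i. F i (\<kappa> i))"
  unfolding mi_deriv_eq_foldr foldr_partial_deriv_prodf[OF F] count_mi_list ..

lemma prodf_differentiable:
  assumes F: "\<And>i. deriv_seq (F i)"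
  shows "prodf (\<lambda>i. F i (k i)) differentiable_on UNIV"
proof -
  have "(\<lambda>x :: real ^ 'a. F i (k i) (x $ i)) differentiable (at x)" for i x
  proof -
    have "(F i (k i) has_derivative (*) (F i (Suc (k i)) (x $ i))) (at (x $ i))"
      using deriv_seqD[OF F] by (simp add: has_field_derivative_def)
    moreover have "((\<lambda>x :: real ^ 'a. x $ i) has_derivative (\<lambda>x. x $ i)) (at x)"
      by (intro bounded_linear_imp_has_derivative bounded_linear_vec_nth)
    ultimately show ?thesis using diff_chain_at[of "\<lambda>x :: real ^ 'a. x $ i" "\<lambda>x. x $ i" x "F i (k i)"]
      unfolding differentiable_def comp_def by blast
  qed
  then obtain d where d: "((\<lambda>x :: real ^ 'a. F i (k i) (x $ i)) has_derivative d i x) (at x)" for i x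
    unfolding differentiable_def by metis
  have "prodf (\<lambda>i. F i (k i)) differentiable (at x)" for x :: "real ^ 'a"
    unfolding differentiable_def prodf_def by (rule exI, rule has_derivative_prod, rule d)
  then show ?thesis by (simp add: differentiable_on_def)
qed

lemma test_function_prodf:
  assumes F: "\<And>i. deriv_seq (F i)" and supp: "\<And>i t. R < \<bar>t\<bar> \<Longrightarrow> F i 0 t = 0"
  shows "test_function (prodf (\<lambda>i::'n::finite. F i 0))"
  unfolding test_function_def
proof (intro conjI allI)
  fix "is" :: "'n list"
  show "foldr partial_deriv is (prodf (\<lambda>i. F i 0)) differentiable_on UNIV"
    unfolding foldr_partial_deriv_prodf[OF F] by (rule prodf_differentiable[OF F])
  have "{x :: real ^ 'n. prodf (\<lambda>i. F i 0) x \<noteq> 0} \<subseteq> cbox (\<chi> i. - R) (\<chi> i. R)"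
  proof
    fix x :: "real ^ 'n" assume "x \<in> {x. prodf (\<lambda>i. F i 0) x \<noteq> 0}"
    then have "F i 0 (x $ i) \<noteq> 0" for i unfolding prodf_def by auto
    then have "\<bar>x $ i\<bar> \<le> R" for i using supp not_le by blast
    then show "x \<in> cbox (\<chi> i. - R) (\<chi> i. R)" unfolding mem_box_cart by (auto simp: abs_le_iff minus_le_iff)
  qed
  then have "closure {x :: real ^ 'n. prodf (\<lambda>i. F i 0) x \<noteq> 0} \<subseteq> cbox (\<chi> i. - R) (\<chi> i. R)"
    by (rule closure_minimal[OF _ closed_cbox])
  then show "compact (closure {x :: real ^ 'n. prodf (\<lambda>i. F i 0) x \<noteq> 0})"
    by (meson bounded_cbox bounded_subset closed_closure compact_eq_bounded_closed)
qed

section \<open>Weak derivatives\<close>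

lemma locally_integrable_measurable:
  assumes "locally_integrable f" shows "f \<in> borel_measurable borel"
proof -
  have I: "set_integrable lborel (cball 0 (real n)) f" for n
    using assms unfolding locally_integrable_def by simp
  have "(\<lambda>x. indicator (cball 0 (real n)) x *\<^sub>R f x) \<in> borel_measurable borel" for n
    using borel_measurable_integrable[OF I[of n, unfolded set_integrable_def]] by simp
  moreover have "(\<lambda>n. indicator (cball 0 (real n)) x *\<^sub>R f x) \<longlonglongrightarrow> f x" for x
  proof (rule tendsto_eventually)
    obtain N where "norm x \<le> real N" using real_arch_simple by blast
    then show "\<forall>\<^sub>F n in sequentially. indicator (cball 0 (real n)) x *\<^sub>R f x = f x"
      unfolding eventually_sequentially by (intro exI[of _ N]) auto
  qed
  ultimately show ?thesis by (rule borel_measurable_LIMSEQ_real[rotated])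
qed

lemma prodf_measurable:
  assumes F: "\<And>i. deriv_seq (F i)" shows "prodf (\<lambda>i. F i (k i)) \<in> borel_measurable borel"
proof -
  have [measurable]: "F i (k i) \<in> borel_measurable borel" for i by (rule deriv_seq_measurable[OF F])
  show ?thesis unfolding prodf_def by measurable
qed

lemma test_functionD:
  assumes "test_function \<phi>"
  shows "foldr partial_deriv is \<phi> differentiable_on UNIV" "compact (closure {x. \<phi> x \<noteq> 0})"
  using assms unfolding test_function_def by auto

lemma test_function_continuous: "test_function \<phi> \<Longrightarrow> continuous_on UNIV \<phi>"
  using test_functionD(1)[of \<phi> "[]"] by (simp add: differentiable_imp_continuous_on)

lemma test_function_bounded_support:
  assumes "test_function \<phi>" shows "\<exists>R>0. \<forall>x. R < norm x \<longrightarrow> \<phi> x = 0"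
proof -
  have "bounded {x. \<phi> x \<noteq> 0}" using test_functionD(2)[OF assms] compact_imp_bounded bounded_subset closure_subset by metis
  then obtain R where "0 < R" "\<And>x. \<phi> x \<noteq> 0 \<Longrightarrow> norm x \<le> R" unfolding bounded_pos by auto
  then show ?thesis by (intro exI[of _ R]) force
qed

lemma continuous_compact_support_bounded:
  fixes d :: "real ^ 'n::finite \<Rightarrow> real"
  assumes d: "continuous_on UNIV d" "\<And>x. R < norm x \<Longrightarrow> d x = 0"
  shows "\<exists>B\<ge>0. \<forall>x. \<bar>d x\<bar> \<le> B"
proof -
  have "bounded (d ` cball 0 R)" by (intro compact_imp_bounded compact_continuous_image) (auto intro: continuous_on_subset[OF d(1)])
  then obtain B where "\<forall>x\<in>cball 0 R. \<bar>d x\<bar> \<le> B" unfolding bounded_iff by auto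
  then have "\<bar>d x\<bar> \<le> \<bar>B\<bar>" for x using d(2)[of x] by (cases "norm x \<le> R") force+
  then show ?thesis by (intro exI[of _ "\<bar>B\<bar>"]) auto
qed

lemma locally_integrable_compact_support:
  fixes u d :: "real ^ 'n::finite \<Rightarrow> real"
  assumes u: "locally_integrable u" and d: "continuous_on UNIV d" "\<And>x. R < norm x \<Longrightarrow> d x = 0"
  shows "integrable lborel (\<lambda>x. u x * d x)"
proof -
  obtain B where B: "0 \<le> B" "\<And>x. \<bar>d x\<bar> \<le> B" using continuous_compact_support_bounded[OF d] by blast
  have I: "integrable lborel (\<lambda>x. indicator (cball 0 R) x *\<^sub>R u x)" using u unfolding locally_integrable_def set_integrable_def by simp
  have [measurable]: "u \<in> borel_measurable borel" "d \<in> borel_measurable borel"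
    using locally_integrable_measurable[OF u] borel_measurable_continuous_onI[OF d(1)] by auto
  show ?thesis
  proof (rule Bochner_Integration.integrable_bound[of _ "\<lambda>x. B * (indicator (cball 0 R) x *\<^sub>R u x)"])
    show "AE x in lborel. norm (u x * d x) \<le> norm (B * (indicator (cball 0 R) x *\<^sub>R u x))"
    proof (rule AE_I2)
      fix x
      show "norm (u x * d x) \<le> norm (B * (indicator (cball 0 R) x *\<^sub>R u x))"
      proof (cases "norm x \<le> R")
        case True
        have "\<bar>u x\<bar> * \<bar>d x\<bar> \<le> \<bar>u x\<bar> * B" using B by (intro mult_left_mono) auto
        then show ?thesis using True B by (simp add: abs_mult mult.commute)
      next
        case False then show ?thesis using d(2) by simp
      qed
    qed
  qed (use I in auto)
qed

lemma locally_integrable_test_function: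
  assumes "locally_integrable u" "test_function \<phi>" shows "integrable lborel (\<lambda>x. u x * \<phi> x)"
proof -
  obtain R where "\<And>x. R < norm x \<Longrightarrow> \<phi> x = 0" using test_function_bounded_support[OF assms(2)] by blast
  then show ?thesis by (rule locally_integrable_compact_support[OF assms(1) test_function_continuous[OF assms(2)]])
qed

text \<open>The fundamental lemma of the calculus of variations.  Product test functions approximate the
  indicators of boxes, so \<open>u\<close> integrates to zero over every box; boxes generate the Borel sets, hence
  the positive and the negative part of \<open>u\<close> are densities of the same measure.\<close>

lemma weakly_zero_imp_AE_zero:
  fixes u :: "real ^ 'n::finite \<Rightarrow> real"
  assumes u: "locally_integrable u"
    and zero: "\<And>F :: 'n \<Rightarrow> nat \<Rightarrow> real \<Rightarrow> real. (\<And>i. deriv_seq (F i)) \<Longrightarrow> (\<exists>R. \<forall>i m t. R < \<bar>t\<bar> \<longrightarrow> F i m t = 0) \<Longrightarrow> (LINT x|lborel. u x * prodf (\<lambda>i. F i 0) x) = 0"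
  shows "AE x in lborel. u x = 0"
proof -
  have um[measurable]: "u \<in> borel_measurable borel" by (rule locally_integrable_measurable[OF u])
  have boxI: "integrable lborel (\<lambda>x. indicator (box a b) x * u x)" for a b :: "real ^ 'n"
  proof (rule Bochner_Integration.integrable_bound[of _ "\<lambda>x. indicator (cbox a b) x *\<^sub>R u x"])
    show "integrable lborel (\<lambda>x. indicator (cbox a b) x *\<^sub>R u x)" using u unfolding locally_integrable_def set_integrable_def by simp
    show "AE x in lborel. norm (indicator (box a b) x * u x) \<le> norm (indicator (cbox a b) x *\<^sub>R u x)"
      using box_subset_cbox[of a b] by (intro AE_I2) (auto simp: indicator_def)
  qed measurable
  have box0: "(LINT x|lborel. indicator (box a b) x * u x) = 0" for a b :: "real ^ 'n"
  proof -
    define F where "F N i = plateau (real (Suc N)) (a $ i) (b $ i)" for N i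
    have ds: "deriv_seq (F N i)" for N i unfolding F_def by (rule deriv_seq_plateau)
    have "\<exists>R. \<forall>i m t. R < \<bar>t\<bar> \<longrightarrow> F N i m t = 0" for N
    proof -
      have bd: "\<bar>a $ i\<bar> \<le> norm a" "\<bar>b $ i\<bar> \<le> norm b" for i using component_le_norm_cart by auto
      have "F N i m t = 0" if "norm a + norm b < \<bar>t\<bar>" for i m t
        unfolding F_def
        using that bd[of i] norm_ge_zero[of a] norm_ge_zero[of b] by (intro plateau_outside) (simp, linarith)
      then show ?thesis by blast
    qed
    then have z: "(LINT x|lborel. u x * prodf (\<lambda>i. F N i 0) x) = 0" for N by (rule zero[OF ds])
    have "(\<lambda>N. LINT x|lborel. u x * prodf (\<lambda>i. F N i 0) x) \<longlonglongrightarrow> (LINT x|lborel. indicator (box a b) x * u x)"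
    proof (rule integral_dominated_convergence[where w = "\<lambda>x. norm (indicator (box a b) x * u x)"])
      show "(\<lambda>x. u x * prodf (\<lambda>i. F N i 0) x) \<in> borel_measurable lborel" for N using prodf_measurable[of "F N" "\<lambda>_. 0", OF ds] by simp
      show "integrable lborel (\<lambda>x. norm (indicator (box a b) x * u x))" using boxI by (intro integrable_norm)
      show "AE x in lborel. (\<lambda>N. u x * prodf (\<lambda>i. F N i 0) x) \<longlonglongrightarrow> indicator (box a b) x * u x"
      proof (rule AE_I2)
        fix x
        have "(\<lambda>N. prodf (\<lambda>i. F N i 0) x) \<longlonglongrightarrow> (\<Prod>i\<in>UNIV. if a $ i < x $ i \<and> x $ i < b $ i then 1 else 0)"
          unfolding prodf_def F_def by (intro tendsto_prod plateau_tendsto)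
        also have "(\<Prod>i\<in>UNIV. if a $ i < x $ i \<and> x $ i < b $ i then 1 else 0) = (indicator (box a b) x :: real)"
        proof (cases "x \<in> box a b")
          case True then show ?thesis by (simp add: mem_box_cart)
        next
          case False
          then obtain i where "\<not> (a $ i < x $ i \<and> x $ i < b $ i)" by (auto simp: mem_box_cart)
          then show ?thesis using False by (auto intro!: prod_zero bexI[of _ i])
        qed
        finally show "(\<lambda>N. u x * prodf (\<lambda>i. F N i 0) x) \<longlonglongrightarrow> indicator (box a b) x * u x"
          by (subst mult.commute[of "indicator _ _"]) (intro tendsto_intros)
      qed
      show "AE x in lborel. norm (u x * prodf (\<lambda>i. F N i 0) x) \<le> norm (indicator (box a b) x * u x)" for N
      proof (rule AE_I2)
        fix x
        show "norm (u x * prodf (\<lambda>i. F N i 0) x) \<le> norm (indicator (box a b) x * u x)"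
        proof (cases "x \<in> box a b")
          case True
          have "\<bar>prodf (\<lambda>i. F N i 0) x\<bar> \<le> 1"
            unfolding prodf_def F_def abs_prod using plateau_0_bounds by (intro prod_le_1) auto
          then show ?thesis using True by (simp add: abs_mult mult_left_le)
        next
          case False
          then obtain i where "\<not> (a $ i < x $ i \<and> x $ i < b $ i)" by (auto simp: mem_box_cart)
          then have "F N i 0 (x $ i) = 0" unfolding F_def by (intro plateau_outside) auto
          then have "prodf (\<lambda>i. F N i 0) x = 0" unfolding prodf_def by (auto intro!: prod_zero)
          then show ?thesis by simp
        qed
      qed
    qed simp
    then show ?thesis unfolding z by (simp add: LIMSEQ_const_iff)
  qed
  \<comment> \<open>\<open>ennreal\<close> truncates at zero: these are the positive and the negative part of \<open>u\<close>\<close>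
  define M1 M2 where "M1 = density lborel (\<lambda>x. ennreal (u x))" and "M2 = density lborel (\<lambda>x. ennreal (- u x))"
  have em: "emeasure M1 (box a b) = emeasure M2 (box a b)" "emeasure M1 (box a b) \<noteq> \<infinity>" for a b :: "real ^ 'n"
  proof -
    have e1: "emeasure M1 (box a b) = (\<integral>\<^sup>+x. ennreal (indicator (box a b) x * u x) \<partial>lborel)"
      unfolding M1_def by (subst emeasure_density) (auto intro!: nn_integral_cong simp: indicator_def)
    have e2: "emeasure M2 (box a b) = (\<integral>\<^sup>+x. ennreal (- (indicator (box a b) x * u x)) \<partial>lborel)"
      unfolding M2_def by (subst emeasure_density) (auto intro!: nn_integral_cong simp: indicator_def)
    have f: "(\<integral>\<^sup>+x. ennreal (indicator (box a b) x * u x) \<partial>lborel) \<noteq> \<infinity>" "(\<integral>\<^sup>+x. ennreal (- (indicator (box a b) x * u x)) \<partial>lborel) \<noteq> \<infinity>"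
      using boxI[of a b] unfolding real_integrable_def by auto
    show "emeasure M1 (box a b) \<noteq> \<infinity>" using e1 f by simp
    have "enn2real (\<integral>\<^sup>+x. ennreal (indicator (box a b) x * u x) \<partial>lborel) = enn2real (\<integral>\<^sup>+x. ennreal (- (indicator (box a b) x * u x)) \<partial>lborel)"
      using box0[of a b] unfolding real_lebesgue_integral_def[OF boxI] by simp
    then show "emeasure M1 (box a b) = emeasure M2 (box a b)"
      unfolding e1 e2 using f by (metis (no_types, lifting) ennreal_enn2real_if infinity_ennreal_def)
  qed
  have "M1 = M2"
  proof (rule measure_eqI_generator_eq)
    let ?E = "range (\<lambda>(a, b). box a b :: (real ^ 'n) set)"
    show "Int_stable ?E" by (auto simp: Int_stable_def box_Int_box)
    show "?E \<subseteq> Pow UNIV" "sets M1 = sigma_sets UNIV ?E" "sets M2 = sigma_sets UNIV ?E"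
      unfolding M1_def M2_def by (simp_all add: borel_eq_box)
    let ?A = "\<lambda>n. box (- (real n *\<^sub>R One)) (real n *\<^sub>R One) :: (real ^ 'n) set"
    show "range ?A \<subseteq> ?E" "(\<Union>i. ?A i) = UNIV" unfolding UN_box_eq_UNIV by auto
    show "emeasure M1 (?A i) \<noteq> \<infinity>" for i by (rule em(2))
    fix X assume "X \<in> ?E"
    then show "emeasure M1 X = emeasure M2 X" using em(1) by force
  qed
  then have "AE x in lborel. ennreal (u x) = ennreal (- u x)"
    unfolding M1_def M2_def by (intro sigma_finite_measure.density_unique[OF sigma_finite_lborel]) auto
  then show ?thesis
  proof eventually_elim
    case (elim x)
    then show ?case by (cases "0 \<le> u x") (auto simp: ennreal_neg ennreal_eq_0_iff dest: sym)
  qed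
qed

lemma locally_integrable_diff:
  assumes "locally_integrable f" "locally_integrable g" shows "locally_integrable (\<lambda>x. f x - g x)"
  using assms unfolding locally_integrable_def by (auto intro!: set_integral_diff(1))

lemma weak_deriv_unique:
  assumes "has_weak_deriv f \<kappa> g" "has_weak_deriv f \<kappa> g'"
  shows "AE x in lborel. g x = g' x"
proof -
  have li: "locally_integrable g" "locally_integrable g'" using assms unfolding has_weak_deriv_def by auto
  have "AE x in lborel. g x - g' x = 0"
  proof (rule weakly_zero_imp_AE_zero[OF locally_integrable_diff[OF li]])
    fix F :: "'a \<Rightarrow> nat \<Rightarrow> real \<Rightarrow> real"
    assume F: "\<And>i. deriv_seq (F i)" and "\<exists>R. \<forall>i m t. R < \<bar>t\<bar> \<longrightarrow> F i m t = 0"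
    then obtain R where R: "\<And>i m t. R < \<bar>t\<bar> \<Longrightarrow> F i m t = 0" by blast
    let ?\<phi> = "prodf (\<lambda>i. F i 0)"
    have T: "test_function ?\<phi>" using test_function_prodf[OF F R] .
    have "(- 1) ^ mi_size \<kappa> * (LINT x|lborel. g x * ?\<phi> x) = (- 1) ^ mi_size \<kappa> * (LINT x|lborel. g' x * ?\<phi> x)"
      using assms[unfolded has_weak_deriv_def, THEN conjunct2, THEN conjunct2, rule_format, OF T] by simp
    then have "(LINT x|lborel. g x * ?\<phi> x) = (LINT x|lborel. g' x * ?\<phi> x)" by simp
    moreover have "integrable lborel (\<lambda>x. g x * ?\<phi> x)" "integrable lborel (\<lambda>x. g' x * ?\<phi> x)"
      by (rule locally_integrable_test_function[OF li(1) T], rule locally_integrable_test_function[OF li(2) T])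
    ultimately show "(LINT x|lborel. (g x - g' x) * ?\<phi> x) = 0" by (simp add: left_diff_distrib)
  qed
  then show ?thesis by eventually_elim simp
qed

section \<open>Integration by parts against Gaussian kernels\<close>

text \<open>The rate \<open>3 / 8\<close> lies below \<open>1 / 2\<close>, which leaves room for shifts and polynomial factors in a
  Gaussian kernel of variance at most one, and above \<open>1 / 4\<close>, which makes such a function integrable
  against every function in \<open>L\<^sup>2\<close> of the Gaussian measure.\<close>

definition rapid :: "(real \<Rightarrow> real) \<Rightarrow> bool" where
  "rapid h \<longleftrightarrow> (\<exists>C. \<forall>y. \<bar>h y\<bar> \<le> C * exp (- (3 / 8) * y\<^sup>2))"

lemma poly_exp_square_bound:
  fixes P :: "real poly"
  shows "\<exists>C. \<forall>z. \<bar>poly P z\<bar> \<le> C * exp (z\<^sup>2 / 32)"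
proof -
  let ?B = "\<Sum>i\<le>degree P. \<bar>coeff P i\<bar> * fact i"
  have B0: "0 \<le> ?B" by (intro sum_nonneg) auto
  have "\<bar>poly P z\<bar> \<le> ?B * exp 8 * exp (z\<^sup>2 / 32)" for z
  proof -
    have "\<bar>poly P z\<bar> \<le> (\<Sum>i\<le>degree P. \<bar>coeff P i\<bar> * \<bar>z\<bar> ^ i)"
      unfolding poly_altdef by (rule order_trans[OF sum_abs]) (simp add: abs_mult power_abs)
    also have "\<dots> \<le> (\<Sum>i\<le>degree P. \<bar>coeff P i\<bar> * (fact i * exp \<bar>z\<bar>))"
      by (intro sum_mono mult_left_mono power_le_fact_exp) auto
    also have "\<dots> = ?B * exp \<bar>z\<bar>" by (simp add: sum_distrib_right mult.assoc)
    also have "\<dots> \<le> ?B * exp (8 + z\<^sup>2 / 32)"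
    proof (intro mult_left_mono B0)
      have "0 \<le> (\<bar>z\<bar> - 16)\<^sup>2" by simp
      then have "\<bar>z\<bar> \<le> 8 + z\<^sup>2 / 32" by (simp add: power2_diff)
      then show "exp \<bar>z\<bar> \<le> exp (8 + z\<^sup>2 / 32)" by simp
    qed
    finally show ?thesis by (simp add: exp_add mult.assoc)
  qed
  then show ?thesis by blast
qed

lemma rapid_poly_gauss:
  assumes tau: "0 < \<tau>" "\<tau> \<le> 1"
  shows "rapid (\<lambda>y. c * (poly P ((y - a) / \<tau>) * std_normal_density ((y - a) / \<tau>)))"
proof -
  obtain C where C: "\<And>z. \<bar>poly P z\<bar> \<le> C * exp (z\<^sup>2 / 32)" using poly_exp_square_bound by blast
  have "\<bar>c * (poly P ((y - a) / \<tau>) * std_normal_density ((y - a) / \<tau>))\<bar>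
     \<le> (\<bar>c\<bar> * C * exp (60 / 32 * a\<^sup>2)) * exp (- (3 / 8) * y\<^sup>2)" for y
  proof -
    let ?z = "(y - a) / \<tau>"
    have C0: "0 \<le> C" using C[of 0] by (simp add: order_trans[OF abs_ge_zero])
    have d1: "std_normal_density ?z \<le> exp (- ?z\<^sup>2 / 2)"
    proof -
      have "1 \<le> sqrt (2 * pi)" using pi_ge_two by simp
      then have "1 / sqrt (2 * pi) \<le> 1" by simp
      then show ?thesis unfolding std_normal_density_def by (intro mult_left_le_one_le) auto
    qed
    have "(y - a)\<^sup>2 \<le> ?z\<^sup>2"
    proof -
      have "(\<tau> * ?z)\<^sup>2 \<le> 1 * ?z\<^sup>2" unfolding power_mult_distrib using tau by (intro mult_right_mono) (auto intro: power_le_one)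
      then show ?thesis using tau by simp
    qed
    then have h1: "y\<^sup>2 - 2 * (y * a) + a\<^sup>2 \<le> ?z\<^sup>2" by (simp add: power2_diff)
    have "0 \<le> (y - 5 * a)\<^sup>2" by simp
    then have h2: "0 \<le> y\<^sup>2 - 10 * (y * a) + 25 * a\<^sup>2" by (simp add: power2_diff power_mult_distrib)
    have "?z\<^sup>2 / 32 - ?z\<^sup>2 / 2 \<le> 60 / 32 * a\<^sup>2 - (3 / 8) * y\<^sup>2" using h1 h2 by linarith
    then have e: "exp (?z\<^sup>2 / 32) * exp (- ?z\<^sup>2 / 2) \<le> exp (60 / 32 * a\<^sup>2) * exp (- (3 / 8) * y\<^sup>2)"
      by (simp add: exp_add[symmetric])
    have "\<bar>poly P ?z * std_normal_density ?z\<bar> \<le> (C * exp (?z\<^sup>2 / 32)) * exp (- ?z\<^sup>2 / 2)"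
      unfolding abs_mult using C[of ?z] d1 C0 by (intro mult_mono) auto
    also have "\<dots> \<le> C * (exp (60 / 32 * a\<^sup>2) * exp (- (3 / 8) * y\<^sup>2))"
      unfolding mult.assoc using e C0 by (rule mult_left_mono)
    finally have "\<bar>c\<bar> * \<bar>poly P ?z * std_normal_density ?z\<bar> \<le> \<bar>c\<bar> * (C * (exp (60 / 32 * a\<^sup>2) * exp (- (3 / 8) * y\<^sup>2)))"
      by (rule mult_left_mono) simp
    then show ?thesis by (simp add: abs_mult mult.assoc)
  qed
  then show ?thesis unfolding rapid_def by blast
qed

text \<open>Relative to the Gaussian density the exponential is a multiple of \<open>exp (\<bar>y\<bar>\<^sup>2 / 8)\<close>, which is square integrable.\<close>

lemma L2_gauss_exp_integrable:
  fixes h :: "real ^ 'n::finite \<Rightarrow> real"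
  assumes h: "h \<in> L2_gauss"
  shows "integrable lborel (\<lambda>y. \<bar>h y\<bar> * exp (- (3 / 8) * (norm y)\<^sup>2))"
proof -
  have [measurable]: "h \<in> borel_measurable borel" using L2_gaussD[OF h] by simp
  have "(\<lambda>y :: real ^ 'n. exp ((norm y)\<^sup>2 / 8)) \<in> L2_gauss"
  proof (rule L2_gaussI)
    have "integrable gauss (\<lambda>z :: real ^ 'n. exp (1 / 4 * (norm z)\<^sup>2))" by (rule gauss_exp_quadratic) simp
    then show "integrable gauss (\<lambda>y :: real ^ 'n. (exp ((norm y)\<^sup>2 / 8))\<^sup>2)"
      by (simp add: power2_eq_square exp_add[symmetric] field_simps)
  qed measurable
  then have "integrable gauss (\<lambda>y. \<bar>h y\<bar> * exp ((norm y)\<^sup>2 / 8))" using L2_gauss_mult[OF L2_gauss_abs[OF h]] by blast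
  then have I: "integrable lborel (\<lambda>y. gauss_density y * (\<bar>h y\<bar> * exp ((norm y)\<^sup>2 / 8)))"
    by (subst (asm) integrable_gauss) auto
  have "gauss_density y * (\<bar>h y\<bar> * exp ((norm y)\<^sup>2 / 8)) = (2 * pi) powr (- real CARD('n) / 2) * (\<bar>h y\<bar> * exp (- (3 / 8) * (norm y)\<^sup>2))" for y :: "real ^ 'n"
  proof -
    have "- (3 / 8) * (norm y)\<^sup>2 = - (norm y)\<^sup>2 / 2 + (norm y)\<^sup>2 / 8" by simp
    then show ?thesis unfolding gauss_density_def by (simp only: exp_add) (simp add: mult_ac)
  qed
  with I have "integrable lborel (\<lambda>y. (2 * pi) powr (- real CARD('n) / 2) * (\<bar>h y\<bar> * exp (- (3 / 8) * (norm y)\<^sup>2)))" by simp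
  from integrable_mult_right[OF this, of "inverse ((2 * pi) powr (- real CARD('n) / 2))"] show ?thesis
    by (simp add: mult.assoc[symmetric])
qed

lemma norm_sq_cart: "(norm (x :: real ^ 'n::finite))\<^sup>2 = (\<Sum>i\<in>UNIV. (x $ i)\<^sup>2)"
  unfolding norm_vec_def L2_set_def by (simp add: sum_nonneg)

lemma prodf_rapid_bound:
  fixes H :: "'n::finite \<Rightarrow> real \<Rightarrow> real"
  assumes "\<And>i t. \<bar>H i t\<bar> \<le> C i * exp (- (3 / 8) * t\<^sup>2)"
  shows "\<bar>prodf H y\<bar> \<le> (\<Prod>i\<in>UNIV. C i) * exp (- (3 / 8) * (norm y)\<^sup>2)"
proof -
  have "\<bar>prodf H y\<bar> \<le> (\<Prod>i\<in>UNIV. C i * exp (- (3 / 8) * (y $ i)\<^sup>2))"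
    unfolding prodf_def abs_prod by (intro prod_mono) (use assms in auto)
  then show ?thesis by (simp add: prod.distrib norm_sq_cart sum_distrib_left exp_sum)
qed

lemma L2_rapid_limit:
  fixes h :: "real ^ 'n::finite \<Rightarrow> real"
  assumes h: "h \<in> L2_gauss" and [measurable]: "\<And>N i. H N i \<in> borel_measurable borel" "\<And>i. L i \<in> borel_measurable borel"
    and bd: "\<And>N i t. \<bar>H N i t\<bar> \<le> C i * exp (- (3 / 8) * t\<^sup>2)" and lim: "\<And>i t. (\<lambda>N. H N i t) \<longlonglongrightarrow> L i t"
  shows "(\<lambda>N. LINT y|lborel. h y * prodf (H N) y) \<longlonglongrightarrow> (LINT y|lborel. h y * prodf L y)"
proof (rule integral_dominated_convergence[where w = "\<lambda>y. (\<Prod>i\<in>UNIV. C i) * (\<bar>h y\<bar> * exp (- (3 / 8) * (norm y)\<^sup>2))"])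
  have [measurable]: "h \<in> borel_measurable borel" using L2_gaussD[OF h] by simp
  show "(\<lambda>y. h y * prodf L y) \<in> borel_measurable lborel" unfolding prodf_def by measurable
  show "(\<lambda>y. h y * prodf (H N) y) \<in> borel_measurable lborel" for N unfolding prodf_def by measurable
  show "integrable lborel (\<lambda>y. (\<Prod>i\<in>UNIV. C i) * (\<bar>h y\<bar> * exp (- (3 / 8) * (norm y)\<^sup>2)))"
    by (intro integrable_mult_right L2_gauss_exp_integrable h)
  show "AE y in lborel. (\<lambda>N. h y * prodf (H N) y) \<longlonglongrightarrow> h y * prodf L y"
    unfolding prodf_def by (intro AE_I2 tendsto_mult tendsto_const tendsto_prod lim)
  show "AE y in lborel. norm (h y * prodf (H N) y) \<le> (\<Prod>i\<in>UNIV. C i) * (\<bar>h y\<bar> * exp (- (3 / 8) * (norm y)\<^sup>2))" for N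
  proof (rule AE_I2)
    fix y
    have "\<bar>h y\<bar> * \<bar>prodf (H N) y\<bar> \<le> \<bar>h y\<bar> * ((\<Prod>i\<in>UNIV. C i) * exp (- (3 / 8) * (norm y)\<^sup>2))"
      by (intro mult_left_mono prodf_rapid_bound bd) simp
    then show "norm (h y * prodf (H N) y) \<le> (\<Prod>i\<in>UNIV. C i) * (\<bar>h y\<bar> * exp (- (3 / 8) * (norm y)\<^sup>2))"
      by (simp add: abs_mult mult_ac)
  qed
qed

text \<open>Derivatives of a smooth cut-off at scale \<open>R\<close>, normalised to \<open>1\<close> at the origin; the constant \<open>exp 2\<close> compensates the
  value of the plateau there.\<close>

definition cutoff :: "real \<Rightarrow> nat \<Rightarrow> real \<Rightarrow> real" where
  "cutoff R m y = (1 / R) ^ m * (exp 2 * plateau 1 (- 1) 1 m (1 / R * y + 0))"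

lemma deriv_seq_cmult: "deriv_seq F \<Longrightarrow> deriv_seq (\<lambda>m x. c * F m x)"
  unfolding deriv_seq_def by (auto intro: DERIV_cmult)

lemma deriv_seq_cutoff: "deriv_seq (cutoff R)"
  unfolding cutoff_def[abs_def]
  using deriv_seq_affine[OF deriv_seq_cmult[OF deriv_seq_plateau], of "1 / R" "exp 2" 1 "-1" 1 0] by simp

lemma plateau_bounded: "\<exists>B. \<forall>x. \<bar>plateau 1 (- 1) 1 m x\<bar> \<le> B"
proof -
  have "bounded (plateau 1 (- 1) 1 m ` {-1..1})"
    by (intro compact_imp_bounded compact_continuous_image deriv_seq_continuous deriv_seq_plateau) simp
  then obtain B where "\<forall>x\<in>{-1..1}. \<bar>plateau 1 (- 1) 1 m x\<bar> \<le> B" unfolding bounded_iff by auto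
  then have B: "\<And>x. x \<in> {-1..1} \<Longrightarrow> \<bar>plateau 1 (- 1) 1 m x\<bar> \<le> B" by blast
  have "\<bar>plateau 1 (- 1) 1 m x\<bar> \<le> \<bar>B\<bar>" for x
  proof (cases "x \<in> {-1..1}")
    case True then show ?thesis using B[of x] by linarith
  next
    case False
    then have "plateau 1 (- 1) 1 m x = 0" by (intro plateau_outside) auto
    then show ?thesis by simp
  qed
  then show ?thesis by blast
qed

lemma cutoff_outside: "0 < R \<Longrightarrow> R < \<bar>t\<bar> \<Longrightarrow> cutoff R m t = 0"
proof -
  assume R: "0 < R" "R < \<bar>t\<bar>"
  have "1 / R * t + 0 \<le> - 1 \<or> 1 \<le> 1 / R * t + 0"
    using R by (auto simp: field_simps abs_if split: if_splits)
  then have "plateau 1 (- 1) 1 m (1 / R * t + 0) = 0" by (intro plateau_outside) auto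
  then show ?thesis unfolding cutoff_def by simp
qed

lemma cutoff_tendsto: "(\<lambda>N. cutoff (real (Suc N)) m t) \<longlonglongrightarrow> (if m = 0 then 1 else 0)"
proof -
  have "isCont (plateau 1 (- 1) 1 m) (0 * t + 0)" by (rule DERIV_isCont[OF deriv_seqD[OF deriv_seq_plateau]])
  then have "(\<lambda>N. plateau 1 (- 1) 1 m (1 / real (Suc N) * t + 0)) \<longlonglongrightarrow> plateau 1 (- 1) 1 m (0 * t + 0)"
    by (rule isCont_tendsto_compose) (intro tendsto_intros LIMSEQ_Suc[OF lim_1_over_n])
  then have "(\<lambda>N. cutoff (real (Suc N)) m t) \<longlonglongrightarrow> 0 ^ m * (exp 2 * plateau 1 (- 1) 1 m (0 * t + 0))"
    unfolding cutoff_def by (intro tendsto_intros LIMSEQ_Suc[OF lim_1_over_n])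
  moreover have "exp 2 * plateau 1 (- 1) 1 0 (0::real) = 1" by (simp add: plateau_0 flat_seq_0 exp_add[symmetric])
  ultimately show ?thesis by (cases m) simp_all
qed

lemma cutoff_bounded: "\<exists>B. \<forall>N t. \<bar>cutoff (real (Suc N)) m t\<bar> \<le> B"
proof -
  obtain B where B: "\<And>x. \<bar>plateau 1 (- 1) 1 m x\<bar> \<le> B" using plateau_bounded by blast
  have "\<bar>cutoff (real (Suc N)) m t\<bar> \<le> 1 * (exp 2 * B)" for N t
    unfolding cutoff_def abs_mult using B by (intro mult_mono) (auto simp: power_le_one abs_mult power_abs)
  then show ?thesis by blast
qed

text \<open>Weak derivatives of square integrable functions may be tested against products of rapidly
  decreasing functions, which need not have compact support: multiply by a cut-off, expand by the
  Leibniz rule and let the scale tend to infinity.\<close>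

lemma weak_deriv_rapid:
  fixes f g :: "real ^ 'n::finite \<Rightarrow> real"
  assumes f: "f \<in> L2_gauss" and g: "g \<in> L2_gauss" and W: "has_weak_deriv f \<kappa> g"
    and F: "\<And>i. deriv_seq (F i)" and rap: "\<And>i m. rapid (F i m)"
  shows "(LINT y|lborel. f y * prodf (\<lambda>i. F i (\<kappa> i)) y) = (- 1) ^ mi_size \<kappa> * (LINT y|lborel. g y * prodf (\<lambda>i. F i 0) y)"
proof -
  define H where "H N i m y = (\<Sum>j\<le>m. real (m choose j) * (F i j y * cutoff (real (Suc N)) (m - j) y))" for N i m y
  have ds: "deriv_seq (H N i)" for N i unfolding H_def[abs_def] by (intro deriv_seq_mult F deriv_seq_cutoff)
  have supp: "real (Suc N) < \<bar>t\<bar> \<Longrightarrow> H N i m t = 0" for N i m t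
    unfolding H_def using cutoff_outside[of "real (Suc N)" t] by (intro sum.neutral) auto
  have lim: "(\<lambda>N. H N i m t) \<longlonglongrightarrow> F i m t" for i m t
  proof -
    have "(\<lambda>N. H N i m t) \<longlonglongrightarrow> (\<Sum>j\<le>m. real (m choose j) * (F i j t * (if m - j = 0 then 1 else 0)))"
      unfolding H_def by (intro tendsto_intros cutoff_tendsto)
    also have "(\<Sum>j\<le>m. real (m choose j) * (F i j t * (if m - j = 0 then 1 else 0))) = (\<Sum>j\<le>m. if j = m then F i m t else 0)"
      by (intro sum.cong) auto
    finally show ?thesis by simp
  qed
  have "\<exists>C. \<forall>N t. \<bar>H N i m t\<bar> \<le> C * exp (- (3 / 8) * t\<^sup>2)" for i m
  proof -
    obtain C where C: "\<And>j t. \<bar>F i j t\<bar> \<le> C j * exp (- (3 / 8) * t\<^sup>2)" using rap[of i] unfolding rapid_def by metis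
    obtain B where B: "\<And>j N t. \<bar>cutoff (real (Suc N)) j t\<bar> \<le> B j" using cutoff_bounded by metis
    have C0: "0 \<le> C j" for j using C[of j 0] by (simp add: order_trans[OF abs_ge_zero])
    have "\<bar>H N i m t\<bar> \<le> (\<Sum>j\<le>m. real (m choose j) * (C j * B (m - j))) * exp (- (3 / 8) * t\<^sup>2)" for N t
    proof -
      have "\<bar>H N i m t\<bar> \<le> (\<Sum>j\<le>m. real (m choose j) * ((C j * exp (- (3 / 8) * t\<^sup>2)) * B (m - j)))"
        unfolding H_def
      proof (rule order_trans[OF sum_abs], intro sum_mono)
        fix j
        have "\<bar>F i j t\<bar> * \<bar>cutoff (real (Suc N)) (m - j) t\<bar> \<le> (C j * exp (- (3 / 8) * t\<^sup>2)) * B (m - j)"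
          using C0 by (intro mult_mono C B) auto
        then show "\<bar>real (m choose j) * (F i j t * cutoff (real (Suc N)) (m - j) t)\<bar> \<le> real (m choose j) * ((C j * exp (- (3 / 8) * t\<^sup>2)) * B (m - j))"
          unfolding abs_mult abs_of_nat by (rule mult_left_mono) simp
      qed
      also have "\<dots> = (\<Sum>j\<le>m. real (m choose j) * (C j * B (m - j))) * exp (- (3 / 8) * t\<^sup>2)"
        by (simp add: sum_distrib_right mult_ac)
      finally show ?thesis .
    qed
    then show ?thesis by blast
  qed
  then obtain C where C: "\<And>i m N t. \<bar>H N i m t\<bar> \<le> C i m * exp (- (3 / 8) * t\<^sup>2)" by metis
  have L: "(\<lambda>N. LINT y|lborel. h y * prodf (\<lambda>i. H N i (k i)) y) \<longlonglongrightarrow> (LINT y|lborel. h y * prodf (\<lambda>i. F i (k i)) y)"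
    if h: "h \<in> L2_gauss" for h :: "real ^ 'n \<Rightarrow> real" and k
    by (rule L2_rapid_limit[OF h _ _ C lim]) (auto intro: deriv_seq_measurable ds F)
  have eq: "(LINT y|lborel. f y * prodf (\<lambda>i. H N i (\<kappa> i)) y) = (- 1) ^ mi_size \<kappa> * (LINT y|lborel. g y * prodf (\<lambda>i. H N i 0) y)" for N
  proof -
    have "test_function (prodf (\<lambda>i. H N i 0))" by (rule test_function_prodf[OF ds supp])
    from W[unfolded has_weak_deriv_def, THEN conjunct2, THEN conjunct2, rule_format, OF this]
    show ?thesis unfolding mi_deriv_prodf[of "H N", OF ds] .
  qed
  have "(\<lambda>N. (- 1) ^ mi_size \<kappa> * (LINT y|lborel. g y * prodf (\<lambda>i. H N i 0) y)) \<longlonglongrightarrow> (- 1) ^ mi_size \<kappa> * (LINT y|lborel. g y * prodf (\<lambda>i. F i 0) y)"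
    by (intro tendsto_intros L g)
  then have "(\<lambda>N. LINT y|lborel. f y * prodf (\<lambda>i. H N i (\<kappa> i)) y) \<longlonglongrightarrow> (- 1) ^ mi_size \<kappa> * (LINT y|lborel. g y * prodf (\<lambda>i. F i 0) y)"
    unfolding eq .
  from LIMSEQ_unique[OF L[OF f] this] show ?thesis .
qed

lemma sqrt_prod: "sqrt (\<Prod>i\<in>A. f i) = (\<Prod>i\<in>A. sqrt (f i))"
  by (induction A rule: infinite_finite_induct) (auto simp: real_sqrt_mult)

section \<open>Hermite coefficients and regularisations of derivatives\<close>

text \<open>The derivatives of \<open>He b\<close> times the Gaussian density (Rodrigues' formula).\<close>

definition He_seq :: "nat \<Rightarrow> nat \<Rightarrow> real \<Rightarrow> real" where
  "He_seq b m y = (- 1) ^ m * (poly (He (b + m)) y * std_normal_density y)"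

lemma deriv_seq_He: "deriv_seq (He_seq b)"
  unfolding deriv_seq_def He_seq_def[abs_def]
proof (intro allI)
  fix m x
  have s: "(std_normal_density has_real_derivative (- x * std_normal_density x)) (at x)"
    unfolding std_normal_density_def[abs_def] by (auto intro!: derivative_eq_intros simp: field_simps)
  have "((\<lambda>y. poly (He (b + m)) y * std_normal_density y) has_real_derivative
      poly (pderiv (He (b + m))) x * std_normal_density x + (- x * std_normal_density x) * poly (He (b + m)) x) (at x)"
    by (rule DERIV_mult[OF poly_DERIV s])
  then have "((\<lambda>y. (- 1) ^ m * (poly (He (b + m)) y * std_normal_density y)) has_real_derivative
      (- 1) ^ m * (poly (pderiv (He (b + m))) x * std_normal_density x + (- x * std_normal_density x) * poly (He (b + m)) x)) (at x)"
    by (rule DERIV_cmult)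
  then show "((\<lambda>y. (- 1) ^ m * (poly (He (b + m)) y * std_normal_density y)) has_real_derivative
      (- 1) ^ Suc m * (poly (He (b + Suc m)) x * std_normal_density x)) (at x)"
    by (simp add: algebra_simps)
qed

lemma gauss_integral_herm:
  fixes h :: "real ^ 'n::finite \<Rightarrow> real"
  assumes h: "h \<in> L2_gauss"
  shows "hcoef \<beta> h * sqrt (\<Prod>i\<in>UNIV. fact (\<beta> i)) = (LINT y|lborel. h y * prodf (\<lambda>i t. poly (He (\<beta> i)) t * std_normal_density t) y)"
proof -
  have [measurable]: "h \<in> borel_measurable borel" using L2_gaussD[OF h] by simp
  have "hcoef \<beta> h = (LINT y|lborel. gauss_density y * (h y * herm \<beta> y))"
    unfolding hcoef_def inner_gauss_def by (rule integral_gauss) measurable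
  moreover have "gauss_density y * (h y * herm \<beta> y) * sqrt (\<Prod>i\<in>UNIV. fact (\<beta> i)) = h y * prodf (\<lambda>i t. poly (He (\<beta> i)) t * std_normal_density t) y" for y
  proof -
    have "(\<Prod>i\<in>UNIV. sqrt (fact (\<beta> i))) \<noteq> (0::real)" by simp
    then show ?thesis unfolding gauss_density_prod herm_def prodf_def by (simp add: prod.distrib prod_dividef sqrt_prod)
  qed
  ultimately show ?thesis by (simp only: integral_mult_left_zero[symmetric])
qed

lemma real_sqrt_prod_fact: "(\<Prod>i\<in>(UNIV :: 'n::finite set). 1 / sqrt (fact (\<kappa> i))) = 1 / sqrt (\<Prod>i\<in>UNIV. fact (\<kappa> i))"
  by (simp add: prod_dividef sqrt_prod)

lemma Hk_gaussD:
  assumes "f \<in> Hk_gauss k" "mi_size \<kappa> \<le> k"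
  obtains g where "has_weak_deriv f \<kappa> g" "g \<in> L2_gauss" "D \<kappa> f = (\<lambda>x. g x / sqrt (\<Prod>i\<in>UNIV. fact (\<kappa> i)))"
proof -
  define g where "g = (SOME g. has_weak_deriv f \<kappa> g)"
  have ex: "\<exists>g. has_weak_deriv f \<kappa> g" and L: "D \<kappa> f \<in> L2_gauss" using assms unfolding Hk_gauss_def by auto
  have W: "has_weak_deriv f \<kappa> g" unfolding g_def using ex by (rule someI_ex)
  have e: "D \<kappa> f = (\<lambda>x. g x / sqrt (\<Prod>i\<in>UNIV. fact (\<kappa> i)))"
    unfolding D_def[abs_def] g_def real_sqrt_prod_fact by simp
  have "0 < sqrt (\<Prod>i\<in>(UNIV :: 'a set). fact (\<kappa> i))" by (simp add: prod_pos)
  then have "g = (\<lambda>x. sqrt (\<Prod>i\<in>UNIV. fact (\<kappa> i)) * D \<kappa> f x)" unfolding e by simp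
  then have "g \<in> L2_gauss" using L2_gauss_cmult[OF L] by metis
  then show thesis using that W e by blast
qed

lemma Hk_gauss_L2: "f \<in> Hk_gauss k \<Longrightarrow> f \<in> L2_gauss" "f \<in> Hk_gauss k \<Longrightarrow> mi_size \<kappa> \<le> k \<Longrightarrow> D \<kappa> f \<in> L2_gauss"
  unfolding Hk_gauss_def by auto

text \<open>Derivatives act on Hermite coefficients as a weighted shift.  The square avoids a choice of square
  roots of the binomial weights.\<close>

lemma hcoef_D:
  fixes f :: "real ^ 'n::finite \<Rightarrow> real"
  assumes f: "f \<in> Hk_gauss k" and \<kappa>: "mi_size \<kappa> \<le> k"
  shows "(hcoef \<beta> (D \<kappa> f))\<^sup>2 = (\<Prod>i\<in>UNIV. real ((\<beta> i + \<kappa> i) choose \<kappa> i)) * (hcoef (\<lambda>i. \<beta> i + \<kappa> i) f)\<^sup>2"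
proof -
  obtain g where W: "has_weak_deriv f \<kappa> g" and g: "g \<in> L2_gauss" and e: "D \<kappa> f = (\<lambda>x. g x / sqrt (\<Prod>i\<in>UNIV. fact (\<kappa> i)))"
    using Hk_gaussD[OF f \<kappa>] by blast
  have rap: "rapid (He_seq b m)" for b m
    unfolding He_seq_def[abs_def] using rapid_poly_gauss[of 1 "(-1) ^ m" "He (b + m)" 0] by simp
  have I: "(LINT y|lborel. f y * prodf (\<lambda>i. He_seq (\<beta> i) (\<kappa> i)) y) = (- 1) ^ mi_size \<kappa> * (LINT y|lborel. g y * prodf (\<lambda>i. He_seq (\<beta> i) 0) y)"
    by (rule weak_deriv_rapid[OF Hk_gauss_L2(1)[OF f] g W deriv_seq_He rap])
  have p1: "prodf (\<lambda>i. He_seq (\<beta> i) (\<kappa> i)) y = (- 1) ^ mi_size \<kappa> * prodf (\<lambda>i t. poly (He (\<beta> i + \<kappa> i)) t * std_normal_density t) y" for y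
    unfolding prodf_def He_seq_def prod.distrib mi_size_def by (simp add: power_sum)
  have p2: "f y * prodf (\<lambda>i. He_seq (\<beta> i) (\<kappa> i)) y = (- 1) ^ mi_size \<kappa> * (f y * prodf (\<lambda>i t. poly (He (\<beta> i + \<kappa> i)) t * std_normal_density t) y)" for y
    unfolding p1 by (rule mult.left_commute)
  have p0: "prodf (\<lambda>i. He_seq (\<beta> i) 0) y = prodf (\<lambda>i t. poly (He (\<beta> i)) t * std_normal_density t) y" for y
    unfolding prodf_def He_seq_def by simp
  have "(- 1) ^ mi_size \<kappa> * (hcoef (\<lambda>i. \<beta> i + \<kappa> i) f * sqrt (\<Prod>i\<in>UNIV. fact (\<beta> i + \<kappa> i))) = (- 1) ^ mi_size \<kappa> * (hcoef \<beta> g * sqrt (\<Prod>i\<in>UNIV. fact (\<beta> i)))"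
    using I unfolding p0 p2 gauss_integral_herm[OF Hk_gauss_L2(1)[OF f]] gauss_integral_herm[OF g] integral_mult_right_zero .
  then have eq: "hcoef (\<lambda>i. \<beta> i + \<kappa> i) f * sqrt (\<Prod>i\<in>UNIV. fact (\<beta> i + \<kappa> i)) = hcoef \<beta> g * sqrt (\<Prod>i\<in>UNIV. fact (\<beta> i))" by simp
  have "hcoef \<beta> (D \<kappa> f) = hcoef \<beta> g / sqrt (\<Prod>i\<in>UNIV. fact (\<kappa> i))"
    unfolding e hcoef_def using inner_gauss_cmult_left[of "1 / sqrt (\<Prod>i\<in>UNIV. fact (\<kappa> i))" g "herm \<beta>"] by simp
  then have h1: "(hcoef \<beta> (D \<kappa> f))\<^sup>2 * (\<Prod>i\<in>UNIV. fact (\<kappa> i)) = (hcoef \<beta> g)\<^sup>2"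
    by (simp add: power_divide prod_nonneg)
  have "(hcoef (\<lambda>i. \<beta> i + \<kappa> i) f)\<^sup>2 * (\<Prod>i\<in>UNIV. fact (\<beta> i + \<kappa> i)) = (hcoef \<beta> g)\<^sup>2 * (\<Prod>i\<in>UNIV. fact (\<beta> i))"
    using arg_cong[OF eq, of "\<lambda>x. x\<^sup>2"] by (simp add: power_mult_distrib prod_nonneg)
  then have "(hcoef (\<lambda>i. \<beta> i + \<kappa> i) f)\<^sup>2 * (\<Prod>i\<in>UNIV. fact (\<beta> i + \<kappa> i)) = (hcoef \<beta> (D \<kappa> f))\<^sup>2 * (\<Prod>i\<in>UNIV. fact (\<kappa> i)) * (\<Prod>i\<in>UNIV. fact (\<beta> i))"
    unfolding h1 .
  moreover have "(\<Prod>i\<in>UNIV. fact (\<beta> i + \<kappa> i)) = (\<Prod>i\<in>UNIV. real ((\<beta> i + \<kappa> i) choose \<kappa> i)) * ((\<Prod>i\<in>UNIV. fact (\<kappa> i)) * (\<Prod>i\<in>UNIV. fact (\<beta> i)))"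
    unfolding prod.distrib[symmetric] by (intro prod.cong refl) (simp add: binomial_fact)
  ultimately have "((\<Prod>i\<in>UNIV. real ((\<beta> i + \<kappa> i) choose \<kappa> i)) * (hcoef (\<lambda>i. \<beta> i + \<kappa> i) f)\<^sup>2) * ((\<Prod>i\<in>UNIV. fact (\<kappa> i)) * (\<Prod>i\<in>UNIV. fact (\<beta> i)))
     = (hcoef \<beta> (D \<kappa> f))\<^sup>2 * ((\<Prod>i\<in>UNIV. fact (\<kappa> i)) * (\<Prod>i\<in>UNIV. fact (\<beta> i)))"
    by (simp only: mult.assoc mult.left_commute mult.commute)
  moreover have "(\<Prod>i\<in>UNIV. fact (\<kappa> i)) * (\<Prod>i\<in>UNIV. fact (\<beta> i)) \<noteq> (0::real)" by simp
  ultimately show ?thesis by (simp only: mult_cancel_right) simp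
qed

lemma OU_kernel_prod:
  fixes x y :: "real ^ 'n::finite"
  assumes s: "0 \<le> s" "s < 1"
  defines "\<tau> \<equiv> sqrt (1 - s\<^sup>2)"
  shows "gauss_density y * mehler s x y = (\<Prod>i\<in>UNIV. 1 / \<tau> * std_normal_density ((y $ i - s * x $ i) / \<tau>))"
proof -
  have t: "0 < 1 - s\<^sup>2" using power_strict_mono[of s 1 2] s by simp
  then have t2: "\<tau>\<^sup>2 = 1 - s\<^sup>2" "0 < \<tau>" unfolding \<tau>_def by auto
  have c: "(y $ i - s * x $ i) / \<tau> = ((1 / \<tau>) *\<^sub>R (y - s *\<^sub>R x)) $ i" for i by simp
  have "(\<Prod>i\<in>UNIV. 1 / \<tau> * std_normal_density ((y $ i - s * x $ i) / \<tau>)) = (1 / \<tau>) ^ CARD('n) * gauss_density ((1 / \<tau>) *\<^sub>R (y - s *\<^sub>R x))"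
    unfolding c prod.distrib gauss_density_prod by simp
  also have "gauss_density ((1 / \<tau>) *\<^sub>R (y - s *\<^sub>R x)) = (2 * pi) powr (- real CARD('n) / 2) * exp (- (norm (y - s *\<^sub>R x))\<^sup>2 / (2 * (1 - s\<^sup>2)))"
    unfolding gauss_density_def t2(1)[symmetric] by (simp add: power_mult_distrib power_divide)
  also have "(1 / \<tau>) ^ CARD('n) * \<dots> = gauss_density y * mehler s x y"
  proof -
    have e: "exp (- (norm y)\<^sup>2 / 2) * exp ((norm y)\<^sup>2 / 2 - (norm (y - s *\<^sub>R x))\<^sup>2 / (2 * (1 - s\<^sup>2))) = exp (- (norm (y - s *\<^sub>R x))\<^sup>2 / (2 * (1 - s\<^sup>2)))"
      unfolding exp_add[symmetric] by simp
    show ?thesis unfolding gauss_density_def mehler_def \<tau>_def[symmetric] e[symmetric] by (simp only: mult_ac)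
  qed
  finally show ?thesis by simp
qed

text \<open>The derivatives of \<open>f\<close> are moved to the kernel, where each of them costs a factor
  \<open>1 / sqrt (1 - s\<^sup>2)\<close> and together they produce a Hermite polynomial.\<close>

lemma OU_D:
  fixes f :: "real ^ 'n::finite \<Rightarrow> real"
  assumes f: "f \<in> Hk_gauss k" and \<kappa>: "mi_size \<kappa> \<le> k" and s: "0 \<le> s" "s < 1"
  defines "\<tau> \<equiv> sqrt (1 - s\<^sup>2)"
  shows "\<bar>OU s (D \<kappa> f) x\<bar> * \<tau> ^ mi_size \<kappa> = \<bar>LINT y|gauss. mehler s x y * (f y * herm \<kappa> ((1 / \<tau>) *\<^sub>R (y - s *\<^sub>R x)))\<bar>"
proof -
  have t: "0 < 1 - s\<^sup>2" using power_strict_mono[of s 1 2] s by simp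
  then have t2: "0 < \<tau>" "\<tau> \<le> 1" unfolding \<tau>_def using s by auto
  obtain g where W: "has_weak_deriv f \<kappa> g" and g: "g \<in> L2_gauss" and e: "D \<kappa> f = (\<lambda>x. g x / sqrt (\<Prod>i\<in>UNIV. fact (\<kappa> i)))"
    using Hk_gaussD[OF f \<kappa>] by blast
  have [measurable]: "f \<in> borel_measurable borel" "g \<in> borel_measurable borel" using L2_gaussD[OF g] L2_gaussD[OF Hk_gauss_L2(1)[OF f]] by auto
  define F where "F i m t = 1 / \<tau> * ((1 / \<tau>) ^ m * He_seq 0 m (1 / \<tau> * t + (- s * x $ i / \<tau>)))" for i m t
  have ds: "deriv_seq (F i)" for i unfolding F_def[abs_def] by (intro deriv_seq_cmult deriv_seq_affine deriv_seq_He)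
  have Fe: "F i m t = (- 1) ^ m * (1 / \<tau>) ^ m * (1 / \<tau>) * (poly (He m) ((t - s * x $ i) / \<tau>) * std_normal_density ((t - s * x $ i) / \<tau>))" for i m t
    unfolding F_def He_seq_def by (simp add: diff_divide_distrib)
  have rap: "rapid (F i m)" for i m
    unfolding Fe[abs_def] by (rule rapid_poly_gauss[OF t2])
  have I: "(LINT y|lborel. f y * prodf (\<lambda>i. F i (\<kappa> i)) y) = (- 1) ^ mi_size \<kappa> * (LINT y|lborel. g y * prodf (\<lambda>i. F i 0) y)"
    by (rule weak_deriv_rapid[OF Hk_gauss_L2(1)[OF f] g W ds rap])
  let ?P = "sqrt (\<Prod>i\<in>UNIV. fact (\<kappa> i)) :: real"
  have P0: "0 < ?P" by (simp add: prod_pos)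
  have p0: "prodf (\<lambda>i. F i 0) y = gauss_density y * mehler s x y" for y
    unfolding prodf_def Fe OU_kernel_prod[OF s] \<tau>_def[symmetric] by simp
  have p1: "prodf (\<lambda>i. F i (\<kappa> i)) y = (- 1 / \<tau>) ^ mi_size \<kappa> * ?P * (gauss_density y * mehler s x y * herm \<kappa> ((1 / \<tau>) *\<^sub>R (y - s *\<^sub>R x)))" for y
  proof -
    have sg: "(- 1 / \<tau>) ^ m = (- 1) ^ m * (1 / \<tau>) ^ m" for m by (simp add: power_mult_distrib[symmetric])
    have "prodf (\<lambda>i. F i (\<kappa> i)) y = (\<Prod>i\<in>UNIV. (- 1 / \<tau>) ^ \<kappa> i * (1 / \<tau> * std_normal_density ((y $ i - s * x $ i) / \<tau>)) * (sqrt (fact (\<kappa> i)) * (poly (He (\<kappa> i)) ((y $ i - s * x $ i) / \<tau>) / sqrt (fact (\<kappa> i)))))"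
      unfolding prodf_def Fe sg by (intro prod.cong refl) (simp add: power_divide)
    also have "\<dots> = (- 1 / \<tau>) ^ mi_size \<kappa> * (gauss_density y * mehler s x y) * (?P * herm \<kappa> ((1 / \<tau>) *\<^sub>R (y - s *\<^sub>R x)))"
      unfolding prod.distrib OU_kernel_prod[OF s] \<tau>_def[symmetric] mi_size_def herm_def
      by (simp add: power_sum sqrt_prod)
    finally show ?thesis by (simp add: mult_ac)
  qed
  let ?I = "LINT y|gauss. mehler s x y * (f y * herm \<kappa> ((1 / \<tau>) *\<^sub>R (y - s *\<^sub>R x)))"
  have hm[measurable]: "(\<lambda>y. herm \<kappa> ((1 / \<tau>) *\<^sub>R (y - s *\<^sub>R x))) \<in> borel_measurable borel" by measurable
  have OUg: "OU s (D \<kappa> f) x * ?P = (LINT y|lborel. g y * prodf (\<lambda>i. F i 0) y)"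
  proof -
    have "OU s (D \<kappa> f) x = OU s g x / ?P" unfolding OU_def e by simp
    moreover have "OU s g x = (LINT y|lborel. g y * prodf (\<lambda>i. F i 0) y)"
      unfolding OU_mehler(1)[OF s \<open>g \<in> borel_measurable borel\<close>] p0 by (subst integral_gauss) (auto simp: mult_ac)
    ultimately show ?thesis using P0 by simp
  qed
  have "(LINT y|lborel. f y * prodf (\<lambda>i. F i (\<kappa> i)) y) = (- 1 / \<tau>) ^ mi_size \<kappa> * ?P * ?I"
  proof -
    have "?I = (LINT y|lborel. gauss_density y * (mehler s x y * (f y * herm \<kappa> ((1 / \<tau>) *\<^sub>R (y - s *\<^sub>R x)))))"
      by (rule integral_gauss) measurable
    moreover have "(LINT y|lborel. f y * prodf (\<lambda>i. F i (\<kappa> i)) y) = (LINT y|lborel. (- 1 / \<tau>) ^ mi_size \<kappa> * ?P * (gauss_density y * (mehler s x y * (f y * herm \<kappa> ((1 / \<tau>) *\<^sub>R (y - s *\<^sub>R x))))))"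
      unfolding p1 by (intro Bochner_Integration.integral_cong refl) (simp only: mult_ac)
    ultimately show ?thesis by simp
  qed
  then have "(- 1 / \<tau>) ^ mi_size \<kappa> * ?P * ?I = (- 1) ^ mi_size \<kappa> * (OU s (D \<kappa> f) x * ?P)" using I OUg by simp
  then have "\<bar>(- 1 / \<tau>) ^ mi_size \<kappa> * ?P * ?I\<bar> = \<bar>(- 1) ^ mi_size \<kappa> * (OU s (D \<kappa> f) x * ?P)\<bar>" by (rule arg_cong)
  then have "(1 / \<tau>) ^ mi_size \<kappa> * ?P * \<bar>?I\<bar> = \<bar>OU s (D \<kappa> f) x\<bar> * ?P" using P0 t2 by (simp add: abs_mult power_abs)
  then show ?thesis using P0 t2 by (simp add: power_divide field_simps)
qed

lemma hweight_le_inner: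
  assumes u: "u \<in> L2_gauss" shows "hweight m u \<le> inner_gauss u u"
proof -
  have "sum (\<lambda>m. hweight m u) {m} \<le> (\<Sum>m. hweight m u)"
    by (rule sum_le_suminf[OF sums_summable[OF parseval[OF u]]]) (simp_all add: hweight_nonneg)
  then show ?thesis unfolding sums_unique[OF parseval[OF u], symmetric] by simp
qed

text \<open>For fixed \<open>x\<close>, the numbers \<open>OU s (D \<kappa> f) x\<close> are up to the power of \<open>1 - s\<^sup>2\<close> the Hermite coefficients
  of the single function \<open>z \<mapsto> f (s x + sqrt (1 - s\<^sup>2) z)\<close>, which is bounded by \<open>1\<close>.  Bessel's inequality
  gives a bound that does not depend on the dimension.\<close>

lemma OU_D_square_sum_le:
  fixes f :: "real ^ 'n::finite \<Rightarrow> real"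
  assumes f: "f \<in> Hk_gauss k" and f1: "AE x in gauss. \<bar>f x\<bar> \<le> 1" and s: "0 \<le> s" "s < 1" and S: "S \<subseteq> {\<kappa>. mi_size \<kappa> = k}"
  shows "(\<Sum>\<kappa>\<in>S. (OU s (D \<kappa> f) x)\<^sup>2) \<le> 1 / (1 - s\<^sup>2) ^ k"
proof -
  define \<tau> where "\<tau> = sqrt (1 - s\<^sup>2)"
  have t: "0 < 1 - s\<^sup>2" using power_strict_mono[of s 1 2] s by simp
  then have t2: "0 < \<tau>" "\<tau>\<^sup>2 = 1 - s\<^sup>2" unfolding \<tau>_def by auto
  have [measurable]: "f \<in> borel_measurable borel" using L2_gaussD[OF Hk_gauss_L2(1)[OF f]] by auto
  \<comment> \<open>a version of \<open>f\<close> that is bounded by \<open>1\<close> everywhere, so that \<open>u\<close> is bounded for every \<open>x\<close>\<close>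
  define f' where "f' y = max (- 1) (min 1 (f y))" for y
  define u where "u z = f' (s *\<^sub>R x + \<tau> *\<^sub>R z)" for z
  have [measurable]: "f' \<in> borel_measurable borel" unfolding f'_def[abs_def] by measurable
  have [measurable]: "u \<in> borel_measurable borel" unfolding u_def[abs_def] by measurable
  have u1: "\<bar>u z\<bar> \<le> 1" for z unfolding u_def f'_def by auto
  have uL: "u \<in> L2_gauss" by (rule L2_gauss_bounded[of u 1]) (auto simp: u1)
  have ff: "AE y in gauss. f y = f' y" using f1 by eventually_elim (auto simp: f'_def)
  have eq: "\<bar>OU s (D \<kappa> f) x\<bar> * \<tau> ^ k = \<bar>hcoef \<kappa> u\<bar>" if "\<kappa> \<in> S" for \<kappa>
  proof -
    have k: "mi_size \<kappa> = k" using S that by auto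
    have hm[measurable]: "(\<lambda>y. herm \<kappa> ((1 / \<tau>) *\<^sub>R (y - s *\<^sub>R x))) \<in> borel_measurable borel" by measurable
    have "(LINT y|gauss. mehler s x y * (f y * herm \<kappa> ((1 / \<tau>) *\<^sub>R (y - s *\<^sub>R x)))) = (LINT y|gauss. mehler s x y * (f' y * herm \<kappa> ((1 / \<tau>) *\<^sub>R (y - s *\<^sub>R x))))"
    proof (rule integral_cong_AE)
      show "AE y in gauss. mehler s x y * (f y * herm \<kappa> ((1 / \<tau>) *\<^sub>R (y - s *\<^sub>R x))) = mehler s x y * (f' y * herm \<kappa> ((1 / \<tau>) *\<^sub>R (y - s *\<^sub>R x)))"
        using ff by eventually_elim simp
    qed simp_all
    also have "\<dots> = OU s (\<lambda>y. f' y * herm \<kappa> ((1 / \<tau>) *\<^sub>R (y - s *\<^sub>R x))) x" by (rule OU_mehler(1)[OF s, symmetric]) measurable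
    also have "\<dots> = hcoef \<kappa> u" unfolding OU_def hcoef_def inner_gauss_def u_def \<tau>_def[symmetric] using t2 by simp
    finally show ?thesis using OU_D[OF f _ s, of \<kappa> x] unfolding \<tau>_def[symmetric] by (simp add: k)
  qed
  have "(\<Sum>\<kappa>\<in>S. (OU s (D \<kappa> f) x)\<^sup>2) * (1 - s\<^sup>2) ^ k = (\<Sum>\<kappa>\<in>S. (\<bar>OU s (D \<kappa> f) x\<bar> * \<tau> ^ k)\<^sup>2)"
    by (simp only: t2(2)[symmetric] sum_distrib_right power_mult_distrib power_mult[symmetric] power2_abs mult.commute[of 2 k])
  also have "\<dots> = (\<Sum>\<kappa>\<in>S. (hcoef \<kappa> u)\<^sup>2)" by (intro sum.cong refl) (simp add: eq)
  also have "\<dots> \<le> hweight k u" unfolding hweight_def by (intro sum_mono2 finite_mi_size S) auto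
  also have "\<dots> \<le> inner_gauss u u" by (rule hweight_le_inner[OF uL])
  also have "\<dots> \<le> (LINT z|(gauss :: (real ^ 'n) measure). 1)"
    unfolding inner_gauss_def
  proof (rule integral_mono)
    show "integrable gauss (\<lambda>z. u z * u z)" by (rule L2_gauss_mult[OF uL uL])
    show "u z * u z \<le> 1" for z using u1[of z] by (simp add: power2_eq_square[symmetric] abs_square_le_1)
  qed simp
  also have "\<dots> = 1" using gauss.prob_space by simp
  finally show ?thesis using t by (simp add: pos_le_divide_eq)
qed

section \<open>Classical derivatives are weak derivatives\<close>

lemma has_partial_deriv:
  fixes \<psi> :: "real ^ 'n::finite \<Rightarrow> real"
  assumes d: "\<psi> differentiable_on UNIV"
  shows "((\<lambda>t. \<psi> (x + t *\<^sub>R axis i 1)) has_real_derivative partial_deriv i \<psi> (x + t *\<^sub>R axis i 1)) (at t)"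
proof -
  let ?y = "x + t *\<^sub>R axis i 1"
  have "\<psi> differentiable (at ?y)" using d by (simp add: differentiable_on_def)
  then obtain l where l: "(\<psi> has_derivative l) (at ?y)" unfolding differentiable_def by blast
  have line: "((\<lambda>u. ?y + u *\<^sub>R axis i 1) has_derivative (\<lambda>u. u *\<^sub>R axis i 1)) (at 0)"
    by (auto intro!: derivative_eq_intros)
  have "((\<lambda>u. \<psi> (?y + u *\<^sub>R axis i 1)) has_derivative (\<lambda>u. l (u *\<^sub>R axis i 1))) (at 0)"
    using has_derivative_compose[OF line, of \<psi> l] l by simp
  then have "(\<lambda>u. \<psi> (?y + u *\<^sub>R axis i 1)) differentiable (at 0)" unfolding differentiable_def by blast
  then have "((\<lambda>u. \<psi> (?y + u *\<^sub>R axis i 1)) has_real_derivative partial_deriv i \<psi> ?y) (at 0)"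
    unfolding partial_deriv_def using DERIV_deriv_iff_real_differentiable by blast
  moreover have "\<psi> (?y + u *\<^sub>R axis i 1) = \<psi> (x + (u + t) *\<^sub>R axis i 1)" for u by (simp add: scaleR_add_left add_ac)
  ultimately show ?thesis using DERIV_shift[of "\<lambda>u. \<psi> (x + u *\<^sub>R axis i 1)" "partial_deriv i \<psi> ?y" 0 t] by simp
qed

lemma partial_deriv_support: "closure {x. partial_deriv i \<phi> x \<noteq> 0} \<subseteq> closure {x. \<phi> x \<noteq> 0}"
proof (rule closure_minimal)
  show "{x. partial_deriv i \<phi> x \<noteq> 0} \<subseteq> closure {x. \<phi> x \<noteq> 0}"
  proof (rule subsetI, rule ccontr)
    fix x assume x: "x \<in> {x. partial_deriv i \<phi> x \<noteq> 0}" "x \<notin> closure {x. \<phi> x \<noteq> 0}"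
    let ?O = "- closure {x. \<phi> x \<noteq> 0}"
    have z: "\<phi> y = 0" if "y \<in> ?O" for y using that closure_subset[of "{x. \<phi> x \<noteq> 0}"] by auto
    have "isCont (\<lambda>t. x + t *\<^sub>R axis i 1) 0" by (intro continuous_intros)
    then have "((\<lambda>t. x + t *\<^sub>R axis i 1) \<longlongrightarrow> x + 0 *\<^sub>R axis i 1) (nhds 0)"
      unfolding continuous_at by (rule iffD1[OF tendsto_at_iff_tendsto_nhds[of "\<lambda>t. x + t *\<^sub>R axis i 1"]])
    then have "\<forall>\<^sub>F t in nhds 0. x + t *\<^sub>R axis i 1 \<in> ?O"
      by (rule topological_tendstoD) (use x(2) in auto)
    then have "\<forall>\<^sub>F t in nhds 0. \<phi> (x + t *\<^sub>R axis i 1) = 0" by eventually_elim (rule z)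
    then have "deriv (\<lambda>t. \<phi> (x + t *\<^sub>R axis i 1)) 0 = deriv (\<lambda>t. 0) 0" by (intro deriv_cong_ev) auto
    then show False using x(1) unfolding partial_deriv_def by simp
  qed
qed simp

lemma test_function_partial_deriv: "test_function \<phi> \<Longrightarrow> test_function (partial_deriv i \<phi>)"
  unfolding test_function_def
proof (intro conjI allI)
  fix "is" assume A: "(\<forall>is. foldr partial_deriv is \<phi> differentiable_on UNIV) \<and> compact (closure {x. \<phi> x \<noteq> 0})"
  from A have "foldr partial_deriv (is @ [i]) \<phi> differentiable_on UNIV" by blast
  then show "foldr partial_deriv is (partial_deriv i \<phi>) differentiable_on UNIV" by simp
  show "compact (closure {x. partial_deriv i \<phi> x \<noteq> 0})"
    using A partial_deriv_support[of i \<phi>] by (meson bounded_subset closed_closure compact_eq_bounded_closed)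
qed

lemma test_function_foldr: "test_function \<phi> \<Longrightarrow> test_function (foldr partial_deriv is \<phi>)"
  by (induction "is") (auto intro: test_function_partial_deriv)

lemma continuous_locally_integrable: "continuous_on UNIV u \<Longrightarrow> locally_integrable u"
  unfolding locally_integrable_def set_integrable_def
  by (intro allI impI borel_integrable_compact) (auto intro: continuous_on_subset)

lemma L2_gauss_locally_integrable:
  fixes u :: "real ^ 'n::finite \<Rightarrow> real"
  assumes u: "u \<in> L2_gauss" shows "locally_integrable u"
  unfolding locally_integrable_def set_integrable_def
proof (intro allI impI)
  fix K :: "(real ^ 'n) set" assume K: "compact K"
  have [measurable]: "u \<in> borel_measurable borel" "K \<in> sets borel" using L2_gaussD[OF u] K by (auto intro: borel_compact)
  obtain R where R: "\<forall>x\<in>K. norm x \<le> R" using compact_imp_bounded[OF K] unfolding bounded_iff by blast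
  show "integrable lborel (\<lambda>x. indicator K x *\<^sub>R u x)"
  proof (rule Bochner_Integration.integrable_bound)
    show "integrable lborel (\<lambda>y. exp (3 / 8 * R\<^sup>2) * (\<bar>u y\<bar> * exp (- (3 / 8) * (norm y)\<^sup>2)))"
      by (intro integrable_mult_right L2_gauss_exp_integrable u)
    show "AE x in lborel. norm (indicator K x *\<^sub>R u x) \<le> norm (exp (3 / 8 * R\<^sup>2) * (\<bar>u x\<bar> * exp (- (3 / 8) * (norm x)\<^sup>2)))"
    proof (rule AE_I2)
      fix x
      show "norm (indicator K x *\<^sub>R u x) \<le> norm (exp (3 / 8 * R\<^sup>2) * (\<bar>u x\<bar> * exp (- (3 / 8) * (norm x)\<^sup>2)))"
      proof (cases "x \<in> K")
        case True
        then have "(norm x)\<^sup>2 \<le> R\<^sup>2" using R by (intro power_mono) auto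
        then have "1 \<le> exp (3 / 8 * R\<^sup>2) * exp (- (3 / 8) * (norm x)\<^sup>2)" unfolding exp_add[symmetric] by simp
        then have "\<bar>u x\<bar> * 1 \<le> \<bar>u x\<bar> * (exp (3 / 8 * R\<^sup>2) * exp (- (3 / 8) * (norm x)\<^sup>2))" by (rule mult_left_mono) simp
        then show ?thesis using True by (simp add: abs_mult mult_ac)
      qed simp
    qed
  qed measurable
qed

text \<open>Lebesgue measure is translation invariant, so difference quotients integrate to zero, and
  they converge boundedly to the derivative.\<close>

lemma integral_partial_deriv_zero:
  fixes v d :: "real ^ 'n::finite \<Rightarrow> real"
  assumes v: "continuous_on UNIV v" "\<And>x. R < norm x \<Longrightarrow> v x = 0"
    and d: "continuous_on UNIV d" "\<And>x. R < norm x \<Longrightarrow> d x = 0"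
    and der: "\<And>x t. ((\<lambda>t. v (x + t *\<^sub>R axis i 1)) has_real_derivative d (x + t *\<^sub>R axis i 1)) (at t)"
  shows "(LINT x|lborel. d x) = 0"
proof -
  obtain B where B: "0 \<le> B" "\<And>x. \<bar>d x\<bar> \<le> B" using continuous_compact_support_bounded[OF d] by blast
  have [measurable]: "v \<in> borel_measurable borel" "d \<in> borel_measurable borel"
    using borel_measurable_continuous_onI[OF v(1)] borel_measurable_continuous_onI[OF d(1)] by auto
  define h where "h N = 1 / real (Suc N)" for N
  have h0: "0 < h N" "h N \<le> 1" for N unfolding h_def by auto
  have hl: "h \<longlonglongrightarrow> 0" unfolding h_def[abs_def] by (rule LIMSEQ_Suc[OF lim_1_over_n])
  define Q where "Q N x = (v (h N *\<^sub>R axis i 1 + x) - v x) / h N" for N x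
  have vI: "integrable lborel v" using locally_integrable_compact_support[of "\<lambda>_. 1" v R] v by (simp add: continuous_locally_integrable)
  have Q0: "(LINT x|lborel. Q N x) = 0" for N
  proof -
    have "integrable lborel (\<lambda>x. v (h N *\<^sub>R axis i 1 + x))" "(LINT x|lborel. v (h N *\<^sub>R axis i 1 + x)) = (LINT x|lborel. v x)"
      using lborel_translate[of v] vI by auto
    then show ?thesis unfolding Q_def using vI by simp
  qed
  have "(\<lambda>N. LINT x|lborel. Q N x) \<longlonglongrightarrow> (LINT x|lborel. d x)"
  proof (rule integral_dominated_convergence[where w = "\<lambda>x. B * indicator (cball 0 (R + 1)) x"])
    show "d \<in> borel_measurable lborel" "Q N \<in> borel_measurable lborel" for N unfolding Q_def[abs_def] by measurable
    show "integrable lborel (\<lambda>x. B * indicator (cball 0 (R + 1)) x)"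
      by (intro integrable_mult_right integrable_real_indicator) (simp_all add: emeasure_bounded_finite[of "cball 0 (R + 1)", simplified])
    show "AE x in lborel. (\<lambda>N. Q N x) \<longlonglongrightarrow> d x"
    proof (rule AE_I2)
      fix x
      have "((\<lambda>e. (v (x + (0 + e) *\<^sub>R axis i 1) - v (x + 0 *\<^sub>R axis i 1)) / e) \<longlongrightarrow> d (x + 0 *\<^sub>R axis i 1)) (at 0)"
        using der[of x 0] unfolding DERIV_def .
      then have "((\<lambda>N. (v (x + (0 + h N) *\<^sub>R axis i 1) - v (x + 0 *\<^sub>R axis i 1)) / h N) \<longlongrightarrow> d (x + 0 *\<^sub>R axis i 1)) sequentially"
        by (rule tendsto_compose_eventually[OF _ hl]) (simp add: h_def)
      then show "(\<lambda>N. Q N x) \<longlonglongrightarrow> d x" unfolding Q_def by (simp add: add.commute)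
    qed
    show "AE x in lborel. norm (Q N x) \<le> B * indicator (cball 0 (R + 1)) x" for N
    proof (rule AE_I2)
      fix x
      show "norm (Q N x) \<le> B * indicator (cball 0 (R + 1)) x"
      proof (cases "norm x \<le> R + 1")
        case True
        obtain z where "0 < z" "z < h N" and z: "v (x + h N *\<^sub>R axis i 1) - v (x + 0 *\<^sub>R axis i 1) = (h N - 0) * d (x + z *\<^sub>R axis i 1)"
          using MVT2[OF h0(1)[of N], of "\<lambda>t. v (x + t *\<^sub>R axis i 1)" "\<lambda>t. d (x + t *\<^sub>R axis i 1)"] der by blast
        then have "Q N x = d (x + z *\<^sub>R axis i 1)" unfolding Q_def using h0(1)[of N] by (simp add: add.commute)
        then show ?thesis using True B by simp
      next
        case False
        have "norm x \<le> norm (h N *\<^sub>R axis i 1 + x) + norm (h N *\<^sub>R axis i 1 :: real ^ 'n)"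
          using norm_triangle_ineq4[of "h N *\<^sub>R axis i 1 + x" "h N *\<^sub>R axis i 1"] by simp
        moreover have "norm (h N *\<^sub>R axis i 1 :: real ^ 'n) \<le> 1" using h0[of N] by simp
        ultimately have "R < norm (h N *\<^sub>R axis i 1 + x)" "R < norm x" using False by linarith+
        then show ?thesis unfolding Q_def using v(2) False by simp
      qed
    qed
  qed
  then show ?thesis unfolding Q0 by (simp add: LIMSEQ_const_iff)
qed

text \<open>Integration by parts one derivative at a time: the product of \<open>F\<close> with a test function has compact
  support, so its partial derivatives integrate to zero.\<close>

lemma has_weak_deriv_prodf:
  fixes F :: "'n::finite \<Rightarrow> nat \<Rightarrow> real \<Rightarrow> real"
  assumes F: "\<And>i. deriv_seq (F i)"
  shows "has_weak_deriv (prodf (\<lambda>i. F i 0)) \<kappa> (prodf (\<lambda>i. F i (\<kappa> i)))"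
proof -
  let ?p = "\<lambda>k. prodf (\<lambda>i. F i (k i))"
  have pd: "?p k differentiable_on UNIV" for k by (rule prodf_differentiable[OF F])
  have pc: "continuous_on UNIV (?p k)" for k by (rule differentiable_imp_continuous_on[OF pd])
  have step: "(LINT x|lborel. ?p k x * partial_deriv j \<psi> x) = - (LINT x|lborel. ?p (k(j := Suc (k j))) x * \<psi> x)"
    if T: "test_function \<psi>" for \<psi> k j
  proof -
    let ?k = "k(j := Suc (k j))"
    have T': "test_function (partial_deriv j \<psi>)" by (rule test_function_partial_deriv[OF T])
    obtain R where R: "\<And>x. R < norm x \<Longrightarrow> \<psi> x = 0" using test_function_bounded_support[OF T] by blast
    obtain R' where R': "\<And>x. R' < norm x \<Longrightarrow> partial_deriv j \<psi> x = 0" using test_function_bounded_support[OF T'] by blast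
    have c: "continuous_on UNIV \<psi>" "continuous_on UNIV (partial_deriv j \<psi>)" using test_function_continuous T T' by auto
    have I: "integrable lborel (\<lambda>x. ?p ?k x * \<psi> x)" "integrable lborel (\<lambda>x. ?p k x * partial_deriv j \<psi> x)"
      by (rule locally_integrable_compact_support[OF continuous_locally_integrable[OF pc] c(1) R], assumption)
         (rule locally_integrable_compact_support[OF continuous_locally_integrable[OF pc] c(2) R'], assumption)
    have "(LINT x|lborel. ?p ?k x * \<psi> x + ?p k x * partial_deriv j \<psi> x) = 0"
    proof (rule integral_partial_deriv_zero[of "\<lambda>x. ?p k x * \<psi> x" "max R R'" _ j])
      show "continuous_on UNIV (\<lambda>x. ?p k x * \<psi> x)" by (intro continuous_intros pc c)
      show "continuous_on UNIV (\<lambda>x. ?p ?k x * \<psi> x + ?p k x * partial_deriv j \<psi> x)" by (intro continuous_intros pc c)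
      fix x t
      have "partial_deriv j (?p k) = ?p ?k" by (rule partial_deriv_prodf[OF F])
      then have "((\<lambda>t. ?p k (x + t *\<^sub>R axis j 1)) has_real_derivative ?p ?k (x + t *\<^sub>R axis j 1)) (at t)"
        using has_partial_deriv[OF pd, of k x j t] by simp
      moreover have "\<psi> differentiable_on UNIV" using test_functionD(1)[OF T, of "[]"] by simp
      ultimately have "((\<lambda>t. ?p k (x + t *\<^sub>R axis j 1) * \<psi> (x + t *\<^sub>R axis j 1)) has_real_derivative
          ?p ?k (x + t *\<^sub>R axis j 1) * \<psi> (x + t *\<^sub>R axis j 1) + partial_deriv j \<psi> (x + t *\<^sub>R axis j 1) * ?p k (x + t *\<^sub>R axis j 1)) (at t)"
        by (intro DERIV_mult has_partial_deriv)
      then show "((\<lambda>t. ?p k (x + t *\<^sub>R axis j 1) * \<psi> (x + t *\<^sub>R axis j 1)) has_real_derivative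
          ?p ?k (x + t *\<^sub>R axis j 1) * \<psi> (x + t *\<^sub>R axis j 1) + ?p k (x + t *\<^sub>R axis j 1) * partial_deriv j \<psi> (x + t *\<^sub>R axis j 1)) (at t)"
        by (simp only: mult.commute)
    qed (use R R' in auto)
    then show ?thesis using I by simp
  qed
  have main: "(LINT x|lborel. ?p k x * foldr partial_deriv is \<phi> x) = (- 1) ^ length is * (LINT x|lborel. ?p (\<lambda>i. k i + count_list is i) x * \<phi> x)"
    if T: "test_function \<phi>" for \<phi> k "is"
  proof (induction "is" arbitrary: k)
    case (Cons j js)
    have e: "(\<lambda>i. (k(j := Suc (k j))) i + count_list js i) = (\<lambda>i. k i + count_list (j # js) i)" by (rule ext) simp
    have "(LINT x|lborel. ?p k x * foldr partial_deriv (j # js) \<phi> x) = - (LINT x|lborel. ?p (k(j := Suc (k j))) x * foldr partial_deriv js \<phi> x)"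
      using step[OF test_function_foldr[OF T], of k j js] by simp
    also have "\<dots> = - ((- 1) ^ length js * (LINT x|lborel. ?p (\<lambda>i. k i + count_list (j # js) i) x * \<phi> x))"
      unfolding Cons.IH by (simp only: fun_cong[OF e])
    finally show ?case by simp
  qed simp
  show ?thesis
    unfolding has_weak_deriv_def
  proof (intro conjI allI impI)
    show "locally_integrable (prodf (\<lambda>i. F i 0))" "locally_integrable (?p \<kappa>)"
      using continuous_locally_integrable[OF pc[of "\<lambda>_. 0"]] continuous_locally_integrable[OF pc[of \<kappa>]] by auto
    fix \<phi> :: "real ^ 'n \<Rightarrow> real" assume T: "test_function \<phi>"
    show "(LINT x|lborel. prodf (\<lambda>i. F i 0) x * mi_deriv \<kappa> \<phi> x) = (- 1) ^ mi_size \<kappa> * (LINT x|lborel. ?p \<kappa> x * \<phi> x)"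
      using main[OF T, of "\<lambda>_. 0" "mi_list \<kappa>"] unfolding mi_deriv_eq_foldr by (simp add: count_mi_list length_mi_list)
  qed
qed

lemma mi_deriv_test_function: "test_function \<phi> \<Longrightarrow> test_function (mi_deriv \<kappa> \<phi>)"
  unfolding mi_deriv_eq_foldr by (rule test_function_foldr)

lemma locally_integrable_sum:
  assumes "finite A" "\<And>a. a \<in> A \<Longrightarrow> locally_integrable (u a)"
  shows "locally_integrable (\<lambda>x. \<Sum>a\<in>A. c a * u a x)"
  unfolding locally_integrable_def set_integrable_def
proof (intro allI impI)
  fix K :: "(real ^ 'b) set" assume "compact K"
  then have "integrable lborel (\<lambda>x. \<Sum>a\<in>A. c a * (indicator K x *\<^sub>R u a x))"
    using assms(2) unfolding locally_integrable_def set_integrable_def by (intro Bochner_Integration.integrable_sum integrable_mult_right) auto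
  then show "integrable lborel (\<lambda>x. indicator K x *\<^sub>R (\<Sum>a\<in>A. c a * u a x))"
    by (simp add: sum_distrib_left mult.left_commute)
qed

lemma has_weak_deriv_sum:
  assumes A: "finite A" and W: "\<And>a. a \<in> A \<Longrightarrow> has_weak_deriv (u a) \<kappa> (w a)"
  shows "has_weak_deriv (\<lambda>x. \<Sum>a\<in>A. c a * u a x) \<kappa> (\<lambda>x. \<Sum>a\<in>A. c a * w a x)"
  unfolding has_weak_deriv_def
proof (intro conjI allI impI)
  have li: "locally_integrable (u a)" "locally_integrable (w a)" if "a \<in> A" for a using W[OF that] unfolding has_weak_deriv_def by auto
  show "locally_integrable (\<lambda>x. \<Sum>a\<in>A. c a * u a x)" "locally_integrable (\<lambda>x. \<Sum>a\<in>A. c a * w a x)"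
    by (intro locally_integrable_sum A li; assumption)+
  fix \<phi> :: "real ^ 'b \<Rightarrow> real" assume T: "test_function \<phi>"
  have I: "integrable lborel (\<lambda>x. c a * (u a x * mi_deriv \<kappa> \<phi> x))" "integrable lborel (\<lambda>x. c a * (w a x * \<phi> x))" if "a \<in> A" for a
    by (intro integrable_mult_right locally_integrable_test_function li that T mi_deriv_test_function)+
  have "(LINT x|lborel. (\<Sum>a\<in>A. c a * u a x) * mi_deriv \<kappa> \<phi> x) = (LINT x|lborel. (\<Sum>a\<in>A. c a * (u a x * mi_deriv \<kappa> \<phi> x)))"
    by (simp only: sum_distrib_right mult.assoc)
  also have "\<dots> = (\<Sum>a\<in>A. c a * (LINT x|lborel. u a x * mi_deriv \<kappa> \<phi> x))"
    by (subst Bochner_Integration.integral_sum) (use I in auto)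
  also have "\<dots> = (\<Sum>a\<in>A. c a * ((- 1) ^ mi_size \<kappa> * (LINT x|lborel. w a x * \<phi> x)))"
    using W T unfolding has_weak_deriv_def by (intro sum.cong) auto
  also have "\<dots> = (- 1) ^ mi_size \<kappa> * (\<Sum>a\<in>A. LINT x|lborel. c a * (w a x * \<phi> x))"
    by (simp add: sum_distrib_left mult.left_commute)
  also have "(\<Sum>a\<in>A. LINT x|lborel. c a * (w a x * \<phi> x)) = (LINT x|lborel. (\<Sum>a\<in>A. c a * (w a x * \<phi> x)))"
    by (subst Bochner_Integration.integral_sum) (use I in auto)
  also have "\<dots> = (LINT x|lborel. (\<Sum>a\<in>A. c a * w a x) * \<phi> x)" by (simp only: sum_distrib_right mult.assoc)
  finally show "(LINT x|lborel. (\<Sum>a\<in>A. c a * u a x) * mi_deriv \<kappa> \<phi> x) = (- 1) ^ mi_size \<kappa> * (LINT x|lborel. (\<Sum>a\<in>A. c a * w a x) * \<phi> x)" .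
qed

lemma has_weak_deriv_zero:
  fixes u :: "real ^ 'n::finite \<Rightarrow> real"
  assumes "locally_integrable u" shows "has_weak_deriv u (\<lambda>_. 0) u"
proof -
  have "mi_list (\<lambda>_ :: 'n. 0) = []" unfolding mi_list_def by (simp add: concat_eq_Nil_conv)
  then show ?thesis using assms unfolding has_weak_deriv_def mi_deriv_eq_foldr by (simp add: mi_size_def)
qed

lemma D_AE:
  fixes f :: "real ^ 'n::finite \<Rightarrow> real"
  assumes W: "has_weak_deriv f \<kappa> g"
  shows "AE x in gauss. D \<kappa> f x = g x / sqrt (\<Prod>i\<in>UNIV. fact (\<kappa> i))"
    and "D \<kappa> f \<in> borel_measurable borel"
proof -
  define w where "w = (SOME g. has_weak_deriv f \<kappa> g)"
  have w: "has_weak_deriv f \<kappa> w" unfolding w_def using W by (rule someI[of "has_weak_deriv f \<kappa>"])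
  have e: "D \<kappa> f = (\<lambda>x. w x / sqrt (\<Prod>i\<in>UNIV. fact (\<kappa> i)))"
    unfolding D_def[abs_def] w_def real_sqrt_prod_fact by simp
  have "AE x in gauss. w x = g x" unfolding AE_gauss_iff by (rule weak_deriv_unique[OF w W])
  then show "AE x in gauss. D \<kappa> f x = g x / sqrt (\<Prod>i\<in>UNIV. fact (\<kappa> i))" unfolding e by eventually_elim simp
  have [measurable]: "w \<in> borel_measurable borel" using w locally_integrable_measurable unfolding has_weak_deriv_def by blast
  show "D \<kappa> f \<in> borel_measurable borel" unfolding e by measurable
qed

lemma D_0_AE: "f \<in> L2_gauss \<Longrightarrow> AE x in gauss. D (\<lambda>_. 0) f x = f x"
  using D_AE(1)[OF has_weak_deriv_zero[OF L2_gauss_locally_integrable]] by simp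

section \<open>The null space of the iterated gradient\<close>

lemma prodf_poly_L2: "prodf (\<lambda>i. poly (P i)) \<in> L2_gauss"
proof (rule L2_gaussI)
  show "prodf (\<lambda>i. poly (P i)) \<in> borel_measurable borel" unfolding prodf_def by measurable
  have "integrable gauss (\<lambda>x. \<Prod>i\<in>UNIV. poly (P i * P i) (x $ i))"
    by (rule gauss_integral_prod(1)) (rule std_normal_poly_integrable, measurable)
  then show "integrable gauss (\<lambda>x. (prodf (\<lambda>i. poly (P i)) x)\<^sup>2)"
    unfolding prodf_def power2_eq_square prod.distrib[symmetric] by simp
qed

definition dherm :: "('n::finite \<Rightarrow> nat) \<Rightarrow> ('n \<Rightarrow> nat) \<Rightarrow> real ^ 'n \<Rightarrow> real" where
  "dherm \<alpha> \<kappa> = prodf (\<lambda>i. poly ((pderiv ^^ \<kappa> i) (smult (1 / sqrt (fact (\<alpha> i))) (He (\<alpha> i)))))"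

lemma has_weak_deriv_herm: "has_weak_deriv (herm \<alpha>) \<kappa> (dherm \<alpha> \<kappa>)"
proof -
  let ?F = "\<lambda>i m. poly ((pderiv ^^ m) (smult (1 / sqrt (fact (\<alpha> i))) (He (\<alpha> i))))"
  have "deriv_seq (?F i)" for i unfolding deriv_seq_def by (simp add: poly_DERIV)
  from has_weak_deriv_prodf[of ?F, OF this] have "has_weak_deriv (prodf (\<lambda>i. ?F i 0)) \<kappa> (dherm \<alpha> \<kappa>)" unfolding dherm_def .
  also have "prodf (\<lambda>i. ?F i 0) = herm \<alpha>" unfolding prodf_def herm_def by (simp add: fun_eq_iff)
  finally show ?thesis .
qed

lemma dherm_zero:
  assumes "mi_size \<alpha> < mi_size \<kappa>" shows "dherm \<alpha> \<kappa> x = 0"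
proof -
  obtain i where "\<alpha> i < \<kappa> i" using assms sum_mono[of UNIV \<kappa> \<alpha>] unfolding mi_size_def by (meson leD not_le_imp_less)
  then have "(pderiv ^^ \<kappa> i) (smult (1 / sqrt (fact (\<alpha> i))) (He (\<alpha> i))) = 0"
    by (simp add: pderiv_funpow_smult pderiv_funpow_He)
  then show ?thesis unfolding dherm_def prodf_def by (intro prod_zero bexI[of _ i]) simp_all
qed

lemma herm_sum_null_space:
  fixes A :: "('n::finite \<Rightarrow> nat) set"
  assumes A: "finite A" "\<And>\<alpha>. \<alpha> \<in> A \<Longrightarrow> mi_size \<alpha> < k"
  shows "(\<lambda>x. \<Sum>\<alpha>\<in>A. c \<alpha> * herm \<alpha> x) \<in> nabla_null_space k"
proof -
  let ?h = "\<lambda>x. \<Sum>\<alpha>\<in>A. c \<alpha> * herm \<alpha> x"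
  have W: "has_weak_deriv ?h \<kappa> (\<lambda>x. \<Sum>\<alpha>\<in>A. c \<alpha> * dherm \<alpha> \<kappa> x)" for \<kappa>
    by (intro has_weak_deriv_sum A(1) has_weak_deriv_herm)
  have "D \<kappa> ?h \<in> L2_gauss" for \<kappa>
  proof (rule L2_gauss_AE_cong[OF _ D_AE(2)[OF W]])
    show "(\<lambda>x. 1 / sqrt (\<Prod>i\<in>UNIV. fact (\<kappa> i)) * (\<Sum>\<alpha>\<in>A. c \<alpha> * dherm \<alpha> \<kappa> x)) \<in> L2_gauss"
      unfolding dherm_def by (intro L2_gauss_cmult L2_gauss_sum A(1) prodf_poly_L2)
    show "AE x in gauss. 1 / sqrt (\<Prod>i\<in>UNIV. fact (\<kappa> i)) * (\<Sum>\<alpha>\<in>A. c \<alpha> * dherm \<alpha> \<kappa> x) = D \<kappa> ?h x"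
      using D_AE(1)[OF W[of \<kappa>]] by eventually_elim simp
  qed
  moreover have "?h \<in> L2_gauss" by (intro L2_gauss_sum A(1) L2_gauss_cmult herm_L2)
  moreover have "AE x in gauss. D \<kappa> ?h x = 0" if k: "mi_size \<kappa> = k" for \<kappa>
    using D_AE(1)[OF W[of \<kappa>]]
  proof eventually_elim
    case (elim x)
    have "(\<Sum>\<alpha>\<in>A. c \<alpha> * dherm \<alpha> \<kappa> x) = 0" using A(2) k by (intro sum.neutral) (simp add: dherm_zero)
    with elim show ?case by simp
  qed
  ultimately show ?thesis unfolding nabla_null_space_def Hk_gauss_def using W by blast
qed

lemma herm_null_space: "mi_size \<alpha> < k \<Longrightarrow> herm \<alpha> \<in> nabla_null_space k"
  using herm_sum_null_space[of "{\<alpha>}" k "\<lambda>_. 1"] by simp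

lemma sub_multi_index:
  fixes \<alpha> :: "'n::finite \<Rightarrow> nat"
  shows "k \<le> mi_size \<alpha> \<Longrightarrow> \<exists>\<kappa>. mi_size \<kappa> = k \<and> (\<forall>i. \<kappa> i \<le> \<alpha> i)"
proof (induction k)
  case 0 show ?case by (rule exI[of _ "\<lambda>_. 0"]) (simp add: mi_size_def)
next
  case (Suc k)
  then obtain \<kappa> where \<kappa>: "mi_size \<kappa> = k" "\<And>i. \<kappa> i \<le> \<alpha> i" by auto
  have "\<exists>j. \<kappa> j < \<alpha> j"
  proof (rule ccontr)
    assume "\<nexists>j. \<kappa> j < \<alpha> j"
    then have "mi_size \<alpha> \<le> mi_size \<kappa>" unfolding mi_size_def by (intro sum_mono) (simp add: not_less)
    then show False using Suc.prems \<kappa>(1) by simp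
  qed
  then obtain j where j: "\<kappa> j < \<alpha> j" by blast
  have "mi_size (\<kappa>(j := Suc (\<kappa> j))) = Suc k"
    using \<kappa>(1) unfolding mi_size_def by (simp add: sum.remove[of UNIV j])
  moreover have "\<forall>i. (\<kappa>(j := Suc (\<kappa> j))) i \<le> \<alpha> i" using \<kappa>(2) j by auto
  ultimately show ?case by blast
qed

text \<open>The coefficient at \<open>\<alpha>\<close> is a nonzero multiple of a coefficient of \<open>D \<kappa> h = 0\<close>, for any \<open>\<kappa> \<le> \<alpha>\<close> of
  size \<open>k\<close>.\<close>

lemma null_space_hcoef:
  assumes h: "h \<in> nabla_null_space k" and \<alpha>: "k \<le> mi_size \<alpha>" shows "hcoef \<alpha> h = 0"
proof -
  obtain \<kappa> where \<kappa>: "mi_size \<kappa> = k" "\<And>i. \<kappa> i \<le> \<alpha> i" using sub_multi_index[OF \<alpha>] by blast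
  have H: "h \<in> Hk_gauss k" and z: "AE x in gauss. D \<kappa> h x = 0" using h \<kappa>(1) unfolding nabla_null_space_def by auto
  have "hcoef (\<lambda>i. \<alpha> i - \<kappa> i) (D \<kappa> h) = inner_gauss (\<lambda>_. 0) (herm (\<lambda>i. \<alpha> i - \<kappa> i))"
    unfolding hcoef_def
    using z L2_gaussD(1)[OF Hk_gauss_L2(2)[OF H, of \<kappa>]] \<kappa>(1) by (intro inner_gauss_AE_cong) auto
  then have "(hcoef (\<lambda>i. \<alpha> i - \<kappa> i) (D \<kappa> h))\<^sup>2 = 0" by (simp add: inner_gauss_def)
  moreover have "(\<lambda>i. \<alpha> i - \<kappa> i + \<kappa> i) = \<alpha>" using \<kappa>(2) by simp
  moreover have "(\<Prod>i\<in>UNIV. real ((\<alpha> i - \<kappa> i + \<kappa> i) choose \<kappa> i)) \<noteq> 0" using \<kappa>(2) by (simp add: binomial_eq_0_iff not_less)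
  ultimately show ?thesis using hcoef_D[OF H, of \<kappa> "\<lambda>i. \<alpha> i - \<kappa> i"] \<kappa>(1) by simp
qed

lemma hcoef_sum_herm:
  assumes "finite A"
  shows "hcoef \<beta> (\<lambda>x. \<Sum>\<alpha>\<in>A. c \<alpha> * herm \<alpha> x) = (if \<beta> \<in> A then c \<beta> else 0)"
proof -
  have "hcoef \<beta> (\<lambda>x. \<Sum>\<alpha>\<in>A. c \<alpha> * herm \<alpha> x) = (\<Sum>\<alpha>\<in>A. c \<alpha> * (if \<alpha> = \<beta> then 1 else 0))"
    unfolding hcoef_def by (subst inner_gauss_sum_left) (simp_all add: assms inner_gauss_cmult_left herm_orthonormal L2_gauss_cmult)
  then show ?thesis using assms by (simp add: if_distrib[of "\<lambda>x. _ * x"] cong: if_cong)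
qed

lemma hcoef_zero_AE_zero:
  assumes r: "r \<in> L2_gauss" and z: "\<And>\<alpha>. hcoef \<alpha> r = 0" shows "AE x in gauss. r x = 0"
proof -
  have "(\<lambda>m. 0) sums inner_gauss r r" using parseval[OF r] unfolding hweight_def z by simp
  then have "(LINT x|gauss. (r x)\<^sup>2) = 0" unfolding inner_gauss_def by (simp add: sums_iff power2_eq_square)
  then show ?thesis using integral_nonneg_eq_0_iff_AE[of gauss "\<lambda>x. (r x)\<^sup>2"] L2_gaussD(2)[OF r] by simp
qed

text \<open>The Hermite polynomials of degree less than \<open>k\<close> span the null space, so removing the Hermite
  coefficients of low degree from \<open>f\<close> yields the orthogonal component.\<close>

lemma ge_part_properties:
  fixes f :: "real ^ 'n::finite \<Rightarrow> real"
  assumes f: "f \<in> L2_gauss"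
  shows "ge_part k f \<in> L2_gauss" "(\<lambda>x. f x - ge_part k f x) \<in> nabla_null_space k"
    "\<And>h. h \<in> nabla_null_space k \<Longrightarrow> inner_gauss (ge_part k f) h = 0"
proof -
  let ?A = "{\<alpha> :: 'n \<Rightarrow> nat. mi_size \<alpha> < k}"
  define proj where "proj u x = (\<Sum>\<alpha>\<in>?A. hcoef \<alpha> u * herm \<alpha> x)" for u x
  have A: "finite ?A" by (rule finite_mi_size_less)
  have pn: "proj u \<in> nabla_null_space k" for u unfolding proj_def[abs_def] by (rule herm_sum_null_space[OF A]) simp
  then have pL: "proj u \<in> L2_gauss" for u unfolding nabla_null_space_def using Hk_gauss_L2(1) by blast
  have ph: "hcoef \<beta> (proj u) = (if mi_size \<beta> < k then hcoef \<beta> u else 0)" for \<beta> u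
    unfolding proj_def[abs_def] hcoef_sum_herm[OF A] by simp
  have hd: "hcoef \<beta> (\<lambda>x. u x - v x) = hcoef \<beta> u - hcoef \<beta> v" if "u \<in> L2_gauss" "v \<in> L2_gauss" for u v \<beta>
    unfolding hcoef_def by (rule inner_gauss_diff_left[OF that herm_L2])
  define g where "g x = f x - proj f x" for x
  have gL: "g \<in> L2_gauss" unfolding g_def[abs_def] by (rule L2_gauss_diff[OF f pL])
  have gh: "hcoef \<beta> g = 0" if "mi_size \<beta> < k" for \<beta> unfolding g_def[abs_def] hd[OF f pL] ph using that by simp
  have orth: "inner_gauss g h = 0" if h: "h \<in> nabla_null_space k" for h
  proof -
    have hL: "h \<in> L2_gauss" using h unfolding nabla_null_space_def using Hk_gauss_L2(1) by blast
    have "AE x in gauss. h x - proj h x = 0"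
    proof (rule hcoef_zero_AE_zero[OF L2_gauss_diff[OF hL pL]])
      fix \<alpha> :: "'n \<Rightarrow> nat"
      show "hcoef \<alpha> (\<lambda>x. h x - proj h x) = 0" unfolding hd[OF hL pL] ph using null_space_hcoef[OF h, of \<alpha>] by auto
    qed
    then have "AE x in gauss. h x = proj h x" by eventually_elim simp
    then have "inner_gauss h g = inner_gauss (proj h) g"
      using L2_gaussD(1)[OF hL] L2_gaussD(1)[OF pL] L2_gaussD(1)[OF gL] by (intro inner_gauss_AE_cong) auto
    also have "\<dots> = (\<Sum>\<alpha>\<in>?A. hcoef \<alpha> h * hcoef \<alpha> g)"
      unfolding proj_def[abs_def]
      by (subst inner_gauss_sum_left) (auto simp: A gL inner_gauss_cmult_left L2_gauss_cmult hcoef_def inner_gauss_commute[of g])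
    also have "\<dots> = 0" using gh by (intro sum.neutral) auto
    finally show ?thesis by (simp add: inner_gauss_commute)
  qed
  have "(\<lambda>x. f x - g x) = proj f" unfolding g_def by simp
  then have "g \<in> L2_gauss \<and> (\<lambda>x. f x - g x) \<in> nabla_null_space k \<and> (\<forall>h\<in>nabla_null_space k. inner_gauss g h = 0)"
    using gL pn orth by simp
  then have "\<exists>g. g \<in> L2_gauss \<and> (\<lambda>x. f x - g x) \<in> nabla_null_space k \<and> (\<forall>h\<in>nabla_null_space k. inner_gauss g h = 0)" by (rule exI[where x = g])
  then have "ge_part k f \<in> L2_gauss \<and> (\<lambda>x. f x - ge_part k f x) \<in> nabla_null_space k \<and> (\<forall>h\<in>nabla_null_space k. inner_gauss (ge_part k f) h = 0)"
    unfolding ge_part_def by (rule someI_ex)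
  then show "ge_part k f \<in> L2_gauss" "(\<lambda>x. f x - ge_part k f x) \<in> nabla_null_space k"
    "\<And>h. h \<in> nabla_null_space k \<Longrightarrow> inner_gauss (ge_part k f) h = 0" by auto
qed

text \<open>Whatever function is chosen as the orthogonal component, its coefficients of degree below \<open>k\<close>
  vanish and the others are those of \<open>f\<close>.\<close>

lemma W_ge_sums:
  fixes f :: "real ^ 'n::finite \<Rightarrow> real"
  assumes f: "f \<in> L2_gauss" shows "(\<lambda>m. hweight (m + k) f) sums W_ge k f"
proof -
  let ?g = "ge_part k f"
  note g = ge_part_properties[OF f, where k = k]
  have low: "hcoef \<alpha> ?g = 0" if "mi_size \<alpha> < k" for \<alpha> unfolding hcoef_def by (rule g(3)[OF herm_null_space[OF that]])
  have high: "hcoef \<alpha> ?g = hcoef \<alpha> f" if "k \<le> mi_size \<alpha>" for \<alpha>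
  proof -
    have "hcoef \<alpha> (\<lambda>x. f x - ?g x) = hcoef \<alpha> f - hcoef \<alpha> ?g" unfolding hcoef_def by (rule inner_gauss_diff_left[OF f g(1) herm_L2])
    then show ?thesis using null_space_hcoef[OF g(2) that] by simp
  qed
  have w: "hweight m ?g = 0" if "m < k" for m unfolding hweight_def using that low by (intro sum.neutral) auto
  have w': "hweight (m + k) ?g = hweight (m + k) f" for m unfolding hweight_def using high by (intro sum.cong) auto
  have "(\<lambda>m. hweight (m + k) ?g) sums (inner_gauss ?g ?g - (\<Sum>m<k. hweight m ?g))"
    by (rule sums_split_initial_segment[OF parseval[OF g(1)]])
  then have "(\<lambda>m. hweight (m + k) f) sums inner_gauss ?g ?g" unfolding w' using w by simp
  moreover have "W_ge k f = inner_gauss ?g ?g"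
  proof -
    have "(LINT x|gauss. \<bar>?g x\<bar> powr 2) = inner_gauss ?g ?g"
      unfolding inner_gauss_def by (intro Bochner_Integration.integral_cong refl) (simp add: powr_numeral power2_eq_square)
    then show ?thesis unfolding W_ge_def Lp_gauss_def using inner_gauss_self_nonneg[of ?g] by (simp add: powr_half_sqrt)
  qed
  ultimately show ?thesis by simp
qed

section \<open>Weights of derivatives\<close>

text \<open>Compare coefficients in \<open>\<Prod>\<^sub>i (1 + X)\<^bsup>\<alpha> i\<^esup> = (1 + X)\<^bsup>mi_size \<alpha>\<^esup>\<close>.\<close>

lemma multi_vandermonde:
  fixes \<alpha> :: "'n::finite \<Rightarrow> nat"
  shows "(\<Sum>\<kappa> | mi_size \<kappa> = k. \<Prod>i\<in>UNIV. real (\<alpha> i choose \<kappa> i)) = real (mi_size \<alpha> choose k)"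
proof -
  have coeff_power: "coeff ([:1, 1::real:] ^ a) j = real (a choose j)" for a j
  proof (cases "j \<le> a")
    case False
    then have "degree ([:1, 1::real:] ^ a) < j" using degree_power_le[of "[:1, 1::real:]" a] by simp
    then show ?thesis using False by (simp add: coeff_eq_0 binomial_eq_0)
  qed (simp add: coeff_linear_poly_power)
  have "coeff (\<Prod>i\<in>UNIV. [:1, 1:] ^ \<alpha> i) k = (\<Sum>\<kappa> | mi_size \<kappa> = k. \<Prod>i\<in>UNIV. real (\<alpha> i choose \<kappa> i))"
  proof -
    have e: "[:1, 1:] ^ a = (\<Sum>j\<in>{..N}. monom (real (a choose j)) j)" if "a \<le> N" for a N
      using that by (intro poly_eqI) (simp add: coeff_sum coeff_power)
    \<comment> \<open>large enough for every multi-index of size \<open>k\<close> and every exponent \<open>\<alpha> i\<close>\<close>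
    define N where "N = mi_size \<alpha> + k"
    have aN: "\<alpha> i \<le> N" for i unfolding N_def mi_size_def using member_le_sum[of i UNIV \<alpha>] by simp
    have "(\<Prod>i\<in>UNIV. [:1, 1:] ^ \<alpha> i) = (\<Prod>i\<in>UNIV. \<Sum>j\<in>{..N}. monom (real (\<alpha> i choose j)) j)"
      by (intro prod.cong refl e aN)
    also have "\<dots> = (\<Sum>\<kappa>\<in>PiE UNIV (\<lambda>_. {..N}). \<Prod>i\<in>UNIV. monom (real (\<alpha> i choose \<kappa> i)) (\<kappa> i))"
      by (rule prod_sum_PiE) auto
    also have "\<dots> = (\<Sum>\<kappa>\<in>PiE UNIV (\<lambda>_. {..N}). monom (\<Prod>i\<in>UNIV. real (\<alpha> i choose \<kappa> i)) (mi_size \<kappa>))"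
    proof (intro sum.cong refl)
      have "(\<Prod>i\<in>A. monom (c i) (d i)) = monom (\<Prod>i\<in>A. c i) (\<Sum>i\<in>A. d i)" if "finite A" for A and c :: "'n \<Rightarrow> real" and d
        using that by induction (auto simp: mult_monom)
      then show "(\<Prod>i\<in>UNIV. monom (real (\<alpha> i choose \<kappa> i)) (\<kappa> i)) = monom (\<Prod>i\<in>UNIV. real (\<alpha> i choose \<kappa> i)) (mi_size \<kappa>)" for \<kappa>
        unfolding mi_size_def by simp
    qed
    finally have "coeff (\<Prod>i\<in>UNIV. [:1, 1:] ^ \<alpha> i) k = (\<Sum>\<kappa>\<in>PiE UNIV (\<lambda>_. {..N}). if mi_size \<kappa> = k then \<Prod>i\<in>UNIV. real (\<alpha> i choose \<kappa> i) else 0)"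
      by (simp add: coeff_sum)
    also have "\<dots> = (\<Sum>\<kappa> | mi_size \<kappa> = k. \<Prod>i\<in>UNIV. real (\<alpha> i choose \<kappa> i))"
    proof (subst sum.inter_filter[symmetric])
      show "finite (PiE (UNIV :: 'n set) (\<lambda>_. {..N}))" by (simp add: finite_PiE)
      have bd: "\<kappa> i \<le> N" if "mi_size \<kappa> = k" for \<kappa> :: "'n \<Rightarrow> nat" and i
        using that member_le_sum[of i UNIV \<kappa>] unfolding mi_size_def N_def by simp
      have "{\<kappa> \<in> PiE (UNIV :: 'n set) (\<lambda>_. {..N}). mi_size \<kappa> = k} = {\<kappa>. mi_size \<kappa> = k}"
        unfolding PiE_UNIV_domain Pi_def mem_Collect_eq atMost_iff using bd by blast
      then show "(\<Sum>\<kappa>\<in>{\<kappa> \<in> PiE UNIV (\<lambda>_. {..N}). mi_size \<kappa> = k}. \<Prod>i\<in>UNIV. real (\<alpha> i choose \<kappa> i)) = (\<Sum>\<kappa> | mi_size \<kappa> = k. \<Prod>i\<in>UNIV. real (\<alpha> i choose \<kappa> i))" by (rule sum.cong[OF _ refl])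
    qed
    finally show ?thesis .
  qed
  moreover have "(\<Prod>i\<in>UNIV. [:1, 1:] ^ \<alpha> i) = [:1, 1::real:] ^ mi_size \<alpha>" unfolding mi_size_def by (simp add: power_sum)
  ultimately show ?thesis by (simp only: coeff_power)
qed

text \<open>A Hermite coefficient of \<open>f\<close> at \<open>\<alpha>\<close> is seen by all derivatives of order \<open>\<kappa> \<le> \<alpha>\<close>; the weights add up
  to a number that depends only on the degree of \<open>\<alpha>\<close>.\<close>

lemma sum_hweight_D:
  fixes f :: "real ^ 'n::finite \<Rightarrow> real"
  assumes f: "f \<in> Hk_gauss k"
  shows "(\<Sum>\<kappa> | mi_size \<kappa> = k. hweight m (D \<kappa> f)) = real ((m + k) choose k) * hweight (m + k) f"
proof -
  let ?K = "{\<kappa> :: 'n \<Rightarrow> nat. mi_size \<kappa> = k}" and ?B = "{\<beta> :: 'n \<Rightarrow> nat. mi_size \<beta> = m}" and ?A = "{\<alpha> :: 'n \<Rightarrow> nat. mi_size \<alpha> = m + k}"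
  let ?t = "\<lambda>\<kappa> \<alpha>. (\<Prod>i\<in>UNIV. real (\<alpha> i choose \<kappa> i)) * (hcoef \<alpha> f)\<^sup>2"
  have fin: "finite ?K" "finite ?B" "finite ?A" by (rule finite_mi_size)+
  have "hweight m (D \<kappa> f) = (\<Sum>\<alpha>\<in>?A. ?t \<kappa> \<alpha>)" if k: "mi_size \<kappa> = k" for \<kappa>
  proof -
    have "hweight m (D \<kappa> f) = (\<Sum>\<beta>\<in>?B. ?t \<kappa> (\<lambda>i. \<beta> i + \<kappa> i))"
      unfolding hweight_def using hcoef_D[OF f, of \<kappa>] k by simp
    also have "\<dots> = (\<Sum>\<alpha>\<in>{\<alpha> \<in> ?A. \<forall>i. \<kappa> i \<le> \<alpha> i}. ?t \<kappa> \<alpha>)"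
      using k by (intro sum.reindex_bij_witness[of _ "\<lambda>\<alpha> i. \<alpha> i - \<kappa> i" "\<lambda>\<beta> i. \<beta> i + \<kappa> i"])
        (auto simp: mi_size_def sum.distrib sum_subtractf_nat)
    also have "\<dots> = (\<Sum>\<alpha>\<in>?A. ?t \<kappa> \<alpha>)"
    proof (rule sum.mono_neutral_left[OF fin(3)])
      show "\<forall>\<alpha>\<in>?A - {\<alpha> \<in> ?A. \<forall>i. \<kappa> i \<le> \<alpha> i}. ?t \<kappa> \<alpha> = 0"
      proof
        fix \<alpha> assume "\<alpha> \<in> ?A - {\<alpha> \<in> ?A. \<forall>i. \<kappa> i \<le> \<alpha> i}"
        then obtain i where "\<alpha> i < \<kappa> i" by (auto simp: not_le)
        then have "(\<Prod>i\<in>UNIV. real (\<alpha> i choose \<kappa> i)) = 0" by (intro prod_zero) (auto intro!: bexI[of _ i] simp: binomial_eq_0)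
        then show "?t \<kappa> \<alpha> = 0" by simp
      qed
    qed auto
    finally show ?thesis .
  qed
  then have "(\<Sum>\<kappa>\<in>?K. hweight m (D \<kappa> f)) = (\<Sum>\<kappa>\<in>?K. \<Sum>\<alpha>\<in>?A. ?t \<kappa> \<alpha>)" by (intro sum.cong) auto
  also have "\<dots> = (\<Sum>\<alpha>\<in>?A. \<Sum>\<kappa>\<in>?K. ?t \<kappa> \<alpha>)" by (rule sum.swap)
  also have "\<dots> = (\<Sum>\<alpha>\<in>?A. real ((m + k) choose k) * (hcoef \<alpha> f)\<^sup>2)"
    by (intro sum.cong refl) (simp add: sum_distrib_right[symmetric] multi_vandermonde)
  also have "\<dots> = real ((m + k) choose k) * hweight (m + k) f" unfolding hweight_def by (simp add: sum_distrib_left)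
  finally show ?thesis .
qed

section \<open>The correlation function of a family\<close>

lemma L2_set_L2_gauss:
  assumes S: "finite S" and g: "\<And>\<kappa>. \<kappa> \<in> S \<Longrightarrow> g \<kappa> \<in> L2_gauss"
  shows "(\<lambda>x. L2_set (\<lambda>\<kappa>. g \<kappa> x) S) \<in> L2_gauss"
proof (rule L2_gaussI)
  have [measurable]: "\<kappa> \<in> S \<Longrightarrow> g \<kappa> \<in> borel_measurable borel" for \<kappa> using L2_gaussD[OF g] by simp
  show "(\<lambda>x. L2_set (\<lambda>\<kappa>. g \<kappa> x) S) \<in> borel_measurable borel" unfolding L2_set_def by measurable
  have "integrable gauss (\<lambda>x. \<Sum>\<kappa>\<in>S. (g \<kappa> x)\<^sup>2)" using L2_gaussD(2)[OF g] by simp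
  then show "integrable gauss (\<lambda>x. (L2_set (\<lambda>\<kappa>. g \<kappa> x) S)\<^sup>2)"
    unfolding L2_set_def by (simp add: sum_nonneg)
qed

lemma sum_mult_le_L2_set: "(\<Sum>i\<in>S. a i * b i) \<le> L2_set a S * L2_set b S"
proof -
  have "(\<Sum>i\<in>S. a i * b i) \<le> (\<Sum>i\<in>S. \<bar>a i\<bar> * \<bar>b i\<bar>)" by (intro sum_mono) (simp add: abs_mult[symmetric])
  also have "\<dots> \<le> L2_set a S * L2_set b S" by (rule L2_set_mult_ineq)
  finally show ?thesis .
qed

lemma L2_set_sq: "finite S \<Longrightarrow> (L2_set f S)\<^sup>2 = (\<Sum>i\<in>S. (f i)\<^sup>2)"
  unfolding L2_set_def by (simp add: sum_nonneg)

text \<open>Minkowski's inequality for the average that defines \<open>OU\<close>, by testing against the vector of averages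
  itself.\<close>

lemma OU_L2_set_le:
  fixes g :: "'k \<Rightarrow> real ^ 'n::finite \<Rightarrow> real"
  assumes S: "finite S" and g: "\<And>\<kappa>. \<kappa> \<in> S \<Longrightarrow> g \<kappa> \<in> L2_gauss" and s: "0 \<le> s" "s < 1"
  shows "AE x in gauss. L2_set (\<lambda>\<kappa>. OU s (g \<kappa>) x) S \<le> OU s (\<lambda>x. L2_set (\<lambda>\<kappa>. g \<kappa> x) S) x"
proof -
  let ?N = "\<lambda>x. L2_set (\<lambda>\<kappa>. g \<kappa> x) S"
  let ?y = "\<lambda>x z. s *\<^sub>R x + sqrt (1 - s\<^sup>2) *\<^sub>R z"
  have "AE x in gauss. \<forall>\<kappa>\<in>S. integrable gauss (\<lambda>z. g \<kappa> (?y x z))"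
    by (intro AE_finite_allI S OU_AE_integrable s L2_gauss_integrable g)
  moreover have "AE x in gauss. integrable gauss (\<lambda>z. ?N (?y x z))"
    by (intro OU_AE_integrable s L2_gauss_integrable L2_set_L2_gauss S g)
  ultimately show ?thesis
  proof eventually_elim
    case (elim x)
    let ?O = "L2_set (\<lambda>\<kappa>. OU s (g \<kappa>) x) S"
    have "?O\<^sup>2 = (\<Sum>\<kappa>\<in>S. LINT z|gauss. OU s (g \<kappa>) x * g \<kappa> (?y x z))"
      unfolding L2_set_sq[OF S] integral_mult_right_zero by (simp add: OU_def power2_eq_square)
    also have "\<dots> = (LINT z|gauss. (\<Sum>\<kappa>\<in>S. OU s (g \<kappa>) x * g \<kappa> (?y x z)))"
      by (subst Bochner_Integration.integral_sum) (use elim(1) in auto)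
    also have "\<dots> \<le> (LINT z|gauss. ?O * ?N (?y x z))"
    proof (rule integral_mono)
      show "integrable gauss (\<lambda>z. \<Sum>\<kappa>\<in>S. OU s (g \<kappa>) x * g \<kappa> (?y x z))"
        by (intro Bochner_Integration.integrable_sum integrable_mult_right) (use elim(1) in auto)
      show "integrable gauss (\<lambda>z. ?O * ?N (?y x z))" using elim(2) by (rule integrable_mult_right)
    qed (rule sum_mult_le_L2_set)
    also have "\<dots> = ?O * OU s ?N x" by (simp add: OU_def)
    finally have sq: "?O * ?O \<le> ?O * OU s ?N x" by (simp add: power2_eq_square)
    have "0 \<le> OU s ?N x" unfolding OU_def by (intro integral_nonneg_AE) simp
    then show ?case using sq L2_set_nonneg[of "\<lambda>\<kappa>. OU s (g \<kappa>) x" S] by (cases "?O = 0") (auto simp: mult_le_cancel_left)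
  qed
qed

lemma OU_powr_le:
  fixes N :: "real ^ 'n::finite \<Rightarrow> real"
  assumes N: "N \<in> L2_gauss" "\<And>x. 0 \<le> N x" and s: "0 \<le> s" "s < 1" and r: "1 \<le> r" "r \<le> 2"
  shows "AE x in gauss. OU s N x powr r \<le> OU s (\<lambda>x. N x powr r) x"
proof -
  have I: "integrable gauss (\<lambda>x. N x powr r)" using L2_gauss_powr_integrable[OF N, of r] r by simp
  show ?thesis
    using OU_AE_integrable[OF s L2_gauss_integrable[OF N(1)]] OU_AE_integrable[OF s I]
  proof eventually_elim
    case (elim x)
    then show ?case unfolding OU_def by (intro gauss_jensen_powr) (use N r in auto)
  qed
qed

lemma OU_L2_set_powr_integral_le:
  fixes g :: "'k \<Rightarrow> real ^ 'n::finite \<Rightarrow> real"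
  assumes S: "finite S" and g: "\<And>\<kappa>. \<kappa> \<in> S \<Longrightarrow> g \<kappa> \<in> L2_gauss" and s: "0 \<le> s" "s < 1" and r: "1 \<le> r" "r \<le> 2"
  shows "(LINT x|gauss. L2_set (\<lambda>\<kappa>. OU s (g \<kappa>) x) S powr r) \<le> (LINT x|gauss. L2_set (\<lambda>\<kappa>. g \<kappa> x) S powr r)"
proof -
  let ?N = "\<lambda>x. L2_set (\<lambda>\<kappa>. g \<kappa> x) S" and ?O = "\<lambda>x. L2_set (\<lambda>\<kappa>. OU s (g \<kappa>) x) S"
  have N: "?N \<in> L2_gauss" by (rule L2_set_L2_gauss[OF S g])
  have O: "?O \<in> L2_gauss" by (rule L2_set_L2_gauss[OF S OU_L2[OF s g]])
  have I: "integrable gauss (\<lambda>x. ?N x powr r)" using L2_gauss_powr_integrable[OF N, of r] r by simp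
  have A: "AE x in gauss. ?O x \<le> OU s ?N x" by (rule OU_L2_set_le[OF S g s])
  have B: "AE x in gauss. OU s ?N x powr r \<le> OU s (\<lambda>x. ?N x powr r) x" by (rule OU_powr_le[OF N _ s r]) simp
  have "(LINT x|gauss. ?O x powr r) \<le> (LINT x|gauss. OU s (\<lambda>x. ?N x powr r) x)"
  proof (rule integral_mono_AE)
    show "integrable gauss (\<lambda>x. ?O x powr r)" using L2_gauss_powr_integrable[OF O, of r] r by simp
    show "integrable gauss (OU s (\<lambda>x. ?N x powr r))" by (rule OU_integral(1)[OF s I])
    show "AE x in gauss. ?O x powr r \<le> OU s (\<lambda>x. ?N x powr r) x"
      using A B
    proof eventually_elim
      case (elim x)
      have "?O x powr r \<le> OU s ?N x powr r" using elim(1) r by (intro powr_mono2) auto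
      then show ?case using elim(2) by linarith
    qed
  qed
  also have "\<dots> = (LINT x|gauss. ?N x powr r)" by (rule OU_integral(2)[OF s I])
  finally show ?thesis .
qed

text \<open>Split one factor of the pointwise product \<open>N O\<close>, where \<open>N\<close> and \<open>O\<close> are the lengths of \<open>g\<close> and of
  \<open>OU s g\<close>, as \<open>O = O\<^sup>p\<^sup>-\<^sup>1 O\<^sup>2\<^sup>-\<^sup>p\<close>.  The uniform bound is applied to \<open>O\<^sup>2\<^sup>-\<^sup>p\<close>; Young's inequality and
  contractivity of \<open>OU\<close> in \<open>L\<^sup>p\<close> turn the rest into the \<open>p\<close>-th moment of \<open>N\<close>.\<close>

lemma correlation_le_moment:
  fixes g :: "'k \<Rightarrow> real ^ 'n::finite \<Rightarrow> real"
  assumes S: "finite S" and g: "\<And>\<kappa>. \<kappa> \<in> S \<Longrightarrow> g \<kappa> \<in> L2_gauss" and s: "0 \<le> s" "s < 1" and p: "1 \<le> p" "p \<le> 2"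
    and bd: "\<And>x. (\<Sum>\<kappa>\<in>S. (OU s (g \<kappa>) x)\<^sup>2) \<le> 1 / (1 - s\<^sup>2) ^ k"
  shows "(\<Sum>\<kappa>\<in>S. inner_gauss (g \<kappa>) (OU s (g \<kappa>))) \<le> (LINT x|gauss. L2_set (\<lambda>\<kappa>. g \<kappa> x) S powr p) * (1 - s\<^sup>2) powr (real k * (p / 2 - 1))"
proof -
  let ?N = "\<lambda>x. L2_set (\<lambda>\<kappa>. g \<kappa> x) S" and ?O = "\<lambda>x. L2_set (\<lambda>\<kappa>. OU s (g \<kappa>) x) S"
  let ?P = "(1 - s\<^sup>2) powr (real k * (p / 2 - 1))"
  have t: "0 < 1 - s\<^sup>2" using power_strict_mono[of s 1 2] s by simp
  have N: "?N \<in> L2_gauss" by (rule L2_set_L2_gauss[OF S g])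
  have O: "?O \<in> L2_gauss" by (rule L2_set_L2_gauss[OF S OU_L2[OF s g]])
  have IN: "integrable gauss (\<lambda>x. ?N x powr p)" using L2_gauss_powr_integrable[OF N, of p] p by simp
  have IO: "integrable gauss (\<lambda>x. ?O x powr p)" using L2_gauss_powr_integrable[OF O, of p] p by simp
  have pt: "(\<Sum>\<kappa>\<in>S. g \<kappa> x * OU s (g \<kappa>) x) \<le> ?P * (?N x powr p / p + (p - 1) / p * ?O x powr p)" for x
  proof (cases "?O x = 0")
    case True
    have "(\<Sum>\<kappa>\<in>S. g \<kappa> x * OU s (g \<kappa>) x) \<le> ?N x * ?O x" by (rule sum_mult_le_L2_set)
    also have "\<dots> = 0" using True by simp
    also have "0 \<le> ?P * (?N x powr p / p + (p - 1) / p * ?O x powr p)" using p by simp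
    finally show ?thesis .
  next
    case False
    then have O0: "0 < ?O x" by (simp add: order_less_le)
    have "(?O x)\<^sup>2 \<le> 1 / (1 - s\<^sup>2) ^ k" unfolding L2_set_sq[OF S] by (rule bd)
    also have "1 / (1 - s\<^sup>2) ^ k = (1 - s\<^sup>2) powr (- real k)" using t by (simp add: powr_minus powr_realpow inverse_eq_divide)
    finally have "((?O x)\<^sup>2) powr (1 - p / 2) \<le> ((1 - s\<^sup>2) powr (- real k)) powr (1 - p / 2)"
      using p by (intro powr_mono2) auto
    also have "\<dots> = ?P" by (simp add: powr_powr algebra_simps)
    also have "((?O x)\<^sup>2) powr (1 - p / 2) = ?O x powr (2 - p)"
    proof -
      have "(?O x)\<^sup>2 = ?O x powr 2" using O0 by (simp add: powr_numeral)
      then show ?thesis by (simp only: powr_powr) (simp add: algebra_simps)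
    qed
    finally have P: "?O x powr (2 - p) \<le> ?P" .
    have "(\<Sum>\<kappa>\<in>S. g \<kappa> x * OU s (g \<kappa>) x) \<le> ?N x * ?O x" by (rule sum_mult_le_L2_set)
    also have "?O x = ?O x powr (p - 1) * ?O x powr (2 - p)" using O0 by (simp add: powr_add[symmetric])
    also have "?N x * (?O x powr (p - 1) * ?O x powr (2 - p)) = (?N x * ?O x powr (p - 1)) * ?O x powr (2 - p)" by simp
    also have "\<dots> \<le> (?N x * ?O x powr (p - 1)) * ?P" using P by (intro mult_left_mono) auto
    also have "\<dots> \<le> (?N x powr p / p + (p - 1) / p * ?O x powr p) * ?P"
      using p by (intro mult_right_mono young_powr) auto
    finally show ?thesis by (simp add: mult.commute)
  qed
  have Im: "integrable gauss (\<lambda>x. g \<kappa> x * OU s (g \<kappa>) x)" if "\<kappa> \<in> S" for \<kappa> by (intro L2_gauss_mult OU_L2 s g that)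
  have "(\<Sum>\<kappa>\<in>S. inner_gauss (g \<kappa>) (OU s (g \<kappa>))) = (LINT x|gauss. (\<Sum>\<kappa>\<in>S. g \<kappa> x * OU s (g \<kappa>) x))"
    unfolding inner_gauss_def by (subst Bochner_Integration.integral_sum) (use Im in auto)
  also have "\<dots> \<le> (LINT x|gauss. ?P * (?N x powr p / p + (p - 1) / p * ?O x powr p))"
    by (rule integral_mono[OF _ _ pt]) (use Im IN IO in auto)
  also have "\<dots> = ?P * ((LINT x|gauss. ?N x powr p) / p + (p - 1) / p * (LINT x|gauss. ?O x powr p))"
    using IN IO by simp
  also have "\<dots> \<le> ?P * ((LINT x|gauss. ?N x powr p) / p + (p - 1) / p * (LINT x|gauss. ?N x powr p))"
    using p by (intro mult_left_mono add_left_mono OU_L2_set_powr_integral_le S g s) auto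
  also have "(LINT x|gauss. ?N x powr p) / p + (p - 1) / p * (LINT x|gauss. ?N x powr p) = (LINT x|gauss. ?N x powr p)"
    using p by (simp add: field_simps)
  finally show ?thesis by (simp add: mult.commute)
qed

lemma gauss_powr_integral_zero:
  fixes N :: "real ^ 'n::finite \<Rightarrow> real"
  assumes N: "N \<in> L2_gauss" "\<And>x. 0 \<le> N x" and r: "0 \<le> r" "r \<le> 2" and z: "(LINT x|gauss. N x powr r) = 0"
  shows "AE x in gauss. N x = 0"
proof -
  have "AE x in gauss. N x powr r = 0"
    using integral_nonneg_eq_0_iff_AE[OF L2_gauss_powr_integrable[OF N r]] z by simp
  then show ?thesis by eventually_elim simp
qed

text \<open>Lyapunov's inequality between the moments \<open>q\<close> and \<open>2\<close>.\<close>

lemma moment_interpolation: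
  fixes H :: "real ^ 'n::finite \<Rightarrow> real"
  assumes H: "H \<in> L2_gauss" "\<And>x. 0 \<le> H x" and q: "1 \<le> q" "q < 2" and \<theta>: "0 \<le> \<theta>" "\<theta> \<le> 1" and r: "1 / r = \<theta> / q + (1 - \<theta>) / 2" "1 \<le> r" "r \<le> 2"
  shows "(LINT x|gauss. H x powr r) powr (2 / r) \<le> (LINT x|gauss. (H x)\<^sup>2) powr (1 - \<theta>) * (LINT x|gauss. H x powr q) powr (2 * \<theta> / q)"
proof -
  define a where "a = r * \<theta> / q"
  define b where "b = r * (1 - \<theta>) / 2"
  have ab: "0 \<le> a" "0 \<le> b" "a + b = 1"
  proof -
    show "0 \<le> a" "0 \<le> b" unfolding a_def b_def using q \<theta> r by auto
    have "a + b = r * (1 / r)" unfolding a_def b_def r(1) by (simp add: algebra_simps)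
    then show "a + b = 1" using r(2) by simp
  qed
  let ?X = "LINT x|gauss. H x powr q" and ?Y = "LINT x|gauss. (H x)\<^sup>2" and ?Z = "LINT x|gauss. H x powr r"
  have I: "integrable gauss (\<lambda>x. H x powr q)" "integrable gauss (\<lambda>x. H x powr r)" "integrable gauss (\<lambda>x. (H x)\<^sup>2)"
    using L2_gauss_powr_integrable[OF H, of q] L2_gauss_powr_integrable[OF H, of r] L2_gaussD(2)[OF H(1)] q r by auto
  have nn: "0 \<le> ?X" "0 \<le> ?Y" "0 \<le> ?Z" by (intro integral_nonneg_AE; simp)+
  have [measurable]: "H \<in> borel_measurable borel" using L2_gaussD[OF H(1)] by simp
  show ?thesis
  proof (cases "?X = 0 \<or> ?Y = 0")
    case True
    have "AE x in gauss. H x = 0"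
      using True
    proof
      assume "?X = 0" then show ?thesis by (intro gauss_powr_integral_zero[OF H, of q]) (use q in auto)
    next
      assume "?Y = 0"
      then have "AE x in gauss. (H x)\<^sup>2 = 0" using integral_nonneg_eq_0_iff_AE[OF I(3)] by simp
      then show ?thesis by eventually_elim simp
    qed
    then have "AE x in gauss. H x powr r = 0" by eventually_elim simp
    then have "?Z = (LINT x|(gauss :: (real ^ 'n) measure). 0)" by (intro integral_cong_AE) auto
    then show ?thesis using nn by simp
  next
    case False
    then have X: "0 < ?X" and Y: "0 < ?Y" using nn by (simp_all add: order_less_le)
    have pt: "H x powr r \<le> ?X powr a * ?Y powr b * (a / ?X * H x powr q + b / ?Y * (H x)\<^sup>2)" for x
    proof (cases "H x = 0")
      case True then show ?thesis using ab X Y by simp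
    next
      case False
      then have h: "0 < H x" using H(2)[of x] by simp
      have "H x powr r = (H x powr q) powr a * ((H x)\<^sup>2) powr b"
      proof -
        have "q * a + 2 * b = r" unfolding a_def b_def using q by (simp add: field_simps)
        moreover have "(H x)\<^sup>2 = H x powr 2" using h by (simp add: powr_numeral)
        ultimately show ?thesis by (simp only: powr_powr powr_add[symmetric])
      qed
      also have "\<dots> = ?X powr a * ?Y powr b * ((H x powr q / ?X) powr a * ((H x)\<^sup>2 / ?Y) powr b)"
        using X Y h by (simp add: powr_divide)
      also have "\<dots> \<le> ?X powr a * ?Y powr b * (a * (H x powr q / ?X) + b * ((H x)\<^sup>2 / ?Y))"
        using ab X Y h by (intro mult_left_mono Youngs_inequality_0) auto
      finally show ?thesis by simp
    qed
    have "?Z \<le> (LINT x|gauss. ?X powr a * ?Y powr b * (a / ?X * H x powr q + b / ?Y * (H x)\<^sup>2))"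
      by (rule integral_mono[OF _ _ pt]) (use I in auto)
    also have "\<dots> = ?X powr a * ?Y powr b * (a / ?X * ?X + b / ?Y * ?Y)" using I by simp
    also have "\<dots> = ?X powr a * ?Y powr b" using X Y ab by simp
    finally have "?Z powr (2 / r) \<le> (?X powr a * ?Y powr b) powr (2 / r)" using nn r by (intro powr_mono2) auto
    also have "\<dots> = ?X powr (a * (2 / r)) * ?Y powr (b * (2 / r))" using X Y by (simp add: powr_mult powr_powr)
    also have "a * (2 / r) = 2 * \<theta> / q" unfolding a_def using r by (simp add: field_simps)
    also have "b * (2 / r) = 1 - \<theta>" unfolding b_def using r by (simp add: field_simps)
    finally show ?thesis by (simp add: mult.commute)
  qed
qed

lemma hweight_OU:
  assumes s: "0 \<le> s" "s < 1" and u: "u \<in> L2_gauss" shows "hweight m (OU s u) = (s\<^sup>2) ^ m * hweight m u"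
  unfolding hweight_def sum_distrib_left
  by (intro sum.cong refl) (simp add: hcoef_OU[OF s u] power_mult_distrib power_mult[symmetric] mult.commute)

text \<open>With \<open>h = OU (sqrt u) g\<close> the semigroup property gives \<open>G u = \<parallel>h\<parallel>\<^sup>2\<close> and \<open>G (s u) = \<langle>h, OU s h\<rangle>\<close>.
  Hypercontractivity bounds the latter by the squared \<open>L\<^sup>1\<^sup>+\<^sup>s\<close> norm of \<open>\<bar>h\<bar>\<close>, and \<open>\<theta>\<close> is the parameter for
  which \<open>1 + s\<close> is interpolated between \<open>q\<close> and \<open>2\<close>.\<close>

lemma correlation_contraction:
  fixes g :: "'k \<Rightarrow> real ^ 'n::finite \<Rightarrow> real"
  assumes S: "finite S" and g: "\<And>\<kappa>. \<kappa> \<in> S \<Longrightarrow> g \<kappa> \<in> L2_gauss" and s: "0 < s" "s < 1" and u: "0 < u" "u < 1"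
    and q: "1 \<le> q" "q < 2" and \<theta>: "\<theta> = 2 * (q / (2 * (2 - q))) * (1 - s) / (1 + s)" "\<theta> \<le> 1"
  defines "G \<equiv> \<lambda>s. \<Sum>\<kappa>\<in>S. inner_gauss (g \<kappa>) (OU s (g \<kappa>))"
  shows "G (s * u) \<le> G u powr (1 - \<theta>) * (LINT x|gauss. L2_set (\<lambda>\<kappa>. g \<kappa> x) S powr q) powr (2 * \<theta> / q)"
proof -
  \<comment> \<open>\<open>OU (sqrt u)\<close> is a square root of \<open>OU u\<close>\<close>
  define v where "v = sqrt u"
  have v: "0 \<le> v" "v < 1" "v\<^sup>2 = u" unfolding v_def using u by auto
  have s': "0 \<le> s" "s < 1" using s by auto
  define h where "h \<kappa> = OU v (g \<kappa>)" for \<kappa>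
  let ?H = "\<lambda>x. L2_set (\<lambda>\<kappa>. h \<kappa> x) S"
  have hL: "h \<kappa> \<in> L2_gauss" if "\<kappa> \<in> S" for \<kappa> unfolding h_def by (rule OU_L2[OF v(1,2) g[OF that]])
  have hw: "hweight m (h \<kappa>) = u ^ m * hweight m (g \<kappa>)" if "\<kappa> \<in> S" for \<kappa> m
    unfolding h_def hweight_OU[OF v(1,2) g[OF that]] v(3) ..
  have H: "?H \<in> L2_gauss" by (rule L2_set_L2_gauss[OF S hL])
  have su: "0 \<le> s * u" "s * u < 1" using s u mult_strict_mono[of s 1 u 1] by auto
  have Gsu: "G (s * u) = (\<Sum>\<kappa>\<in>S. inner_gauss (h \<kappa>) (OU s (h \<kappa>)))"
    unfolding G_def
  proof (intro sum.cong refl)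
    fix \<kappa> assume k: "\<kappa> \<in> S"
    have "(\<lambda>m. (s * u) ^ m * hweight m (g \<kappa>)) sums inner_gauss (g \<kappa>) (OU (s * u) (g \<kappa>))" by (rule OU_form_sums[OF su g[OF k]])
    moreover have "(\<lambda>m. (s * u) ^ m * hweight m (g \<kappa>)) sums inner_gauss (h \<kappa>) (OU s (h \<kappa>))"
      using OU_form_sums[OF s' hL[OF k]] unfolding hw[OF k] by (simp add: power_mult_distrib mult.assoc)
    ultimately show "inner_gauss (g \<kappa>) (OU (s * u) (g \<kappa>)) = inner_gauss (h \<kappa>) (OU s (h \<kappa>))" by (rule sums_unique2)
  qed
  have Gu: "G u = (LINT x|gauss. (?H x)\<^sup>2)"
  proof -
    have "G u = (\<Sum>\<kappa>\<in>S. inner_gauss (h \<kappa>) (h \<kappa>))"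
      unfolding G_def
    proof (intro sum.cong refl)
      fix \<kappa> assume k: "\<kappa> \<in> S"
      have u': "0 \<le> u" "u < 1" using u by auto
      have "(\<lambda>m. u ^ m * hweight m (g \<kappa>)) sums inner_gauss (h \<kappa>) (h \<kappa>)" using parseval[OF hL[OF k]] unfolding hw[OF k] .
      with OU_form_sums[OF u' g[OF k]] show "inner_gauss (g \<kappa>) (OU u (g \<kappa>)) = inner_gauss (h \<kappa>) (h \<kappa>)" by (rule sums_unique2)
    qed
    also have "\<dots> = (LINT x|gauss. (\<Sum>\<kappa>\<in>S. h \<kappa> x * h \<kappa> x))"
      unfolding inner_gauss_def by (subst Bochner_Integration.integral_sum) (use L2_gauss_mult[OF hL hL] in auto)
    finally show ?thesis unfolding L2_set_sq[OF S] by (simp only: power2_eq_square)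
  qed
  have th: "0 \<le> \<theta>" unfolding \<theta>(1) using q s by simp
  have r: "1 / (1 + s) = \<theta> / q + (1 - \<theta>) / 2"
  proof -
    have "2 * (q / (2 * (2 - q))) = q / (2 - q)"
      unfolding times_divide_eq_right by (rule nonzero_mult_divide_mult_cancel_left) simp
    then have "\<theta> = q * ((1 - s) / ((2 - q) * (1 + s)))" unfolding \<theta>(1) by simp
    then have "\<theta> / q * (2 - q) = (1 - s) / (1 + s)" using q by simp
    moreover have "\<theta> / q + (1 - \<theta>) / 2 = 1 / 2 + \<theta> / q * (2 - q) / 2" using q by (simp add: field_simps)
    moreover have "1 / (1 + s) = 1 / 2 + (1 - s) / (1 + s) / 2" using s by (simp add: field_simps)
    ultimately show ?thesis by (simp only:)
  qed
  have "G (s * u) = (\<Sum>\<kappa>\<in>S. LINT xy|corr s. h \<kappa> (fst xy) * h \<kappa> (snd xy))"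
    unfolding Gsu by (intro sum.cong refl inner_OU s' hL)
  also have "\<dots> = (LINT xy|corr s. (\<Sum>\<kappa>\<in>S. h \<kappa> (fst xy) * h \<kappa> (snd xy)))"
    by (subst Bochner_Integration.integral_sum) (use corr_integrable_mult[OF s' hL hL] in auto)
  also have "\<dots> \<le> (LINT xy|corr s. ?H (fst xy) * ?H (snd xy))"
    by (rule integral_mono[OF _ _ sum_mult_le_L2_set])
      (use corr_integrable_mult[OF s' hL hL] corr_integrable_mult[OF s' H H] in auto)
  also have "\<dots> \<le> (LINT z|gauss. ?H z powr (1 + s)) powr (2 / (1 + s))" by (rule hypercontractive[OF s' H]) simp
  also have "\<dots> \<le> (LINT x|gauss. (?H x)\<^sup>2) powr (1 - \<theta>) * (LINT x|gauss. ?H x powr q) powr (2 * \<theta> / q)"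
    by (rule moment_interpolation[OF H _ q th \<theta>(2) r]) (use s in auto)
  also have "\<dots> \<le> (LINT x|gauss. (?H x)\<^sup>2) powr (1 - \<theta>) * (LINT x|gauss. L2_set (\<lambda>\<kappa>. g \<kappa> x) S powr q) powr (2 * \<theta> / q)"
  proof (intro mult_left_mono powr_mono2)
    show "(LINT x|gauss. ?H x powr q) \<le> (LINT x|gauss. L2_set (\<lambda>\<kappa>. g \<kappa> x) S powr q)"
      unfolding h_def by (rule OU_L2_set_powr_integral_le[OF S g v(1,2)]) (use q in auto)
    show "0 \<le> (LINT x|gauss. ?H x powr q)" by (intro integral_nonneg_AE) simp
    show "0 \<le> 2 * \<theta> / q" using th q by simp
  qed simp
  finally show ?thesis unfolding Gu .
qed

section \<open>The Beta integral\<close>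

text \<open>Integration by parts lowers \<open>m\<close> and raises \<open>k\<close>.\<close>

lemma beta_has_integral:
  "1 \<le> k \<Longrightarrow> ((\<lambda>s::real. real k * (1 - s) ^ (k - 1) * s ^ m) has_integral 1 / real ((m + k) choose k)) {0..1}"
proof (induction m arbitrary: k)
  case 0
  have "((\<lambda>s::real. real k * (1 - s) ^ (k - 1)) has_integral (- ((1 - 1) ^ k) - (- ((1 - 0) ^ k)))) {0..1}"
    by (rule fundamental_theorem_of_calculus)
      (auto intro!: derivative_eq_intros simp: has_real_derivative_iff_has_vector_derivative[symmetric])
  then show ?case using 0 by (simp add: zero_power)
next
  case (Suc m)
  have "((\<lambda>s::real. (1 - s) ^ k * s ^ Suc m) has_real_derivative real (Suc m) * x ^ m * (1 - x) ^ k - real k * (1 - x) ^ (k - 1) * x ^ Suc m) (at x within {0..1})" for x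
    by (auto intro!: derivative_eq_intros simp del: power_Suc simp: algebra_simps)
  then have "((\<lambda>s::real. real (Suc m) * s ^ m * (1 - s) ^ k - real k * (1 - s) ^ (k - 1) * s ^ Suc m) has_integral ((1 - 1) ^ k * 1 ^ Suc m - (1 - 0) ^ k * 0 ^ Suc m)) {0..1}"
    by (intro fundamental_theorem_of_calculus) (simp_all add: has_real_derivative_iff_has_vector_derivative[symmetric])
  then have A: "((\<lambda>s::real. real (Suc m) * s ^ m * (1 - s) ^ k - real k * (1 - s) ^ (k - 1) * s ^ Suc m) has_integral 0) {0..1}"
    using Suc.prems by (simp add: zero_power)
  have "((\<lambda>s::real. real (Suc m) / real (Suc k) * (real (Suc k) * (1 - s) ^ (Suc k - 1) * s ^ m)) has_integral real (Suc m) / real (Suc k) * (1 / real ((m + Suc k) choose Suc k))) {0..1}"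
    by (intro has_integral_mult_right Suc.IH) simp
  then have B: "((\<lambda>s::real. real (Suc m) * s ^ m * (1 - s) ^ k) has_integral real (Suc m) / real (Suc k) * (1 / real ((m + Suc k) choose Suc k))) {0..1}"
    by (simp add: mult_ac)
  have c: "real (Suc m) / real (Suc k) * (1 / real ((m + Suc k) choose Suc k)) = 1 / real ((Suc m + k) choose k)"
  proof -
    have "Suc k * (Suc (m + k) choose Suc k) = Suc (m + k) * ((m + k) choose k)"
      using binomial_absorption[of k "Suc (m + k)"] by (simp del: binomial_Suc_Suc mult_Suc mult_Suc_right)
    moreover have "Suc m * (Suc (m + k) choose k) = Suc (m + k) * ((m + k) choose k)"
      using binomial_absorb_comp[of "Suc (m + k)" k] by (simp del: binomial_Suc_Suc mult_Suc mult_Suc_right)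
    ultimately have "Suc k * (Suc (m + k) choose Suc k) = Suc m * (Suc (m + k) choose k)" by (simp only:)
    then have "real (Suc k) * real (Suc (m + k) choose Suc k) = real (Suc m) * real (Suc (m + k) choose k)"
      by (simp only: of_nat_mult[symmetric])
    moreover have "0 < (Suc (m + k) choose Suc k)" "0 < (Suc (m + k) choose k)" by (rule zero_less_binomial; simp)+
    ultimately have "real (Suc m) / real (Suc k) * (1 / real (Suc (m + k) choose Suc k)) = 1 / real (Suc (m + k) choose k)"
      by (simp add: divide_simps del: binomial_Suc_Suc of_nat_Suc) (simp add: mult.commute del: binomial_Suc_Suc of_nat_Suc)?
    then show ?thesis by (simp only: add_Suc add_Suc_right)
  qed
  from has_integral_diff[OF B A] show ?case unfolding c by simp
qed

section \<open>The one-dimensional extremal problem\<close>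

lemma M_quot_le_1:
  assumes "0 \<le> p" "p \<le> 2" "0 < x" shows "M_quot p x \<le> 1"
proof -
  have "1 - exp (- x) \<le> x powr (p / 2)"
  proof (cases "x \<le> 1")
    case True
    have "1 - exp (- x) \<le> x powr 1"
      using exp_ge_add_one_self[of "-x"] assms by simp
    also have "\<dots> \<le> x powr (p / 2)"
      using assms True by (intro powr_mono') auto
    finally show ?thesis .
  next
    case False
    then have "1 \<le> x powr (p / 2)" using assms by (intro ge_one_powr_ge_zero) auto
    then show ?thesis by (smt (verit) exp_ge_zero)
  qed
  then show ?thesis unfolding M_quot_def using assms by (simp add: divide_le_eq_1)
qed

lemma M_quot_nonneg: "0 \<le> x \<Longrightarrow> 0 \<le> M_quot p x"
  unfolding M_quot_def by simp

text \<open>Beyond the threshold the quotient decreases, so that its supremum may be computed on a bounded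
  interval.\<close>

lemma M_quot_antimono:
  assumes p: "1 \<le> p" "p \<le> 2" and x: "0 < x0" "(2 - p) * 2 / p \<le> x0" "x0 \<le> x"
  shows "M_quot p x \<le> M_quot p x0"
proof (cases "x0 = x")
  case False
  define f where "f t = (1 - exp (- t)) * t powr (- (p / 2))" for t :: real
  have "f x \<le> f x0"
  proof (rule DERIV_nonpos_imp_nonincreasing[where f = f])
    fix t assume t: "x0 \<le> t" "t \<le> x"
    then have t0: "0 < t" using x by simp
    have "(f has_real_derivative exp (- t) * t powr (- (p/2)) + (1 - exp (- t)) * (- (p/2) * t powr (- (p/2) - 1))) (at t)"
      unfolding f_def using t0 by (auto intro!: derivative_eq_intros)
    moreover have "exp (- t) * t powr (- (p/2)) + (1 - exp (- t)) * (- (p/2) * t powr (- (p/2) - 1)) \<le> 0"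
    proof -
      have "t \<le> p / 2 * (t + t\<^sup>2 / 2)"
      proof -
        have "(2 - p) * 2 \<le> t * p" using x(2) t(1) p
          by (smt (verit) divide_le_eq)
        then have "1 \<le> p / 2 * (1 + t / 2)" by (simp add: field_simps)
        then have "t * 1 \<le> t * (p / 2 * (1 + t / 2))" using t0 by (intro mult_left_mono) auto
        then show ?thesis by (simp add: field_simps power2_eq_square)
      qed
      also have "\<dots> \<le> p / 2 * (exp t - 1)"
        using exp_lower_Taylor_quadratic[of t] t0 p by (intro mult_left_mono) auto
      finally have "t \<le> p / 2 * (exp t - 1)" .
      then have "exp (- t) * t \<le> exp (- t) * (p / 2 * (exp t - 1))" by (intro mult_left_mono) auto
      also have "\<dots> = p / 2 * (1 - exp (- t))" by (simp add: exp_minus field_simps)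
      finally have "exp (- t) * t \<le> p / 2 * (1 - exp (- t))" .
      moreover have "t powr (- (p/2)) = t * t powr (- (p/2) - 1)"
        using t0 by (simp add: powr_diff)
      ultimately have "t powr (- (p/2) - 1) * (exp (- t) * t - p / 2 * (1 - exp (- t))) \<le> 0"
        by (intro mult_nonneg_nonpos) auto
      then show ?thesis using \<open>t powr (- (p/2)) = _\<close> by (simp add: algebra_simps)
    qed
    ultimately show "\<exists>y. (f has_real_derivative y) (at t) \<and> y \<le> 0" by blast
  qed (use x in simp)
  then show ?thesis using x unfolding M_quot_def f_def by (simp add: powr_minus_divide)
qed simp

lemma M_quot_tendsto_0:
  assumes p: "1 \<le> p" "p \<le> 2"
  shows "(M_quot p \<longlongrightarrow> (if p = 2 then 1 else 0)) (at_right 0)"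
proof (cases "p = 2")
  case True
  have "((\<lambda>x::real. - exp (- x)) has_real_derivative 1) (at 0)"
    by (auto intro!: derivative_eq_intros)
  then have "((\<lambda>x::real. (1 - exp (- x)) / x) \<longlongrightarrow> 1) (at 0)"
    by (simp add: DERIV_def)
  then have "((\<lambda>x::real. (1 - exp (- x)) / x) \<longlongrightarrow> 1) (at_right 0)"
    by (rule tendsto_within_subset) simp
  moreover have "\<forall>\<^sub>F x in at_right 0. (1 - exp (- x)) / x = M_quot p (x::real)"
    unfolding eventually_at_right_field M_quot_def True by (intro exI[of _ 1]) auto
  ultimately have "(M_quot p \<longlongrightarrow> 1) (at_right 0)" by (rule Lim_transform_eventually)
  then show ?thesis using True by simp
next
  case False
  have lim: "((\<lambda>x::real. x powr (1 - p / 2)) \<longlongrightarrow> 0) (at_right 0)"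
  proof -
    have "((\<lambda>x::real. x powr (1 - p / 2)) \<longlongrightarrow> 0 powr (1 - p / 2)) (at_right 0)"
      using False p by (intro tendsto_powr' tendsto_const tendsto_ident_at)
        (auto simp: eventually_at_filter)
    then show ?thesis by simp
  qed
  have low: "\<forall>\<^sub>F x in at_right 0. 0 \<le> M_quot p x"
      unfolding eventually_at_right_field by (intro exI[of _ 1]) (auto intro: M_quot_nonneg)
  have up: "\<forall>\<^sub>F x in at_right 0. M_quot p x \<le> x powr (1 - p / 2)"
      unfolding eventually_at_right_field
    proof (intro exI[of _ 1] conjI allI impI)
      fix x :: real assume x: "0 < x"
      have "1 - exp (- x) \<le> x" using exp_ge_add_one_self[of "-x"] by simp
      then show "M_quot p x \<le> x powr (1 - p / 2)"
        unfolding M_quot_def powr_diff using x by (simp add: divide_right_mono)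
    qed simp
  have "(M_quot p \<longlongrightarrow> 0) (at_right 0)"
    by (rule tendsto_sandwich[OF low up tendsto_const lim])
  then show ?thesis using False by simp
qed

lemma M_const_le:
  assumes p: "1 \<le> p" "p \<le> 2" and x0: "0 < x0" "(2 - p) * 2 / p \<le> x0"
    and le: "\<And>x. 0 < x \<Longrightarrow> x \<le> x0 \<Longrightarrow> M_quot p x \<le> C"
  shows "M_const p \<le> p * 2 powr (- p / 2) * C"
proof -
  have all: "M_quot p x \<le> C" if "0 < x" for x
    using le[of x] le[of x0] M_quot_antimono[OF p x0, of x] that x0 by (cases "x \<le> x0") auto
  have "(if x = 0 then Lim (at_right 0) (M_quot p) else M_quot p x) \<le> C" if "0 \<le> x" for x
  proof (cases "x = 0")
    case True
    have L: "Lim (at_right 0) (M_quot p) = (if p = 2 then 1 else 0)"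
      by (rule tendsto_Lim[OF _ M_quot_tendsto_0[OF p]]) simp
    have "(if p = 2 then 1 else 0) \<le> C"
      by (rule tendsto_upperbound[OF M_quot_tendsto_0[OF p]])
        (auto simp: eventually_at_right_field intro!: exI[of _ 1] all)
    then show ?thesis using True L by simp
  qed (use all that in auto)
  then have "(SUP x\<in>{0..}. if x = 0 then Lim (at_right 0) (M_quot p) else M_quot p x) \<le> C"
    by (intro cSUP_least) auto
  then show ?thesis unfolding M_const_def using p by (intro mult_left_mono) auto
qed

lemma M_const_ge:
  assumes p: "1 \<le> p" "p \<le> 2"
  shows "p * 2 powr (- p / 2) * (1 - exp (- 1)) \<le> M_const p"
proof -
  have L: "Lim (at_right 0) (M_quot p) = (if p = 2 then 1 else 0)"
    by (rule tendsto_Lim[OF _ M_quot_tendsto_0[OF p]]) simp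
  have "bdd_above ((\<lambda>x. if x = 0 then Lim (at_right 0) (M_quot p) else M_quot p x) ` {0..})"
    using M_quot_le_1[of p] p by (intro bdd_aboveI[of _ 1]) (auto simp: L)
  then have "(if (1::real) = 0 then Lim (at_right 0) (M_quot p) else M_quot p 1)
     \<le> (SUP x\<in>{0..}. if x = 0 then Lim (at_right 0) (M_quot p) else M_quot p x)"
    by (intro cSUP_upper) auto
  then show ?thesis unfolding M_const_def using p by (intro mult_left_mono) (auto simp: M_quot_def)
qed

lemma M_const_ge_quarter:
  assumes "1 \<le> p" "p \<le> 2" shows "1 / 4 \<le> M_const p"
proof -
  have "(2::real) powr (- 1) \<le> 2 powr (- p / 2)" using assms by (intro powr_mono) auto
  then have a: "1 / 2 \<le> (2::real) powr (- p / 2)" by (simp add: powr_minus)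
  have "exp (-1) \<le> (1/2::real)" using exp_ge_add_one_self[of "1::real"] by (simp add: exp_minus field_simps)
  then have b: "1 / 2 \<le> 1 - exp (- 1::real)" by simp
  have "(1 * (1/2)) * (1/2) \<le> p * 2 powr (- p / 2) * (1 - exp (- 1))"
    using assms by (intro mult_mono a b) auto
  then show ?thesis using M_const_ge[OF assms] by simp
qed

lemma two_minus_over_two_plus_le_exp:
  assumes "0 \<le> (T::real)" shows "(2 - T) / (2 + T) \<le> exp (- T)"
proof -
  have "(\<lambda>t. (2 + t) * exp (- t) - (2 - t)) 0 \<le> (\<lambda>t::real. (2 + t) * exp (- t) - (2 - t)) T"
  proof (rule DERIV_nonneg_imp_nondecreasing[where f = "\<lambda>t. (2 + t) * exp (- t) - (2 - t)", OF assms])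
    fix t :: real assume t: "0 \<le> t" "t \<le> T"
    have "((\<lambda>t. (2 + t) * exp (- t) - (2 - t)) has_real_derivative 1 - (1 + t) * exp (- t)) (at t)"
      by (auto intro!: derivative_eq_intros simp: algebra_simps)
    moreover have "(1 + t) * exp (- t) \<le> 1"
      using exp_ge_add_one_self[of t] by (simp add: exp_minus field_simps)
    ultimately show "\<exists>y. ((\<lambda>t. (2 + t) * exp (- t) - (2 - t)) has_real_derivative y) (at t) \<and> 0 \<le> y"
      by (intro exI[of _ "1 - (1 + t) * exp (- t)"]) auto
  qed
  then show ?thesis using assms by (simp add: field_simps)
qed

lemma powr_le_tangent:
  assumes "0 \<le> (x::real)" "0 < w" "0 \<le> \<theta>" "\<theta> \<le> 1"
  shows "x powr (1 - \<theta>) \<le> w powr (1 - \<theta>) * ((1 - \<theta>) * x / w + \<theta>)"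
proof (cases "x = 0")
  case True then show ?thesis using assms by simp
next
  case False
  have "(x / w) powr (1 - \<theta>) * 1 powr \<theta> \<le> (1 - \<theta>) * (x / w) + \<theta> * 1"
    using assms False by (intro Youngs_inequality_0) auto
  then have "w powr (1 - \<theta>) * (x / w) powr (1 - \<theta>) \<le> w powr (1 - \<theta>) * ((1 - \<theta>) * x / w + \<theta>)"
    using assms by (intro mult_left_mono) auto
  then show ?thesis using assms False by (simp add: powr_divide)
qed

text \<open>The derivative of the right-hand side in \<open>s\<close> is minus the upper bound for \<open>\<phi>\<close> times
  \<open>(4 / (1 + s)\<^sup>2)\<^bsup>p/2\<^esup> \<ge> 1\<close>.\<close>

lemma integral_tail_bound:
  fixes \<phi> :: "real \<Rightarrow> real"
  assumes p: "1 \<le> p" "p \<le> 2" and cont: "continuous_on {0..1} \<phi>"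
    and upper: "\<And>v. 0 < v \<Longrightarrow> v < 1 \<Longrightarrow> \<phi> v \<le> (1 - v\<^sup>2) powr (p / 2 - 1)"
    and s: "0 \<le> s" "s < 1"
  shows "integral {s..1} \<phi> \<le> (4 * (1 - s) / (1 + s)) powr (p / 2) / p"
proof -
  define \<Xi> where "\<Xi> v = (4 * (1 - v) / (1 + v)) powr (p / 2) / p" for v :: real
  have conts: "continuous_on {s..1} \<phi>" using cont s by (elim continuous_on_subset) auto
  have "integral {s..1} \<phi> + \<Xi> 1 \<le> integral {s..s} \<phi> + \<Xi> s"
  proof (rule DERIV_nonpos_imp_decreasing_open[where f = "\<lambda>v. integral {s..v} \<phi> + \<Xi> v", OF less_imp_le[OF s(2)]])
    fix v assume v: "s < v" "v < 1"
    have d1: "((\<lambda>v. integral {s..v} \<phi>) has_real_derivative \<phi> v) (at v)"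
    proof -
      have "((\<lambda>v. integral {s..v} \<phi>) has_real_derivative \<phi> v) (at v within {s..1})"
        by (rule integral_has_real_derivative[OF conts]) (use v in auto)
      then show ?thesis using v by (simp add: at_within_Icc_at)
    qed
    define D where "D = (p / 2 * (4 * (1 - v) / (1 + v)) powr (p / 2 - 1) * (- 8 / (1 + v)\<^sup>2)) / p"
    have d2: "(\<Xi> has_real_derivative D) (at v)"
    proof -
      have "((\<lambda>v. 4 * (1 - v) / (1 + v)) has_real_derivative - 8 / (1 + v)\<^sup>2) (at v)"
        using v s by (auto intro!: derivative_eq_intros simp: field_simps power2_eq_square)
      moreover have "((\<lambda>z. z powr (p / 2)) has_real_derivative
          p / 2 * (4 * (1 - v) / (1 + v)) powr (p / 2 - 1)) (at (4 * (1 - v) / (1 + v)))"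
        using v s by (intro has_real_derivative_powr) auto
      ultimately have "((\<lambda>v. (4 * (1 - v) / (1 + v)) powr (p / 2)) has_real_derivative
          p / 2 * (4 * (1 - v) / (1 + v)) powr (p / 2 - 1) * (- 8 / (1 + v)\<^sup>2)) (at v)"
        by (rule DERIV_chain2[rotated])
      then show ?thesis unfolding \<Xi>_def D_def by (rule DERIV_cdivide)
    qed
    have "D = - ((4 * (1 - v) / (1 + v)) powr (p / 2 - 1) * (4 / (1 + v)\<^sup>2))"
      unfolding D_def using p by (simp add: field_simps)
    also have "\<dots> = - ((1 - v\<^sup>2) powr (p / 2 - 1) * (4 / (1 + v)\<^sup>2) powr (p / 2))"
    proof -
      have e: "4 * (1 - v) / (1 + v) = (1 - v\<^sup>2) * (4 / (1 + v)\<^sup>2)"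
      proof -
        have "1 - v\<^sup>2 = (1 - v) * (1 + v)" by (simp add: power2_eq_square algebra_simps)
        then show ?thesis using v s by (simp add: power2_eq_square)
      qed
      have v2: "v\<^sup>2 < 1" using v s by (simp add: power_less_one_iff abs_square_less_1)
      have "(4 / (1 + v)\<^sup>2) powr (p / 2 - 1) * (4 / (1 + v)\<^sup>2) = (4 / (1 + v)\<^sup>2) powr (p / 2)"
        using powr_add[of "4 / (1 + v)\<^sup>2" "p / 2 - 1" 1] v s by simp
      then show ?thesis unfolding e using v s v2 by (subst powr_mult) (auto simp del: times_divide_eq_right)
    qed
    also have "\<dots> \<le> - ((1 - v\<^sup>2) powr (p / 2 - 1) * 1)"
    proof -
      have "(1 + v)\<^sup>2 \<le> 2\<^sup>2" using v s by (intro power_mono) auto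
      then have "1 \<le> 4 / (1 + v)\<^sup>2" using v s by (simp add: field_simps)
      then have "1 \<le> (4 / (1 + v)\<^sup>2) powr (p / 2)" using p by (intro ge_one_powr_ge_zero) auto
      then show ?thesis by (intro le_imp_neg_le mult_left_mono) auto
    qed
    also have "\<dots> \<le> - \<phi> v" using upper[of v] v s by simp
    finally have "\<phi> v + D \<le> 0" by simp
    moreover have "((\<lambda>v. integral {s..v} \<phi> + \<Xi> v) has_real_derivative \<phi> v + D) (at v)"
      by (rule DERIV_add[OF d1 d2])
    ultimately show "\<exists>y. ((\<lambda>v. integral {s..v} \<phi> + \<Xi> v) has_real_derivative y) (at v) \<and> y \<le> 0" by blast
  next
    have "continuous_on {s..1} \<Xi>"
      unfolding \<Xi>_def using p s by (intro continuous_intros continuous_on_powr') auto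
    then show "continuous_on {s..1} (\<lambda>v. integral {s..v} \<phi> + \<Xi> v)"
      using conts by (intro continuous_intros indefinite_integral_continuous_1 integrable_continuous_real)
  qed
  then show ?thesis unfolding \<Xi>_def using p by simp
qed

text \<open>Split the integral at \<open>s = (2 - T) / (2 + T)\<close>.  Beyond \<open>s\<close> the pointwise upper bound is used.  Below
  \<open>s\<close> rescale to the unit interval, apply the contraction with \<open>\<theta> = K T\<close> and linearise the concave power at
  the mean \<open>w\<close>, which gains the factor \<open>(\<beta> / w)\<^sup>\<theta>\<close> if \<open>\<beta> < w\<close>.  With \<open>y = ln_plus (w / \<beta>)\<close> the result is
  \<open>w (1 - exp (- (1 + K y) T)) \<le> (2 T)\<^bsup>p/2\<^esup> / p\<close> for all \<open>T \<le> 1 / K\<close>.  After rescaling \<open>T\<close>, the left-hand side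
  over the right-hand side is up to constant factors the quotient whose supremum defines \<open>M_const p\<close>, so the best choice of \<open>T\<close>
  bounds \<open>w\<close> by \<open>M_const p\<close> and \<open>1 + K y\<close>.  Finally \<open>w\<close> inside the logarithm is removed at the price of the
  summand \<open>p K / (2 e)\<close>.\<close>

lemma contractive_profile_bound:
  fixes \<phi> :: "real \<Rightarrow> real"
  assumes p: "1 \<le> p" "p \<le> 2" and K: "1 / 2 \<le> K" "K * (2 - p) \<le> p / 2"
    and cont: "continuous_on {0..1} \<phi>" and nonneg: "\<And>v. 0 \<le> v \<Longrightarrow> v \<le> 1 \<Longrightarrow> 0 \<le> \<phi> v"
    and mono: "\<And>u v. 0 \<le> u \<Longrightarrow> u \<le> v \<Longrightarrow> v \<le> 1 \<Longrightarrow> \<phi> u \<le> \<phi> v"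
    and upper: "\<And>v. 0 < v \<Longrightarrow> v < 1 \<Longrightarrow> \<phi> v \<le> (1 - v\<^sup>2) powr (p / 2 - 1)"
    and contr: "\<And>s u \<theta>. 0 < s \<Longrightarrow> s < 1 \<Longrightarrow> 0 < u \<Longrightarrow> u < 1 \<Longrightarrow> \<theta> = 2 * K * (1 - s) / (1 + s) \<Longrightarrow> \<theta> \<le> 1
         \<Longrightarrow> \<phi> (s * u) \<le> \<phi> u powr (1 - \<theta>) * \<beta> powr \<theta>"
    and \<beta>: "0 < \<beta>" and w: "w = integral {0..1} \<phi>" "0 < w"
  shows "w \<le> ((M_const p powr (- 2 / p) + p * K / (2 * exp 1)) / (1 + K * ln_plus (1 / \<beta>))) powr (p / 2)"
proof -
  define y where "y = ln_plus (w / \<beta>)"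
  define lam where "lam = 1 + K * y"
  have y0: "0 \<le> y" unfolding y_def ln_plus_def by simp
  have lam1: "1 \<le> lam" unfolding lam_def using y0 K by simp
  have int\<phi>: "\<phi> integrable_on {a..b}" if "0 \<le> a" "b \<le> 1" for a b
    using cont that by (intro integrable_continuous_real) (auto elim!: continuous_on_subset)
  have head: "integral {0..s} \<phi> \<le> s * w * exp (- (\<theta> * y))"
    if s: "0 \<le> s" "s < 1" and \<theta>: "\<theta> = 2 * K * (1 - s) / (1 + s)" "\<theta> \<le> 1" for s \<theta>
  proof (cases "s = 0")
    case False
    then have s0: "0 < s" using s by simp
    have \<theta>0: "0 \<le> \<theta>" using \<theta> s K by simp
    have su: "continuous_on {0..1} (\<lambda>u. \<phi> (s * u))"
      using s s0 by (intro continuous_on_compose2[OF cont]) (auto intro!: continuous_intros mult_le_one)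
    have "((\<lambda>u. \<phi> (s * u)) has_integral (1 / \<bar>s\<bar>) * integral {0..s} \<phi>) ((\<lambda>x. x / s) ` {0..s})"
      using has_integral_stretch_real[OF integrable_integral[OF int\<phi>[of 0 s]], of s] s s0 by simp
    moreover have "(\<lambda>x. x / s) ` {0..s} = {0..1}"
      using s0 by (subst image_divide_atLeastAtMost) auto
    ultimately have "((\<lambda>u. \<phi> (s * u)) has_integral (1 / s) * integral {0..s} \<phi>) {0..1}" using s0 by simp
    then have eq: "integral {0..s} \<phi> = s * integral {0..1} (\<lambda>u. \<phi> (s * u))"
      using s0 by (simp add: integral_unique)
    have "integral {0..1} (\<lambda>u. \<phi> (s * u)) \<le> w * exp (- (\<theta> * y))"
    proof (cases "w \<le> \<beta>")
      case True
      then have "y = 0" unfolding y_def ln_plus_def using w \<beta> by (simp add: divide_le_eq_1)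
      moreover have "integral {0..1} (\<lambda>u. \<phi> (s * u)) \<le> integral {0..1} \<phi>"
        using su s s0 by (intro integral_le integrable_continuous_real int\<phi> mono cont) (auto simp: mult_le_cancel_right2)
      ultimately show ?thesis using w by simp
    next
      case False
      then have y: "y = ln (w / \<beta>)" unfolding y_def ln_plus_def using \<beta> w by (simp add: max_def)
      define R where "R u = \<beta> powr \<theta> * w powr (1 - \<theta>) * ((1 - \<theta>) / w * \<phi> u + \<theta>)" for u
      have Rc: "continuous_on {0..1} R" unfolding R_def by (intro continuous_intros cont)
      have in01: "\<phi> (s * u) \<le> R u" if "u \<in> {0<..<1}" for u
      proof -
        have "\<phi> (s * u) \<le> \<phi> u powr (1 - \<theta>) * \<beta> powr \<theta>" using that s s0 \<theta> by (intro contr) auto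
        also have "\<dots> \<le> (w powr (1 - \<theta>) * ((1 - \<theta>) * \<phi> u / w + \<theta>)) * \<beta> powr \<theta>"
          using that w \<theta> \<theta>0 nonneg by (intro mult_right_mono powr_le_tangent) auto
        finally show ?thesis unfolding R_def by (simp add: algebra_simps)
      qed
      have "0 \<le> R u - \<phi> (s * u)" if "u \<in> {0..1}" for u
      proof (rule continuous_ge_on_closure[where f = "\<lambda>u. R u - \<phi> (s * u)" and S = "{0<..<1}"])
        show "continuous_on (closure {0<..<1}) (\<lambda>u. R u - \<phi> (s * u))"
          using Rc su by (auto intro!: continuous_intros)
      qed (use that in01 in auto)
      then have "integral {0..1} (\<lambda>u. \<phi> (s * u)) \<le> integral {0..1} R"
        by (intro integral_le integrable_continuous_real su Rc) auto
      also have "\<dots> = \<beta> powr \<theta> * w powr (1 - \<theta>) * ((1 - \<theta>) / w * w + \<theta>)"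
      proof (rule integral_unique)
        have "((\<lambda>u. (1 - \<theta>) / w * \<phi> u + \<theta>) has_integral (1 - \<theta>) / w * w + (1 - 0) *\<^sub>R \<theta>) {0..1}"
          using w int\<phi>[of 0 1] has_integral_const_real[of \<theta> 0 1]
          by (intro has_integral_add has_integral_mult_right) (auto simp: integrable_integral)
        from has_integral_mult_right[OF this, of "\<beta> powr \<theta> * w powr (1 - \<theta>)"]
        show "(R has_integral \<beta> powr \<theta> * w powr (1 - \<theta>) * ((1 - \<theta>) / w * w + \<theta>)) {0..1}"
          unfolding R_def by simp
      qed
      also have "\<dots> = w * (\<beta> / w) powr \<theta>" using w \<beta> by (simp add: powr_diff powr_divide)
      also have "(\<beta> / w) powr \<theta> = exp (- (\<theta> * y))"
        unfolding powr_def y using w \<beta> by (simp add: ln_div algebra_simps)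
      finally show ?thesis .
    qed
    then show ?thesis unfolding eq using s0 by (simp add: mult.assoc)
  qed simp
  have key: "w * (1 - exp (- (lam * T))) \<le> (2 * T) powr (p / 2) / p" if T: "0 < T" "K * T \<le> 1" for T
  proof -
    have "1 / 2 * T \<le> K * T" using T K by (intro mult_right_mono) auto
    then have T2: "T \<le> 2" using T by linarith
    \<comment> \<open>the point at which \<open>\<theta> = K T\<close>\<close>
    define s where "s = (2 - T) / (2 + T)"
    have s: "0 \<le> s" "s < 1" unfolding s_def using T T2 by auto
    have th: "K * T = 2 * K * (1 - s) / (1 + s)" and th2: "4 * (1 - s) / (1 + s) = 2 * T"
      unfolding s_def using T T2 by (auto simp: field_simps)
    have "w = integral {0..s} \<phi> + integral {s..1} \<phi>"
      unfolding w using s by (intro Henstock_Kurzweil_Integration.integral_combine[symmetric] int\<phi>) auto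
    also have "\<dots> \<le> s * w * exp (- (K * T * y)) + (2 * T) powr (p / 2) / p"
      using head[OF s th T(2)] integral_tail_bound[OF p cont upper s] th2 by simp
    also have "s * w * exp (- (K * T * y)) \<le> exp (- T) * w * exp (- (K * T * y))"
      using two_minus_over_two_plus_le_exp[of T] T w unfolding s_def[symmetric] by (intro mult_right_mono) auto
    also have "exp (- T) * w * exp (- (K * T * y)) = w * exp (- (lam * T))"
      unfolding lam_def by (simp add: exp_add[symmetric] algebra_simps)
    finally show ?thesis by (simp add: algebra_simps)
  qed
  define C where "C = 2 powr (p / 2) / (p * w * lam powr (p / 2))"
  have K0: "0 < K" using K by simp
  have "M_const p \<le> p * 2 powr (- p / 2) * C"
  proof (rule M_const_le[OF p, of "lam / K"])
    show "0 < lam / K" using lam1 K0 by simp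
    have "(2 - p) * 2 / p \<le> 1 / K" using K K0 p by (simp add: field_simps)
    also have "\<dots> \<le> lam / K" using lam1 K0 by (simp add: divide_right_mono)
    finally show "(2 - p) * 2 / p \<le> lam / K" .
  next
    fix x assume x: "0 < x" "x \<le> lam / K"
    have "w * (1 - exp (- (lam * (x / lam)))) \<le> (2 * (x / lam)) powr (p / 2) / p"
      using x lam1 K0 by (intro key) (auto simp: field_simps)
    then have "w * (1 - exp (- x)) \<le> 2 powr (p / 2) * x powr (p / 2) / lam powr (p / 2) / p"
      using lam1 x by (simp add: powr_mult powr_divide)
    then show "M_quot p x \<le> C"
      unfolding M_quot_def C_def using x lam1 p w by (simp add: field_simps)
  qed
  also have "p * 2 powr (- p / 2) * C = 1 / (w * lam powr (p / 2))"
    unfolding C_def using p by (simp add: powr_minus field_simps)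
  finally have M: "M_const p \<le> 1 / (w * lam powr (p / 2))" .
  have M0: "0 < M_const p" using M_const_ge_quarter[OF p] by simp
  define X where "X = w powr (2 / p)"
  define m where "m = M_const p powr (- 2 / p)"
  have X0: "0 < X" unfolding X_def using w by simp
  have Xw: "X powr (p / 2) = w" unfolding X_def using w p by (simp add: powr_powr)
  have Xm: "X * lam \<le> m"
  proof -
    have "(1 / (w * lam powr (p / 2))) powr (- 2 / p) \<le> m"
      unfolding m_def using M M0 p by (intro powr_mono2') auto
    moreover have "(1 / (w * lam powr (p / 2))) powr (- 2 / p) = X * lam"
      using lam1 w p unfolding X_def by (simp add: powr_divide powr_mult powr_powr powr_minus_divide)
    ultimately show ?thesis by simp
  qed
  have "X * (1 + K * ln_plus (1 / \<beta>)) \<le> m + p * K / (2 * exp 1)"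
  proof (cases "\<beta> \<ge> 1")
    case True
    then have "ln_plus (1 / \<beta>) = 0" unfolding ln_plus_def by (simp add: ln_div)
    moreover have "X * 1 \<le> X * lam" using X0 lam1 by (intro mult_left_mono) auto
    moreover have "0 \<le> p * K / (2 * exp 1)" using p K0 by simp
    ultimately show ?thesis using Xm by simp
  next
    case False
    \<comment> \<open>\<open>- X ln X\<close> is at most its maximum \<open>1 / e\<close>; this is the origin of the summand \<open>p K / (2 e)\<close>\<close>
    have "ln (exp (-1) / X) \<le> exp (-1) / X - 1" using X0 by (intro ln_le_minus_one) auto
    then have "- ln X \<le> exp (-1) / X" using X0 by (simp add: ln_div)
    then have "X * (- ln X) \<le> X * (exp (-1) / X)" using X0 by (intro mult_left_mono) auto
    then have xl: "X * (- ln X) \<le> exp (-1)" using X0 by simp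
    have "ln w = (p / 2) * ln X" unfolding X_def using w p by (simp add: ln_powr)
    moreover have "ln (w / \<beta>) \<le> y" unfolding y_def ln_plus_def by simp
    ultimately have "ln_plus (1 / \<beta>) \<le> y + (p / 2) * (- ln X)"
      using False \<beta> w unfolding ln_plus_def by (simp add: ln_div)
    then have "X * (1 + K * ln_plus (1 / \<beta>)) \<le> X * (1 + K * (y + (p / 2) * (- ln X)))"
      using X0 K0 by (intro mult_left_mono add_left_mono) auto
    also have "\<dots> = X * lam + K * (p / 2) * (X * (- ln X))" unfolding lam_def by (simp add: algebra_simps)
    also have "\<dots> \<le> m + K * (p / 2) * exp (- 1)"
      using Xm xl K0 p by (intro add_mono mult_left_mono) auto
    finally show ?thesis by (simp add: exp_minus field_simps)
  qed
  moreover have L0: "0 < 1 + K * ln_plus (1 / \<beta>)"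
    using K0 unfolding ln_plus_def by (intro add_pos_nonneg mult_nonneg_nonneg) auto
  ultimately have "X \<le> (m + p * K / (2 * exp 1)) / (1 + K * ln_plus (1 / \<beta>))"
    by (simp only: pos_le_divide_eq)
  then have "X powr (p / 2) \<le> ((m + p * K / (2 * exp 1)) / (1 + K * ln_plus (1 / \<beta>))) powr (p / 2)"
    using X0 p by (intro powr_mono2) auto
  then show ?thesis unfolding Xw m_def .
qed

text \<open>For monotone \<open>\<phi>\<close> the tail integral \<open>P s\<close> is at least \<open>(1 - s) \<phi> s\<close>, and \<open>k P\<^sup>k\<^sup>-\<^sup>1 \<phi>\<close> is the derivative of
  \<open>- P\<^sup>k\<close>.  This inequality reduces order \<open>k\<close> to order \<open>1\<close>.\<close>

lemma integral_power_le_power_integral: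
  fixes \<phi> :: "real \<Rightarrow> real"
  assumes k: "1 \<le> k" and cont: "continuous_on {0..1} \<phi>"
    and nonneg: "\<And>v. 0 \<le> v \<Longrightarrow> v \<le> 1 \<Longrightarrow> 0 \<le> \<phi> v"
    and mono: "\<And>u v. 0 \<le> u \<Longrightarrow> u \<le> v \<Longrightarrow> v \<le> 1 \<Longrightarrow> \<phi> u \<le> \<phi> v"
  shows "integral {0..1} (\<lambda>s. real k * (1 - s) ^ (k - 1) * \<phi> s ^ k) \<le> (integral {0..1} \<phi>) ^ k"
proof -
  define P where "P s = integral {s..1} \<phi>" for s
  have int\<phi>: "\<phi> integrable_on {a..b}" if "0 \<le> a" "b \<le> 1" for a b
    using cont that by (intro integrable_continuous_real) (auto elim!: continuous_on_subset)
  have dP: "(P has_real_derivative - \<phi> s) (at s within {0..1})" if "s \<in> {0..1}" for s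
    unfolding P_def using integral_has_real_derivative'[OF cont that] .
  have P_lower: "(1 - s) * \<phi> s \<le> P s" if "0 \<le> s" "s \<le> 1" for s
  proof -
    have "integral {s..1} (\<lambda>_. \<phi> s) \<le> P s"
      unfolding P_def using that by (intro integral_le int\<phi> mono) auto
    then show ?thesis using that by (simp add: mult.commute)
  qed
  have Pc: "continuous_on {0..1} P"
    unfolding continuous_on_eq_continuous_within by (intro ballI DERIV_continuous[OF dP])
  have "((\<lambda>s. real k * P s ^ (k - 1) * \<phi> s) has_integral (- (P 1 ^ k)) - (- (P 0 ^ k))) {0..1}"
  proof (rule fundamental_theorem_of_calculus)
    fix s :: real assume s: "s \<in> {0..1}"
    have "((\<lambda>s. - (P s ^ k)) has_real_derivative real k * P s ^ (k - 1) * \<phi> s) (at s within {0..1})"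
      using dP[OF s] by (auto intro!: derivative_eq_intros)
    then show "((\<lambda>s. - (P s ^ k)) has_vector_derivative real k * P s ^ (k - 1) * \<phi> s) (at s within {0..1})"
      by (simp add: has_real_derivative_iff_has_vector_derivative)
  qed simp
  moreover have "P 1 = 0" unfolding P_def by simp
  ultimately have hi: "((\<lambda>s. real k * P s ^ (k - 1) * \<phi> s) has_integral P 0 ^ k) {0..1}"
    using k by (cases k) auto
  have "integral {0..1} (\<lambda>s. real k * (1 - s) ^ (k - 1) * \<phi> s ^ k)
      \<le> integral {0..1} (\<lambda>s. real k * P s ^ (k - 1) * \<phi> s)"
  proof (rule integral_le)
    show "(\<lambda>s. real k * (1 - s) ^ (k - 1) * \<phi> s ^ k) integrable_on {0..1}"
      by (intro integrable_continuous_real continuous_intros cont)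
    show "(\<lambda>s. real k * P s ^ (k - 1) * \<phi> s) integrable_on {0..1}" using hi by blast
    fix s :: real assume s: "s \<in> {0..1}"
    have "\<phi> s ^ k = \<phi> s ^ (k - 1) * \<phi> s" using k by (cases k) auto
    then have "real k * (1 - s) ^ (k - 1) * \<phi> s ^ k = real k * ((1 - s) * \<phi> s) ^ (k - 1) * \<phi> s"
      by (simp add: power_mult_distrib)
    also have "\<dots> \<le> real k * P s ^ (k - 1) * \<phi> s"
      using s nonneg P_lower by (intro mult_right_mono mult_left_mono power_mono) auto
    finally show "real k * (1 - s) ^ (k - 1) * \<phi> s ^ k \<le> real k * P s ^ (k - 1) * \<phi> s" .
  qed
  also have "\<dots> = P 0 ^ k" using hi by (rule integral_unique)
  finally show ?thesis unfolding P_def .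
qed

lemma C_const_lower_bound:
  assumes pq: "1 \<le> q" "q \<le> p" "p \<le> 2" "q < 2"
  shows "(2 - q) / 17 \<le> C_const p q"
proof -
  define m where "m = M_const p powr (- 2 / p)"
  have p: "1 \<le> p" using pq by simp
  have "m \<le> (1 / 4) powr (- 2 / p)" unfolding m_def
    using M_const_ge_quarter[OF p pq(3)] p by (intro powr_mono2') auto
  also have "\<dots> = 4 powr (2 / p)" by (simp add: powr_divide powr_minus_divide)
  also have "\<dots> \<le> 4 powr 2" using p by (intro powr_mono) (auto simp: field_simps)
  finally have m16: "m \<le> 16" by simp
  have e1: "1 \<le> exp (1::real)" by simp
  have "p * q \<le> 2 * 2" using pq p by (intro mult_mono) auto
  then have "p * q / (4 * exp 1 * (2 - q)) \<le> 4 / (4 * exp 1 * (2 - q))"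
    using pq by (intro divide_right_mono) auto
  also have "\<dots> \<le> 1 / (2 - q)"
  proof -
    have "4 * (2 - q) * 1 \<le> 4 * (2 - q) * exp 1" using pq e1 by (intro mult_left_mono) auto
    then show ?thesis using pq by (simp add: field_simps)
  qed
  finally have t: "p * q / (4 * exp 1 * (2 - q)) \<le> 1 / (2 - q)" .
  have "1 \<le> 1 / (2 - q)" using pq by (simp add: field_simps)
  then have "m + p * q / (4 * exp 1 * (2 - q)) \<le> 16 * (1 / (2 - q)) + 1 / (2 - q)"
    using m16 t by (smt (verit))
  also have "\<dots> = 17 / (2 - q)" by simp
  finally have S: "m + p * q / (4 * exp 1 * (2 - q)) \<le> 17 / (2 - q)" .
  have S0: "0 < m + p * q / (4 * exp 1 * (2 - q))"
    unfolding m_def using pq p by (intro add_nonneg_pos divide_pos_pos) auto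
  have "(2 - q) / 17 = (17 / (2 - q)) powr (- 1)" using pq by (simp add: powr_minus_divide)
  also have "\<dots> \<le> (17 / (2 - q)) powr (- p / 2)"
    using pq by (intro powr_mono) (auto simp: field_simps)
  also have "\<dots> \<le> C_const p q"
    unfolding C_const_def m_def[symmetric] using S S0 p by (intro powr_mono2') auto
  finally show ?thesis .
qed

section \<open>From the correlation function to the inequality\<close>

lemma Lp_gauss_powr:
  assumes "1 \<le> p" shows "Lp_gauss p h powr p = (LINT x|gauss. \<bar>h x\<bar> powr p)"
proof -
  have "0 \<le> (LINT x|gauss. \<bar>h x\<bar> powr p)" by (intro integral_nonneg_AE) simp
  then show ?thesis unfolding Lp_gauss_def using assms by (simp add: powr_powr)
qed

lemma Lp_gauss_sq:
  assumes "1 \<le> q" shows "(Lp_gauss q h)\<^sup>2 = (LINT x|gauss. \<bar>h x\<bar> powr q) powr (2 / q)"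
proof -
  have "(Lp_gauss q h)\<^sup>2 = Lp_gauss q h powr 2" unfolding Lp_gauss_def by (simp add: powr_numeral)
  then show ?thesis unfolding Lp_gauss_def by (simp add: powr_powr)
qed

lemma talagrand_quot_nonneg: "0 \<le> talagrand_quot k p q h"
  unfolding talagrand_quot_def by simp

text \<open>Since \<open>1 / ((m + k) choose k)\<close> is a Beta integral, \<open>V\<close> is an average of the power series.\<close>

lemma beta_sum_le_integral:
  fixes a :: "nat \<Rightarrow> real"
  assumes k: "1 \<le> k" and a: "\<And>m. 0 \<le> a m" "summable a" and V: "(\<lambda>m. a m / real ((m + k) choose k)) sums V"
  shows "V \<le> integral {0..1} (\<lambda>s. real k * (1 - s) ^ (k - 1) * (\<Sum>m. s ^ m * a m))"
proof -
  let ?G = "\<lambda>s. \<Sum>m. s ^ m * a m"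
  have sm: "summable (\<lambda>m. s ^ m * a m)" if s: "s \<in> {0..1}" for s :: real
    by (rule summable_comparison_test'[OF a(2), of 0]) (use a(1) s in \<open>auto simp: abs_mult power_abs intro!: mult_left_le_one_le power_le_one\<close>)
  have GI: "(\<lambda>s. real k * (1 - s) ^ (k - 1) * ?G s) integrable_on {0..1}"
    by (intro integrable_continuous_real continuous_intros power_series_continuous_01 a)
  have "(\<Sum>m<M. a m / real ((m + k) choose k)) \<le> integral {0..1} (\<lambda>s. real k * (1 - s) ^ (k - 1) * ?G s)" for M
  proof (rule has_integral_le)
    show "((\<lambda>s. \<Sum>m<M. a m * (real k * (1 - s) ^ (k - 1) * s ^ m)) has_integral (\<Sum>m<M. a m / real ((m + k) choose k))) {0..1}"
    proof (rule has_integral_sum)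
      fix m
      from has_integral_mult_right[OF beta_has_integral[OF k, of m], of "a m"]
      show "((\<lambda>s. a m * (real k * (1 - s) ^ (k - 1) * s ^ m)) has_integral a m / real ((m + k) choose k)) {0..1}" by simp
    qed simp
    show "((\<lambda>s. real k * (1 - s) ^ (k - 1) * ?G s) has_integral integral {0..1} (\<lambda>s. real k * (1 - s) ^ (k - 1) * ?G s)) {0..1}"
      by (rule integrable_integral[OF GI])
    fix s :: real assume s: "s \<in> {0..1}"
    have "(\<Sum>m<M. s ^ m * a m) \<le> ?G s" by (rule sum_le_suminf[OF sm[OF s]]) (use a s in auto)
    then have "real k * (1 - s) ^ (k - 1) * (\<Sum>m<M. s ^ m * a m) \<le> real k * (1 - s) ^ (k - 1) * ?G s"
      using s by (intro mult_left_mono) auto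
    then show "(\<Sum>m<M. a m * (real k * (1 - s) ^ (k - 1) * s ^ m)) \<le> real k * (1 - s) ^ (k - 1) * ?G s"
      by (simp add: sum_distrib_left mult_ac)
  qed
  then show ?thesis using V unfolding sums_def by (intro LIMSEQ_le_const2) auto
qed

text \<open>The common core of both inequalities, for a finite family of functions with the uniform bound on
  their regularisations.  The \<open>k\<close>-th root \<open>\<phi>\<close> of the normalised correlation function satisfies the
  hypotheses of the one-dimensional extremal problem, and the powers of its integral control the
  weight; \<open>p\<close> and \<open>K\<close> enter that problem in the same way for every \<open>k\<close>.\<close>

lemma talagrand_family:
  fixes g :: "'k \<Rightarrow> real ^ 'n::finite \<Rightarrow> real"
  assumes k: "1 \<le> k" and pq: "1 \<le> q" "q \<le> p" "p \<le> 2" "q < 2"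
    and S: "finite S" and g: "\<And>\<kappa>. \<kappa> \<in> S \<Longrightarrow> g \<kappa> \<in> L2_gauss"
    and bd: "\<And>s x. 0 \<le> s \<Longrightarrow> s < 1 \<Longrightarrow> (\<Sum>\<kappa>\<in>S. (OU s (g \<kappa>) x)\<^sup>2) \<le> 1 / (1 - s\<^sup>2) ^ k"
    and V: "(\<lambda>m. (\<Sum>\<kappa>\<in>S. hweight m (g \<kappa>)) / real ((m + k) choose k)) sums V"
  shows "C_const p q ^ k * V \<le> talagrand_quot k p q (\<lambda>x. L2_set (\<lambda>\<kappa>. g \<kappa> x) S)"
proof -
  let ?N = "\<lambda>x. L2_set (\<lambda>\<kappa>. g \<kappa> x) S"
  have p: "1 \<le> p" "p \<le> 2" using pq by auto
  define K where "K = q / (2 * (2 - q))"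
  define A where "A = (LINT x|gauss. ?N x powr p)"
  \<comment> \<open>the logarithm in the quotient is that of \<open>A / B\<close>\<close>
  define Q where "Q = (LINT x|gauss. ?N x powr q)"
  define B where "B = Q powr (2 / q)"
  define a where "a m = (\<Sum>\<kappa>\<in>S. hweight m (g \<kappa>))" for m
  define G where "G s = (\<Sum>m. s ^ m * a m)" for s :: real
  have N: "?N \<in> L2_gauss" by (rule L2_set_L2_gauss[OF S g])
  have A0: "0 \<le> A" and Q0: "0 \<le> Q" unfolding A_def Q_def by (intro integral_nonneg_AE; simp)+
  have quot: "talagrand_quot k p q ?N = A / (1 + K / real k * ln_plus (A / B)) powr (real k * p / 2)"
  proof -
    have "q / (2 * real k * (2 - q)) = K / real k" unfolding K_def by simp
    moreover have "Lp_gauss p ?N powr p = A" unfolding A_def using Lp_gauss_powr[OF p(1), of ?N] by simp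
    moreover have "(Lp_gauss q ?N)\<^sup>2 = B" unfolding B_def Q_def using Lp_gauss_sq[OF pq(1), of ?N] by simp
    ultimately show ?thesis unfolding talagrand_quot_def by simp
  qed
  have C0: "0 \<le> C_const p q" unfolding C_const_def by simp
  have a0: "0 \<le> a m" for m unfolding a_def by (intro sum_nonneg hweight_nonneg)
  have a_sums: "a sums (\<Sum>\<kappa>\<in>S. inner_gauss (g \<kappa>) (g \<kappa>))" unfolding a_def[abs_def] by (intro sums_sum parseval g)
  then have sa: "summable a" by (rule sums_summable)
  have G_sums: "(\<lambda>m. s ^ m * a m) sums (\<Sum>\<kappa>\<in>S. inner_gauss (g \<kappa>) (OU s (g \<kappa>)))" if s: "0 \<le> s" "s < 1" for s
    unfolding a_def[abs_def] sum_distrib_left by (intro sums_sum OU_form_sums s g)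
  have G_eq: "G s = (\<Sum>\<kappa>\<in>S. inner_gauss (g \<kappa>) (OU s (g \<kappa>)))" if s: "0 \<le> s" "s < 1" for s
    unfolding G_def using G_sums[OF s] by (simp add: sums_iff)
  have sm: "summable (\<lambda>m. s ^ m * a m)" if s: "0 \<le> s" "s \<le> 1" for s :: real
    by (rule summable_comparison_test'[OF sa, of 0]) (use a0 s in \<open>auto simp: abs_mult power_abs intro!: mult_left_le_one_le power_le_one\<close>)
  have G_cont: "continuous_on {0..1} G" unfolding G_def[abs_def] by (rule power_series_continuous_01[OF a0 sa])
  have G_nonneg: "0 \<le> G s" if "0 \<le> s" "s \<le> 1" for s unfolding G_def using that a0 by (intro suminf_nonneg sm) auto
  have G_mono: "G u \<le> G v" if "0 \<le> u" "u \<le> v" "v \<le> 1" for u v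
    unfolding G_def using that a0 by (intro suminf_le sm mult_right_mono power_mono) auto
  have V_le: "V \<le> integral {0..1} (\<lambda>s. real k * (1 - s) ^ (k - 1) * G s)"
    unfolding G_def by (rule beta_sum_le_integral[OF k a0 sa]) (use V in \<open>simp add: a_def\<close>)
  have trivial: ?thesis if "V \<le> 0"
    using that C0 talagrand_quot_nonneg[of k p q ?N] by (meson mult_nonneg_nonpos order_trans zero_le_power)
  have zero: "V \<le> 0" if z: "AE x in gauss. ?N x = 0"
  proof -
    have "inner_gauss (g \<kappa>) (g \<kappa>) = 0" if k: "\<kappa> \<in> S" for \<kappa>
    proof -
      have "AE x in gauss. g \<kappa> x = 0"
        using z
      proof eventually_elim
        case (elim x)
        have "\<bar>g \<kappa> x\<bar> \<le> ?N x" using member_le_L2_set[OF S k, of "\<lambda>\<kappa>. \<bar>g \<kappa> x\<bar>"] by (simp add: L2_set_def)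
        then show ?case using elim by simp
      qed
      then have "inner_gauss (g \<kappa>) (g \<kappa>) = inner_gauss (\<lambda>_. 0) (g \<kappa>)"
        using L2_gaussD(1)[OF g[OF k]] by (intro inner_gauss_AE_cong) auto
      then show ?thesis by (simp add: inner_gauss_def)
    qed
    then have "a sums 0" using a_sums by simp
    then have "a m = 0" for m using a0 sums_unique[of a 0] suminf_eq_zero_iff[OF sa] by auto
    then have "(\<lambda>m. 0) sums V" using V unfolding a_def[symmetric] by simp
    then have "V = 0" by (simp add: sums_iff)
    then show ?thesis by simp
  qed
  show ?thesis
  proof (cases "A = 0 \<or> Q = 0")
    case True
    then have "AE x in gauss. ?N x = 0"
    proof
      assume "A = 0" then show ?thesis unfolding A_def by (intro gauss_powr_integral_zero[OF N, of p]) (use p in auto)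
    next
      assume "Q = 0" then show ?thesis unfolding Q_def by (intro gauss_powr_integral_zero[OF N, of q]) (use pq in auto)
    qed
    then show ?thesis by (intro trivial zero)
  next
    case False
    then have A1: "0 < A" and B1: "0 < B" using A0 Q0 unfolding B_def by auto
    define \<phi> where "\<phi> s = (G s / A) powr (1 / real k)" for s
    define \<beta> where "\<beta> = (B / A) powr (1 / real k)"
    define w where "w = integral {0..1} \<phi>"
    have k0: "0 < real k" using k by simp
    have \<phi>k: "\<phi> s ^ k = G s / A" if "0 \<le> s" "s \<le> 1" for s
    proof -
      have "0 \<le> G s / A" using G_nonneg[OF that] A1 by simp
      moreover have "\<phi> s ^ k = \<phi> s powr real k" using k unfolding \<phi>_def by (subst powr_realpow') auto
      ultimately show ?thesis unfolding \<phi>_def using k0 G_nonneg[OF that] A1 by (simp add: powr_powr)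
    qed
    have cont: "continuous_on {0..1} \<phi>"
      unfolding \<phi>_def[abs_def] using A1 G_nonneg k0 by (intro continuous_on_powr' continuous_on_divide G_cont continuous_on_const) auto
    have nonneg: "0 \<le> \<phi> v" for v unfolding \<phi>_def by simp
    have mono: "\<phi> u \<le> \<phi> v" if "0 \<le> u" "u \<le> v" "v \<le> 1" for u v
      unfolding \<phi>_def using that G_mono[OF that] G_nonneg[of u] A1 by (intro powr_mono2 divide_right_mono) auto
    have "V \<le> A * w ^ k"
    proof -
      have "integral {0..1} (\<lambda>s. real k * (1 - s) ^ (k - 1) * G s) = integral {0..1} (\<lambda>s. A * (real k * (1 - s) ^ (k - 1) * \<phi> s ^ k))"
        using A1 by (intro integral_cong) (simp add: \<phi>k)
      also have "\<dots> = A * integral {0..1} (\<lambda>s. real k * (1 - s) ^ (k - 1) * \<phi> s ^ k)" by simp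
      also have "\<dots> \<le> A * w ^ k"
        unfolding w_def using A1 by (intro mult_left_mono integral_power_le_power_integral k cont nonneg mono) auto
      finally show ?thesis using V_le by linarith
    qed
    show ?thesis
    proof (cases "0 < w")
      case False
      have "0 \<le> w" unfolding w_def by (intro integral_nonneg integrable_continuous_real cont nonneg)
      then have "w = 0" using False by simp
      then have "V \<le> 0" using \<open>V \<le> A * w ^ k\<close> k by (simp add: zero_power)
      then show ?thesis by (rule trivial)
    next
      case True
      let ?X = "M_const p powr (- 2 / p) + p * K / (2 * exp 1)" and ?Y = "1 + K * ln_plus (1 / \<beta>)"
      have K0: "1 / 2 \<le> K" unfolding K_def using pq by (simp add: field_simps)
      \<comment> \<open>the constraint \<open>q \<le> p\<close> makes this hold\<close>
      have K1: "K * (2 - p) \<le> p / 2"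
      proof -
        have "K * (2 - p) \<le> K * (2 - q)" using pq K0 by (intro mult_left_mono) auto
        also have "\<dots> = q / 2"
          unfolding K_def times_divide_eq_left by (rule nonzero_mult_divide_mult_cancel_right) (use pq in simp)
        finally show ?thesis using pq by linarith
      qed
      have w: "w \<le> (?X / ?Y) powr (p / 2)"
      proof (rule contractive_profile_bound[OF p K0 K1 cont nonneg mono])
        show "0 < \<beta>" unfolding \<beta>_def using A1 B1 by simp
        show "w = integral {0..1} \<phi>" "0 < w" using True unfolding w_def by auto
        show "\<phi> v \<le> (1 - v\<^sup>2) powr (p / 2 - 1)" if v: "0 < v" "v < 1" for v
        proof -
          have v': "0 \<le> v" "v < 1" using v by auto
          have "G v \<le> A * (1 - v\<^sup>2) powr (real k * (p / 2 - 1))"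
            unfolding G_eq[OF v'] A_def by (rule correlation_le_moment[OF S g v' p bd[OF v']])
          then have "G v / A \<le> (1 - v\<^sup>2) powr (real k * (p / 2 - 1))" using A1 by (simp add: pos_divide_le_eq mult.commute)
          then have "\<phi> v \<le> ((1 - v\<^sup>2) powr (real k * (p / 2 - 1))) powr (1 / real k)"
            unfolding \<phi>_def using A1 G_nonneg[of v] v by (intro powr_mono2) auto
          also have "\<dots> = (1 - v\<^sup>2) powr (p / 2 - 1)" unfolding powr_powr using k0 by simp
          finally show ?thesis .
        qed
        show "\<phi> (s * u) \<le> \<phi> u powr (1 - \<theta>) * \<beta> powr \<theta>"
          if s: "0 < s" "s < 1" and u: "0 < u" "u < 1" and \<theta>: "\<theta> = 2 * K * (1 - s) / (1 + s)" "\<theta> \<le> 1" for s u \<theta>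
        proof -
          have su: "0 \<le> s * u" "s * u < 1" and u': "0 \<le> u" "u < 1" using s u mult_strict_mono[of s 1 u 1] by auto
          have Gu: "0 \<le> G u" "0 \<le> G (s * u)" using G_nonneg su u by auto
          have "G (s * u) \<le> G u powr (1 - \<theta>) * Q powr (2 * \<theta> / q)"
            unfolding G_eq[OF su] G_eq[OF u'] Q_def
            by (rule correlation_contraction[OF S g s u pq(1,4) \<theta>(1)[unfolded K_def] \<theta>(2)])
          also have "Q powr (2 * \<theta> / q) = B powr \<theta>" unfolding B_def powr_powr by simp
          finally have "G (s * u) / A \<le> (G u powr (1 - \<theta>) * B powr \<theta>) / A" using A1 by (intro divide_right_mono) auto
          also have "\<dots> = (G u / A) powr (1 - \<theta>) * (B / A) powr \<theta>"
          proof -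
            have "A = A powr (1 - \<theta>) * A powr \<theta>" using A1 by (simp add: powr_add[symmetric])
            then show ?thesis using Gu A1 B1 by (simp add: powr_divide)
          qed
          finally have "\<phi> (s * u) \<le> ((G u / A) powr (1 - \<theta>) * (B / A) powr \<theta>) powr (1 / real k)"
            unfolding \<phi>_def using A1 Gu by (intro powr_mono2) auto
          also have "\<dots> = \<phi> u powr (1 - \<theta>) * \<beta> powr \<theta>"
            unfolding \<phi>_def \<beta>_def by (simp add: powr_mult powr_powr mult.commute)
          finally show ?thesis .
        qed
      qed
      have M0: "0 < M_const p" using M_const_ge_quarter[OF p] by linarith
      have X0: "0 < ?X" using M0 p K0 by (intro add_pos_nonneg) auto
      have Y1: "1 \<le> ?Y" using K0 unfolding ln_plus_def by simp
      have Y_eq: "?Y = 1 + K / real k * ln_plus (A / B)"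
      proof -
        have "1 / \<beta> = (A / B) powr (1 / real k)" unfolding \<beta>_def using A1 B1 by (simp add: powr_divide)
        then have "ln (1 / \<beta>) = ln (A / B) / real k" using A1 B1 by (simp add: ln_powr)
        then have "ln_plus (1 / \<beta>) = ln_plus (A / B) / real k" unfolding ln_plus_def using k0 by (simp add: max_def divide_le_0_iff)
        then show ?thesis by simp
      qed
      have Ck: "C_const p q ^ k = ?X powr (- p / 2 * real k)"
      proof -
        have "p * q / (4 * exp 1 * (2 - q)) = p * K / (2 * exp 1)" unfolding K_def by simp
        then have "C_const p q = ?X powr (- p / 2)" unfolding C_const_def by simp
        then show ?thesis using X0 by (simp add: powr_power mult.commute)
      qed
      have "C_const p q ^ k * V \<le> C_const p q ^ k * (A * w ^ k)" using \<open>V \<le> A * w ^ k\<close> C0 by (intro mult_left_mono) auto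
      also have "\<dots> \<le> C_const p q ^ k * (A * ((?X / ?Y) powr (p / 2)) ^ k)"
        using w True A1 C0 by (intro mult_left_mono power_mono) auto
      also have "\<dots> = A * (?X powr (- p / 2 * real k) * (?X / ?Y) powr (p / 2 * real k))"
        unfolding Ck using X0 Y1 by (simp add: powr_power mult.commute mult.left_commute)
      also have "\<dots> = A / ?Y powr (real k * p / 2)"
      proof -
        have e: "p / 2 * real k = real k * p / 2" "- p / 2 * real k = - (real k * p / 2)" by simp_all
        have "?X powr (- (real k * p / 2)) * ?X powr (real k * p / 2) = 1" using X0 by (simp add: powr_add[symmetric])
        then show ?thesis unfolding e using X0 Y1 by (simp add: powr_divide)
      qed
      finally show ?thesis unfolding quot Y_eq .
    qed
  qed
qed

lemma talagrand_quot_abs: "talagrand_quot k p q (\<lambda>x. \<bar>h x\<bar>) = talagrand_quot k p q h"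
  unfolding talagrand_quot_def Lp_gauss_def by simp

text \<open>For \<open>k = 0\<close> the statement is \<open>f\<^sup>2 \<le> \<bar>f\<bar>\<^sup>p\<close>, integrated.\<close>

lemma talagrand_zero:
  fixes f h :: "real ^ 'n::finite \<Rightarrow> real"
  assumes p: "1 \<le> p" "p \<le> 2" and f: "f \<in> L2_gauss" "AE x in gauss. \<bar>f x\<bar> \<le> 1"
    and h: "h \<in> borel_measurable borel" "AE x in gauss. \<bar>h x\<bar> = \<bar>f x\<bar>"
  shows "W_ge 0 f \<le> talagrand_quot 0 p q h"
proof -
  have [measurable]: "f \<in> borel_measurable borel" "h \<in> borel_measurable borel" using L2_gaussD[OF f(1)] h by auto
  have "(\<lambda>m. hweight m f) sums W_ge 0 f" using W_ge_sums[OF f(1), of 0] by simp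
  then have "W_ge 0 f = inner_gauss f f" using parseval[OF f(1)] sums_unique2 by blast
  also have "\<dots> \<le> (LINT x|gauss. \<bar>f x\<bar> powr p)"
    unfolding inner_gauss_def
  proof (rule integral_mono_AE)
    show "integrable gauss (\<lambda>x. f x * f x)" by (rule L2_gauss_mult[OF f(1) f(1)])
    show "integrable gauss (\<lambda>x. \<bar>f x\<bar> powr p)" using L2_gauss_powr_integrable[OF L2_gauss_abs[OF f(1)], of p] p by simp
    show "AE x in gauss. f x * f x \<le> \<bar>f x\<bar> powr p"
      using f(2)
    proof eventually_elim
      case (elim x)
      have "f x * f x = \<bar>f x\<bar> powr 2" by (simp add: powr_numeral power2_eq_square)
      also have "\<dots> \<le> \<bar>f x\<bar> powr p" by (rule powr_mono') (use elim p in auto)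
      finally show ?case .
    qed
  qed
  also have "\<dots> = (LINT x|gauss. \<bar>h x\<bar> powr p)"
    by (rule integral_cong_AE) (use h(2) in \<open>auto elim: eventually_mono\<close>)
  also have "\<dots> = talagrand_quot 0 p q h" unfolding talagrand_quot_def Lp_gauss_powr[OF p(1)] by simp
  finally show ?thesis .
qed

text \<open>The family of all derivatives of order \<open>k\<close> gives the first inequality; each derivative alone, taken
  with its share \<open>V \<kappa>\<close> of the weight, gives the second.\<close>

lemma talagrand_gradient:
  fixes f :: "real ^ 'n::finite \<Rightarrow> real"
  assumes k: "1 \<le> k" and f: "f \<in> Hk_gauss k" and f1: "AE x in gauss. \<bar>f x\<bar> \<le> 1"
    and pq: "1 \<le> q" "q \<le> p" "p \<le> 2" "q < 2"
  shows "C_const p q ^ k * W_ge k f \<le> talagrand_quot k p q (nabla_norm k f)"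
    and "C_const p q ^ k * W_ge k f \<le> (\<Sum>\<kappa> | mi_size \<kappa> = k. talagrand_quot k p q (D \<kappa> f))"
proof -
  let ?K = "{\<kappa> :: 'n \<Rightarrow> nat. mi_size \<kappa> = k}"
  have fin: "finite ?K" by (rule finite_mi_size)
  have DL: "D \<kappa> f \<in> L2_gauss" if "\<kappa> \<in> ?K" for \<kappa> using Hk_gauss_L2(2)[OF f] that by simp
  have bd: "(\<Sum>\<kappa>\<in>S. (OU s (D \<kappa> f) x)\<^sup>2) \<le> 1 / (1 - s\<^sup>2) ^ k" if "S \<subseteq> ?K" "0 \<le> s" "s < 1" for S s x
    by (rule OU_D_square_sum_le[OF f f1 that(2,3,1)])
  have ch: "0 < real ((m + k) choose k)" for m by simp
  have W: "(\<lambda>m. (\<Sum>\<kappa>\<in>?K. hweight m (D \<kappa> f)) / real ((m + k) choose k)) sums W_ge k f"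
    using W_ge_sums[OF Hk_gauss_L2(1)[OF f], of k] by (simp add: sum_hweight_D[OF f])
  from talagrand_family[OF k pq fin DL bd[OF subset_refl] W]
  show "C_const p q ^ k * W_ge k f \<le> talagrand_quot k p q (nabla_norm k f)" unfolding nabla_norm_def[abs_def] .
  define V where "V \<kappa> = (\<Sum>m. hweight m (D \<kappa> f) / real ((m + k) choose k))" for \<kappa>
  have V: "(\<lambda>m. hweight m (D \<kappa> f) / real ((m + k) choose k)) sums V \<kappa>" if \<kappa>: "\<kappa> \<in> ?K" for \<kappa>
    unfolding V_def
  proof (rule summable_sums, rule summable_comparison_test'[OF sums_summable[OF parseval[OF DL[OF \<kappa>]]], of 0])
    fix m :: nat
    have "1 \<le> (m + k) choose k" by (simp add: Suc_le_eq)
    then have "hweight m (D \<kappa> f) / real ((m + k) choose k) \<le> hweight m (D \<kappa> f) / 1"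
      by (intro divide_left_mono hweight_nonneg) auto
    then show "norm (hweight m (D \<kappa> f) / real ((m + k) choose k)) \<le> hweight m (D \<kappa> f)"
      using hweight_nonneg[of m "D \<kappa> f"] by simp
  qed
  have "(\<lambda>m. \<Sum>\<kappa>\<in>?K. hweight m (D \<kappa> f) / real ((m + k) choose k)) sums (\<Sum>\<kappa>\<in>?K. V \<kappa>)" by (intro sums_sum V)
  then have "W_ge k f = (\<Sum>\<kappa>\<in>?K. V \<kappa>)" using W sums_unique2 by (fastforce simp: sum_divide_distrib)
  also have "C_const p q ^ k * \<dots> = (\<Sum>\<kappa>\<in>?K. C_const p q ^ k * V \<kappa>)" by (rule sum_distrib_left)
  also have "\<dots> \<le> (\<Sum>\<kappa>\<in>?K. talagrand_quot k p q (D \<kappa> f))"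
  proof (rule sum_mono)
    fix \<kappa> assume \<kappa>: "\<kappa> \<in> ?K"
    have "C_const p q ^ k * V \<kappa> \<le> talagrand_quot k p q (\<lambda>x. L2_set (\<lambda>\<kappa>. D \<kappa> f x) {\<kappa>})"
      by (rule talagrand_family[OF k pq _ _ bd]) (use \<kappa> DL V in auto)
    then show "C_const p q ^ k * V \<kappa> \<le> talagrand_quot k p q (D \<kappa> f)"
      using talagrand_quot_abs[of k p q "D \<kappa> f"] by (simp add: L2_set_def)
  qed
  finally show "C_const p q ^ k * W_ge k f \<le> (\<Sum>\<kappa> | mi_size \<kappa> = k. talagrand_quot k p q (D \<kappa> f))" .
qed

theorem theorem1p5:
  shows "(\<forall>(k::nat) (f :: real ^ 'n::finite \<Rightarrow> real) (p::real) (q::real).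
            f \<in> Hk_gauss k \<longrightarrow> Linf_gauss f \<le> 1 \<longrightarrow> 1 \<le> q \<longrightarrow> q \<le> p \<longrightarrow> p \<le> 2 \<longrightarrow> q < 2 \<longrightarrow>
              talagrand_quot k p q (nabla_norm k f) \<ge> C_const p q ^ k * W_ge k f \<and>
              (\<Sum>\<kappa> | mi_size \<kappa> = k. talagrand_quot k p q (D \<kappa> f)) \<ge> C_const p q ^ k * W_ge k f)
         \<and> (\<exists>c::real. c > 0 \<and>
              (\<forall>p q. 1 \<le> q \<longrightarrow> q \<le> p \<longrightarrow> p \<le> 2 \<longrightarrow> q < 2 \<longrightarrow> C_const p q \<ge> c * (2 - q)))"
proof (rule conjI, intro allI impI)
  fix k :: nat and f :: "real ^ 'n \<Rightarrow> real" and p q :: real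
  assume f: "f \<in> Hk_gauss k" and inf: "Linf_gauss f \<le> 1" and pq: "1 \<le> q" "q \<le> p" "p \<le> 2" "q < 2"
  have f1: "AE x in gauss. \<bar>f x\<bar> \<le> 1"
    using esssup_AE[of "\<lambda>x. ereal \<bar>f x\<bar>" gauss]
  proof eventually_elim
    case (elim x)
    then have "ereal \<bar>f x\<bar> \<le> 1" using inf unfolding Linf_gauss_def by (rule order_trans)
    then show ?case by simp
  qed
  show "talagrand_quot k p q (nabla_norm k f) \<ge> C_const p q ^ k * W_ge k f \<and>
      (\<Sum>\<kappa> | mi_size \<kappa> = k. talagrand_quot k p q (D \<kappa> f)) \<ge> C_const p q ^ k * W_ge k f"
  proof (cases "k = 0")
    case False
    then show ?thesis using talagrand_gradient[OF _ f f1 pq] by simp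
  next
    case True
    have fL: "f \<in> L2_gauss" by (rule Hk_gauss_L2(1)[OF f])
    have p: "1 \<le> p" "p \<le> 2" using pq by auto
    have K: "{\<kappa> :: 'n \<Rightarrow> nat. mi_size \<kappa> = 0} = {\<lambda>_. 0}" unfolding mi_size_def by auto
    have d: "D (\<lambda>_. 0) f \<in> borel_measurable borel" using Hk_gauss_L2(2)[OF f, of "\<lambda>_. 0"] by (simp add: mi_size_def L2_gaussD)
    have e: "AE x in gauss. \<bar>D (\<lambda>_. 0) f x\<bar> = \<bar>f x\<bar>" using D_0_AE[OF fL] by eventually_elim simp
    have n: "nabla_norm 0 f = (\<lambda>x. \<bar>D (\<lambda>_. 0) f x\<bar>)" unfolding nabla_norm_def[abs_def] K by (simp add: L2_set_def)
    have "W_ge 0 f \<le> talagrand_quot 0 p q (D (\<lambda>_. 0) f)" by (rule talagrand_zero[OF p fL f1 d e])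
    then show ?thesis unfolding True K n talagrand_quot_abs by simp
  qed
next
  have "(1 :: real) / 17 > 0 \<and> (\<forall>p q. 1 \<le> q \<longrightarrow> q \<le> p \<longrightarrow> p \<le> 2 \<longrightarrow> q < 2 \<longrightarrow> C_const p q \<ge> 1 / 17 * (2 - q))"
    using C_const_lower_bound by simp
  then show "\<exists>c::real. c > 0 \<and> (\<forall>p q. 1 \<le> q \<longrightarrow> q \<le> p \<longrightarrow> p \<le> 2 \<longrightarrow> q < 2 \<longrightarrow> C_const p q \<ge> c * (2 - q))" by blast
qed

end
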